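(* Let $E$ be an ordered basis of $\mathbf R^d$ with dual basis $E'$, $\boldsymbol r\in (0,\infty ]^d$, $r\in (0,1]$, let $\mathscr B\subseteq L^r_{loc}(\mathbf R^d)$ be an $E'$-split Lebesgue space on $\mathbf R^d$, let $\ell _{\mathscr B,E'}(\Lambda _E')$ be its discrete version, let $\omega _0\in \mathscr P_E(\mathbf R^d)$ and let $\omega (x,\xi )=\omega _0(\xi )$ for $x,\xi \in \mathbf R^d$. Then $$ \mathcal L^E(\omega _0,\ell _{\mathscr B,E'}(\Lambda _E')) = \mathcal M^{\boldsymbol r}_E(\omega ,\mathscr B)\cap (\mathcal E_0^E)'(\mathbf R^d) = \mathcal W^{\boldsymbol r}_E(\omega ,\mathscr B)\cap (\mathcal E_0^E)'(\mathbf R^d). $$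
   Context: Bases. For an ordered basis $E=\{e_1,\dots ,e_d\}$ of $\mathbf R^d$: $\Lambda _E=\{k_1e_1+\cdots +k_de_d:k\in \mathbf Z^d\}$; $\kappa (E)$ is the closed parallelepiped spanned by $E$; the dual basis $E'=\{e_1',\dots ,e_d'\}$ is given by $\langle e_j,e_k'\rangle =2\pi \delta _{jk}$, and $\Lambda _E'=\Lambda _{E'}$. Weights. A weight on $\mathbf R^n$ is a positive $\omega \in L^\infty _{loc}$ with $1/\omega \in L^\infty _{loc}$; $\mathscr P_E(\mathbf R^n)$ is the set of weights $\omega$ which are moderate, i.e. for which there are a positive weight $v$ and a constant $C$ with $\omega (x+y)\le C\omega (x)v(y)$ for all $x,y$ (the subscript in $\mathscr P_E$ is part of the symbol, unrelated to the basis $E$). Lebesgue spaces. For an ordered basis $B=\{b_1,\dots ,b_d\}$ of $\mathbf R^d$, $\boldsymbol q\in (0,\infty ]^d$, a weight $\vartheta \in \mathscr P_E(\mathbf R^d)$ and measurable $g$ on $\mathbf R^d$, let $g_0(x_1,\dots ,x_d)=|g(\sum x_kb_k)\vartheta (\sum x_kb_k)|$, $g_k(z)=\Vert g_{k-1}(\cdot ,z)\Vert _{L^{q_k}(\mathbf R)}$ for $z\in \mathbf R^{d-k}$, $k=1,\dots ,d-1$, and $\Vert g\Vert _{L^{\boldsymbol q}_{B,(\vartheta )}}=\Vert g_{d-1}\Vert _{L^{q_d}(\mathbf R)}$. The space $L^{\boldsymbol q}_{B,(\vartheta )}(\mathbf R^d)$ of $g$ with finite quasi-norm is called a $B$-split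 Lebesgue space on $\mathbf R^d$; thus an $E'$-split Lebesgue space is $\mathscr B=L^{\boldsymbol q}_{E',(\vartheta )}(\mathbf R^d)$ for some $\boldsymbol q\in(0,\infty]^d$ and $\vartheta\in\mathscr P_E(\mathbf R^d)$. We write $L^{\boldsymbol r}_E$ when $\vartheta =1$, and $\Vert g\Vert _{L^{\boldsymbol r}_E(\Omega )}=\Vert g\chi _\Omega \Vert _{L^{\boldsymbol r}_E}$ for measurable $\Omega$. The discrete version $\ell _{\mathscr B,E'}(\Lambda _E')$ is the set of sequences $a$ on $\Lambda _E'$ with finite quasi-norm $\Vert a\Vert _{\ell _{\mathscr B,E'}}=\Vert \sum _{j\in \Lambda _E'}a(j)\chi _{j+\kappa (E')}\Vert _{\mathscr B}$. STFT and spaces. $\Sigma _1(\mathbf R^d)$ is the set of $f\in C^\infty(\mathbf R^d)$ with $\sup _{\alpha ,\beta ,x}\frac {|x^\alpha \partial ^\beta f(x)|}{h^{|\alpha +\beta |}\alpha !\,\beta !}<\infty$ for every $h>0$, with its projective limit topology, and $\Sigma _1'(\mathbf R^d)$ is its dual. For a fixed $\phi \in \Sigma _1(\mathbf R^d)\setminus 0$ and $f\in \Sigma _1'(\mathbf R^d)$, $V_\phi f(x,\xi )=(2\pi )^{-d/2}(f,\phi (\cdot -x)e^{i\langle \cdot ,\xi \rangle})$, where $(\cdot ,\cdot )$ extends the $L^2$ scalar product. Put $F=V_\phi f\cdot \omega$. - $\mathcal M^{\boldsymbol r}_E(\omega ,\mathscr B)$ is the set of $f\in \Sigma _1'(\mathbf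 R^d)$ with $\Vert g\Vert _{\mathscr B}<\infty$, where $g(\xi )=\sup _{j\in \Lambda _E}\Vert F(\cdot ,\xi )\Vert _{L^{\boldsymbol r}_E(j+\kappa (E))}$. - $\mathcal W^{\boldsymbol r}_E(\omega ,\mathscr B)$ is the set of $f\in \Sigma _1'(\mathbf R^d)$ with $\sup _{j\in \Lambda _E}\Vert h\Vert _{L^{\boldsymbol r}_E(j+\kappa (E))}<\infty$, where $h(x)=\Vert F(x,\cdot )\Vert _{\mathscr B}$. Periodic elements. $(\mathcal E_0^E)'(\mathbf R^d)$ is the set of all formal expansions $f=\sum _{\alpha \in \Lambda _E'}c(f,\alpha )e^{i\langle \cdot ,\alpha \rangle}$ with $c(f,\alpha )\in \mathbf C$. The $E$-periodic elements of $\Sigma _1'(\mathbf R^d)$ (those with $f(\cdot +y)=f$ for all $y\in E$) are identified with those formal expansions for which $|c(f,\alpha )|\le Ce^{R|\alpha |}$ for some $C,R>0$, via $\langle f,\varphi \rangle =(2\pi )^{d/2}\sum _\alpha c(f,\alpha )\widehat \varphi (-\alpha )$, $\varphi \in \Sigma _1(\mathbf R^d)$, where $\widehat \varphi (\xi )=(2\pi )^{-d/2}\int \varphi (x)e^{-i\langle x,\xi \rangle}dx$; so intersecting a subspace of $\Sigma _1'(\mathbf R^d)$ with $(\mathcal E_0^E)'(\mathbf R^d)$ means taking its $E$-periodic elements. $\mathcal L^E(\omega _0,\ell _{\mathscr B,E'}(\Lambda _E'))$ is the set of $f\in (\mathcal E_0^E)'(\mathbf R^d)$ with $\Vert \{c(f,\alpha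 )\omega _0(\alpha )\}_{\alpha \in \Lambda _E'}\Vert _{\ell _{\mathscr B,E'}}<\infty$. *)

theory Defs
  imports "HOL-Analysis.Analysis"
begin

section \<open>Ordered bases, lattices and parallelepipeds\<close>

definition ordered_basis :: "(real^'n) list \<Rightarrow> bool" where
  "ordered_basis E \<longleftrightarrow> distinct E \<and> independent (set E) \<and> span (set E) = UNIV"

definition dual_basis :: "(real^'n) list \<Rightarrow> (real^'n) list \<Rightarrow> bool" where
  "dual_basis E E' \<longleftrightarrow> length E' = length E \<and>
     (\<forall>j<length E. \<forall>k<length E. E ! j \<bullet> E' ! k = (if j = k then 2 * pi else 0))"

definition lin_comb :: "(real^'n) list \<Rightarrow> real list \<Rightarrow> real^'n" where
  "lin_comb E xs = (\<Sum>k<length E. (xs ! k) *\<^sub>R (E ! k))"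

definition basis_lattice :: "(real^'n) list \<Rightarrow> (real^'n) set" where
  "basis_lattice E = {lin_comb E xs | xs. length xs = length E \<and> set xs \<subseteq> \<int>}"

definition parallelepiped :: "(real^'n) list \<Rightarrow> (real^'n) set" where
  "parallelepiped E = {lin_comb E xs | xs. length xs = length E \<and> set xs \<subseteq> {0..1}}"

section \<open>Weights\<close>

definition Linf_loc :: "('a::euclidean_space \<Rightarrow> real) set" where
  "Linf_loc = {f \<in> borel_measurable lebesgue.
     \<forall>K. compact K \<longrightarrow> (\<exists>C. AE x in lebesgue. x \<in> K \<longrightarrow> \<bar>f x\<bar> \<le> C)}"

definition weights :: "('a::euclidean_space \<Rightarrow> real) set" where
  "weights = {\<omega>. (\<forall>x. 0 < \<omega> x) \<and> \<omega> \<in> Linf_loc \<and> (\<lambda>x. 1 / \<omega> x) \<in> Linf_loc}"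

definition moderate_weights :: "('a::euclidean_space \<Rightarrow> real) set" where
  "moderate_weights =
     {\<omega> \<in> weights. \<exists>v\<in>weights. \<exists>C. \<forall>x y. \<omega> (x + y) \<le> C * \<omega> x * v y}"

section \<open>Split Lebesgue spaces\<close>

text \<open>Exponents range over \<^term>\<open>{0<..\<infinity>} :: ennreal set\<close>. The quasi-norms below act on
  \<^typ>\<open>ennreal\<close>-valued functions, since the inner functions of iterated norms may take the
  value \<^term>\<open>\<infinity> :: ennreal\<close>; \<^term>\<open>g :: real^'n \<Rightarrow> complex\<close> enters through its modulus.\<close>

definition exponents :: "nat \<Rightarrow> ennreal list set" where
  "exponents d = {q. length q = d \<and> (\<forall>p\<in>set q. 0 < p)}"

definition ennpowr :: "ennreal \<Rightarrow> real \<Rightarrow> ennreal" where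
  "ennpowr x a = (if x = \<infinity> then \<infinity> else ennreal (enn2real x powr a))"

definition Lp_norm :: "ennreal \<Rightarrow> (real \<Rightarrow> ennreal) \<Rightarrow> ennreal" where
  "Lp_norm p f =
     (if p = \<infinity> then Inf {c. AE x in lebesgue. f x \<le> c}
      else ennpowr (\<integral>\<^sup>+x. ennpowr (f x) (enn2real p) \<partial>lebesgue) (1 / enn2real p))"

text \<open>The first coordinate is integrated first; \<open>z\<close> collects the remaining ones.\<close>

fun mixed_norm :: "ennreal list \<Rightarrow> (real list \<Rightarrow> ennreal) \<Rightarrow> ennreal" where
  "mixed_norm [] g = g []"
| "mixed_norm (q # qs) g = mixed_norm qs (\<lambda>z. Lp_norm q (\<lambda>x. g (x # z)))"

definition split_norm ::
  "(real^'n) list \<Rightarrow> ennreal list \<Rightarrow> (real^'n \<Rightarrow> real) \<Rightarrow> (real^'n \<Rightarrow> ennreal) \<Rightarrow> ennreal" where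
  "split_norm B q \<theta> g = mixed_norm q (\<lambda>xs. g (lin_comb B xs) * ennreal \<bar>\<theta> (lin_comb B xs)\<bar>)"

definition split_Lebesgue ::
  "(real^'n) list \<Rightarrow> ennreal list \<Rightarrow> (real^'n \<Rightarrow> real) \<Rightarrow> (real^'n \<Rightarrow> complex) set" where
  "split_Lebesgue B q \<theta> =
     {g \<in> borel_measurable lebesgue. split_norm B q \<theta> (\<lambda>x. ennreal (cmod (g x))) < \<infinity>}"

definition Lr_loc :: "real \<Rightarrow> (real^'n \<Rightarrow> complex) set" where
  "Lr_loc r = {g \<in> borel_measurable lebesgue.
     \<forall>K. compact K \<longrightarrow> (\<integral>\<^sup>+x\<in>K. ennreal (cmod (g x) powr r) \<partial>lebesgue) < \<infinity>}"

definition split_norm_on ::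
  "(real^'n) list \<Rightarrow> ennreal list \<Rightarrow> (real^'n) set \<Rightarrow> (real^'n \<Rightarrow> ennreal) \<Rightarrow> ennreal" where
  "split_norm_on E r \<Omega> g = split_norm E r (\<lambda>_. 1) (\<lambda>x. g x * indicator \<Omega> x)"

text \<open>From here on a split Lebesgue space \<open>\<B>\<close> is passed by its quasi-norm \<open>N\<close>.\<close>

definition discrete_norm ::
  "((real^'n \<Rightarrow> ennreal) \<Rightarrow> ennreal) \<Rightarrow> (real^'n) list \<Rightarrow> (real^'n \<Rightarrow> complex) \<Rightarrow> ennreal" where
  "discrete_norm N B a =
     N (\<lambda>x. ennreal (cmod (\<Sum>\<^sub>\<infinity>j\<in>basis_lattice B. a j * indicator ((+) j ` parallelepiped B) x)))"

section \<open>The test function space \<open>\<Sigma>\<^sub>1\<close> and its dual\<close>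

definition partial_deriv :: "'n::finite \<Rightarrow> (real^'n \<Rightarrow> complex) \<Rightarrow> real^'n \<Rightarrow> complex" where
  "partial_deriv i f x = vector_derivative (\<lambda>t. f (x + t *\<^sub>R axis i 1)) (at 0)"

text \<open>Differentiability of all iterated partial derivatives, in any order, makes all of them
  continuous.\<close>

definition smooth :: "(real^'n \<Rightarrow> complex) \<Rightarrow> bool" where
  "smooth f \<longleftrightarrow> (\<forall>is. foldr partial_deriv is f differentiable_on UNIV)"

text \<open>\<open>\<partial>\<^sup>\<beta>\<close> for a multi-index \<open>\<beta>\<close>, the coordinate directions being taken in some fixed order,
  which is irrelevant for smooth functions.\<close>

definition coord_enum :: "'n::finite list" where
  "coord_enum = (SOME is. distinct is \<and> set is = UNIV)"

definition multi_deriv :: "('n::finite \<Rightarrow> nat) \<Rightarrow> (real^'n \<Rightarrow> complex) \<Rightarrow> real^'n \<Rightarrow> complex" where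
  "multi_deriv \<beta> f = foldr (\<lambda>i. partial_deriv i ^^ \<beta> i) coord_enum f"

definition monomial :: "('n::finite \<Rightarrow> nat) \<Rightarrow> real^'n \<Rightarrow> real" where
  "monomial \<alpha> x = (\<Prod>i\<in>UNIV. (x $ i) ^ \<alpha> i)"

definition multi_fact :: "('n::finite \<Rightarrow> nat) \<Rightarrow> real" where
  "multi_fact \<alpha> = (\<Prod>i\<in>UNIV. fact (\<alpha> i))"

definition Sigma1_norm :: "real \<Rightarrow> (real^'n \<Rightarrow> complex) \<Rightarrow> ennreal" where
  "Sigma1_norm h f = (SUP (\<alpha>, \<beta>, x)\<in>UNIV.
     ennreal (cmod (monomial \<alpha> x *\<^sub>R multi_deriv \<beta> f x) /
       (h ^ (\<Sum>i\<in>UNIV. \<alpha> i + \<beta> i) * multi_fact \<alpha> * multi_fact \<beta>)))"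

definition Sigma1 :: "(real^'n \<Rightarrow> complex) set" where
  "Sigma1 = {f. smooth f \<and> (\<forall>h>0. Sigma1_norm h f < \<infinity>)}"

text \<open>The projective limit topology, i.e. the coarsest one making the inclusions into all the
  spaces normed by \<^term>\<open>Sigma1_norm h\<close>, \<open>h > 0\<close>, continuous.\<close>

definition Sigma1_topology :: "(real^'n \<Rightarrow> complex) topology" where
  "Sigma1_topology = topology_generated_by
     {{\<psi> \<in> Sigma1. Sigma1_norm h (\<lambda>x. \<psi> x - \<phi> x) < ennreal \<epsilon>} | h \<phi> \<epsilon>.
        0 < h \<and> \<phi> \<in> Sigma1 \<and> 0 < \<epsilon>}"

text \<open>Functionals are linear (not conjugate linear), and extensional so that they are determined
  by their values on \<^term>\<open>Sigma1\<close>.\<close>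

definition Sigma1_dual :: "((real^'n \<Rightarrow> complex) \<Rightarrow> complex) set" where
  "Sigma1_dual = {f \<in> extensional Sigma1.
     (\<forall>\<phi>\<in>Sigma1. \<forall>\<psi>\<in>Sigma1. f (\<lambda>x. \<phi> x + \<psi> x) = f \<phi> + f \<psi>) \<and>
     (\<forall>a. \<forall>\<phi>\<in>Sigma1. f (\<lambda>x. a * \<phi> x) = a * f \<phi>) \<and>
     continuous_map Sigma1_topology euclidean f}"

section \<open>Short-time Fourier transform and the spaces \<open>\<M>\<close> and \<open>\<W>\<close>\<close>

text \<open>The extension of the \<open>L\<^sup>2\<close> scalar product is \<open>(f, \<psi>) = f (cnj \<circ> \<psi>)\<close>.\<close>

definition STFT ::
  "(real^'n \<Rightarrow> complex) \<Rightarrow> ((real^'n \<Rightarrow> complex) \<Rightarrow> complex) \<Rightarrow> real^'n \<Rightarrow> real^'n \<Rightarrow> complex" where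
  "STFT \<phi> f x \<xi> = of_real ((2 * pi) powr (- real CARD('n) / 2)) *
     f (\<lambda>y. cnj (\<phi> (y - x) * exp (\<i> * of_real (y \<bullet> \<xi>))))"

definition weighted_STFT ::
  "(real^'n \<Rightarrow> complex) \<Rightarrow> ((real^'n) \<times> (real^'n) \<Rightarrow> real) \<Rightarrow>
   ((real^'n \<Rightarrow> complex) \<Rightarrow> complex) \<Rightarrow> real^'n \<Rightarrow> real^'n \<Rightarrow> ennreal" where
  "weighted_STFT \<phi> \<omega> f x \<xi> = ennreal (cmod (STFT \<phi> f x \<xi> * of_real (\<omega> (x, \<xi>))))"

definition M_space ::
  "(real^'n \<Rightarrow> complex) \<Rightarrow> (real^'n) list \<Rightarrow> ennreal list \<Rightarrow> ((real^'n) \<times> (real^'n) \<Rightarrow> real) \<Rightarrow>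
   ((real^'n \<Rightarrow> ennreal) \<Rightarrow> ennreal) \<Rightarrow> ((real^'n \<Rightarrow> complex) \<Rightarrow> complex) set" where
  "M_space \<phi> E r \<omega> N = {f \<in> Sigma1_dual.
     N (\<lambda>\<xi>. SUP j\<in>basis_lattice E.
          split_norm_on E r ((+) j ` parallelepiped E) (\<lambda>x. weighted_STFT \<phi> \<omega> f x \<xi>)) < \<infinity>}"

definition W_space ::
  "(real^'n \<Rightarrow> complex) \<Rightarrow> (real^'n) list \<Rightarrow> ennreal list \<Rightarrow> ((real^'n) \<times> (real^'n) \<Rightarrow> real) \<Rightarrow>
   ((real^'n \<Rightarrow> ennreal) \<Rightarrow> ennreal) \<Rightarrow> ((real^'n \<Rightarrow> complex) \<Rightarrow> complex) set" where
  "W_space \<phi> E r \<omega> N = {f \<in> Sigma1_dual.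
     (SUP j\<in>basis_lattice E.
        split_norm_on E r ((+) j ` parallelepiped E) (\<lambda>x. N (weighted_STFT \<phi> \<omega> f x))) < \<infinity>}"

section \<open>Formal expansions and periodic elements\<close>

text \<open>A formal expansion is given by its coefficients on the dual lattice, extended by \<open>0\<close>.\<close>

definition formal_expansions :: "(real^'n) list \<Rightarrow> (real^'n \<Rightarrow> complex) set" where
  "formal_expansions E' = {c. \<forall>\<alpha>. \<alpha> \<notin> basis_lattice E' \<longrightarrow> c \<alpha> = 0}"

definition fourier_transform :: "(real^'n \<Rightarrow> complex) \<Rightarrow> real^'n \<Rightarrow> complex" where
  "fourier_transform \<phi> \<xi> = of_real ((2 * pi) powr (- real CARD('n) / 2)) *
     (LINT x|lebesgue. \<phi> x * exp (- \<i> * of_real (x \<bullet> \<xi>)))"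

definition has_expansion ::
  "(real^'n) list \<Rightarrow> ((real^'n \<Rightarrow> complex) \<Rightarrow> complex) \<Rightarrow> (real^'n \<Rightarrow> complex) \<Rightarrow> bool" where
  "has_expansion E' f c \<longleftrightarrow> c \<in> formal_expansions E' \<and>
     (\<exists>C>0. \<exists>R>0. \<forall>\<alpha>\<in>basis_lattice E'. cmod (c \<alpha>) \<le> C * exp (R * norm \<alpha>)) \<and>
     (\<forall>\<phi>\<in>Sigma1. f \<phi> = of_real ((2 * pi) powr (real CARD('n) / 2)) *
        (\<Sum>\<^sub>\<infinity>\<alpha>\<in>basis_lattice E'. c \<alpha> * fourier_transform \<phi> (- \<alpha>)))"

definition periodic :: "(real^'n) list \<Rightarrow> ((real^'n \<Rightarrow> complex) \<Rightarrow> complex) \<Rightarrow> bool" where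
  "periodic E f \<longleftrightarrow> (\<forall>y\<in>set E. \<forall>\<phi>\<in>Sigma1. f (\<lambda>x. \<phi> (x - y)) = f \<phi>)"

definition expansion_of ::
  "(real^'n) list \<Rightarrow> ((real^'n \<Rightarrow> complex) \<Rightarrow> complex) \<Rightarrow> real^'n \<Rightarrow> complex" where
  "expansion_of E' f = (THE c. has_expansion E' f c)"

text \<open>The intersection of \<open>X \<subseteq> \<Sigma>\<^sub>1'\<close> with the formal expansions: all periodic elements of \<open>X\<close>,
  each identified with its formal expansion.\<close>

definition periodic_elements ::
  "(real^'n) list \<Rightarrow> (real^'n) list \<Rightarrow> ((real^'n \<Rightarrow> complex) \<Rightarrow> complex) set \<Rightarrow>
   (real^'n \<Rightarrow> complex) set" where
  "periodic_elements E E' X = expansion_of E' ` {f \<in> X. periodic E f}"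

definition L_space ::
  "(real^'n) list \<Rightarrow> (real^'n \<Rightarrow> real) \<Rightarrow> ((real^'n \<Rightarrow> ennreal) \<Rightarrow> ennreal) \<Rightarrow>
   (real^'n \<Rightarrow> complex) set" where
  "L_space E' \<omega>\<^sub>0 N =
     {c \<in> formal_expansions E'. discrete_norm N E' (\<lambda>\<alpha>. c \<alpha> * of_real (\<omega>\<^sub>0 \<alpha>)) < \<infinity>}"

end

theory Submission
  imports Defs "HOL-Library.Sublist"
begin

text \<open>
  A periodic \<open>f\<close> has a coefficient sequence \<open>c\<close> of at most exponential growth, and up to a constant
  \<open>V\<^sub>\<phi> f(x, \<xi>)\<close> is, apart from a unimodular factor, the absolutely convergent series of
  \<open>c(\<alpha>) e\<^bsup>i\<langle>x, \<alpha>\<rangle>\<^esup>\<close> times the conjugate of the Fourier transform of \<open>\<phi>\<close> at \<open>\<alpha> - \<xi>\<close>, which decays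
  faster than any exponential. All three memberships are equivalent to the finiteness of one discrete
  mixed norm of \<open>|c(\<alpha>)| \<omega>\<^sub>0(\<alpha>) \<theta>(\<alpha>)\<close>.

  Upper bounds: the series is dominated, uniformly in \<open>x\<close>, by \<open>sup\<^sub>\<alpha> |c(\<alpha>)| \<omega>\<^sub>0(\<alpha>) \<theta>(\<alpha>) e\<^bsup>-d|\<alpha> - \<xi>|\<^esup>\<close>,
  and discrete mixed norms are stable under such maximal functions, for all exponents in \<open>(0, \<infinity>]\<close>.

  Lower bounds: integrating over a cell of \<open>\<Lambda>\<^sub>E\<close> recovers \<open>c(\<beta>)\<close> from \<open>V\<^sub>\<phi> f(\<cdot>, \<beta> - \<xi>\<^sub>0)\<close>, where \<open>\<xi>\<^sub>0\<close> is not a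
  zero of the Fourier transform of \<open>\<phi>\<close>. Hence some box of a fine grid of the cell carries a large value of
  \<open>V\<^sub>\<phi> f\<close>, and as \<open>V\<^sub>\<phi> f\<close> oscillates little on small boxes, the value is large on the whole box, the error
  being absorbed. There are finitely many boxes, so it suffices to bound the contribution of each of them,
  where the local \<open>L\<^sup>r\<close> quasi-norm in \<open>x\<close> and the norm in \<open>\<xi>\<close> can be estimated separately.
\<close>

section \<open>Moderate weights and dual bases\<close>

text \<open>Exponents below 1 shape the norm estimates: the triangle inequality fails, and the tool
  valid on all of (0, \<infinity>] is that the \<open>p\<close>-th power of a supremum is at most
  the sum of the \<open>p\<close>-th powers. So series are first dominated by suprema with
  exponentially decaying weights. Each of the \<open>CARD('n)\<close> iterated norms then costs one
  summable factor, and decay at any prescribed rate pays for all of them as well as for the growth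
  of the weights.

  The absorption in the lower bound subtracts a supremum of damped coefficients from both sides, so
  that supremum must be finite. Hence an expansion with coefficients of exponential growth has to be
  constructed beforehand: the translated window, paired with the periodic functional and integrated
  over a cell, yields the coefficients by way of Poisson summation. Both this and the recovery of
  \<open>c(\<beta>)\<close> divide by a nonzero value of the Fourier transform of \<phi>. That such
  a value exists, and that a continuous periodic function is determined by its Fourier coefficients,
  are both derived from the Stone-Weierstrass theorem.\<close>

lemma moderate_weight_local_bound:
  fixes \<omega> :: "'a::euclidean_space \<Rightarrow> real"
  assumes "\<omega> \<in> moderate_weights"
  obtains K where "K \<ge> 1" "\<And>x y. norm y \<le> 1 \<Longrightarrow> \<omega> (x + y) \<le> K * \<omega> x"
proof -
  from assms have pos: "\<And>x. 0 < \<omega> x" by (auto simp: moderate_weights_def weights_def)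
  from assms obtain v C where v: "v \<in> weights" and C: "\<And>x y. \<omega> (x + y) \<le> C * \<omega> x * v y"
    by (auto simp: moderate_weights_def)
  have vpos: "\<And>x. 0 < v x" using v by (auto simp: weights_def)
  have "0 < C * \<omega> 0 * v 0" using C[of 0 0] pos[of 0] by (metis add_0 less_le_trans)
  then have Cpos: "C > 0" using pos[of 0] vpos[of 0] by (simp add: zero_less_mult_iff)
  obtain M where M: "AE x in lebesgue. x \<in> cball 0 1 \<longrightarrow> \<bar>v x\<bar> \<le> M"
    using v compact_cball[of "0::'a" 1] unfolding weights_def Linf_loc_def by blast
  \<comment> \<open>\<open>v\<close> is bounded on the unit ball only outside a null set.
    \<open>S\<close> collects the exceptional points, so moderateness cannot be applied to
    \<open>y\<close> directly.\<close>
  define S where "S = {x. \<not> (x \<in> cball 0 1 \<longrightarrow> \<bar>v x\<bar> \<le> M)}"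
  have negS: "negligible S"
    using M unfolding S_def negligible_iff_null_sets
    by (auto simp: eventually_ae_filter elim!: completion.complete2[rotated])
  define K where "K = max 1 (C * M * (C * M))"
  have "\<omega> (x + y) \<le> K * \<omega> x" if y: "norm y \<le> 1" for x y
  proof -
    have "negligible ((\<lambda>x. -x) ` S)"
      by (rule negligible_differentiable_image_negligible[OF order_refl negS])
         (intro differentiable_on_minus differentiable_on_ident)
    then have "negligible ((\<lambda>x. y + x) ` ((\<lambda>x. -x) ` S))"
      by (rule negligible_translation)
    \<comment> \<open>The points \<open>z\<close> for which \<open>z\<close> or \<open>y - z\<close>
      is exceptional are negligible, so the ball of radius 1/2 about \<open>y / 2\<close> contains a
      \<open>z\<close> for which neither is. Both \<open>z\<close> and \<open>y - z\<close> then
      have norm at most 1, and \<open>y = z + (y - z)\<close> uses moderateness twice; this is the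
      square in \<open>K\<close>.\<close>
    then have "negligible (S \<union> (\<lambda>x. y + x) ` ((\<lambda>x. -x) ` S))"
      using negS by (intro negligible_Un)
    moreover have "\<not> negligible (ball (y /\<^sub>R 2) (1/2))"
      using open_not_negligible[of "ball (y /\<^sub>R 2) (1/2)"] by auto
    ultimately obtain z where z: "z \<in> ball (y /\<^sub>R 2) (1/2)" "z \<notin> S"
        "z \<notin> (\<lambda>x. y + x) ` ((\<lambda>x. -x) ` S)"
      by (meson UnCI negligible_subset subsetI)
    have "norm z \<le> norm (z - y /\<^sub>R 2) + norm (y /\<^sub>R 2)"
      using norm_triangle_sub[of z "y /\<^sub>R 2"] by simp
    then have nz: "norm z \<le> 1" using z(1) y by (auto simp: dist_norm norm_minus_commute)
    have "y - z = (y /\<^sub>R 2 - z) + y /\<^sub>R 2"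
      by (smt (verit) add_diff_eq diff_add_eq field_sum_of_halves scaleR_half_double scaleR_right_diff_distrib real_vector.scale_left_diff_distrib scaleR_2 diff_diff_add add.commute divideR_right scaleR_add_right zero_neq_numeral inverse_eq_divide)
    then have "norm (y - z) \<le> norm (y /\<^sub>R 2 - z) + norm (y /\<^sub>R 2)"
      by (metis norm_triangle_ineq)
    then have nyz: "norm (y - z) \<le> 1" using z(1) y by (auto simp: dist_norm)
    have "y - z \<notin> S"
    proof
      assume "y - z \<in> S"
      then have "y + - (y - z) \<in> (\<lambda>x. y + x) ` ((\<lambda>x. -x) ` S)" by blast
      then show False using z(3) by simp
    qed
    then have vb: "v z \<le> M" "v (y - z) \<le> M" using z(2) nz nyz by (auto simp: S_def)
    have "\<omega> (x + y) = \<omega> ((x + z) + (y - z))" by simp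
    also have "\<dots> \<le> C * \<omega> (x + z) * v (y - z)" by (rule C)
    also have "\<dots> \<le> C * \<omega> (x + z) * M" using vb Cpos pos[of "x+z"] by (intro mult_left_mono) auto
    also have "\<dots> \<le> C * (C * \<omega> x * v z) * M"
      using vb Cpos vpos[of z] by (intro mult_left_mono mult_right_mono C) auto
    also have "\<dots> \<le> C * (C * \<omega> x * M) * M"
      using vb Cpos pos[of x] vpos[of z] by (intro mult_left_mono mult_right_mono) auto
    also have "\<dots> = (C * M * (C * M)) * \<omega> x" by (simp add: algebra_simps)
    also have "\<dots> \<le> K * \<omega> x" using pos[of x] unfolding K_def by (intro mult_right_mono) auto
    finally show ?thesis .
  qed
  moreover have "K \<ge> 1" by (simp add: K_def)
  ultimately show thesis using that by blast
qed

text \<open>The segment from \<open>x\<close> to \<open>y\<close> is cut into at most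
  \<open>norm (y - x) + 1\<close> steps of length at most 1, each costing a factor \<open>K\<close>;
  hence the rate \<open>ln K\<close>, and one more \<open>K\<close> for rounding up.\<close>

lemma moderate_weight_exp_bound:
  fixes \<omega> :: "'a::euclidean_space \<Rightarrow> real"
  assumes "\<omega> \<in> moderate_weights"
  obtains K R where "K \<ge> 1" "R \<ge> 0" "\<And>x y. \<omega> y \<le> K * exp (R * norm (x - y)) * \<omega> x"
proof -
  from assms have pos: "\<And>x. 0 < \<omega> x" by (auto simp: moderate_weights_def weights_def)
  obtain K where K: "K \<ge> 1" "\<And>x y. norm y \<le> 1 \<Longrightarrow> \<omega> (x + y) \<le> K * \<omega> x"
    using moderate_weight_local_bound[OF assms] by blast
  have iter: "\<omega> (x + of_nat n *\<^sub>R y) \<le> K ^ n * \<omega> x" if "norm y \<le> 1" for x y n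
  proof (induction n)
    case (Suc n)
    have "\<omega> (x + of_nat (Suc n) *\<^sub>R y) = \<omega> ((x + of_nat n *\<^sub>R y) + y)" by (simp add: algebra_simps)
    also have "\<dots> \<le> K * \<omega> (x + of_nat n *\<^sub>R y)" by (rule K(2)[OF that])
    also have "\<dots> \<le> K * (K ^ n * \<omega> x)" using Suc K(1) by (intro mult_left_mono) auto
    finally show ?case by (simp add: mult.assoc)
  qed simp
  have "\<omega> y \<le> K * exp (ln K * norm (x - y)) * \<omega> x" for x y
  proof -
    define m where "m = nat \<lceil>norm (y - x)\<rceil>"
    show ?thesis
    proof (cases "y = x")
      case True
      then show ?thesis using K(1) pos[of x] by simp
    next
      case False
      then have m: "norm (y - x) \<le> real m" "0 < m" "real m \<le> norm (y - x) + 1"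
        unfolding m_def using of_nat_ceiling[of "norm (y - x)"]
        by (auto simp: less_ceiling_iff of_nat_nat ceiling_le_iff)
      have "y = x + of_nat m *\<^sub>R ((y - x) /\<^sub>R real m)" using m by simp
      moreover have "norm ((y - x) /\<^sub>R real m) \<le> 1" unfolding norm_scaleR using m by (simp add: field_simps)
      ultimately have "\<omega> y \<le> K ^ m * \<omega> x" using iter by metis
      also have "K ^ m = exp (ln K * real m)" using K(1) by (simp add: exp_of_nat2_mult)
      also have "\<dots> \<le> exp (ln K * (norm (y - x) + 1))" using K(1) m by (intro iffD2[OF exp_le_cancel_iff] mult_left_mono) auto
      also have "\<dots> = K * exp (ln K * norm (x - y))" using K(1) by (simp add: exp_add distrib_left norm_minus_commute mult.commute)
      finally show ?thesis using pos[of x] by (simp add: mult_right_mono)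
    qed
  qed
  then show thesis using that[of K "ln K"] K(1) by auto
qed

definition coords :: "(real^'n) list \<Rightarrow> real^'n \<Rightarrow> real list" where
  "coords B x = map (\<lambda>e. (x \<bullet> e) / (2 * pi)) B"

text \<open>The coordinates of \<open>x\<close> with respect to \<open>E\<close> are \<open>coords E' x\<close>, and vice versa.\<close>

locale dual_pair =
  fixes E E' :: "(real^'n) list"
  assumes length_eq: "length E' = length E" and length_card: "length E = CARD('n)"
    and inner_dual: "\<And>j k. j < length E \<Longrightarrow> k < length E \<Longrightarrow> E ! j \<bullet> E' ! k = (if j = k then 2 * pi else 0)"
    and lin_comb_coords: "\<And>x. lin_comb E (coords E' x) = x"
    and lin_comb_coords': "\<And>x. lin_comb E' (coords E x) = x"

lemma dual_pair_sym: "dual_pair E E' \<Longrightarrow> dual_pair E' E"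
  unfolding dual_pair_def by (auto simp: inner_commute)

lemma length_coords [simp]: "length (coords B x) = length B"
  by (simp add: coords_def)

lemma nth_coords [simp]: "k < length B \<Longrightarrow> coords B x ! k = (x \<bullet> B ! k) / (2 * pi)"
  by (simp add: coords_def)

lemma inner_lin_comb_dual:
  assumes "length E' = length E"
    "\<And>j k. j < length E \<Longrightarrow> k < length E \<Longrightarrow> E ! j \<bullet> E' ! k = (if j = k then 2 * pi else 0)"
    "k < length E"
  shows "lin_comb E xs \<bullet> E' ! k = 2 * pi * xs ! k"
proof -
  have "lin_comb E xs \<bullet> E' ! k = (\<Sum>j<length E. xs ! j * (if j = k then 2 * pi else 0))"
    unfolding lin_comb_def inner_sum_left by (intro sum.cong refl) (use assms in auto)
  also have "\<dots> = (\<Sum>j<length E. if j = k then xs ! j * (2 * pi) else 0)"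
    by (intro sum.cong) auto
  also have "\<dots> = 2 * pi * xs ! k" using assms(3) by simp
  finally show ?thesis .
qed

lemma span_list_eq_lin_comb:
  fixes E :: "(real^'n) list"
  assumes "x \<in> span (set E)" "distinct E"
  shows "\<exists>xs. x = lin_comb E xs"
proof -
  obtain u where u: "x = (\<Sum>v\<in>set E. u v *\<^sub>R v)"
    using assms(1) span_finite[of "set E"] by auto
  have "x = (\<Sum>k<length E. u (E ! k) *\<^sub>R E ! k)"
    unfolding u by (rule sum.reindex_bij_betw[symmetric, of "(!) E" "{..<length E}"])
      (use bij_betw_nth[OF assms(2)] in auto)
  also have "\<dots> = lin_comb E (map u E)" unfolding lin_comb_def by (intro sum.cong) auto
  finally show ?thesis by blast
qed

lemma ordered_basis_length:
  fixes E :: "(real^'n) list"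
  assumes "ordered_basis E" shows "length E = CARD('n)"
proof -
  have "card (set E) = dim (UNIV :: (real^'n) set)"
    using assms unfolding ordered_basis_def by (metis dim_eq_card_independent dim_span)
  then show ?thesis using assms by (simp add: ordered_basis_def distinct_card dim_UNIV)
qed

lemma dual_pairI:
  fixes E E' :: "(real^'n) list"
  assumes "ordered_basis E" "dual_basis E E'"
  shows "dual_pair E E'"
proof
  show len: "length E' = length E" using assms(2) by (simp add: dual_basis_def)
  show "length E = CARD('n)" by (rule ordered_basis_length[OF assms(1)])
  show dual: "E ! j \<bullet> E' ! k = (if j = k then 2 * pi else 0)" if "j < length E" "k < length E" for j k
    using assms(2) that by (simp add: dual_basis_def)
  show "lin_comb E (coords E' x) = x" for x
  proof -
    obtain xs where xs: "x = lin_comb E xs"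
      using span_list_eq_lin_comb[of x E] assms(1) by (auto simp: ordered_basis_def)
    show ?thesis
      unfolding xs lin_comb_def[of E "coords _ _"]
      by (subst (2) lin_comb_def, intro sum.cong refl) (simp add: len inner_lin_comb_dual[OF len dual])
  qed
  \<comment> \<open>\<open>E'\<close> is not yet known to span. The difference of the two sides is
    orthogonal to every vector of \<open>E\<close>, hence to the span of \<open>E\<close>, which is
    everything, hence to itself.\<close>
  show "lin_comb E' (coords E x) = x" for x
  proof -
    have orth: "(lin_comb E' (coords E x) - x) \<bullet> e = 0" if e: "e \<in> set E" for e
    proof -
      obtain k where k: "k < length E" "e = E ! k" using e by (metis in_set_conv_nth)
      have "lin_comb E' (coords E x) \<bullet> E ! k = 2 * pi * coords E x ! k"
        by (rule inner_lin_comb_dual) (use len dual k in \<open>auto simp: inner_commute\<close>)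
      then show ?thesis using k by (simp add: inner_diff_left)
    qed
    have "(lin_comb E' (coords E x) - x) \<bullet> y = 0" if "y \<in> span (set E)" for y
      using that
    proof (induction rule: span_induct_alt)
      case base then show ?case by simp
    next
      case (step c e y) then show ?case using orth[of e] by (simp add: inner_add_right inner_scaleR_right)
    qed
    then have "(lin_comb E' (coords E x) - x) \<bullet> (lin_comb E' (coords E x) - x) = 0"
      using assms(1) by (simp add: ordered_basis_def)
    then show ?thesis by simp
  qed
qed

section \<open>Lattices and fundamental cells\<close>

text \<open>An enumeration of \<open>I\<close> turns the unordered sum into an ordinary series, to
  which \<open>integral_suminf\<close> applies; absolute summability makes the two notions of sum
  agree.\<close>

lemma integral_infsum:
  fixes h :: "'i \<Rightarrow> 'a \<Rightarrow> complex"
  assumes "countable I" and int: "\<And>i. i \<in> I \<Longrightarrow> integrable M (h i)"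
    and sum1: "(\<lambda>i. \<integral>x. norm (h i x) \<partial>M) summable_on I"
    and sum2: "\<And>x. x \<in> space M \<Longrightarrow> (\<lambda>i. norm (h i x)) summable_on I"
  shows "((\<lambda>i. \<integral>x. h i x \<partial>M) has_sum (\<integral>x. (\<Sum>\<^sub>\<infinity>i\<in>I. h i x) \<partial>M)) I"
proof (cases "finite I")
  case True
  then have "(\<integral>x. (\<Sum>\<^sub>\<infinity>i\<in>I. h i x) \<partial>M) = (\<Sum>i\<in>I. \<integral>x. h i x \<partial>M)"
    using int by (simp add: Bochner_Integration.integral_sum)
  then show ?thesis using True by (simp add: has_sum_finiteI)
next
  case False
  define e where "e = from_nat_into I"
  have e: "bij_betw e UNIV I" unfolding e_def using bij_betw_from_nat_into[OF assms(1) False] by simp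
  have eI: "e n \<in> I" for n using e by (auto simp: bij_betw_def)
  have s1: "summable (\<lambda>n. \<integral>x. norm (h (e n) x) \<partial>M)"
    using sum1 summable_on_reindex_bij_betw[OF e, of "\<lambda>i. \<integral>x. norm (h i x) \<partial>M"]
    by (simp add: summable_on_UNIV_nonneg_real_iff)
  have s2: "summable (\<lambda>n. norm (h (e n) x))" if "x \<in> space M" for x
    using sum2[OF that] summable_on_reindex_bij_betw[OF e, of "\<lambda>i. norm (h i x)"]
    by (simp add: summable_on_UNIV_nonneg_real_iff)
  have eq: "(\<Sum>\<^sub>\<infinity>i\<in>I. h i x) = (\<Sum>n. h (e n) x)" if "x \<in> space M" for x
  proof -
    have "(\<Sum>\<^sub>\<infinity>i\<in>I. h i x) = (\<Sum>\<^sub>\<infinity>n. h (e n) x)"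
      using infsum_reindex_bij_betw[OF e, of "\<lambda>i. h i x"] by simp
    also have "\<dots> = (\<Sum>n. h (e n) x)"
      using norm_summable_imp_has_sum[OF s2[OF that] summable_sums[OF summable_norm_cancel[OF s2[OF that]]]]
      by (simp add: infsumI)
    finally show ?thesis .
  qed
  have "(\<integral>x. (\<Sum>\<^sub>\<infinity>i\<in>I. h i x) \<partial>M) = (\<integral>x. (\<Sum>n. h (e n) x) \<partial>M)"
    by (intro Bochner_Integration.integral_cong refl eq)
  also have "\<dots> = (\<Sum>n. \<integral>x. h (e n) x \<partial>M)"
    by (intro integral_suminf int eI s1 AE_I2 s2)
  finally have E: "(\<integral>x. (\<Sum>\<^sub>\<infinity>i\<in>I. h i x) \<partial>M) = (\<Sum>n. \<integral>x. h (e n) x \<partial>M)" .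
  have s3: "summable (\<lambda>n. norm (\<integral>x. h (e n) x \<partial>M))"
    by (rule summable_comparison_test[OF _ s1]) (auto intro!: exI[of _ 0])
  have "((\<lambda>n. \<integral>x. h (e n) x \<partial>M) has_sum (\<integral>x. (\<Sum>\<^sub>\<infinity>i\<in>I. h i x) \<partial>M)) UNIV"
    unfolding E by (rule norm_summable_imp_has_sum[OF s3 summable_sums[OF summable_norm_cancel[OF s3]]])
  then show ?thesis using has_sum_reindex_bij_betw[OF e, of "\<lambda>i. \<integral>x. h i x \<partial>M"] by simp
qed

lemma integral_translate_lborel:
  fixes g :: "'a::euclidean_space \<Rightarrow> 'b::{banach, second_countable_topology}"
  assumes "g \<in> borel_measurable borel"
  shows "(\<integral>x. g (x + a) \<partial>lborel) = (\<integral>x. g x \<partial>lborel)"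
proof -
  have "(\<integral>x. g x \<partial>lborel) = (\<integral>x. g x \<partial>distr lborel borel ((+) a))"
    by (simp add: lborel_distr_plus)
  also have "\<dots> = (\<integral>x. g (a + x) \<partial>lborel)" using assms by (intro integral_distr) auto
  finally show ?thesis by (simp add: add.commute)
qed

lemma integrable_translate_lborel:
  fixes g :: "'a::euclidean_space \<Rightarrow> 'b::{banach, second_countable_topology}"
  assumes "integrable lborel g"
  shows "integrable lborel (\<lambda>x. g (x + a))"
proof -
  have "integrable (distr lborel borel ((+) a)) g" using assms by (simp add: lborel_distr_plus)
  then have "integrable lborel (\<lambda>x. g (a + x))" by (rule integrable_distr[rotated]) auto
  then show ?thesis by (simp add: add.commute)
qed

lemma nn_integral_exp_abs_finite:
  assumes "c > 0" shows "(\<integral>\<^sup>+t. ennreal (exp (- (c * \<bar>t::real\<bar>))) \<partial>lborel) < \<infinity>"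
proof -
  have "filterlim (\<lambda>x. - (c * x)) at_bot at_top"
    using assms by (simp add: filterlim_uminus_at_top[symmetric] filterlim_tendsto_pos_mult_at_top[OF tendsto_const _ filterlim_ident])
  then have "((\<lambda>x. exp (- (c * x))) \<longlongrightarrow> 0) at_top"
    by (rule filterlim_compose[OF exp_at_bot])
  from tendsto_divide[OF tendsto_minus[OF this] tendsto_const[of c]]
  have lim: "((\<lambda>x. - exp (- (c * x)) / c) \<longlongrightarrow> 0) at_top" using assms by simp
  have half: "(\<integral>\<^sup>+t. ennreal (exp (- (c * t))) * indicator {0..} t \<partial>lborel) = ennreal (0 - (- exp (- (c * 0)) / c))"
    by (rule nn_integral_FTC_atLeast[OF _ _ _ lim])
       (use assms in \<open>auto intro!: derivative_eq_intros\<close>)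
  have "(\<integral>\<^sup>+t. ennreal (exp (- (c * \<bar>t\<bar>))) \<partial>lborel) \<le>
     (\<integral>\<^sup>+t. ennreal (exp (- (c * t))) * indicator {0..} t + ennreal (exp (- (c * (-t)))) * indicator {0..} (-t) \<partial>lborel)"
    by (intro nn_integral_mono) (auto simp: indicator_def abs_if)
  also have "\<dots> = (\<integral>\<^sup>+t. ennreal (exp (- (c * t))) * indicator {0..} t \<partial>lborel) +
       (\<integral>\<^sup>+t. ennreal (exp (- (c * (-t)))) * indicator {0..} (-t) \<partial>lborel)"
    by (rule nn_integral_add) auto
  also have "(\<integral>\<^sup>+t. ennreal (exp (- (c * (-t)))) * indicator {0..} (-t) \<partial>lborel) =
      (\<integral>\<^sup>+t. ennreal (exp (- (c * t))) * indicator {0..} t \<partial>lborel)"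
    using nn_integral_real_affine[of "\<lambda>t. ennreal (exp (- (c * t))) * indicator {0..} t" "-1" 0] by simp
  finally show ?thesis unfolding half by (auto simp: less_top[symmetric] top_unique)
qed

text \<open>Since \<open>norm x\<close> is at least the average of the
  \<open>\<bar>x \<bullet> b\<bar>\<close>, the function is dominated by a product of
  one-dimensional exponentials of rate \<open>R / D\<close>, whose integral factorizes.\<close>

lemma integrable_exp_norm:
  assumes "R > 0" shows "integrable lborel (\<lambda>x::'a::euclidean_space. exp (- (R * norm x)))"
proof (rule integrableI_nonneg)
  define D where "D = real DIM('a)"
  have D: "D > 0" by (simp add: D_def)
  have "(\<integral>\<^sup>+x. ennreal (exp (- (R * norm (x::'a)))) \<partial>lborel) \<le>
      (\<integral>\<^sup>+x. (\<Prod>b\<in>Basis. ennreal (exp (- (R / D * \<bar>x \<bullet> b\<bar>)))) \<partial>(lborel :: 'a measure))"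
  proof (intro nn_integral_mono)
    fix x :: 'a
    have "(\<Sum>b\<in>(Basis::'a set). \<bar>x \<bullet> b\<bar>) \<le> D * norm x"
      unfolding D_def using sum_bounded_above[of "Basis::'a set" "\<lambda>b. \<bar>x \<bullet> b\<bar>" "norm x"] Basis_le_norm by auto
    then have "(\<Sum>b\<in>(Basis::'a set). R / D * \<bar>x \<bullet> b\<bar>) \<le> R / D * (D * norm x)"
      unfolding sum_distrib_left[symmetric] using assms D by (intro mult_left_mono) auto
    then have "exp (- (R * norm x)) \<le> exp (\<Sum>b\<in>(Basis::'a set). - (R / D * \<bar>x \<bullet> b\<bar>))"
      using D by (simp add: sum_negf)
    also have "\<dots> = (\<Prod>b\<in>(Basis::'a set). exp (- (R / D * \<bar>x \<bullet> b\<bar>)))" by (simp add: exp_sum)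
    finally show "ennreal (exp (- (R * norm x))) \<le> (\<Prod>b\<in>Basis. ennreal (exp (- (R / D * \<bar>x \<bullet> b\<bar>))))"
      by (simp add: prod_ennreal ennreal_leI)
  qed
  also have "\<dots> = (\<Prod>b\<in>(Basis::'a set). (\<integral>\<^sup>+t. ennreal (exp (- (R / D * \<bar>t\<bar>))) \<partial>lborel))"
    by (rule nn_integral_lborel_prod) auto
  also have "\<dots> < \<infinity>"
    using nn_integral_exp_abs_finite[of "R / D"] assms D by (auto simp: less_top[symmetric] power_eq_top_ennreal)
  finally show "(\<integral>\<^sup>+x. ennreal (exp (- (R * norm (x::'a)))) \<partial>lborel) < \<infinity>" .
qed auto

text \<open>For a dual pair \<open>E\<close>, \<open>E'\<close>, \<open>cell E'\<close> is the half-open parallelepiped spanned by \<open>E\<close>.\<close>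

definition cell :: "(real^'n) list \<Rightarrow> (real^'n) set" where
  "cell B = {x. \<forall>e\<in>set B. 0 \<le> (x \<bullet> e) / (2 * pi) \<and> (x \<bullet> e) / (2 * pi) < 1}"

lemma cell_borel [measurable]: "cell B \<in> sets borel"
  unfolding cell_def by measurable

text \<open>An upper bound for the diameter of the parallelepiped spanned by \<open>B\<close>, from
  the triangle inequality alone.\<close>

definition list_diam :: "(real^'n) list \<Rightarrow> real" where
  "list_diam B = (\<Sum>k<length B. norm (B ! k))"

lemma list_diam_nonneg: "list_diam B \<ge> 0"
  unfolding list_diam_def by (intro sum_nonneg) auto

lemma norm_lin_comb_le:
  assumes "\<And>k. k < length B \<Longrightarrow> \<bar>xs ! k\<bar> \<le> c"
  shows "norm (lin_comb B xs) \<le> c * list_diam B"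
proof -
  have "norm (lin_comb B xs) \<le> (\<Sum>k<length B. \<bar>xs ! k\<bar> * norm (B ! k))"
    unfolding lin_comb_def by (intro order_trans[OF norm_sum]) (simp add: sum_mono)
  also have "\<dots> \<le> (\<Sum>k<length B. c * norm (B ! k))"
    by (intro sum_mono mult_right_mono) (use assms in auto)
  finally show ?thesis by (simp add: list_diam_def sum_distrib_left)
qed

section \<open>Tiling of space by the lattice translates of a half-open cell\<close>

context dual_pair
begin

lemma inner_lin_comb: "k < length E \<Longrightarrow> lin_comb E xs \<bullet> E' ! k = 2 * pi * xs ! k"
  using inner_lin_comb_dual[OF length_eq inner_dual] .

lemma coords_lin_comb: "length xs = length E \<Longrightarrow> coords E' (lin_comb E xs) = xs"
  by (intro nth_equalityI) (simp_all add: length_eq inner_lin_comb)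

lemma in_lattice_iff: "y \<in> basis_lattice E \<longleftrightarrow> (\<forall>e\<in>set E'. (y \<bullet> e) / (2 * pi) \<in> \<int>)"
proof
  assume "y \<in> basis_lattice E"
  then obtain xs where xs: "y = lin_comb E xs" "length xs = length E" "set xs \<subseteq> \<int>"
    by (auto simp: basis_lattice_def)
  then have "set (coords E' y) \<subseteq> \<int>" by (simp add: coords_lin_comb)
  then show "\<forall>e\<in>set E'. (y \<bullet> e) / (2 * pi) \<in> \<int>" by (auto simp: coords_def)
next
  assume "\<forall>e\<in>set E'. (y \<bullet> e) / (2 * pi) \<in> \<int>"
  then have "set (coords E' y) \<subseteq> \<int>" by (auto simp: coords_def)
  then show "y \<in> basis_lattice E" unfolding basis_lattice_def
    using lin_comb_coords[of y] length_eq length_coords[of E' y] by (metis (mono_tags, lifting) mem_Collect_eq)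
qed

lemma lattice_0 [simp]: "0 \<in> basis_lattice E"
  by (simp add: in_lattice_iff)

lemma lattice_add: "x \<in> basis_lattice E \<Longrightarrow> y \<in> basis_lattice E \<Longrightarrow> x + y \<in> basis_lattice E"
  by (simp add: in_lattice_iff inner_add_left add_divide_distrib)

lemma lattice_uminus: "x \<in> basis_lattice E \<Longrightarrow> - x \<in> basis_lattice E"
  by (simp add: in_lattice_iff)

lemma lattice_uminus_iff [simp]: "- x \<in> basis_lattice E \<longleftrightarrow> x \<in> basis_lattice E"
  using lattice_uminus by fastforce

lemma lattice_diff: "x \<in> basis_lattice E \<Longrightarrow> y \<in> basis_lattice E \<Longrightarrow> x - y \<in> basis_lattice E"
  using lattice_add[of x "-y"] by simp

lemma lattice_inner: 
  assumes "y \<in> basis_lattice E" "\<alpha> \<in> basis_lattice E'"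
  shows "\<exists>n::int. y \<bullet> \<alpha> = 2 * pi * of_int n"
proof -
  obtain xs where xs: "\<alpha> = lin_comb E' xs" "length xs = length E'" "set xs \<subseteq> \<int>"
    using assms(2) by (auto simp: basis_lattice_def)
  have "y \<bullet> \<alpha> / (2 * pi) = (\<Sum>k<length E'. xs ! k * ((y \<bullet> E' ! k) / (2 * pi)))"
    unfolding xs(1) lin_comb_def inner_sum_right by (simp add: sum_divide_distrib)
  also have "\<dots> \<in> \<int>"
  proof (rule Ints_sum, rule Ints_mult)
    fix k assume "k \<in> {..<length E'}"
    then show "xs ! k \<in> \<int>" "y \<bullet> E' ! k / (2 * pi) \<in> \<int>" 
      using xs assms(1) by (auto simp: in_lattice_iff)
  qed
  finally obtain n where "y \<bullet> \<alpha> / (2 * pi) = of_int n" by (elim Ints_cases)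
  then show ?thesis by (intro exI[of _ n]) (simp add: field_simps)
qed

lemma cis_lattice: "y \<in> basis_lattice E \<Longrightarrow> \<alpha> \<in> basis_lattice E' \<Longrightarrow> cis (y \<bullet> \<alpha>) = 1"
  using lattice_inner[of y \<alpha>] by (metis cis_multiple_2pi Ints_of_int)

lemma countable_lattice: "countable (basis_lattice E)"
proof -
  have "basis_lattice E \<subseteq> range (\<lambda>ks::int list. lin_comb E (map of_int ks))"
  proof
    fix y assume "y \<in> basis_lattice E"
    then obtain xs where xs: "y = lin_comb E xs" "set xs \<subseteq> \<int>" by (auto simp: basis_lattice_def)
    then have "xs = map of_int (map floor xs)" by (auto simp: list_eq_iff_nth_eq) (metis Ints_cases floor_of_int nth_mem subsetD)
    then show "y \<in> range (\<lambda>ks::int list. lin_comb E (map of_int ks))" using xs(1) by (metis rangeI)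
  qed
  then show ?thesis by (rule countable_subset) auto
qed

definition floor_pt :: "real^'n \<Rightarrow> real^'n" where
  "floor_pt x = lin_comb E (map (\<lambda>t. of_int \<lfloor>t\<rfloor>) (coords E' x))"

lemma floor_pt_lattice: "floor_pt x \<in> basis_lattice E"
  unfolding floor_pt_def basis_lattice_def using length_eq by (intro CollectI exI conjI refl) auto

lemma floor_pt_cell: "x - floor_pt x \<in> cell E'"
proof -
  have "0 \<le> ((x - floor_pt x) \<bullet> E' ! k) / (2 * pi) \<and> ((x - floor_pt x) \<bullet> E' ! k) / (2 * pi) < 1"
    if k: "k < length E'" for k
  proof -
    have "floor_pt x \<bullet> E' ! k = 2 * pi * of_int \<lfloor>(x \<bullet> E' ! k) / (2 * pi)\<rfloor>"
      unfolding floor_pt_def using k length_eq by (subst inner_lin_comb) auto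
    then have "((x - floor_pt x) \<bullet> E' ! k) / (2 * pi) = (x \<bullet> E' ! k) / (2 * pi) - of_int \<lfloor>(x \<bullet> E' ! k) / (2 * pi)\<rfloor>"
      by (simp add: inner_diff_left diff_divide_distrib)
    then show ?thesis by (simp only: ) linarith
  qed
  then show ?thesis unfolding cell_def by (auto simp: in_set_conv_nth)
qed

lemma tile_unique:
  assumes "y \<in> basis_lattice E" "x - y \<in> cell E'" shows "y = floor_pt x"
proof -
  have "coords E' y = map (\<lambda>t. of_int \<lfloor>t\<rfloor>) (coords E' x)"
  proof (intro nth_equalityI)
    fix k assume "k < length (coords E' y)"
    then have k: "k < length E'" by simp
    have "(y \<bullet> E' ! k) / (2 * pi) \<in> \<int>" using assms(1) k by (auto simp: in_lattice_iff)
    then obtain n where n: "(y \<bullet> E' ! k) / (2 * pi) = of_int n" by (elim Ints_cases)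
    have "0 \<le> ((x - y) \<bullet> E' ! k) / (2 * pi)" "((x - y) \<bullet> E' ! k) / (2 * pi) < 1"
      using assms(2) k by (auto simp: cell_def)
    then have "\<lfloor>(x \<bullet> E' ! k) / (2 * pi)\<rfloor> = n" using n
      by (simp add: floor_eq_iff inner_diff_left diff_divide_distrib)
    then show "coords E' y ! k = map (\<lambda>t. of_int \<lfloor>t\<rfloor>) (coords E' x) ! k" using k n by simp
  qed simp
  then show ?thesis unfolding floor_pt_def by (metis lin_comb_coords)
qed

lemma tile_iff: "y \<in> basis_lattice E \<Longrightarrow> x - y \<in> cell E' \<longleftrightarrow> y = floor_pt x"
  using tile_unique floor_pt_cell by blast

lemma cell_norm_le: assumes "x \<in> cell E'" shows "norm x \<le> list_diam E"
proof -
  have "norm (lin_comb E (coords E' x)) \<le> 1 * list_diam E"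
  proof (rule norm_lin_comb_le)
    fix k assume "k < length E"
    then have "E' ! k \<in> set E'" "k < length E'" using length_eq by auto
    then show "\<bar>coords E' x ! k\<bar> \<le> 1" using assms unfolding cell_def
      by (simp only: nth_coords mem_Collect_eq) (smt (verit, ccfv_threshold))
  qed
  then show ?thesis by (simp add: lin_comb_coords)
qed

lemma emeasure_cell_finite: "emeasure lborel (cell E') < \<infinity>"
  by (rule emeasure_bounded_finite) (use cell_norm_le in \<open>auto simp: bounded_iff\<close>)

definition cell_vol :: real where "cell_vol = measure lborel (cell E')"

lemma cell_vol_pos: "cell_vol > 0"
proof -
  define U where "U = {x. \<forall>e\<in>set E'. 0 < (x \<bullet> e) / (2 * pi) \<and> (x \<bullet> e) / (2 * pi) < 1}"
  have "U = (\<Inter>e\<in>set E'. {x. 0 < (x \<bullet> e) / (2 * pi)} \<inter> {x. (x \<bullet> e) / (2 * pi) < 1})"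
    by (auto simp: U_def)
  then have "open U" by (auto intro!: open_INT open_Collect_less continuous_intros)
  moreover have "lin_comb E (replicate (length E) (1/2)) \<in> U"
    unfolding U_def by (auto simp: in_set_conv_nth length_eq inner_lin_comb)
  ultimately have "\<not> negligible U" using open_not_negligible by blast
  then have "\<not> negligible (cell E')" using negligible_subset[of "cell E'" U] by (force simp: U_def cell_def)
  then have "emeasure lborel (cell E') \<noteq> 0"
    using null_sets_completionI[of "cell E'" lborel] by (auto simp: negligible_iff_null_sets null_sets_def)
  then show ?thesis unfolding cell_vol_def using emeasure_cell_finite
    by (auto simp: measure_def enn2real_positive_iff less_top zero_less_iff_neq_zero)
qed

lemma cell_integrable:
  fixes g :: "real^'n \<Rightarrow> complex"
  assumes "g \<in> borel_measurable borel" "\<And>x. x \<in> cell E' \<Longrightarrow> norm (g x) \<le> C"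
  shows "set_integrable lborel (cell E') g"
  unfolding set_integrable_def
proof (rule Bochner_Integration.integrable_bound)
  show "integrable lborel (\<lambda>x. C *\<^sub>R indicator (cell E') x :: real)"
    using emeasure_cell_finite by (intro integrable_scaleR_right) (auto simp: integrable_indicator_iff)
  show "(\<lambda>x. indicat_real (cell E') x *\<^sub>R g x) \<in> borel_measurable lborel" using assms(1) by simp
  have "norm (indicat_real (cell E') x *\<^sub>R g x) \<le> norm (C *\<^sub>R indicat_real (cell E') x)" for x
    using assms(2)[of x] by (cases "x \<in> cell E'") auto
  then show "AE x in lborel. norm (indicat_real (cell E') x *\<^sub>R g x) \<le> norm (C *\<^sub>R indicat_real (cell E') x)"
    by simp
qed

lemma cell_integral_norm_le:
  fixes g :: "real^'n \<Rightarrow> complex"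
  assumes "\<And>x. x \<in> cell E' \<Longrightarrow> norm (g x) \<le> C"
  shows "norm (LINT x:cell E'|lborel. g x) \<le> C * cell_vol"
proof (cases "set_integrable lborel (cell E') g")
  case True
  have "norm (LINT x:cell E'|lborel. g x) \<le> (\<integral>x. C *\<^sub>R indicat_real (cell E') x \<partial>lborel)"
    unfolding set_lebesgue_integral_def
  proof (rule order_trans[OF integral_norm_bound integral_mono])
    show "integrable lborel (\<lambda>x. C *\<^sub>R indicator (cell E') x :: real)"
      using emeasure_cell_finite by (intro integrable_scaleR_right) (auto simp: integrable_indicator_iff)
    show "norm (indicat_real (cell E') x *\<^sub>R g x) \<le> C *\<^sub>R indicat_real (cell E') x" for x
      using assms[of x] by (cases "x \<in> cell E'") auto
  qed (rule integrable_norm, use True in \<open>simp add: set_integrable_def\<close>)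
  also have "\<dots> = C * cell_vol" by (simp add: cell_vol_def)
  finally show ?thesis .
next
  \<comment> \<open>A function that is not integrable has integral 0 by convention, so only
    \<open>C \<ge> 0\<close> is left to show. It comes from the bound at the point 0 of the
    cell.\<close>
  case False
  have "0 \<in> cell E'" by (simp add: cell_def)
  then have "C \<ge> 0" using assms[of 0] norm_ge_zero order_trans by blast
  then show ?thesis using False cell_vol_pos
    by (simp add: set_integrable_def set_lebesgue_integral_def not_integrable_integral_eq)
qed

text \<open>Comparison with an integral: the translates of the cell are disjoint, and on the
  translate at \<open>y\<close> the exponential is at least its value at \<open>y\<close> divided by
  \<open>exp (R * list_diam E)\<close>.\<close>

lemma summable_on_exp_lattice:
  assumes "R > 0" shows "(\<lambda>y. exp (- (R * norm y))) summable_on basis_lattice E"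
proof (rule nonneg_bdd_above_summable_on)
  define J where "J = (\<integral>x. exp (- (R * norm (x::real^'n))) \<partial>lborel)"
  define B where "B = exp (R * list_diam E) * J / cell_vol"
  show "bdd_above (sum (\<lambda>y. exp (- (R * norm y))) ` {F. F \<subseteq> basis_lattice E \<and> finite F})"
  proof (rule bdd_aboveI2)
    fix F assume "F \<in> {F. F \<subseteq> basis_lattice E \<and> finite F}"
    then have F: "F \<subseteq> basis_lattice E" "finite F" by auto
    have int1: "integrable lborel (\<lambda>x::real^'n. exp (R * list_diam E) * (indicator (cell E') (x - y) * exp (- (R * norm x))))" for y
      by (intro integrable_mult_right Bochner_Integration.integrable_bound[OF integrable_exp_norm[OF assms]])
         (auto simp: indicator_def)
    have int2: "integrable lborel (\<lambda>x. indicat_real (cell E') (x - y) * exp (- (R * norm y)))" for y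
      using integrable_translate_lborel[of "indicat_real (cell E')" "-y"] emeasure_cell_finite
      by (intro integrable_mult_left) (auto simp: integrable_indicator_iff)
    have one: "cell_vol * exp (- (R * norm y)) \<le> (\<integral>x. exp (R * list_diam E) * (indicator (cell E') (x - y) * exp (- (R * norm x))) \<partial>lborel)"
      for y :: "real^'n"
    proof -
      have "cell_vol * exp (- (R * norm y)) = (\<integral>x. indicat_real (cell E') (x - y) * exp (- (R * norm y)) \<partial>lborel)"
        using integral_translate_lborel[of "indicat_real (cell E')" "-y"] emeasure_cell_finite
        by (simp add: cell_vol_def)
      also have "\<dots> \<le> (\<integral>x. exp (R * list_diam E) * (indicator (cell E') (x - y) * exp (- (R * norm x))) \<partial>lborel)"
      proof (intro integral_mono int1 int2)
        fix x :: "real^'n"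
        show "indicat_real (cell E') (x - y) * exp (- (R * norm y)) \<le> exp (R * list_diam E) * (indicat_real (cell E') (x - y) * exp (- (R * norm x)))"
        proof (cases "x - y \<in> cell E'")
          case True
          have "norm x \<le> list_diam E + norm y" using cell_norm_le[OF True] norm_triangle_sub[of x y] by linarith
          then have "R * norm x \<le> R * list_diam E + R * norm y"
            using assms by (simp add: distrib_left[symmetric])
          then show ?thesis using True by (simp add: exp_add[symmetric])
        qed auto
      qed
      finally show ?thesis .
    qed
    have "cell_vol * (\<Sum>y\<in>F. exp (- (R * norm y))) \<le> (\<Sum>y\<in>F. \<integral>x. exp (R * list_diam E) * (indicator (cell E') (x - y) * exp (- (R * norm x))) \<partial>lborel)"
      unfolding sum_distrib_left by (intro sum_mono one)
    also have "\<dots> = (\<integral>x. (\<Sum>y\<in>F. exp (R * list_diam E) * (indicator (cell E') (x - y) * exp (- (R * norm x)))) \<partial>lborel)"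
      by (intro Bochner_Integration.integral_sum[symmetric] int1)
    also have "\<dots> \<le> (\<integral>x. exp (R * list_diam E) * exp (- (R * norm (x::real^'n))) \<partial>lborel)"
    proof (intro integral_mono Bochner_Integration.integrable_sum int1 integrable_mult_right integrable_exp_norm assms)
      fix x :: "real^'n"
      have "(\<Sum>y\<in>F. indicat_real (cell E') (x - y)) = (\<Sum>y\<in>F. if y = floor_pt x then 1 else 0)"
        using F by (intro sum.cong refl) (auto simp: indicator_def tile_iff subset_iff)
      also have "\<dots> \<le> 1" using F by simp
      finally have "(\<Sum>y\<in>F. indicat_real (cell E') (x - y)) * (exp (R * list_diam E) * exp (- (R * norm x))) \<le> 1 * (exp (R * list_diam E) * exp (- (R * norm x)))"
        by (intro mult_right_mono) auto
      then show "(\<Sum>y\<in>F. exp (R * list_diam E) * (indicat_real (cell E') (x - y) * exp (- (R * norm x)))) \<le> exp (R * list_diam E) * exp (- (R * norm x))"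
        by (simp add: sum_distrib_right sum_distrib_left mult_ac)
    qed
    also have "\<dots> = exp (R * list_diam E) * J" by (simp add: J_def)
    finally show "(\<Sum>y\<in>F. exp (- (R * norm y))) \<le> B"
      using cell_vol_pos by (simp add: B_def field_simps)
  qed
qed auto

end

text \<open>By the M-test the finite partial sums converge uniformly in \<open>t\<close>, so the
  limit in \<open>t\<close> and the limit over finite subsets can be exchanged. This is dominated
  convergence for unordered sums.\<close>

lemma tendsto_infsum_dominated:
  fixes f :: "'a \<Rightarrow> 'b \<Rightarrow> 'c::banach"
  assumes "\<And>i. i \<in> I \<Longrightarrow> ((\<lambda>t. f i t) \<longlongrightarrow> l i) F"
    and bound: "\<forall>\<^sub>F t in F. \<forall>i\<in>I. norm (f i t) \<le> M i" and "M summable_on I"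
    and nontriv: "F \<noteq> bot"
  shows "((\<lambda>t. \<Sum>\<^sub>\<infinity>i\<in>I. f i t) \<longlongrightarrow> (\<Sum>\<^sub>\<infinity>i\<in>I. l i)) F"
proof (rule swap_uniform_limit')
  define Y where "Y = {t. \<forall>i\<in>I. norm (f i t) \<le> M i}"
  show "uniform_limit Y (\<lambda>X t. \<Sum>i\<in>X. f i t) (\<lambda>t. \<Sum>\<^sub>\<infinity>i\<in>I. f i t) (finite_subsets_at_top I)"
    by (rule Weierstrass_m_test_general[OF _ assms(3)]) (auto simp: Y_def)
  show "\<forall>\<^sub>F t in F. t \<in> Y" using bound by (simp add: Y_def)
  show "\<forall>\<^sub>F X in finite_subsets_at_top I. ((\<lambda>t. \<Sum>i\<in>X. f i t) \<longlongrightarrow> (\<Sum>i\<in>X. l i)) F"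
    by (intro eventually_finite_subsets_at_top_weakI tendsto_sum assms(1)) auto
  have lb: "norm (l i) \<le> M i" if "i \<in> I" for i
    by (rule tendsto_upperbound[OF tendsto_norm[OF assms(1)[OF that]] _ nontriv])
       (use bound that in \<open>auto elim: eventually_mono\<close>)
  have "l summable_on I"
    by (rule abs_summable_summable, rule Infinite_Sum.abs_summable_on_comparison_test'[OF assms(3) lb])
  then show "((\<lambda>X. \<Sum>i\<in>X. l i) \<longlongrightarrow> (\<Sum>\<^sub>\<infinity>i\<in>I. l i)) (finite_subsets_at_top I)"
    by (rule infsum_tendsto)
qed auto

lemma infsum_single_support:
  fixes f :: "'a \<Rightarrow> 'b::{topological_comm_monoid_add, t2_space}"
  assumes "a \<in> I" "\<And>i. i \<in> I \<Longrightarrow> i \<noteq> a \<Longrightarrow> f i = 0"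
  shows "(f has_sum f a) I"
proof -
  have "(f has_sum f a) {a}" by (simp add: has_sum_finiteI)
  then show ?thesis using has_sum_cong_neutral[of "{a}" I f f "f a"] assms by auto
qed

lemma borel_measurable_cis_inner [measurable]: "(\<lambda>x::'a::euclidean_space. cis (x \<bullet> \<alpha>)) \<in> borel_measurable borel"
  by (intro borel_measurable_continuous_onI continuous_intros)

context dual_pair
begin

text \<open>The functions cut off to different translates of the cell have disjoint supports, so
  every finite partial sum is bounded by the integral of \<open>norm (g x)\<close>.\<close>

lemma tile_summable:
  fixes g :: "real^'n \<Rightarrow> complex"
  assumes "integrable lborel g"
  shows "(\<lambda>y. \<integral>x. norm (indicat_real (cell E') (x - y) *\<^sub>R g x) \<partial>lborel) summable_on basis_lattice E"
proof (rule nonneg_bdd_above_summable_on)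
  have int: "integrable lborel (\<lambda>x. norm (indicat_real (cell E') (x - y) *\<^sub>R g x))" for y
    by (rule Bochner_Integration.integrable_bound[OF assms]) (use assms in \<open>auto simp: indicator_def\<close>)
  show "bdd_above (sum (\<lambda>y. \<integral>x. norm (indicat_real (cell E') (x - y) *\<^sub>R g x) \<partial>lborel) ` {F. F \<subseteq> basis_lattice E \<and> finite F})"
  proof (rule bdd_aboveI2)
    fix F assume "F \<in> {F. F \<subseteq> basis_lattice E \<and> finite F}"
    then have F: "F \<subseteq> basis_lattice E" "finite F" by auto
    have "(\<Sum>y\<in>F. \<integral>x. norm (indicat_real (cell E') (x - y) *\<^sub>R g x) \<partial>lborel) =
        (\<integral>x. (\<Sum>y\<in>F. norm (indicat_real (cell E') (x - y) *\<^sub>R g x)) \<partial>lborel)"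
      by (intro Bochner_Integration.integral_sum[symmetric] int)
    also have "\<dots> \<le> (\<integral>x. norm (g x) \<partial>lborel)"
    proof (intro integral_mono Bochner_Integration.integrable_sum int integrable_norm assms)
      fix x
      have "(\<Sum>y\<in>F. indicat_real (cell E') (x - y)) = (\<Sum>y\<in>F. if y = floor_pt x then 1 else 0)"
        using F by (intro sum.cong refl) (auto simp: indicator_def tile_iff subset_iff)
      also have "\<dots> \<le> 1" using F by simp
      finally have "(\<Sum>y\<in>F. indicat_real (cell E') (x - y)) * norm (g x) \<le> 1 * norm (g x)"
        by (intro mult_right_mono) auto
      then show "(\<Sum>y\<in>F. norm (indicat_real (cell E') (x - y) *\<^sub>R g x)) \<le> norm (g x)"
        by (simp add: sum_distrib_right)
    qed
    finally show "(\<Sum>y\<in>F. \<integral>x. norm (indicat_real (cell E') (x - y) *\<^sub>R g x) \<partial>lborel) \<le> (\<integral>x. norm (g x) \<partial>lborel)" .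
  qed
qed auto

lemma tile_integral_translate:
  fixes g :: "real^'n \<Rightarrow> 'b::{banach, second_countable_topology}"
  assumes [measurable]: "g \<in> borel_measurable borel"
  shows "(\<integral>x. indicat_real (cell E') (x - y) *\<^sub>R g x \<partial>lborel) = (LINT x:cell E'|lborel. g (x + y))"
  using integral_translate_lborel[of "\<lambda>x. indicat_real (cell E') (x - y) *\<^sub>R g x" y]
  by (simp add: set_lebesgue_integral_def)

text \<open>At every \<open>x\<close> only the translate at \<open>floor_pt x\<close> contributes,
  so the cut-off functions add up to \<open>g x\<close>; sum and integral are then exchanged and
  each piece is moved back to the cell.\<close>

lemma tile_integral:
  fixes g :: "real^'n \<Rightarrow> complex"
  assumes "integrable lborel g"
  shows "((\<lambda>y. LINT x:cell E'|lborel. g (x + y)) has_sum (\<integral>x. g x \<partial>lborel)) (basis_lattice E)"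
proof -
  have g [measurable]: "g \<in> borel_measurable borel" using assms by auto
  have hs: "((\<lambda>y. indicat_real (cell E') (x - y) *\<^sub>R g x) has_sum g x) (basis_lattice E)" for x
    using infsum_single_support[of "floor_pt x" "basis_lattice E" "\<lambda>y. indicat_real (cell E') (x - y) *\<^sub>R g x"]
    by (auto simp: floor_pt_lattice indicator_def tile_iff floor_pt_cell)
  have hs': "((\<lambda>y. norm (indicat_real (cell E') (x - y) *\<^sub>R g x)) has_sum norm (g x)) (basis_lattice E)" for x
    using infsum_single_support[of "floor_pt x" "basis_lattice E" "\<lambda>y. norm (indicat_real (cell E') (x - y) *\<^sub>R g x)"]
    by (auto simp: floor_pt_lattice indicator_def tile_iff floor_pt_cell)
  have "((\<lambda>y. \<integral>x. indicat_real (cell E') (x - y) *\<^sub>R g x \<partial>lborel) has_sum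
      (\<integral>x. (\<Sum>\<^sub>\<infinity>y\<in>basis_lattice E. indicat_real (cell E') (x - y) *\<^sub>R g x) \<partial>lborel)) (basis_lattice E)"
  proof (rule integral_infsum[OF countable_lattice _ tile_summable[OF assms]])
    show "integrable lborel (\<lambda>x. indicat_real (cell E') (x - y) *\<^sub>R g x)" for y
      by (rule Bochner_Integration.integrable_bound[OF assms]) (auto simp: indicator_def)
    show "(\<lambda>y. norm (indicat_real (cell E') (x - y) *\<^sub>R g x)) summable_on basis_lattice E" for x
      using hs' by (auto simp: summable_on_def)
  qed
  then show ?thesis by (simp add: infsumI[OF hs] tile_integral_translate)
qed

text \<open>The shifted cell is cut along the lattice translates of the cell, and periodicity moves
  the pieces back. Concretely, \<open>g\<close> is \<open>G\<close> cut off to the shifted cell; the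
  lattice translates of \<open>g\<close> add up to \<open>G\<close> on the cell, because for each
  \<open>x\<close> only \<open>y = - floor_pt (x - s)\<close> contributes.\<close>

lemma cell_integral_shift:
  fixes G :: "real^'n \<Rightarrow> complex"
  assumes [measurable]: "G \<in> borel_measurable borel" and bdd: "\<And>x. norm (G x) \<le> C"
    and per: "\<And>x y. y \<in> basis_lattice E \<Longrightarrow> G (x + y) = G x"
  shows "(LINT x:cell E'|lborel. G (x + s)) = (LINT x:cell E'|lborel. G x)"
proof -
  define g where "g x = indicat_real (cell E') (x - s) *\<^sub>R G x" for x
  have [measurable]: "g \<in> borel_measurable borel" unfolding g_def by measurable
  have "integrable lborel (\<lambda>x. indicat_real (cell E') x *\<^sub>R G (x + s))"
    using cell_integrable[of "\<lambda>x. G (x + s)" C] bdd by (simp add: set_integrable_def)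
  from integrable_translate_lborel[OF this, of "-s"] have gint: "integrable lborel g"
    by (simp add: g_def[abs_def])
  have gI: "(\<integral>x. g x \<partial>lborel) = (LINT x:cell E'|lborel. G (x + s))"
    unfolding g_def by (rule tile_integral_translate) simp
  define h where "h y x = indicat_real (cell E') x *\<^sub>R g (x + y)" for x y
  have h: "h y x = (if y = - floor_pt (x - s) then indicat_real (cell E') x *\<^sub>R G x else 0)" if "y \<in> basis_lattice E" for x y
  proof -
    have "x + y - s \<in> cell E' \<longleftrightarrow> -y = floor_pt (x - s)"
      using tile_iff[of "-y" "x - s"] that by (simp add: algebra_simps)
    then have "x + y - s \<in> cell E' \<longleftrightarrow> y = - floor_pt (x - s)"
      by (metis add.inverse_inverse)
    then show ?thesis using per[OF that] by (auto simp: h_def g_def indicator_def)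
  qed
  have mem: "- floor_pt (x - s) \<in> basis_lattice E" for x by (simp add: floor_pt_lattice)
  have hs: "((\<lambda>y. h y x) has_sum (indicat_real (cell E') x *\<^sub>R G x)) (basis_lattice E)" for x
    using infsum_single_support[OF mem[of x], of "\<lambda>y. h y x"] mem[of x] by (simp add: h)
  have hs': "((\<lambda>y. norm (h y x)) has_sum norm (indicat_real (cell E') x *\<^sub>R G x)) (basis_lattice E)" for x
    using infsum_single_support[OF mem[of x], of "\<lambda>y. norm (h y x)"] mem[of x] by (simp add: h)
  have "((\<lambda>y. \<integral>x. h y x \<partial>lborel) has_sum (\<integral>x. (\<Sum>\<^sub>\<infinity>y\<in>basis_lattice E. h y x) \<partial>lborel)) (basis_lattice E)"
  proof (rule integral_infsum[OF countable_lattice])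
    show "integrable lborel (h y)" for y
      using integrable_translate_lborel[OF gint, of y] unfolding h_def
      by (rule Bochner_Integration.integrable_bound) (auto simp: indicator_def)
    have "(\<integral>x. norm (h y x) \<partial>lborel) = (\<integral>x. norm (indicat_real (cell E') (x - y) *\<^sub>R g x) \<partial>lborel)" for y
      using integral_translate_lborel[of "\<lambda>x. norm (indicat_real (cell E') (x - y) *\<^sub>R g x)" y]
      by (simp add: h_def)
    then show "(\<lambda>y. \<integral>x. norm (h y x) \<partial>lborel) summable_on basis_lattice E"
      using tile_summable[OF gint] by simp
    show "(\<lambda>y. norm (h y x)) summable_on basis_lattice E" for x
      using hs' by (auto simp: summable_on_def)
  qed
  then have 1: "((\<lambda>y. \<integral>x. h y x \<partial>lborel) has_sum (LINT x:cell E'|lborel. G x)) (basis_lattice E)"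
    by (simp add: infsumI[OF hs] set_lebesgue_integral_def)
  have 2: "((\<lambda>y. \<integral>x. h y x \<partial>lborel) has_sum (LINT x:cell E'|lborel. G (x + s))) (basis_lattice E)"
    using tile_integral[OF gint] unfolding gI by (simp add: set_lebesgue_integral_def h_def)
  show ?thesis using has_sum_unique[OF 2 1] .
qed

text \<open>For \<alpha> \<noteq> 0 a shift by half a wavelength in the direction of \<alpha>
  reverses the sign of the integrand, while by \<open>cell_integral_shift\<close> it leaves the
  integral unchanged.\<close>

lemma cell_integral_cis:
  assumes "\<alpha> \<in> basis_lattice E'"
  shows "(LINT x:cell E'|lborel. cis (x \<bullet> \<alpha>)) = (if \<alpha> = 0 then complex_of_real cell_vol else 0)"
proof (cases "\<alpha> = 0")
  case True
  then show ?thesis using emeasure_cell_finite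
    by (simp add: cell_vol_def set_lebesgue_integral_def scaleR_conv_of_real)
next
  case False
  define s where "s = (pi / (\<alpha> \<bullet> \<alpha>)) *\<^sub>R \<alpha>"
  have s: "s \<bullet> \<alpha> = pi" using False by (simp add: s_def)
  have "(LINT x:cell E'|lborel. cis ((x + s) \<bullet> \<alpha>)) = (LINT x:cell E'|lborel. cis (x \<bullet> \<alpha>))"
    by (rule cell_integral_shift[where C = 1])
       (auto simp: inner_add_left cis_mult[symmetric] cis_lattice[OF _ assms])
  moreover have "(LINT x:cell E'|lborel. cis ((x + s) \<bullet> \<alpha>)) = - (LINT x:cell E'|lborel. cis (x \<bullet> \<alpha>))"
    by (simp add: inner_add_left s cis_mult[symmetric] set_lebesgue_integral_def)
  ultimately show ?thesis using False by (simp add: eq_neg_iff_add_eq_0)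
qed

end

section \<open>Derivatives along lists of directions\<close>

abbreviation pderivs :: "'n::finite list \<Rightarrow> (real^'n \<Rightarrow> complex) \<Rightarrow> real^'n \<Rightarrow> complex" where
  "pderivs js f \<equiv> foldr partial_deriv js f"

text \<open>The order of differentiation prescribed by \<open>multi_deriv\<close>, spelled out as a
  list. Lists of directions admit induction, and sublists of an index list are index lists again, so
  the Leibniz rule stays within this order.\<close>

definition index_list :: "('n::finite \<Rightarrow> nat) \<Rightarrow> 'n list" where
  "index_list \<beta> = concat (map (\<lambda>i. replicate (\<beta> i) i) coord_enum)"

definition list_fact :: "'n::finite list \<Rightarrow> real" where
  "list_fact js = (\<Prod>i\<in>UNIV. fact (count_list js i))"

lemma coord_enum: "distinct (coord_enum :: 'n::finite list)" "set (coord_enum :: 'n list) = UNIV"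
proof -
  have "\<exists>is. distinct is \<and> set is = (UNIV :: 'n set)" using finite_distinct_list[of "UNIV :: 'n set"] by auto
  from someI_ex[OF this] show "distinct (coord_enum :: 'n list)" "set (coord_enum :: 'n list) = UNIV"
    by (auto simp: coord_enum_def)
qed

lemma pderivs_replicate: "pderivs (replicate n i) f = (partial_deriv i ^^ n) f"
  by (induction n) auto

lemma multi_deriv_eq_pderivs: "multi_deriv \<beta> f = pderivs (index_list \<beta>) f"
proof -
  have "foldr (\<lambda>i. partial_deriv i ^^ \<beta> i) is f = pderivs (concat (map (\<lambda>i. replicate (\<beta> i) i) is)) f" for "is"
    by (induction "is") (auto simp: pderivs_replicate)
  then show ?thesis by (simp add: multi_deriv_def index_list_def)
qed

lemma count_list_replicate: "count_list (replicate n x) y = (if x = y then n else 0)"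
  by (induction n) auto

lemma count_index_list [simp]: "count_list (index_list \<beta>) i = \<beta> i"
proof -
  have "count_list (concat (map (\<lambda>i. replicate (\<beta> i) i) is)) i = (if i \<in> set is then \<beta> i else 0)"
    if "distinct is" for "is" using that
    by (induction "is") (auto simp: count_list_replicate)
  then show ?thesis by (simp add: index_list_def coord_enum)
qed

lemma sum_coord_enum:
  fixes \<beta> :: "'n::finite \<Rightarrow> nat"
  shows "(\<Sum>i\<leftarrow>coord_enum. \<beta> i) = (\<Sum>i\<in>UNIV. \<beta> i)"
  using sum_list_distinct_conv_sum_set[OF coord_enum(1), of \<beta>] by (simp add: coord_enum)

lemma length_index_list [simp]: "length (index_list \<beta>) = (\<Sum>i\<in>UNIV. \<beta> i)"
  unfolding index_list_def length_concat by (simp add: comp_def sum_coord_enum)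

lemma list_fact_index_list: "list_fact (index_list \<beta>) = multi_fact \<beta>"
  by (simp add: list_fact_def multi_fact_def)

lemma list_fact_Cons: "list_fact (i # js) = real (count_list js i + 1) * list_fact js"
proof -
  have "list_fact (i # js) = fact (count_list js i + 1) * (\<Prod>k\<in>UNIV - {i}. fact (count_list js k))"
    unfolding list_fact_def by (subst prod.remove[of _ i]) (auto intro!: prod.cong)
  also have "\<dots> = real (count_list js i + 1) * (fact (count_list js i) * (\<Prod>k\<in>UNIV - {i}. fact (count_list js k)))"
    by (simp add: algebra_simps)
  also have "(fact (count_list js i) * (\<Prod>k\<in>UNIV - {i}. fact (count_list js k))) = list_fact js"
    unfolding list_fact_def by (subst prod.remove[of _ i]) auto
  finally show ?thesis .
qed

lemma list_fact_ge_1: "list_fact js \<ge> 1"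
  unfolding list_fact_def by (intro prod_ge_1) (simp add: fact_ge_1)

lemma list_fact_Nil [simp]: "list_fact [] = 1"
  by (simp add: list_fact_def)

text \<open>The terms of the Leibniz formula with repetitions: the \<open>2 ^ length\<close> ways of
  distributing the positions of a list over two factors take the place of binomial
  coefficients.\<close>

fun splits :: "'a list \<Rightarrow> ('a list \<times> 'a list) list" where
  "splits [] = [([], [])]"
| "splits (i # is) = map (\<lambda>(js, ks). (i # js, ks)) (splits is) @ map (\<lambda>(js, ks). (js, i # ks)) (splits is)"

lemma splits_count: "(js, ks) \<in> set (splits is) \<Longrightarrow> count_list js i + count_list ks i = count_list is i"
  by (induction "is" arbitrary: js ks) auto

lemma splits_length: "(js, ks) \<in> set (splits is) \<Longrightarrow> length js + length ks = length is"
  by (induction "is" arbitrary: js ks) auto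

lemma splits_subseq: "(js, ks) \<in> set (splits is) \<Longrightarrow> subseq js is \<and> subseq ks is"
  by (induction "is" arbitrary: js ks) auto

text \<open>The value of the sum of \<gamma>! (\<beta> - \<gamma>)! over all Leibniz terms: each
  \<gamma> occurs binomially often and so contributes \<beta>! in total, and the number of \<gamma>
  is the product of the \<beta>_i + 1.\<close>

definition list_fact2 :: "'n::finite list \<Rightarrow> real" where
  "list_fact2 js = (\<Prod>i\<in>UNIV. fact (count_list js i + 1))"

lemma list_fact2_Cons: "list_fact2 (i # js) = real (count_list js i + 2) * list_fact2 js"
proof -
  have "list_fact2 (i # js) = fact (count_list js i + 2) * (\<Prod>k\<in>UNIV - {i}. fact (count_list js k + 1))"
    unfolding list_fact2_def by (subst prod.remove[of _ i]) (auto intro!: prod.cong)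
  also have "\<dots> = real (count_list js i + 2) * (fact (count_list js i + 1) * (\<Prod>k\<in>UNIV - {i}. fact (count_list js k + 1)))"
    by (simp add: algebra_simps)
  also have "(fact (count_list js i + 1) * (\<Prod>k\<in>UNIV - {i}. fact (count_list js k + 1))) = list_fact2 js"
    unfolding list_fact2_def by (subst prod.remove[of _ i]) auto
  finally show ?thesis .
qed

text \<open>Prepending \<open>i\<close> multiplies the two kinds of terms by \<open>count js i + 1\<close> and
  \<open>count ks i + 1\<close>, whose sum depends on \<open>is\<close> only.\<close>

lemma sum_splits_fact:
  "(\<Sum>(js, ks)\<leftarrow>splits is. list_fact js * list_fact ks) = list_fact2 is"
proof (induction "is")
  case Nil then show ?case by (simp add: list_fact2_def)
next
  case (Cons i "is")
  have eq: "(case jk of (js, ks) \<Rightarrow> list_fact (i # js) * list_fact ks) + (case jk of (js, ks) \<Rightarrow> list_fact js * list_fact (i # ks))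
      = real (count_list is i + 2) * (case jk of (js, ks) \<Rightarrow> list_fact js * list_fact ks)" if mem: "jk \<in> set (splits is)" for jk
  proof -
    obtain js ks where jk: "jk = (js, ks)" by fastforce
    have c: "count_list js i + count_list ks i = count_list is i" using splits_count mem unfolding jk by fast
    show ?thesis unfolding jk by (simp add: list_fact_Cons c[symmetric] algebra_simps)
  qed
  have "(\<Sum>(js, ks)\<leftarrow>splits (i # is). list_fact js * list_fact ks) =
      (\<Sum>jk\<leftarrow>splits is. (case jk of (js, ks) \<Rightarrow> list_fact (i # js) * list_fact ks)) +
      (\<Sum>jk\<leftarrow>splits is. (case jk of (js, ks) \<Rightarrow> list_fact js * list_fact (i # ks)))"
    by (simp add: comp_def case_prod_unfold)
  also have "\<dots> = (\<Sum>jk\<leftarrow>splits is. real (count_list is i + 2) * (case jk of (js, ks) \<Rightarrow> list_fact js * list_fact ks))"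
    unfolding sum_list_addf[symmetric] by (intro arg_cong[where f = sum_list] map_cong refl eq)
  also have "\<dots> = real (count_list is i + 2) * list_fact2 is"
    by (simp add: sum_list_const_mult Cons)
  finally show ?case by (simp add: list_fact2_Cons)
qed

lemma sum_count_list: "(\<Sum>i\<in>UNIV. count_list js i) = length (js :: 'n::finite list)"
proof -
  have "length js = (\<Sum>i\<in>set js. count_list js i)" by (simp add: sum_count_set)
  also have "\<dots> = (\<Sum>i\<in>UNIV. count_list js i)"
    by (intro sum.mono_neutral_left) (auto simp: count_list_0_iff)
  finally show ?thesis by simp
qed

text \<open>From \<open>k + 1 \<le> 2 ^ k\<close> in each coordinate. The factor
  \<open>2 ^ length js\<close> is what halves the radius of derivative bounds under
  multiplication.\<close>

lemma list_fact2_le: "list_fact2 js \<le> 2 ^ length js * list_fact js"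
proof -
  have "list_fact2 js \<le> (\<Prod>i\<in>UNIV. 2 ^ count_list js i * fact (count_list js i))"
    unfolding list_fact2_def
  proof (intro prod_mono conjI)
    fix i
    have "Suc (count_list js i) \<le> 2 ^ count_list js i" by (simp add: Suc_leI)
    then have "real (count_list js i + 1) \<le> 2 ^ count_list js i" by (metis Suc_eq_plus1 of_nat_le_iff of_nat_numeral of_nat_power)
    then show "fact (count_list js i + 1) \<le> (2 ^ count_list js i * fact (count_list js i) :: real)"
      by (simp add: mult_right_mono)
  qed simp
  also have "\<dots> = 2 ^ length js * list_fact js"
    by (simp add: prod.distrib list_fact_def power_sum[symmetric] sum_count_list)
  finally show ?thesis .
qed

text \<open>A sublist of the concatenated blocks \<open>replicate (\<beta> i) i\<close> takes a
  sublist of each block, which is a block again. So bounds that are stated only for index lists can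
  be used in every term of the Leibniz rule.\<close>

lemma subseq_index_list:
  assumes "subseq js (index_list \<beta>)" shows "\<exists>\<gamma>. js = index_list \<gamma>"
proof -
  have "distinct is \<Longrightarrow> subseq js (concat (map (\<lambda>i. replicate (\<beta> i) i) is)) \<Longrightarrow>
      \<exists>\<gamma>. js = concat (map (\<lambda>i. replicate (\<gamma> i) i) is)" for "is" js
  proof (induction "is" arbitrary: js)
    case Nil then show ?case by (simp)
  next
    case (Cons i "is")
    from Cons.prems(2) obtain as bs where ab: "js = as @ bs" "subseq as (replicate (\<beta> i) i)"
        "subseq bs (concat (map (\<lambda>i. replicate (\<beta> i) i) is))"
      by (auto simp: subseq_append_iff)
    obtain \<gamma> where \<gamma>: "bs = concat (map (\<lambda>i. replicate (\<gamma> i) i) is)" using Cons ab(3) by auto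
    have as: "replicate (length as) i = as"
    proof (rule sym, rule replicate_eqI)
      fix x assume "x \<in> set as"
      then show "x = i" using list_emb_set[OF ab(2), of x] by (metis in_set_replicate)
    qed simp
    have m: "map (\<lambda>k. replicate ((\<gamma>(i := length as)) k) k) is = map (\<lambda>i. replicate (\<gamma> i) i) is"
      using Cons.prems(1) by (intro map_cong) auto
    have "concat (map (\<lambda>k. replicate ((\<gamma>(i := length as)) k) k) (i # is)) =
        replicate (length as) i @ concat (map (\<lambda>k. replicate ((\<gamma>(i := length as)) k) k) is)" by simp
    also have "\<dots> = js" unfolding m as ab(1) \<gamma> ..
    finally show ?case by metis
  qed
  from this[OF coord_enum(1) assms[unfolded index_list_def]] show ?thesis by (simp add: index_list_def)
qed

section \<open>Calculus of iterated partial derivatives\<close>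

lemma partial_deriv_eq:
  assumes "(f has_derivative f') (at x)" shows "partial_deriv i f x = f' (axis i 1)"
proof -
  have "((\<lambda>t. x + t *\<^sub>R axis i 1) has_derivative (\<lambda>t. t *\<^sub>R axis i 1)) (at 0)"
    by (auto intro!: derivative_eq_intros)
  from diff_chain_at[OF this, of f f'] assms
  have "((\<lambda>t. f (x + t *\<^sub>R axis i 1)) has_derivative (\<lambda>t. f' (t *\<^sub>R axis i 1))) (at 0)"
    by (simp add: comp_def)
  moreover have "f' (t *\<^sub>R axis i 1) = t *\<^sub>R f' (axis i 1)" for t
    using has_derivative_linear[OF assms] by (simp add: linear_cmul)
  ultimately show ?thesis unfolding partial_deriv_def
    by (intro vector_derivative_at) (simp add: has_vector_derivative_def)
qed

lemma differentiable_onUNIV: "f differentiable_on UNIV \<longleftrightarrow> (\<forall>x. f differentiable (at x))"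
  by (auto simp: differentiable_on_def)

lemma partial_deriv_add:
  assumes "f differentiable (at x)" "g differentiable (at x)"
  shows "partial_deriv i (\<lambda>x. f x + g x) x = partial_deriv i f x + partial_deriv i g x"
  using assms unfolding differentiable_def
  by (auto simp: partial_deriv_eq[OF has_derivative_add] partial_deriv_eq)

lemma partial_deriv_mult:
  assumes "f differentiable (at x)" "g differentiable (at x)"
  shows "partial_deriv i (\<lambda>x. f x * g x) x = partial_deriv i f x * g x + f x * partial_deriv i g x"
  using assms unfolding differentiable_def
  by (auto simp: partial_deriv_eq[OF has_derivative_mult] partial_deriv_eq)

lemma partial_deriv_const [simp]: "partial_deriv i (\<lambda>x. c) = (\<lambda>x. 0)"
  by (rule ext) (simp add: partial_deriv_eq[OF has_derivative_const])

lemma smoothD: "smooth f \<Longrightarrow> pderivs js f differentiable (at x)"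
  by (simp add: smooth_def differentiable_onUNIV)

lemma smooth_continuous: "smooth f \<Longrightarrow> continuous_on UNIV (pderivs js f)"
  unfolding smooth_def by (auto intro: differentiable_imp_continuous_on)

lemma pderivs_mult:
  assumes "smooth f" "smooth g"
  shows "pderivs is (\<lambda>x. f x * g x) = (\<lambda>x. \<Sum>(js, ks)\<leftarrow>splits is. pderivs js f x * pderivs ks g x)"
proof (induction "is")
  case (Cons i "is")
  \<comment> \<open>Both facts are stated for an arbitrary list \<open>L\<close> of pairs, so that
    the induction over the Leibniz terms is detached from the list of directions.\<close>
  have diff: "(\<lambda>x. \<Sum>(js, ks)\<leftarrow>L. pderivs js f x * pderivs ks g x) differentiable (at x)"
    and deriv: "partial_deriv i (\<lambda>x. \<Sum>(js, ks)\<leftarrow>L. pderivs js f x * pderivs ks g x) x =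
      (\<Sum>(js, ks)\<leftarrow>L. pderivs (i # js) f x * pderivs ks g x) + (\<Sum>(js, ks)\<leftarrow>L. pderivs js f x * pderivs (i # ks) g x)"
    for L x
  proof (induction L)
    case (Cons jk L)
    obtain js ks where jk: "jk = (js, ks)" by fastforce
    have d: "(\<lambda>x. pderivs js f x * pderivs ks g x) differentiable (at x)"
      using assms by (intro differentiable_mult smoothD)
    { case 1 show ?case using Cons.IH(1) d by (simp add: jk) }
    { case 2 show ?case using Cons.IH d assms
      by (simp add: jk partial_deriv_add partial_deriv_mult smoothD) }
  qed auto
  show ?case
    unfolding foldr.simps comp_apply Cons by (rule ext, subst deriv) (simp add: comp_def case_prod_unfold)
qed simp

lemma smooth_mult:
  assumes "smooth f" "smooth g" shows "smooth (\<lambda>x. f x * g x)"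
proof -
  have "(\<lambda>x. \<Sum>(js, ks)\<leftarrow>L. pderivs js f x * pderivs ks g x) differentiable (at x)" for L x
  proof (induction L)
    case (Cons jk L)
    obtain js ks where jk: "jk = (js, ks)" by fastforce
    have "(\<lambda>x. pderivs js f x * pderivs ks g x) differentiable (at x)"
      using assms by (intro differentiable_mult smoothD)
    then show ?case using Cons.IH by (simp add: jk)
  qed auto
  then show ?thesis unfolding smooth_def differentiable_onUNIV pderivs_mult[OF assms] by blast
qed

lemma pderivs_add:
  assumes "smooth f" "smooth g"
  shows "pderivs is (\<lambda>x. f x + g x) = (\<lambda>x. pderivs is f x + pderivs is g x)"
  by (induction "is") (auto simp: partial_deriv_add smoothD assms)

lemma smooth_add: "smooth f \<Longrightarrow> smooth g \<Longrightarrow> smooth (\<lambda>x. f x + g x)"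
  unfolding smooth_def[of "\<lambda>x. f x + g x"] pderivs_add differentiable_onUNIV by (simp add: smoothD)

lemma pderivs_const: "pderivs js (\<lambda>x. c) = (\<lambda>x. if js = [] then c else 0)"
  by (induction js) auto

lemma smooth_const: "smooth (\<lambda>x. c)"
  unfolding smooth_def pderivs_const by auto

lemma pderivs_cmult:
  assumes "smooth f" shows "pderivs is (\<lambda>x. c * f x) = (\<lambda>x. c * pderivs is f x)"
  by (induction "is") (auto simp: partial_deriv_mult smoothD assms)

lemma smooth_cmult: "smooth f \<Longrightarrow> smooth (\<lambda>x. c * f x)"
  using smooth_mult[OF smooth_const] .

lemma partial_deriv_translate: "partial_deriv i (\<lambda>x. f (x - y)) x = partial_deriv i f (x - y)"
  unfolding partial_deriv_def by (simp add: algebra_simps)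

lemma pderivs_translate: "pderivs js (\<lambda>x. f (x - y)) = (\<lambda>x. pderivs js f (x - y))"
  by (induction js) (auto simp: partial_deriv_translate)

lemma smooth_translate: assumes "smooth f" shows "smooth (\<lambda>x. f (x - y))"
  unfolding smooth_def pderivs_translate differentiable_onUNIV
proof (intro allI)
  fix js x
  have "pderivs js f differentiable at (x - y)" using smoothD[OF assms] .
  from differentiable_compose[of "pderivs js f" "\<lambda>x. x - y", OF this]
  show "(\<lambda>x. pderivs js f (x - y)) differentiable at x" by simp
qed

lemma partial_deriv_cnj:
  assumes "f differentiable (at x)" shows "partial_deriv i (\<lambda>x. cnj (f x)) x = cnj (partial_deriv i f x)"
proof -
  obtain f' where f': "(f has_derivative f') (at x)" using assms by (auto simp: differentiable_def)
  show ?thesis using partial_deriv_eq[OF has_derivative_cnj[OF f']] partial_deriv_eq[OF f'] by simp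
qed

lemma pderivs_cnj:
  assumes "smooth f" shows "pderivs is (\<lambda>x. cnj (f x)) = (\<lambda>x. cnj (pderivs is f x))"
  by (induction "is") (auto simp: partial_deriv_cnj smoothD assms)

lemma smooth_cnj: assumes "smooth f" shows "smooth (\<lambda>x. cnj (f x))"
  unfolding smooth_def pderivs_cnj[OF assms] differentiable_onUNIV
proof (intro allI)
  fix js x
  obtain f' where "(pderivs js f has_derivative f') (at x)"
    using smoothD[OF assms] by (auto simp: differentiable_def)
  from differentiableI[OF has_derivative_cnj[OF this]]
  show "(\<lambda>x. cnj (pderivs js f x)) differentiable (at x)" .
qed

lemma has_derivative_cis_inner:
  "((\<lambda>x. cis (x \<bullet> \<xi>)) has_derivative (\<lambda>h. \<i> * of_real (h \<bullet> \<xi>) * cis (x \<bullet> \<xi>))) (at (x::real^'n))"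
proof -
  have 1: "((\<lambda>x. \<i> * complex_of_real (x \<bullet> \<xi>)) has_derivative (\<lambda>h. \<i> * complex_of_real (h \<bullet> \<xi>))) (at x)"
    by (intro has_derivative_mult_right has_derivative_of_real has_derivative_inner_left has_derivative_ident)
  from has_derivative_compose[OF 1 DERIV_exp[unfolded has_field_derivative_def]]
  show ?thesis by (simp add: cis_conv_exp mult_ac)
qed

lemma pderivs_cis: "pderivs js (\<lambda>x. cis (x \<bullet> \<xi>)) = (\<lambda>x. (\<Prod>j\<leftarrow>js. \<i> * of_real (\<xi> $ j)) * cis (x \<bullet> \<xi>))"
proof (induction js)
  case (Cons i js)
  have "partial_deriv i (\<lambda>x. c * cis (x \<bullet> \<xi>)) x = c * (\<i> * of_real (\<xi> $ i) * cis (x \<bullet> \<xi>))" for c x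
    using partial_deriv_eq[OF has_derivative_mult_right[OF has_derivative_cis_inner[of \<xi> x], of c], of i]
    by (simp add: inner_axis')
  then show ?case unfolding foldr.simps comp_apply Cons by (simp add: fun_eq_iff)
qed simp

lemma smooth_cis: "smooth (\<lambda>x. cis (x \<bullet> \<xi>))"
  unfolding smooth_def pderivs_cis differentiable_onUNIV
  by (intro allI differentiableI[OF has_derivative_mult_right[OF has_derivative_cis_inner]])

section \<open>The space \<open>\<Sigma>\<^sub>1\<close> and its Fourier transform\<close>

lemma power_le_fact_exp:
  fixes t :: real assumes "t \<ge> 0" shows "t ^ k \<le> fact k * exp t"
proof -
  have "(\<lambda>n. t ^ n /\<^sub>R fact n) sums exp t" by (rule exp_converges)
  then have "(\<Sum>n\<in>{k}. t ^ n /\<^sub>R fact n) \<le> exp t"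
    using sum_le_suminf[of "\<lambda>n. t ^ n /\<^sub>R fact n" "{k}"] assms by (auto simp: sums_iff)
  then show ?thesis by (simp add: field_simps)
qed

text \<open>If all terms were smaller, the series of \<open>exp (t / 2)\<close>, whose terms are
  \<open>(1 / 2) ^ n * (t ^ n / fact n)\<close>, would be at most
  \<open>2 * exp (t / 2) / 4\<close>. The lemma turns bounds for all monomials or all derivatives
  into exponential decay, at the price of half the rate and a factor 4.\<close>

lemma ex_power_ge_exp:
  fixes t :: real assumes "t \<ge> 0" shows "\<exists>k. exp (t / 2) / 4 \<le> t ^ k / fact k"
proof (rule ccontr)
  assume "\<not> ?thesis"
  then have lt: "t ^ k / fact k \<le> exp (t / 2) / 4" for k by (meson linear not_le order_less_imp_le)
  have s1: "(\<lambda>n. (t / 2) ^ n /\<^sub>R fact n) sums exp (t / 2)" by (rule exp_converges)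
  have "(\<lambda>n. (1 / 2) ^ n :: real) sums (1 / (1 - 1 / 2))" by (rule geometric_sums) simp
  then have s2: "(\<lambda>n. (1 / 2) ^ n * (exp (t / 2) / 4)) sums (1 / (1 - 1 / 2) * (exp (t / 2) / 4))"
    by (rule sums_mult2)
  have "(t / 2) ^ n /\<^sub>R fact n \<le> (1 / 2) ^ n * (exp (t / 2) / 4)" for n
    using mult_left_mono[OF lt[of n], of "(1 / 2) ^ n"] by (simp add: power_divide field_simps)
  then have "exp (t / 2) \<le> 1 / (1 - 1 / 2) * (exp (t / 2) / 4)" by (rule sums_le[OF _ s1 s2])
  then show False by simp
qed

text \<open>Cauchy estimates of radius \<open>R\<close> with a pointwise weight \<open>u\<close>,
  along the lists that occur in \<open>multi_deriv\<close>. A general \<open>u\<close> covers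
  decaying functions as well as characters, so that the two can be multiplied.\<close>

definition deriv_bound :: "real \<Rightarrow> (real^'n \<Rightarrow> real) \<Rightarrow> (real^'n \<Rightarrow> complex) \<Rightarrow> bool" where
  "deriv_bound R u f \<longleftrightarrow>
     (\<forall>js\<in>range index_list. \<forall>x. cmod (pderivs js f x) \<le> list_fact js / R ^ length js * u x)"

text \<open>Radius and decay rate are tied together, just as a single \<open>h\<close> governs
  derivatives and monomials in \<open>Sigma1_norm\<close>; the least \<open>A\<close> acts as a norm
  of \<open>f\<close>.\<close>

definition exp_bound :: "real \<Rightarrow> real \<Rightarrow> (real^'n \<Rightarrow> complex) \<Rightarrow> bool" where
  "exp_bound R A f \<longleftrightarrow> deriv_bound R (\<lambda>x. A * exp (- (R * norm x))) f"

lemma deriv_boundD: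
  "deriv_bound R u f \<Longrightarrow> js \<in> range index_list \<Longrightarrow> cmod (pderivs js f x) \<le> list_fact js / R ^ length js * u x"
  unfolding deriv_bound_def by blast

lemma Nil_index_list: "[] \<in> range index_list"
proof -
  have "index_list (\<lambda>_. 0) = []" by (simp add: index_list_def)
  then show ?thesis by (metis rangeI)
qed

lemma deriv_bound_0: "deriv_bound R u f \<Longrightarrow> cmod (f x) \<le> u x"
  using deriv_boundD[OF _ Nil_index_list, of R u f x] by simp

lemma deriv_bound_nonneg: "deriv_bound R u f \<Longrightarrow> 0 \<le> u x"
  using deriv_bound_0 norm_ge_zero order_trans by blast

lemma exp_bound_0: "exp_bound R A f \<Longrightarrow> cmod (f x) \<le> A * exp (- (R * norm x))"
  unfolding exp_bound_def by (rule deriv_bound_0)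

lemma exp_bound_nonneg: "exp_bound R A f \<Longrightarrow> 0 \<le> A"
  using order_trans[OF norm_ge_zero exp_bound_0[of R A f 0]] by simp

lemma deriv_bound_mono:
  assumes "deriv_bound R u f" "0 < R'" "R' \<le> R" "\<And>x. u x \<le> v x"
  shows "deriv_bound R' v f"
  unfolding deriv_bound_def
proof (intro ballI allI)
  fix js x assume js: "js \<in> range (index_list :: ('a \<Rightarrow> nat) \<Rightarrow> _)"
  have "list_fact js / R ^ length js \<le> list_fact js / R' ^ length js"
    using assms list_fact_ge_1[of js] by (intro divide_left_mono power_mono mult_pos_pos zero_less_power) auto
  then have "list_fact js / R ^ length js * u x \<le> list_fact js / R' ^ length js * v x"
    using assms deriv_bound_nonneg[OF assms(1)] list_fact_ge_1[of js] by (intro mult_mono) auto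
  then show "cmod (pderivs js f x) \<le> list_fact js / R' ^ length js * v x"
    using deriv_boundD[OF assms(1) js, of x] by linarith
qed

lemma exp_bound_mono:
  assumes "exp_bound R A f" "A \<le> A'" "0 < R'" "R' \<le> R" shows "exp_bound R' A' f"
  unfolding exp_bound_def
proof (rule deriv_bound_mono[OF assms(1)[unfolded exp_bound_def] assms(3,4)])
  fix x
  have "exp (- (R * norm x)) \<le> exp (- (R' * norm x))" using assms by (simp add: mult_right_mono)
  then show "A * exp (- (R * norm x)) \<le> A' * exp (- (R' * norm x))"
    using exp_bound_nonneg[OF assms(1)] assms by (intro mult_mono) auto
qed

lemma norm_sum_list_le:
  fixes F :: "'a \<Rightarrow> 'b::real_normed_vector"
  assumes "\<And>x. x \<in> set L \<Longrightarrow> norm (F x) \<le> G x"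
  shows "norm (sum_list (map F L)) \<le> sum_list (map G L)"
  using assms by (induction L) (auto intro: norm_triangle_le add_mono)

text \<open>By the Leibniz rule and \<open>sum_splits_fact\<close> the derivative along
  \<open>is\<close> is bounded in terms of \<open>list_fact2 is\<close>. Returning to
  \<open>list_fact is\<close> costs \<open>2 ^ length is\<close>, that is, half of the
  radius.\<close>

lemma deriv_bound_mult:
  assumes "R > 0" "smooth f" "smooth g" and f: "deriv_bound R u f" and g: "deriv_bound R v g"
  shows "deriv_bound (R / 2) (\<lambda>x. u x * v x) (\<lambda>x. f x * g x)"
  unfolding deriv_bound_def
proof (intro ballI allI)
  fix "is" :: "'a list" and x assume "is": "is \<in> range index_list"
  have uv: "0 \<le> u x" "0 \<le> v x" using f g deriv_bound_nonneg by blast+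
  have mem: "js \<in> range index_list" "ks \<in> range index_list" if "(js, ks) \<in> set (splits is)" for js ks
    using splits_subseq[OF that] "is" subseq_index_list by blast+
  have "cmod (\<Sum>(js, ks)\<leftarrow>splits is. pderivs js f x * pderivs ks g x) \<le>
      (\<Sum>(js, ks)\<leftarrow>splits is. (u x * v x / R ^ length is) * (list_fact js * list_fact ks))"
  proof (rule norm_sum_list_le, clarify)
    fix js ks assume m: "(js, ks) \<in> set (splits is)"
    have "cmod (pderivs js f x * pderivs ks g x) \<le>
        (list_fact js / R ^ length js * u x) * (list_fact ks / R ^ length ks * v x)"
      unfolding norm_mult using mem[OF m] f g uv list_fact_ge_1[of js] assms(1)
      by (intro mult_mono deriv_boundD) auto
    also have "\<dots> = (u x * v x / R ^ (length js + length ks)) * (list_fact js * list_fact ks)"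
      by (simp add: power_add)
    finally show "cmod (pderivs js f x * pderivs ks g x) \<le> (u x * v x / R ^ length is) * (list_fact js * list_fact ks)"
      by (simp add: splits_length[OF m])
  qed
  also have "\<dots> = u x * v x / R ^ length is * list_fact2 is"
    unfolding sum_splits_fact[symmetric] sum_list_const_mult[symmetric]
    by (intro arg_cong[where f = sum_list] map_cong refl) auto
  also have "\<dots> \<le> u x * v x / R ^ length is * (2 ^ length is * list_fact is)"
    using uv assms(1) by (intro mult_left_mono list_fact2_le) auto
  also have "\<dots> = list_fact is / (R / 2) ^ length is * (u x * v x)"
    by (simp add: power_divide)
  finally show "cmod (pderivs is (\<lambda>x. f x * g x) x) \<le> list_fact is / (R / 2) ^ length is * (u x * v x)"
    by (simp add: pderivs_mult assms)
qed

lemma deriv_bound_translate: "deriv_bound R u f \<Longrightarrow> deriv_bound R (\<lambda>x. u (x - y)) (\<lambda>x. f (x - y))"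
  by (simp add: deriv_bound_def pderivs_translate)

lemma deriv_bound_cnj: "smooth f \<Longrightarrow> deriv_bound R u f \<Longrightarrow> deriv_bound R u (\<lambda>x. cnj (f x))"
  by (simp add: deriv_bound_def pderivs_cnj)

lemma deriv_bound_add:
  assumes "smooth f" "smooth g" "deriv_bound R u f" "deriv_bound R v g"
  shows "deriv_bound R (\<lambda>x. u x + v x) (\<lambda>x. f x + g x)"
  unfolding deriv_bound_def pderivs_add[OF assms(1,2)]
  using assms(3,4) by (auto simp: deriv_bound_def distrib_left intro!: norm_triangle_le add_mono)

lemma deriv_bound_cmult: "smooth f \<Longrightarrow> deriv_bound R u f \<Longrightarrow> deriv_bound R (\<lambda>x. cmod c * u x) (\<lambda>x. c * f x)"
  unfolding deriv_bound_def pderivs_cmult norm_mult mult.left_commute[of _ "cmod c"]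
  by (blast intro: mult_left_mono norm_ge_zero)

lemma prod_list_count:
  fixes a :: "'n::finite \<Rightarrow> real"
  shows "(\<Prod>j\<leftarrow>js. a j) = (\<Prod>i\<in>UNIV. a i ^ count_list js i)"
proof (induction js)
  case (Cons j js)
  have "(\<Prod>i\<in>UNIV. a i ^ count_list (j # js) i) = (\<Prod>i\<in>UNIV. (if i = j then a j else 1) * a i ^ count_list js i)"
    by (intro prod.cong) auto
  then show ?case using Cons by (simp add: prod.distrib)
qed simp

text \<open>A derivative of a character is a monomial in \<xi> times the character, and
  \<open>(R * t) ^ k \<le> fact k * exp (R * t)\<close> trades each power for a factorial. Every
  coordinate contributes one exponential, hence \<open>CARD('n)\<close> in the exponent.\<close>

lemma deriv_bound_cis:
  assumes "R > 0"
  shows "deriv_bound R (\<lambda>_. exp (R * (real CARD('n) * norm \<xi>))) (\<lambda>x::real^'n. cis (x \<bullet> \<xi>))"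
  unfolding deriv_bound_def
proof (intro ballI allI)
  fix js :: "'n list" and x :: "real^'n"
  have "cmod (\<Prod>j\<leftarrow>js. \<i> * complex_of_real (\<xi> $ j)) = (\<Prod>j\<leftarrow>js. \<bar>\<xi> $ j\<bar>)"
    by (induction js) (auto simp: norm_mult)
  then have "cmod (pderivs js (\<lambda>x. cis (x \<bullet> \<xi>)) x) = (\<Prod>j\<leftarrow>js. \<bar>\<xi> $ j\<bar>)"
    by (simp add: pderivs_cis norm_mult)
  also have "\<dots> = (\<Prod>i\<in>UNIV. \<bar>\<xi> $ i\<bar> ^ count_list js i)" by (rule prod_list_count)
  also have "\<dots> \<le> (\<Prod>i\<in>UNIV. fact (count_list js i) * exp (R * norm \<xi>) / R ^ count_list js i)"
  proof (intro prod_mono conjI)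
    fix i
    have "(R * \<bar>\<xi> $ i\<bar>) ^ count_list js i \<le> fact (count_list js i) * exp (R * \<bar>\<xi> $ i\<bar>)"
      using assms by (intro power_le_fact_exp) auto
    also have "\<dots> \<le> fact (count_list js i) * exp (R * norm \<xi>)"
      using assms component_le_norm_cart[of \<xi> i] by (intro mult_left_mono) auto
    finally show "\<bar>\<xi> $ i\<bar> ^ count_list js i \<le> fact (count_list js i) * exp (R * norm \<xi>) / R ^ count_list js i"
      using assms by (simp add: field_simps)
  qed auto
  also have "\<dots> = list_fact js / R ^ length js * exp (R * (real CARD('n) * norm \<xi>))"
  proof -
    have "R ^ length js = (\<Prod>i\<in>UNIV. R ^ count_list js i)"
      by (simp only: sum_count_list[symmetric] power_sum)
    moreover have "exp (R * (real CARD('n) * norm \<xi>)) = (\<Prod>i\<in>(UNIV :: 'n set). exp (R * norm \<xi>))"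
      by (simp add: exp_of_nat_mult[symmetric] mult.left_commute)
    ultimately show ?thesis by (simp only: prod.distrib prod_dividef list_fact_def times_divide_eq_left)
  qed
  finally show "cmod (pderivs js (\<lambda>x. cis (x \<bullet> \<xi>)) x) \<le> list_fact js / R ^ length js * exp (R * (real CARD('n) * norm \<xi>))" .
qed

lemma exp_bound_translate:
  assumes "R > 0" "exp_bound R A f" shows "exp_bound R (A * exp (R * norm y)) (\<lambda>x. f (x - y))"
  unfolding exp_bound_def
proof (rule deriv_bound_mono[OF deriv_bound_translate[OF assms(2)[unfolded exp_bound_def], of y] assms(1) order_refl])
  fix x
  have "R * norm x \<le> R * (norm y + norm (x - y))"
    using assms(1) norm_triangle_sub[of x y] by (intro mult_left_mono) auto
  then have "exp (- (R * norm (x - y))) \<le> exp (R * norm y) * exp (- (R * norm x))"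
    by (simp add: exp_add[symmetric] distrib_left)
  then show "A * exp (- (R * norm (x - y))) \<le> A * exp (R * norm y) * exp (- (R * norm x))"
    using exp_bound_nonneg[OF assms(2)] by (simp add: mult.assoc mult_left_mono)
qed

text \<open>Multiplication halves the radius, so both factors are bounded at radius
  \<open>2 * R\<close>; the constant of the character at that radius is the price of the
  modulation.\<close>

lemma exp_bound_cis:
  assumes "R > 0" "smooth f" "exp_bound (2 * R) A f"
  shows "exp_bound R (A * exp (2 * R * (real CARD('n) * norm \<xi>))) (\<lambda>x::real^'n. f x * cis (x \<bullet> \<xi>))"
proof -
  have "deriv_bound (2 * R / 2) (\<lambda>x. A * exp (- (2 * R * norm x)) * exp (2 * R * (real CARD('n) * norm \<xi>))) (\<lambda>x. f x * cis (x \<bullet> \<xi>))"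
    using assms by (intro deriv_bound_mult smooth_cis deriv_bound_cis) (auto simp: exp_bound_def)
  then show ?thesis unfolding exp_bound_def
  proof (rule deriv_bound_mono)
    fix x :: "real^'n"
    have "exp (- (2 * R * norm x)) \<le> exp (- (R * norm x))" using assms by simp
    then show "A * exp (- (2 * R * norm x)) * exp (2 * R * (real CARD('n) * norm \<xi>)) \<le> A * exp (2 * R * (real CARD('n) * norm \<xi>)) * exp (- (R * norm x))"
      using exp_bound_nonneg[OF assms(3)] by (simp add: mult_ac mult_left_mono)
  qed (use assms in auto)
qed

text \<open>From \<open>norm y \<le> norm x + norm (x - y)\<close>: the joint decay of the factors
  at rate \<open>2 * R\<close> pays both for the decay in \<open>x\<close> and for a factor in
  \<open>y\<close> that makes sums over lattice translates converge.\<close>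

lemma exp_bound_mult_translate:
  assumes "R > 0" "smooth f" "exp_bound (2 * R) A f" "smooth g" "exp_bound (2 * R) B g"
  shows "exp_bound R (A * B * exp (- (R * norm y))) (\<lambda>x. f x * g (x - y))"
proof -
  have "deriv_bound (2 * R / 2) (\<lambda>x. A * exp (- (2 * R * norm x)) * (B * exp (- (2 * R * norm (x - y))))) (\<lambda>x. f x * g (x - y))"
    using assms by (intro deriv_bound_mult smooth_translate) 
      (auto simp: exp_bound_def intro: deriv_bound_translate[where u = "\<lambda>x. B * exp (- (2 * R * norm x))"])
  then show ?thesis unfolding exp_bound_def
  proof (rule deriv_bound_mono)
    fix x
    have "norm y \<le> norm x + norm (x - y)" using norm_triangle_sub[of y x] by (simp add: norm_minus_commute)
    then have "norm y + norm x \<le> 2 * norm x + 2 * norm (x - y)"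
      using norm_ge_zero[of "x - y"] by linarith
    then have "R * (norm y + norm x) \<le> R * (2 * norm x + 2 * norm (x - y))"
      using assms(1) by (intro mult_left_mono) auto
    then have "exp (- (2 * R * norm x)) * exp (- (2 * R * norm (x - y))) \<le> exp (- (R * norm y)) * exp (- (R * norm x))"
      by (simp add: exp_add[symmetric] algebra_simps)
    from mult_left_mono[OF this, of "A * B"]
    show "A * exp (- (2 * R * norm x)) * (B * exp (- (2 * R * norm (x - y)))) \<le> A * B * exp (- (R * norm y)) * exp (- (R * norm x))"
      using exp_bound_nonneg[OF assms(3)] exp_bound_nonneg[OF assms(5)] by (simp add: mult_ac)
  qed (use assms in auto)
qed

section \<open>The space \<open>Sigma1\<close> in terms of exponential bounds\<close>

lemma Sigma1_norm_le_iff: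
  assumes "A \<ge> 0"
  shows "Sigma1_norm h f \<le> ennreal A \<longleftrightarrow>
    (\<forall>\<alpha> \<beta> x. cmod (monomial \<alpha> x *\<^sub>R multi_deriv \<beta> f x) /
       (h ^ (\<Sum>i\<in>UNIV. \<alpha> i + \<beta> i) * multi_fact \<alpha> * multi_fact \<beta>) \<le> A)"
  unfolding Sigma1_norm_def SUP_le_iff using assms by (auto simp: ennreal_le_iff)

lemma multi_fact_pos: "multi_fact \<alpha> > 0"
  unfolding multi_fact_def by (intro prod_pos) auto

text \<open>The monomial is chosen separately for each \<open>x\<close>, so large that it detects an
  exponential: \<open>ex_power_ge_exp\<close> in every coordinate provides \<alpha>. Half the rate
  gives the radius \<open>1 / (2 * h)\<close>, and the factors 1/4 give
  \<open>4 ^ CARD('n)\<close>.\<close>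

lemma Sigma1_norm_imp_exp_bound:
  fixes f :: "real^'n \<Rightarrow> complex"
  assumes "h > 0" "A \<ge> 0" "Sigma1_norm h f \<le> ennreal A"
  shows "exp_bound (1 / (2 * h)) (4 ^ CARD('n) * A) f"
  unfolding exp_bound_def deriv_bound_def
proof (intro ballI allI)
  fix js and x :: "real^'n" assume "js \<in> range (index_list :: ('n \<Rightarrow> nat) \<Rightarrow> _)"
  then obtain \<beta> :: "'n \<Rightarrow> nat" where js: "js = index_list \<beta>" by auto
  have "\<forall>i. \<exists>k. exp (\<bar>x $ i\<bar> / h / 2) / 4 \<le> (\<bar>x $ i\<bar> / h) ^ k / fact k"
    by (intro allI ex_power_ge_exp) (use assms(1) in simp)
  then obtain \<alpha> where \<alpha>: "\<And>i. exp (\<bar>x $ i\<bar> / h / 2) / 4 \<le> (\<bar>x $ i\<bar> / h) ^ \<alpha> i / fact (\<alpha> i)" by metis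
  let ?D = "cmod (pderivs js f x)"
  have "exp (norm x / h / 2) / 4 ^ CARD('n) \<le> exp (\<Sum>i\<in>UNIV. \<bar>x $ i\<bar> / h / 2) / 4 ^ CARD('n)"
  proof -
    have "norm x / h / 2 \<le> (\<Sum>i\<in>UNIV. \<bar>x $ i\<bar>) / h / 2"
      using norm_le_l1_cart[of x] assms(1) by (intro divide_right_mono) auto
    then show ?thesis by (simp add: divide_right_mono sum_divide_distrib)
  qed
  also have "\<dots> = (\<Prod>i\<in>UNIV. exp (\<bar>x $ i\<bar> / h / 2) / 4)"
    by (simp add: exp_sum prod_dividef)
  also have "\<dots> \<le> (\<Prod>i\<in>UNIV. (\<bar>x $ i\<bar> / h) ^ \<alpha> i / fact (\<alpha> i))"
    by (intro prod_mono conjI \<alpha>) auto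
  also have "\<dots> = \<bar>monomial \<alpha> x\<bar> / (h ^ (\<Sum>i\<in>UNIV. \<alpha> i) * multi_fact \<alpha>)"
    by (simp add: prod_dividef prod.distrib power_divide monomial_def multi_fact_def abs_prod power_abs power_sum)
  finally have m: "exp (norm x / h / 2) / 4 ^ CARD('n) \<le> \<bar>monomial \<alpha> x\<bar> / (h ^ (\<Sum>i\<in>UNIV. \<alpha> i) * multi_fact \<alpha>)" .
  have "\<bar>monomial \<alpha> x\<bar> * ?D / (h ^ (\<Sum>i\<in>UNIV. \<alpha> i + \<beta> i) * multi_fact \<alpha> * multi_fact \<beta>) \<le> A"
    using assms(3) unfolding Sigma1_norm_le_iff[OF assms(2)] multi_deriv_eq_pderivs js[symmetric] by (simp add: js)
  then have "\<bar>monomial \<alpha> x\<bar> / (h ^ (\<Sum>i\<in>UNIV. \<alpha> i) * multi_fact \<alpha>) * ?D \<le> A * (h ^ (\<Sum>i\<in>UNIV. \<beta> i) * multi_fact \<beta>)"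
    using assms(1) multi_fact_pos[of \<alpha>] multi_fact_pos[of \<beta>] by (simp add: sum.distrib power_add field_simps)
  moreover have "exp (norm x / h / 2) / 4 ^ CARD('n) * ?D \<le> \<bar>monomial \<alpha> x\<bar> / (h ^ (\<Sum>i\<in>UNIV. \<alpha> i) * multi_fact \<alpha>) * ?D"
    by (intro mult_right_mono m) auto
  ultimately have "exp (norm x / h / 2) / 4 ^ CARD('n) * ?D \<le> A * (h ^ (\<Sum>i\<in>UNIV. \<beta> i) * multi_fact \<beta>)" by linarith
  also have "\<dots> \<le> A * ((2 * h) ^ (\<Sum>i\<in>UNIV. \<beta> i) * multi_fact \<beta>)"
    using assms multi_fact_pos[of \<beta>] by (intro mult_left_mono mult_right_mono power_mono) auto
  finally have "exp (norm x / h / 2) / 4 ^ CARD('n) * ?D \<le> A * ((2 * h) ^ (\<Sum>i\<in>UNIV. \<beta> i) * multi_fact \<beta>)" .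
  then have "?D \<le> A * ((2 * h) ^ (\<Sum>i\<in>UNIV. \<beta> i) * multi_fact \<beta>) * 4 ^ CARD('n) / exp (norm x / h / 2)"
    by (simp add: field_simps)
  then show "?D \<le> list_fact js / (1 / (2 * h)) ^ length js * (4 ^ CARD('n) * A * exp (- (1 / (2 * h) * norm x)))"
  proof -
    have e: "1 / (2 * h) * norm x = norm x / h / 2" by simp
    have "list_fact js / (1 / (2 * h)) ^ length js * (4 ^ CARD('n) * A * exp (- (1 / (2 * h) * norm x))) =
        multi_fact \<beta> / (1 / (2 * h) ^ (\<Sum>i\<in>UNIV. \<beta> i)) * (4 ^ CARD('n) * A * (1 / exp (norm x / h / 2)))"
      by (simp only: e js list_fact_index_list length_index_list power_one_over exp_minus inverse_eq_divide)
    also have "\<dots> = A * ((2 * h) ^ (\<Sum>i\<in>UNIV. \<beta> i) * multi_fact \<beta>) * 4 ^ CARD('n) / exp (norm x / h / 2)"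
      by simp
    finally show "?D \<le> A * ((2 * h) ^ (\<Sum>i\<in>UNIV. \<beta> i) * multi_fact \<beta>) * 4 ^ CARD('n) / exp (norm x / h / 2) \<Longrightarrow> ?thesis"
      by simp
  qed
qed

text \<open>Each coordinate power is at most a factorial and a power of \<open>h\<close> times
  \<open>exp (norm x / h)\<close>. Together the coordinates cost
  \<open>exp (CARD('n) / h * norm x)\<close>, which the decay at rate \<open>R\<close>
  absorbs.\<close>

lemma exp_bound_imp_Sigma1_norm:
  fixes f :: "real^'n \<Rightarrow> complex"
  assumes "h > 0" "real CARD('n) / h \<le> R" "exp_bound R A f"
  shows "Sigma1_norm h f \<le> ennreal A"
  unfolding Sigma1_norm_le_iff[OF exp_bound_nonneg[OF assms(3)]]
proof (intro allI)
  fix \<alpha> \<beta> :: "'n \<Rightarrow> nat" and x :: "real^'n"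
  have A: "A \<ge> 0" using exp_bound_nonneg[OF assms(3)] .
  have card: "real CARD('n) \<ge> 1" by (simp add: Suc_leI)
  have R: "R > 0" using assms(1,2) card by (smt (verit, best) divide_pos_pos)
  have Rh: "1 / R \<le> h"
  proof -
    have "1 / h \<le> R" using assms card by (smt (verit, best) divide_right_mono)
    then show ?thesis using R assms(1) by (simp add: field_simps)
  qed
  have "\<bar>monomial \<alpha> x\<bar> = (\<Prod>i\<in>UNIV. \<bar>x $ i\<bar> ^ \<alpha> i)" by (simp add: monomial_def abs_prod power_abs)
  also have "\<dots> \<le> (\<Prod>i\<in>UNIV. h ^ \<alpha> i * (fact (\<alpha> i) * exp (norm x / h)))"
  proof (intro prod_mono conjI)
    fix i
    have "(\<bar>x $ i\<bar> / h) ^ \<alpha> i \<le> fact (\<alpha> i) * exp (\<bar>x $ i\<bar> / h)" using assms by (intro power_le_fact_exp) auto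
    also have "\<dots> \<le> fact (\<alpha> i) * exp (norm x / h)"
      using assms component_le_norm_cart[of x i] by (intro mult_left_mono) (auto simp: divide_right_mono)
    finally show "\<bar>x $ i\<bar> ^ \<alpha> i \<le> h ^ \<alpha> i * (fact (\<alpha> i) * exp (norm x / h))"
      using assms(1) by (simp add: power_divide field_simps)
  qed auto
  also have "\<dots> = h ^ (\<Sum>i\<in>UNIV. \<alpha> i) * multi_fact \<alpha> * exp (real CARD('n) / h * norm x)"
    by (simp add: prod.distrib multi_fact_def power_sum exp_of_nat_mult[symmetric] mult.assoc)
  also have "\<dots> \<le> h ^ (\<Sum>i\<in>UNIV. \<alpha> i) * multi_fact \<alpha> * exp (R * norm x)"
    using assms(1) multi_fact_pos[of \<alpha>] mult_right_mono[OF assms(2) norm_ge_zero[of x]]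
    by (intro mult_left_mono iffD2[OF exp_le_cancel_iff]) auto
  finally have m: "\<bar>monomial \<alpha> x\<bar> \<le> h ^ (\<Sum>i\<in>UNIV. \<alpha> i) * multi_fact \<alpha> * exp (R * norm x)" .
  have "cmod (multi_deriv \<beta> f x) \<le> multi_fact \<beta> * (1 / R) ^ (\<Sum>i\<in>UNIV. \<beta> i) * (A * exp (- (R * norm x)))"
    using deriv_boundD[OF assms(3)[unfolded exp_bound_def], of "index_list \<beta>" x]
    by (simp add: multi_deriv_eq_pderivs list_fact_index_list power_divide)
  also have "\<dots> \<le> multi_fact \<beta> * h ^ (\<Sum>i\<in>UNIV. \<beta> i) * (A * exp (- (R * norm x)))"
    using A R Rh multi_fact_pos[of \<beta>] by (intro mult_right_mono mult_left_mono power_mono) auto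
  finally have "\<bar>monomial \<alpha> x\<bar> * cmod (multi_deriv \<beta> f x) \<le>
     (h ^ (\<Sum>i\<in>UNIV. \<alpha> i) * multi_fact \<alpha> * exp (R * norm x)) * (multi_fact \<beta> * h ^ (\<Sum>i\<in>UNIV. \<beta> i) * (A * exp (- (R * norm x))))"
    using m assms(1) multi_fact_pos[of \<alpha>] by (intro mult_mono) auto
  also have "\<dots> = A * (h ^ (\<Sum>i\<in>UNIV. \<alpha> i + \<beta> i) * multi_fact \<alpha> * multi_fact \<beta>) * (exp (R * norm x) * exp (- (R * norm x)))"
    by (simp add: sum.distrib power_add mult_ac)
  also have "\<dots> = A * (h ^ (\<Sum>i\<in>UNIV. \<alpha> i + \<beta> i) * multi_fact \<alpha> * multi_fact \<beta>)"
    by (simp add: exp_add[symmetric])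
  finally show "cmod (monomial \<alpha> x *\<^sub>R multi_deriv \<beta> f x) / (h ^ (\<Sum>i\<in>UNIV. \<alpha> i + \<beta> i) * multi_fact \<alpha> * multi_fact \<beta>) \<le> A"
    using assms(1) multi_fact_pos[of \<alpha>] multi_fact_pos[of \<beta>] by (simp add: divide_le_eq)
qed

text \<open>The two conversions only change \<open>h\<close>, \<open>R\<close> and the constant, and
  membership ranges over all \<open>h\<close> or all \<open>R\<close>. The closure properties of
  \<open>Sigma1\<close> are read off from this form.\<close>

lemma Sigma1_iff: "f \<in> Sigma1 \<longleftrightarrow> smooth f \<and> (\<forall>R>0. \<exists>A. exp_bound R A f)"
proof -
  have "\<exists>A. exp_bound R A f" if fin: "\<forall>h>0. Sigma1_norm h f < \<infinity>" and R: "R > 0" for R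
  proof -
    define h where "h = 1 / (2 * R)"
    have h: "h > 0" "1 / (2 * h) = R" using R by (auto simp: h_def)
    obtain A where "A \<ge> 0" "Sigma1_norm h f = ennreal A"
      using fin[rule_format, OF h(1)] by (cases "Sigma1_norm h f") auto
    then show ?thesis using Sigma1_norm_imp_exp_bound[OF h(1), of A f] h(2) by auto
  qed
  moreover have "Sigma1_norm h f < \<infinity>" if ex: "\<forall>R>0. \<exists>A. exp_bound R A f" and h: "h > 0" for h
  proof -
    have pos: "real CARD('a) / h > 0" using h by simp
    obtain A where "exp_bound (real CARD('a) / h) A f" using ex pos by blast
    then have "Sigma1_norm h f \<le> ennreal A" by (rule exp_bound_imp_Sigma1_norm[OF h order_refl])
    then show ?thesis using ennreal_less_top[of A] by (metis infinity_ennreal_def order_le_less_trans)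
  qed
  ultimately show ?thesis unfolding Sigma1_def by auto
qed

lemma Sigma1_smooth: "f \<in> Sigma1 \<Longrightarrow> smooth f"
  by (simp add: Sigma1_iff)

lemma Sigma1_exp_bound: "f \<in> Sigma1 \<Longrightarrow> R > 0 \<Longrightarrow> \<exists>A. exp_bound R A f"
  by (simp add: Sigma1_iff)

lemma Sigma1_translate:
  assumes "f \<in> Sigma1" shows "(\<lambda>x. f (x - y)) \<in> Sigma1"
  unfolding Sigma1_iff
proof (intro conjI allI impI smooth_translate Sigma1_smooth assms)
  fix R :: real assume R: "R > 0"
  then obtain A where "exp_bound R A f" using Sigma1_exp_bound[OF assms] by blast
  from exp_bound_translate[OF R this, of y]
  show "\<exists>A. exp_bound R A (\<lambda>x. f (x - y))" by blast
qed

lemma Sigma1_cnj: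
  assumes "f \<in> Sigma1" shows "(\<lambda>x. cnj (f x)) \<in> Sigma1"
  unfolding Sigma1_iff
proof (intro conjI allI impI smooth_cnj Sigma1_smooth assms)
  fix R :: real assume "R > 0"
  then obtain A where "exp_bound R A f" using Sigma1_exp_bound[OF assms] by blast
  then have "exp_bound R A (\<lambda>x. cnj (f x))"
    unfolding exp_bound_def by (rule deriv_bound_cnj[OF Sigma1_smooth[OF assms]])
  then show "\<exists>A. exp_bound R A (\<lambda>x. cnj (f x))" by blast
qed

lemma Sigma1_cis:
  assumes "f \<in> Sigma1" shows "(\<lambda>x. f x * cis (x \<bullet> \<xi>)) \<in> Sigma1"
  unfolding Sigma1_iff
proof (intro conjI allI impI smooth_mult smooth_cis Sigma1_smooth assms)
  fix R :: real assume R: "R > 0"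
  then obtain A where "exp_bound (2 * R) A f" using Sigma1_exp_bound[OF assms, of "2 * R"] by auto
  from exp_bound_cis[OF R Sigma1_smooth[OF assms] this, of \<xi>]
  show "\<exists>A. exp_bound R A (\<lambda>x. f x * cis (x \<bullet> \<xi>))" by blast
qed

lemma Sigma1_mult_translate:
  assumes "f \<in> Sigma1" "g \<in> Sigma1" shows "(\<lambda>x. f x * g (x - y)) \<in> Sigma1"
  unfolding Sigma1_iff
proof (intro conjI allI impI)
  show "smooth (\<lambda>x. f x * g (x - y))"
    using assms by (intro smooth_mult smooth_translate Sigma1_smooth)
  fix R :: real assume R: "R > 0"
  obtain A B where "exp_bound (2 * R) A f" "exp_bound (2 * R) B g"
    using Sigma1_exp_bound[OF assms(1), of "2 * R"] Sigma1_exp_bound[OF assms(2), of "2 * R"] R by auto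
  then show "\<exists>A. exp_bound R A (\<lambda>x. f x * g (x - y))"
    using exp_bound_mult_translate[OF R Sigma1_smooth[OF assms(1)] _ Sigma1_smooth[OF assms(2)]] by blast
qed

lemma exp_bound_cmult:
  assumes "smooth f" "exp_bound R A f" shows "exp_bound R (cmod c * A) (\<lambda>x. c * f x)"
  using deriv_bound_cmult[OF assms(1) assms(2)[unfolded exp_bound_def], of c]
  by (simp only: exp_bound_def mult.assoc)

lemma Sigma1_cmult: assumes "f \<in> Sigma1" shows "(\<lambda>x. c * f x) \<in> Sigma1"
  unfolding Sigma1_iff
proof (intro conjI allI impI)
  show "smooth (\<lambda>x. c * f x)" by (rule smooth_cmult[OF Sigma1_smooth[OF assms]])
  fix R :: real assume R: "R > 0"
  obtain A where "exp_bound R A f" using Sigma1_exp_bound[OF assms R] by blast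
  then have "exp_bound R (cmod c * A) (\<lambda>x. c * f x)" by (rule exp_bound_cmult[OF Sigma1_smooth[OF assms]])
  then show "\<exists>A. exp_bound R A (\<lambda>x. c * f x)" by blast
qed

lemma exp_bound_add:
  assumes "smooth f" "smooth g" "exp_bound R A f" "exp_bound R B g"
  shows "exp_bound R (A + B) (\<lambda>x. f x + g x)"
  using deriv_bound_add[OF assms(1,2) assms(3,4)[unfolded exp_bound_def]]
  by (simp only: exp_bound_def distrib_right)

lemma Sigma1_add:
  assumes "f \<in> Sigma1" "g \<in> Sigma1" shows "(\<lambda>x. f x + g x) \<in> Sigma1"
  unfolding Sigma1_iff
proof (intro conjI allI impI)
  show "smooth (\<lambda>x. f x + g x)"
    by (rule smooth_add[OF Sigma1_smooth[OF assms(1)] Sigma1_smooth[OF assms(2)]])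
  fix R :: real assume R: "R > 0"
  then obtain A B where "exp_bound R A f" "exp_bound R B g"
    using Sigma1_exp_bound[OF assms(1), of R] Sigma1_exp_bound[OF assms(2), of R] by auto
  from exp_bound_add[OF Sigma1_smooth[OF assms(1)] Sigma1_smooth[OF assms(2)] this]
  show "\<exists>A. exp_bound R A (\<lambda>x. f x + g x)" by blast
qed

lemma Sigma1_zero: "(\<lambda>x. 0) \<in> Sigma1"
  unfolding Sigma1_iff exp_bound_def deriv_bound_def pderivs_const
  by (intro conjI allI impI exI[of _ 0] smooth_const) simp

lemma Sigma1_sum: "finite F \<Longrightarrow> (\<And>i. i \<in> F \<Longrightarrow> g i \<in> Sigma1) \<Longrightarrow> (\<lambda>x. \<Sum>i\<in>F. g i x) \<in> Sigma1"
proof (induction F rule: finite_induct)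
  case empty then show ?case by (simp add: Sigma1_zero)
next
  case (insert i F)
  then show ?case using Sigma1_add[of "g i" "\<lambda>x. \<Sum>i\<in>F. g i x"] by simp
qed

lemma Sigma1_norm_triangle:
  assumes "h > 0" "smooth f" "smooth g"
  shows "Sigma1_norm h (\<lambda>x. f x + g x) \<le> Sigma1_norm h f + Sigma1_norm h g"
  unfolding Sigma1_norm_def[of h "\<lambda>x. f x + g x"]
proof (rule SUP_least, clarify)
  fix \<alpha> \<beta> :: "'a \<Rightarrow> nat" and x :: "real^'a"
  define W where "W = h ^ (\<Sum>i\<in>UNIV. \<alpha> i + \<beta> i) * multi_fact \<alpha> * multi_fact \<beta>"
  have W: "W > 0" unfolding W_def using assms(1) multi_fact_pos[of \<alpha>] multi_fact_pos[of \<beta>] by simp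
  have "cmod (monomial \<alpha> x *\<^sub>R multi_deriv \<beta> (\<lambda>x. f x + g x) x) / W \<le>
      cmod (monomial \<alpha> x *\<^sub>R multi_deriv \<beta> f x) / W + cmod (monomial \<alpha> x *\<^sub>R multi_deriv \<beta> g x) / W"
    unfolding multi_deriv_eq_pderivs pderivs_add[OF assms(2,3)] scaleR_add_right add_divide_distrib[symmetric]
    using W by (intro divide_right_mono norm_triangle_ineq) auto
  then have "ennreal (cmod (monomial \<alpha> x *\<^sub>R multi_deriv \<beta> (\<lambda>x. f x + g x) x) / W) \<le>
      ennreal (cmod (monomial \<alpha> x *\<^sub>R multi_deriv \<beta> f x) / W) + ennreal (cmod (monomial \<alpha> x *\<^sub>R multi_deriv \<beta> g x) / W)"
    using W by (simp add: ennreal_plus[symmetric] ennreal_leI del: ennreal_plus)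
  also have "\<dots> \<le> Sigma1_norm h f + Sigma1_norm h g"
    unfolding Sigma1_norm_def W_def by (intro add_mono; rule SUP_upper2[where i = "(\<alpha>, \<beta>, x)"]) auto
  finally show "ennreal (cmod (monomial \<alpha> x *\<^sub>R multi_deriv \<beta> (\<lambda>x. f x + g x) x) /
      (h ^ (\<Sum>i\<in>UNIV. \<alpha> i + \<beta> i) * multi_fact \<alpha> * multi_fact \<beta>)) \<le> Sigma1_norm h f + Sigma1_norm h g"
    unfolding W_def .
qed

lemma Sigma1_norm_antimono:
  assumes "0 < h" "h \<le> h'" shows "Sigma1_norm h' f \<le> Sigma1_norm h f"
  unfolding Sigma1_norm_def[of h']
proof (rule SUP_least, clarify)
  fix \<alpha> \<beta> :: "'a \<Rightarrow> nat" and x :: "real^'a"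
  have "h ^ (\<Sum>i\<in>UNIV. \<alpha> i + \<beta> i) * multi_fact \<alpha> * multi_fact \<beta> \<le> h' ^ (\<Sum>i\<in>UNIV. \<alpha> i + \<beta> i) * multi_fact \<alpha> * multi_fact \<beta>"
    using assms multi_fact_pos[of \<alpha>] multi_fact_pos[of \<beta>] by (intro mult_right_mono power_mono) auto
  then have "cmod (monomial \<alpha> x *\<^sub>R multi_deriv \<beta> f x) / (h' ^ (\<Sum>i\<in>UNIV. \<alpha> i + \<beta> i) * multi_fact \<alpha> * multi_fact \<beta>)
      \<le> cmod (monomial \<alpha> x *\<^sub>R multi_deriv \<beta> f x) / (h ^ (\<Sum>i\<in>UNIV. \<alpha> i + \<beta> i) * multi_fact \<alpha> * multi_fact \<beta>)"
    using assms multi_fact_pos[of \<alpha>] multi_fact_pos[of \<beta>]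
    by (intro divide_left_mono mult_pos_pos zero_less_power) auto
  then have "ennreal (cmod (monomial \<alpha> x *\<^sub>R multi_deriv \<beta> f x) / (h' ^ (\<Sum>i\<in>UNIV. \<alpha> i + \<beta> i) * multi_fact \<alpha> * multi_fact \<beta>))
      \<le> ennreal (cmod (monomial \<alpha> x *\<^sub>R multi_deriv \<beta> f x) / (h ^ (\<Sum>i\<in>UNIV. \<alpha> i + \<beta> i) * multi_fact \<alpha> * multi_fact \<beta>))"
    by (rule ennreal_leI)
  also have "\<dots> \<le> Sigma1_norm h f"
    unfolding Sigma1_norm_def by (rule SUP_upper2[where i = "(\<alpha>, \<beta>, x)"]) auto
  finally show "ennreal (cmod (monomial \<alpha> x *\<^sub>R multi_deriv \<beta> f x) / (h' ^ (\<Sum>i\<in>UNIV. \<alpha> i + \<beta> i) * multi_fact \<alpha> * multi_fact \<beta>))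
      \<le> Sigma1_norm h f" .
qed

section \<open>Continuous functionals on \<open>Sigma1\<close>\<close>

lemma Sigma1_dual_add: "f \<in> Sigma1_dual \<Longrightarrow> \<phi> \<in> Sigma1 \<Longrightarrow> \<psi> \<in> Sigma1 \<Longrightarrow> f (\<lambda>x. \<phi> x + \<psi> x) = f \<phi> + f \<psi>"
  by (simp add: Sigma1_dual_def)

lemma Sigma1_dual_cmult: "f \<in> Sigma1_dual \<Longrightarrow> \<phi> \<in> Sigma1 \<Longrightarrow> f (\<lambda>x. a * \<phi> x) = a * f \<phi>"
  by (simp add: Sigma1_dual_def)

lemma Sigma1_dual_zero: "f \<in> Sigma1_dual \<Longrightarrow> f (\<lambda>x. 0) = 0"
  using Sigma1_dual_cmult[of f "\<lambda>x. 0" 0] Sigma1_zero by simp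

lemma Sigma1_dual_sum:
  assumes "f \<in> Sigma1_dual" "finite F" "\<And>i. i \<in> F \<Longrightarrow> g i \<in> Sigma1"
  shows "f (\<lambda>x. \<Sum>i\<in>F. g i x) = (\<Sum>i\<in>F. f (g i))"
  using assms(2,3)
proof (induction F rule: finite_induct)
  case empty then show ?case using Sigma1_dual_zero[OF assms(1)] by simp
next
  case (insert i F)
  then show ?case using Sigma1_dual_add[OF assms(1), of "g i" "\<lambda>x. \<Sum>i\<in>F. g i x"] Sigma1_sum[of F g] by simp
qed

lemma Sigma1_dual_diff:
  assumes "f \<in> Sigma1_dual" "\<phi> \<in> Sigma1" "\<psi> \<in> Sigma1"
  shows "(\<lambda>x. \<phi> x - \<psi> x) \<in> Sigma1" "f (\<lambda>x. \<phi> x - \<psi> x) = f \<phi> - f \<psi>"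
  using Sigma1_add[OF assms(2) Sigma1_cmult[OF assms(3), of "-1"]]
    Sigma1_dual_add[OF assms(1,2) Sigma1_cmult[OF assms(3), of "-1"]] Sigma1_dual_cmult[OF assms(1,3), of "-1"]
  by simp_all

lemma Sigma1_diff: "\<phi> \<in> Sigma1 \<Longrightarrow> \<psi> \<in> Sigma1 \<Longrightarrow> (\<lambda>x. \<phi> x - \<psi> x) \<in> Sigma1"
  using Sigma1_add[OF _ Sigma1_cmult, of \<phi> \<psi> "-1"] by simp

text \<open>The balls form only a subbasis and have arbitrary centres, hence the induction over the
  generation of open sets: an intersection is handled by the smaller \<open>h\<close> and the
  smaller radius, and a ball about \<phi> containing 0 by the triangle inequality.\<close>

lemma Sigma1_topology_nhd_0:
  fixes U :: "(real^'n \<Rightarrow> complex) set"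
  assumes "openin Sigma1_topology U" "(\<lambda>x. 0) \<in> U"
  shows "\<exists>h>0. \<exists>\<epsilon>>0. \<forall>\<psi>\<in>Sigma1. Sigma1_norm h \<psi> < ennreal \<epsilon> \<longrightarrow> \<psi> \<in> U"
proof -
  have "generate_topology_on {{\<psi> \<in> Sigma1. Sigma1_norm h (\<lambda>x. \<psi> x - \<phi> x) < ennreal \<epsilon>} | h \<phi> \<epsilon>.
        0 < h \<and> \<phi> \<in> Sigma1 \<and> 0 < \<epsilon>} U"
    using assms(1) unfolding Sigma1_topology_def by (rule openin_topology_generated_by)
  then show ?thesis using assms(2)
  proof (induction rule: generate_topology_on.induct)
    case Empty then show ?case by simp
  next
    case (Int a b)
    from Int.prems have "(\<lambda>x. 0) \<in> a" "(\<lambda>x. 0) \<in> b" by auto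
    then obtain h1 e1 h2 e2 where h: "h1 > 0" "e1 > 0" "h2 > 0" "e2 > 0"
      "\<forall>\<psi>\<in>Sigma1. Sigma1_norm h1 \<psi> < ennreal e1 \<longrightarrow> \<psi> \<in> a"
      "\<forall>\<psi>\<in>Sigma1. Sigma1_norm h2 \<psi> < ennreal e2 \<longrightarrow> \<psi> \<in> b"
      using Int.IH by blast
    have "Sigma1_norm h1 \<psi> < ennreal e1 \<and> Sigma1_norm h2 \<psi> < ennreal e2"
      if "Sigma1_norm (min h1 h2) \<psi> < ennreal (min e1 e2)" for \<psi> :: "real^'n \<Rightarrow> complex"
    proof -
      have "Sigma1_norm h1 \<psi> \<le> Sigma1_norm (min h1 h2) \<psi>" "Sigma1_norm h2 \<psi> \<le> Sigma1_norm (min h1 h2) \<psi>"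
        using h(1,3) by (auto intro: Sigma1_norm_antimono)
      moreover have "ennreal (min e1 e2) \<le> ennreal e1" "ennreal (min e1 e2) \<le> ennreal e2"
        by (auto intro: ennreal_leI)
      ultimately show ?thesis using that by (meson le_less_trans less_le_trans)
    qed
    then have "\<forall>\<psi>\<in>Sigma1. Sigma1_norm (min h1 h2) \<psi> < ennreal (min e1 e2) \<longrightarrow> \<psi> \<in> a \<inter> b"
      using h(5,6) by blast
    moreover have "min h1 h2 > 0" "min e1 e2 > 0" using h(1-4) by auto
    ultimately show ?case by blast
  next
    case (UN K)
    then obtain k where k: "k \<in> K" "(\<lambda>x. 0) \<in> k" by blast
    from UN.IH[OF this] show ?case using k(1) by blast
  next
    case (Basis s)
    then obtain h \<phi> \<epsilon> where s: "s = {\<psi> \<in> Sigma1. Sigma1_norm h (\<lambda>x. \<psi> x - \<phi> x) < ennreal \<epsilon>}"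
      and h: "0 < h" "\<phi> \<in> Sigma1" "0 < \<epsilon>" by blast
    \<comment> \<open>The distance from 0 to the centre; the part \<open>\<epsilon> - m\<close> of
      the radius is left for the ball about 0.\<close>
    define n where "n = Sigma1_norm h (\<lambda>x. - \<phi> x)"
    have n: "n < ennreal \<epsilon>" using Basis.prems unfolding s n_def by simp
    then obtain m where m: "n = ennreal m" "m \<ge> 0" by (cases n) auto
    have sm: "smooth (\<lambda>x. - \<phi> x)" using Sigma1_smooth[OF Sigma1_cmult[OF h(2), of "-1"]] by simp
    show ?case
    proof (rule exI[of _ h], rule conjI[OF h(1)], rule exI[of _ "\<epsilon> - m"], intro conjI ballI impI)
      show "\<epsilon> - m > 0" using n m by (simp add: ennreal_less_iff)
      fix \<psi> :: "real^'n \<Rightarrow> complex" assume psi: "\<psi> \<in> Sigma1" "Sigma1_norm h \<psi> < ennreal (\<epsilon> - m)"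
      obtain p where p: "Sigma1_norm h \<psi> = ennreal p" "p \<ge> 0" using psi(2) by (cases "Sigma1_norm h \<psi>") auto
      have "Sigma1_norm h (\<lambda>x. \<psi> x + - \<phi> x) \<le> ennreal p + ennreal m"
        using Sigma1_norm_triangle[OF h(1) Sigma1_smooth[OF psi(1)] sm] m p by (simp add: n_def)
      also have "\<dots> < ennreal \<epsilon>" using psi(2) p m h(3)
        by (simp add: ennreal_plus[symmetric] ennreal_less_iff del: ennreal_plus)
      finally show "\<psi> \<in> s" unfolding s using psi(1) by simp
    qed
  qed
qed

lemma topspace_Sigma1_topology: "topspace Sigma1_topology = (Sigma1 :: (real^'a \<Rightarrow> complex) set)"
proof -
  have "Sigma1_norm 1 (\<lambda>x. \<psi> x - \<psi> x) < ennreal 1" for \<psi> :: "real^'a \<Rightarrow> complex"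
  proof -
    have "Sigma1_norm 1 (\<lambda>x::real^'a. 0::complex) \<le> ennreal 0"
      by (rule exp_bound_imp_Sigma1_norm[of 1 "real CARD('a)"])
         (simp_all add: exp_bound_def deriv_bound_def pderivs_const)
    then show ?thesis by simp
  qed
  note n = this
  define S :: "(real^'a \<Rightarrow> complex) set set" where
    "S = {{\<psi> \<in> Sigma1. Sigma1_norm h (\<lambda>x. \<psi> x - \<phi> x) < ennreal \<epsilon>} | h \<phi> \<epsilon>. 0 < h \<and> \<phi> \<in> Sigma1 \<and> 0 < \<epsilon>}"
  have "\<psi> \<in> \<Union> S" if psi: "\<psi> \<in> Sigma1" for \<psi>
  proof (rule UnionI)
    show "{\<psi>' \<in> Sigma1. Sigma1_norm 1 (\<lambda>x. \<psi>' x - \<psi> x) < ennreal 1} \<in> S"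
      unfolding S_def using psi by (intro CollectI) (metis zero_less_one)
  qed (use psi n[of \<psi>] in simp)
  moreover have "\<Union> S \<subseteq> Sigma1" unfolding S_def by blast
  ultimately show ?thesis unfolding Sigma1_topology_def S_def[symmetric] topology_generated_by_topspace by blast
qed

text \<open>Continuity at 0 gives a ball on which \<open>f\<close> is below 1, and scaling spreads
  this over \<open>Sigma1\<close>. Every element of \<open>Sigma1\<close> has an exponential bound
  at the resulting rate, so one pair \<open>R\<close>, \<open>C\<close> controls
  \<open>f\<close>.\<close>

lemma Sigma1_dual_bounded:
  fixes f :: "(real^'n \<Rightarrow> complex) \<Rightarrow> complex"
  assumes "f \<in> Sigma1_dual"
  obtains R C where "R > 0" "C > 0" "\<And>\<psi> A. \<psi> \<in> Sigma1 \<Longrightarrow> exp_bound R A \<psi> \<Longrightarrow> cmod (f \<psi>) \<le> C * A"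
proof -
  have "continuous_map Sigma1_topology euclidean f" using assms by (simp add: Sigma1_dual_def)
  then have "openin Sigma1_topology {\<psi> \<in> topspace Sigma1_topology. f \<psi> \<in> ball 0 1}"
    by (rule openin_continuous_map_preimage) auto
  moreover have "(\<lambda>x. 0) \<in> {\<psi> \<in> topspace Sigma1_topology. f \<psi> \<in> ball 0 1}"
    using Sigma1_dual_zero[OF assms] Sigma1_zero by (simp add: topspace_Sigma1_topology)
  ultimately obtain h \<epsilon> where h: "h > 0" "\<epsilon> > 0"
    and hb': "\<forall>\<psi>\<in>Sigma1. Sigma1_norm h \<psi> < ennreal \<epsilon> \<longrightarrow> \<psi> \<in> {\<psi> \<in> topspace Sigma1_topology. f \<psi> \<in> ball 0 1}"
    using Sigma1_topology_nhd_0 by blast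
  have hb: "cmod (f \<psi>) < 1" if "\<psi> \<in> Sigma1" "Sigma1_norm h \<psi> < ennreal \<epsilon>" for \<psi>
    using hb' that by (auto simp: dist_norm)
  define R where "R = real CARD('n) / h"
  have b: "cmod (f \<psi>) \<le> 2 / \<epsilon> * A" if psi: "\<psi> \<in> Sigma1" "exp_bound R A \<psi>" "A > 0" for \<psi> A
  proof -
    define c where "c = \<epsilon> / (2 * A)"
    have c: "c > 0" using h psi by (simp add: c_def)
    have "exp_bound R (cmod (of_real c) * A) (\<lambda>x. of_real c * \<psi> x)"
      by (rule exp_bound_cmult[OF Sigma1_smooth[OF psi(1)] psi(2)])
    from exp_bound_imp_Sigma1_norm[OF h(1) _ this] have "Sigma1_norm h (\<lambda>x. of_real c * \<psi> x) \<le> ennreal (c * A)"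
      using c by (simp add: R_def)
    also have "\<dots> < ennreal \<epsilon>" using h psi by (simp add: c_def ennreal_less_iff)
    finally have "cmod (f (\<lambda>x. of_real c * \<psi> x)) < 1" by (intro hb Sigma1_cmult psi)
    then have "c * cmod (f \<psi>) < 1" using c by (simp add: Sigma1_dual_cmult[OF assms psi(1)] norm_mult)
    then show ?thesis using c h psi by (simp add: c_def field_simps)
  qed
  \<comment> \<open>The scaling divides by \<open>A\<close>, which may be 0, so \<open>A\<close> is
    first enlarged by an arbitrarily small amount.\<close>
  have "cmod (f \<psi>) \<le> 2 / \<epsilon> * A" if psi: "\<psi> \<in> Sigma1" "exp_bound R A \<psi>" for \<psi> A
  proof (rule field_le_epsilon)
    fix e :: real assume e: "e > 0"
    have R: "R > 0" using h by (simp add: R_def)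
    have A: "A \<ge> 0" using exp_bound_nonneg[OF psi(2)] .
    have "exp_bound R (A + e * \<epsilon> / 2) \<psi>" by (rule exp_bound_mono[OF psi(2)]) (use R e h in auto)
    then have "cmod (f \<psi>) \<le> 2 / \<epsilon> * (A + e * \<epsilon> / 2)" using e h A by (intro b psi) (auto intro: add_nonneg_pos)
    then show "cmod (f \<psi>) \<le> 2 / \<epsilon> * A + e" using h by (simp add: field_simps)
  qed
  then show thesis using that[of R "2 / \<epsilon>"] h by (simp add: R_def)
qed

text \<open>By linearity one norm bound gives continuity at every point. The \<open>h\<close> with
  \<open>1 / (2 * h) = R\<close> fits \<open>Sigma1_norm_imp_exp_bound\<close>, and \<open>D\<close>
  makes room for its constant \<open>4 ^ CARD('n)\<close>.\<close>

lemma Sigma1_dualI: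
  fixes f :: "(real^'n \<Rightarrow> complex) \<Rightarrow> complex"
  assumes "f \<in> extensional Sigma1"
    and add: "\<And>\<phi> \<psi>. \<phi> \<in> Sigma1 \<Longrightarrow> \<psi> \<in> Sigma1 \<Longrightarrow> f (\<lambda>x. \<phi> x + \<psi> x) = f \<phi> + f \<psi>"
    and scale: "\<And>a \<phi>. \<phi> \<in> Sigma1 \<Longrightarrow> f (\<lambda>x. a * \<phi> x) = a * f \<phi>"
    and R: "R > 0" and bound: "\<And>\<psi> A. \<psi> \<in> Sigma1 \<Longrightarrow> exp_bound R A \<psi> \<Longrightarrow> cmod (f \<psi>) \<le> C * A"
  shows "f \<in> Sigma1_dual"
proof -
  define h where "h = 1 / (2 * R)"
  have h: "h > 0" "1 / (2 * h) = R" using R by (auto simp: h_def)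
  have diff: "f (\<lambda>x. \<phi> x - \<psi> x) = f \<phi> - f \<psi>" if "\<phi> \<in> Sigma1" "\<psi> \<in> Sigma1" for \<phi> \<psi>
    using add[OF that(1) Sigma1_cmult[OF that(2), of "-1"]] scale[OF that(2), of "-1"] by simp
  have "continuous_map Sigma1_topology euclidean f"
    unfolding continuous_map_def
  proof (intro conjI allI impI)
    fix U :: "complex set" assume "openin euclidean U"
    then have U: "open U" by simp
    show "openin Sigma1_topology {x \<in> topspace Sigma1_topology. f x \<in> U}"
    proof (subst openin_subopen, intro ballI)
      fix \<psi>0 assume "\<psi>0 \<in> {x \<in> topspace Sigma1_topology. f x \<in> U}"
      then have p0: "\<psi>0 \<in> Sigma1" "f \<psi>0 \<in> U" by (auto simp: topspace_Sigma1_topology)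
      obtain e where e: "e > 0" "ball (f \<psi>0) e \<subseteq> U" using U p0 by (meson openE)
      define D where "D = \<bar>C\<bar> * 4 ^ CARD('n) + 1"
      have D: "D > 0" unfolding D_def by (simp add: add_nonneg_pos)
      define T where "T = {\<psi> \<in> Sigma1. Sigma1_norm h (\<lambda>x. \<psi> x - \<psi>0 x) < ennreal (e / D)}"
      have "openin Sigma1_topology T"
        unfolding Sigma1_topology_def T_def
        by (rule topology_generated_by_Basis, rule CollectI, rule exI[of _ h], rule exI[of _ \<psi>0],
            rule exI[of _ "e / D"]) (use h p0 e D in simp)
      moreover have "\<psi>0 \<in> T"
      proof -
        have "Sigma1_norm h (\<lambda>x::real^'n. 0::complex) \<le> ennreal 0"
          by (rule exp_bound_imp_Sigma1_norm[OF h(1) order_refl])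
             (simp_all add: exp_bound_def deriv_bound_def pderivs_const)
        then show ?thesis unfolding T_def using p0 e D by simp
      qed
      moreover have "T \<subseteq> {x \<in> topspace Sigma1_topology. f x \<in> U}"
      proof
        fix \<psi> assume "\<psi> \<in> T"
        then have psi: "\<psi> \<in> Sigma1" "Sigma1_norm h (\<lambda>x. \<psi> x - \<psi>0 x) \<le> ennreal (e / D)" by (auto simp: T_def)
        have "exp_bound R (4 ^ CARD('n) * (e / D)) (\<lambda>x. \<psi> x - \<psi>0 x)"
          using Sigma1_norm_imp_exp_bound[OF h(1) _ psi(2)] e D unfolding h(2) by simp
        then have "cmod (f \<psi> - f \<psi>0) \<le> C * (4 ^ CARD('n) * (e / D))"
          using bound[OF Sigma1_diff[OF psi(1) p0(1)]] unfolding diff[OF psi(1) p0(1)] by blast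
        also have "\<dots> \<le> \<bar>C\<bar> * (4 ^ CARD('n) * (e / D))" using e D by (intro mult_right_mono) auto
        also have "\<dots> = (D - 1) * (e / D)" by (simp add: D_def)
        also have "\<dots> < e" using e D by (simp add: field_simps)
        finally have "f \<psi> \<in> ball (f \<psi>0) e" by (simp add: dist_norm norm_minus_commute)
        then show "\<psi> \<in> {x \<in> topspace Sigma1_topology. f x \<in> U}" using e psi by (auto simp: topspace_Sigma1_topology)
      qed
      ultimately show "\<exists>T. openin Sigma1_topology T \<and> \<psi>0 \<in> T \<and> T \<subseteq> {x \<in> topspace Sigma1_topology. f x \<in> U}" by blast
    qed
  qed simp
  then show ?thesis unfolding Sigma1_dual_def using assms by auto
qed

lemma has_vector_derivative_at_0_iff:
  "(s has_vector_derivative L) (at 0) \<longleftrightarrow> ((\<lambda>t. (s t - s 0) /\<^sub>R t) \<longlongrightarrow> L) (at (0::real))"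
proof -
  have "((\<lambda>t. (s t - s 0) /\<^sub>R t) \<longlongrightarrow> L) (at 0) \<longleftrightarrow> ((\<lambda>t. norm ((s t - s 0) /\<^sub>R t - L)) \<longlongrightarrow> 0) (at (0::real))"
    unfolding tendsto_norm_zero_iff by (rule Lim_null)
  also have "\<dots> \<longleftrightarrow> ((\<lambda>t. norm (s t - s 0 - t *\<^sub>R L) / norm t) \<longlongrightarrow> 0) (at (0::real))"
  proof (rule filterlim_cong[OF refl refl])
    show "\<forall>\<^sub>F t in at 0. norm ((s t - s 0) /\<^sub>R t - L) = norm (s t - s 0 - t *\<^sub>R L) / norm t"
      unfolding eventually_at_filter
    proof (intro always_eventually allI impI)
      fix t :: real assume t: "t \<noteq> 0"
      then have "(s t - s 0) /\<^sub>R t - L = (s t - s 0 - t *\<^sub>R L) /\<^sub>R t"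
        by (simp add: scaleR_diff_right)
      then show "norm ((s t - s 0) /\<^sub>R t - L) = norm (s t - s 0 - t *\<^sub>R L) / norm t"
        by (simp add: divide_inverse mult.commute)
    qed
  qed
  also have "\<dots> \<longleftrightarrow> (s has_vector_derivative L) (at 0)"
    unfolding has_vector_derivative_def has_derivative_at by (simp add: bounded_linear_scaleR_left)
  finally show ?thesis by simp
qed

lemma partial_deriv_tendsto:
  assumes "f differentiable (at x)"
  shows "((\<lambda>t. (f (x + t *\<^sub>R axis i 1) - f x) /\<^sub>R t) \<longlongrightarrow> partial_deriv i f x) (at (0::real))"
proof -
  obtain f' where f': "(f has_derivative f') (at x)" using assms by (auto simp: differentiable_def)
  have "((\<lambda>t. x + t *\<^sub>R axis i 1) has_derivative (\<lambda>t. t *\<^sub>R axis i 1)) (at 0)"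
    by (auto intro!: derivative_eq_intros)
  from diff_chain_at[OF this, of f f'] f'
  have "((\<lambda>t. f (x + t *\<^sub>R axis i 1)) has_derivative (\<lambda>t. f' (t *\<^sub>R axis i 1))) (at 0)"
    by (simp add: comp_def)
  moreover have "f' (t *\<^sub>R axis i 1) = t *\<^sub>R f' (axis i 1)" for t
    using has_derivative_linear[OF f'] by (simp add: linear_cmul)
  ultimately have "((\<lambda>t. f (x + t *\<^sub>R axis i 1)) has_vector_derivative partial_deriv i f x) (at 0)"
    by (simp add: has_vector_derivative_def partial_deriv_eq[OF f'])
  then show ?thesis unfolding has_vector_derivative_at_0_iff by simp
qed

lemma partial_deriv_Lipschitz:
  assumes diff: "\<And>x. f differentiable (at x)"
    and B: "\<And>s. s \<in> closed_segment 0 t \<Longrightarrow> cmod (partial_deriv i f (x + s *\<^sub>R axis i 1)) \<le> B"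
  shows "cmod (f (x + t *\<^sub>R axis i 1) - f x) \<le> B * \<bar>t\<bar>"
proof -
  have "norm (f (x + t *\<^sub>R axis i 1) - f (x + 0 *\<^sub>R axis i 1)) \<le> B * norm (t - 0)"
  proof (rule differentiable_bound[where f = "\<lambda>s. f (x + s *\<^sub>R axis i 1)" and S = "closed_segment 0 t"
        and f' = "\<lambda>s h. h *\<^sub>R partial_deriv i f (x + s *\<^sub>R axis i 1)"])
    fix s assume s: "s \<in> closed_segment 0 t"
    obtain f' where f': "(f has_derivative f') (at (x + s *\<^sub>R axis i 1))" using diff by (auto simp: differentiable_def)
    have "((\<lambda>s. x + s *\<^sub>R axis i 1) has_derivative (\<lambda>t. t *\<^sub>R axis i 1)) (at s)"
      by (auto intro!: derivative_eq_intros)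
    from diff_chain_at[OF this, of f f'] f'
    have "((\<lambda>t. f (x + t *\<^sub>R axis i 1)) has_derivative (\<lambda>t. f' (t *\<^sub>R axis i 1))) (at s)"
      by (simp add: comp_def)
    moreover have "f' (t *\<^sub>R axis i 1) = t *\<^sub>R f' (axis i 1)" for t
      using has_derivative_linear[OF f'] by (simp add: linear_cmul)
    ultimately show "((\<lambda>s. f (x + s *\<^sub>R axis i 1)) has_derivative (\<lambda>h. h *\<^sub>R partial_deriv i f (x + s *\<^sub>R axis i 1))) (at s within closed_segment 0 t)"
      by (simp add: partial_deriv_eq[OF f'] has_derivative_at_withinI)
    show "onorm (\<lambda>h. h *\<^sub>R partial_deriv i f (x + s *\<^sub>R axis i 1)) \<le> B"
      using B[OF s] by (intro onorm_le) (simp add: mult.commute[of B] mult_left_mono)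
  qed auto
  then show ?thesis by simp
qed

lemma has_sum_uminusI:
  fixes f :: "'a \<Rightarrow> 'b::topological_ab_group_add"
  shows "(f has_sum a) I \<Longrightarrow> ((\<lambda>i. - f i) has_sum (- a)) I"
  by (simp add: has_sum_uminus)

text \<open>The mean value inequality bounds all difference quotients of \<open>h i\<close> by
  \<open>B i\<close>, uniformly in the increment, so dominated convergence applies to the series of
  quotients.\<close>

lemma partial_deriv_infsum:
  assumes diff: "\<And>i x. i \<in> I \<Longrightarrow> h i differentiable (at x)"
    and B: "\<And>i x. i \<in> I \<Longrightarrow> cmod (partial_deriv a (h i) x) \<le> B i" "B summable_on I"
    and sum: "\<And>x. (\<lambda>i. h i x) summable_on I"
  shows "partial_deriv a (\<lambda>x. \<Sum>\<^sub>\<infinity>i\<in>I. h i x) x = (\<Sum>\<^sub>\<infinity>i\<in>I. partial_deriv a (h i) x)"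
proof -
  have "((\<lambda>t. \<Sum>\<^sub>\<infinity>i\<in>I. (h i (x + t *\<^sub>R axis a 1) - h i x) /\<^sub>R t) \<longlongrightarrow> (\<Sum>\<^sub>\<infinity>i\<in>I. partial_deriv a (h i) x)) (at (0::real))"
  proof (rule tendsto_infsum_dominated[OF _ _ B(2)])
    show "\<forall>\<^sub>F t in at 0. \<forall>i\<in>I. cmod ((h i (x + t *\<^sub>R axis a 1) - h i x) /\<^sub>R t) \<le> B i"
      unfolding eventually_at_filter
    proof (intro always_eventually allI impI ballI)
      fix t :: real and i assume t: "t \<noteq> 0" and i: "i \<in> I"
      have "cmod (h i (x + t *\<^sub>R axis a 1) - h i x) \<le> B i * \<bar>t\<bar>"
        by (rule partial_deriv_Lipschitz) (use diff B i in auto)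
      then show "cmod ((h i (x + t *\<^sub>R axis a 1) - h i x) /\<^sub>R t) \<le> B i"
        unfolding norm_scaleR using t by (simp add: field_simps)
    qed
  qed (use diff in \<open>auto intro: partial_deriv_tendsto\<close>)
  moreover have "(\<Sum>\<^sub>\<infinity>i\<in>I. (h i (x + t *\<^sub>R axis a 1) - h i x) /\<^sub>R t) =
      ((\<Sum>\<^sub>\<infinity>i\<in>I. h i (x + t *\<^sub>R axis a 1)) - (\<Sum>\<^sub>\<infinity>i\<in>I. h i x)) /\<^sub>R t" for t
  proof -
    have "((\<lambda>i. (h i (x + t *\<^sub>R axis a 1) - h i x) /\<^sub>R t) has_sum
      (((\<Sum>\<^sub>\<infinity>i\<in>I. h i (x + t *\<^sub>R axis a 1)) - (\<Sum>\<^sub>\<infinity>i\<in>I. h i x)) /\<^sub>R t)) I"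
      unfolding diff_conv_add_uminus
      by (intro has_sum_scaleR has_sum_add has_sum_infsum sum has_sum_uminusI)
    then show ?thesis by (rule infsumI)
  qed
  ultimately have "((\<lambda>t. \<Sum>\<^sub>\<infinity>i\<in>I. h i (x + t *\<^sub>R axis a 1)) has_vector_derivative (\<Sum>\<^sub>\<infinity>i\<in>I. partial_deriv a (h i) x)) (at 0)"
    unfolding has_vector_derivative_at_0_iff by simp
  then show ?thesis unfolding partial_deriv_def[of a "\<lambda>x. \<Sum>\<^sub>\<infinity>i\<in>I. h i x"] by (rule vector_derivative_at)
qed

lemma exp_boundD:
  assumes "exp_bound R A f" "js \<in> range index_list"
  shows "cmod (pderivs js f x) \<le> list_fact js / R ^ length js * (A * exp (- (R * norm x)))"
  using deriv_boundD[OF assms(1)[unfolded exp_bound_def] assms(2)] .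

lemma exp_bound_pderivs_le:
  assumes "exp_bound R A f" "R > 0" "js \<in> range index_list"
  shows "cmod (pderivs js f x) \<le> list_fact js / R ^ length js * A"
proof -
  have "A * exp (- (R * norm x)) \<le> A * 1"
    using exp_bound_nonneg[OF assms(1)] assms(2) by (intro mult_left_mono) auto
  then have "list_fact js / R ^ length js * (A * exp (- (R * norm x))) \<le> list_fact js / R ^ length js * A"
    using list_fact_ge_1[of js] assms(2) by (intro mult_left_mono) auto
  then show ?thesis using exp_boundD[OF assms(1,3), of x] by linarith
qed

lemma abs_summable_bound:
  fixes f :: "'a \<Rightarrow> 'b::banach"
  assumes "A summable_on I" "\<And>i. i \<in> I \<Longrightarrow> norm (f i) \<le> c * A i"
  shows "(\<lambda>i. norm (f i)) summable_on I" "f summable_on I"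
proof -
  have "(\<lambda>i. c * A i) summable_on I" by (rule summable_on_cmult_right[OF assms(1)])
  then show 1: "(\<lambda>i. norm (f i)) summable_on I"
    by (rule summable_on_comparison_test) (use assms(2) in auto)
  show "f summable_on I" by (rule abs_summable_summable[OF 1])
qed

section \<open>Series of test functions with summable exponential bounds\<close>

context
  fixes g :: "'i \<Rightarrow> real^'n \<Rightarrow> complex" and A :: "'i \<Rightarrow> real" and I :: "'i set" and R :: real
  assumes R: "R > 0" and g: "\<And>i. i \<in> I \<Longrightarrow> g i \<in> Sigma1"
    and b: "\<And>i. i \<in> I \<Longrightarrow> exp_bound R (A i) (g i)" and A: "A summable_on I"
begin

lemma pderivs_summable:
  assumes "js \<in> range index_list" shows "(\<lambda>i. pderivs js (g i) x) summable_on I"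
  by (rule abs_summable_bound(2)[OF A]) (rule exp_bound_pderivs_le[OF b R assms])

lemma pderivs_infsum:
  assumes "js \<in> range index_list"
  shows "pderivs js (\<lambda>x. \<Sum>\<^sub>\<infinity>i\<in>I. g i x) = (\<lambda>x. \<Sum>\<^sub>\<infinity>i\<in>I. pderivs js (g i) x)"
  using assms
proof (induction js)
  case (Cons a js)
  have js: "js \<in> range index_list"
    using Cons.prems subseq_index_list[of js] by (auto) (metis list_emb_Cons subseq_order.order_refl rangeI)
  have "partial_deriv a (\<lambda>x. \<Sum>\<^sub>\<infinity>i\<in>I. pderivs js (g i) x) x = (\<Sum>\<^sub>\<infinity>i\<in>I. partial_deriv a (pderivs js (g i)) x)" for x
  proof (rule partial_deriv_infsum[where B = "\<lambda>i. list_fact (a # js) / R ^ length (a # js) * A i"])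
    show "(\<lambda>i. list_fact (a # js) / R ^ length (a # js) * A i) summable_on I"
      by (rule summable_on_cmult_right[OF A])
    show "cmod (partial_deriv a (pderivs js (g i)) x) \<le> list_fact (a # js) / R ^ length (a # js) * A i" if "i \<in> I" for i x
      using exp_bound_pderivs_le[OF b[OF that] R Cons.prems] by simp
    show "(\<lambda>i. pderivs js (g i) x) summable_on I" for x by (rule pderivs_summable[OF js])
    show "pderivs js (g i) differentiable at x" if "i \<in> I" for i x
      by (rule smoothD[OF Sigma1_smooth[OF g[OF that]]])
  qed
  then show ?case using Cons.IH[OF js] by auto
qed simp

text \<open>Termwise bounds are summed over the complement of \<open>F\<close>. The partial sums
  thus converge to the series in the sense of \<open>exp_bound R\<close>, with the tail of
  \<open>A\<close> as error.\<close>

lemma pderivs_tail: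
  assumes js: "js \<in> range index_list" and F: "finite F" "F \<subseteq> I"
  shows "cmod (pderivs js (\<lambda>x. \<Sum>\<^sub>\<infinity>i\<in>I. g i x) x - (\<Sum>i\<in>F. pderivs js (g i) x)) \<le>
    list_fact js / R ^ length js * (((\<Sum>\<^sub>\<infinity>i\<in>I. A i) - (\<Sum>i\<in>F. A i)) * exp (- (R * norm x)))"
proof -
  let ?c = "list_fact js / R ^ length js * exp (- (R * norm x))"
  have 1: "((\<lambda>i. pderivs js (g i) x) has_sum (pderivs js (\<lambda>x. \<Sum>\<^sub>\<infinity>i\<in>I. g i x) x - (\<Sum>i\<in>F. pderivs js (g i) x))) (I - F)"
    unfolding pderivs_infsum[OF js] using F
    by (intro has_sum_Diff has_sum_infsum pderivs_summable[OF js] has_sum_finite) auto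
  have 2: "((\<lambda>i. ?c * A i) has_sum (?c * ((\<Sum>\<^sub>\<infinity>i\<in>I. A i) - (\<Sum>i\<in>F. A i)))) (I - F)"
    using F by (intro has_sum_cmult_right has_sum_Diff has_sum_infsum A has_sum_finite) auto
  have "cmod (pderivs js (\<lambda>x. \<Sum>\<^sub>\<infinity>i\<in>I. g i x) x - (\<Sum>i\<in>F. pderivs js (g i) x)) \<le> (\<Sum>\<^sub>\<infinity>i\<in>I - F. ?c * A i)"
  proof (rule norm_infsum_le[OF 1])
    show "((\<lambda>i. ?c * A i) has_sum (\<Sum>\<^sub>\<infinity>i\<in>I - F. ?c * A i)) (I - F)"
      using 2 by (simp add: infsumI)
    show "cmod (pderivs js (g i) x) \<le> ?c * A i" if "i \<in> I - F" for i
      using exp_boundD[OF b js, of i x] that by (simp add: mult_ac)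
  qed
  also have "(\<Sum>\<^sub>\<infinity>i\<in>I - F. ?c * A i) = ?c * ((\<Sum>\<^sub>\<infinity>i\<in>I. A i) - (\<Sum>i\<in>F. A i))" by (rule infsumI[OF 2])
  finally show ?thesis by (simp add: mult_ac)
qed

end

lemma pderivs_sum:
  assumes "finite F" "\<And>i. i \<in> F \<Longrightarrow> g i \<in> Sigma1"
  shows "pderivs js (\<lambda>x. \<Sum>i\<in>F. g i x) x = (\<Sum>i\<in>F. pderivs js (g i) x)"
  using assms
proof (induction F rule: finite_induct)
  case empty then show ?case by (simp add: pderivs_const)
next
  case (insert i F)
  have "smooth (g i)" "smooth (\<lambda>x. \<Sum>i\<in>F. g i x)"
    using insert by (auto intro: Sigma1_smooth Sigma1_sum)
  then show ?case using insert pderivs_add[of "g i" "\<lambda>x. \<Sum>i\<in>F. g i x" js] by simp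
qed

text \<open>Equality of the sums cannot be inserted into \<open>f\<close> directly: the bounds hold
  for one \<open>R\<close> only, so the common sum may lie outside \<open>Sigma1\<close>. The
  difference of two finite partial sums does lie in \<open>Sigma1\<close>, and comparison with the
  common sum bounds it by the two tails. The two limits over finite sets are then taken one after
  the other.\<close>

lemma Sigma1_dual_series_eq:
  fixes f :: "(real^'n \<Rightarrow> complex) \<Rightarrow> complex"
  assumes f: "f \<in> Sigma1_dual" and R: "R > 0"
    and C: "\<And>\<psi> A. \<psi> \<in> Sigma1 \<Longrightarrow> exp_bound R A \<psi> \<Longrightarrow> cmod (f \<psi>) \<le> C * A"
    and g: "\<And>i. i \<in> I \<Longrightarrow> g i \<in> Sigma1" "\<And>i. i \<in> I \<Longrightarrow> exp_bound R (A i) (g i)" "A summable_on I"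
    and g': "\<And>j. j \<in> J \<Longrightarrow> g' j \<in> Sigma1" "\<And>j. j \<in> J \<Longrightarrow> exp_bound R (A' j) (g' j)" "A' summable_on J"
    and eq: "\<And>x. (\<Sum>\<^sub>\<infinity>i\<in>I. g i x) = (\<Sum>\<^sub>\<infinity>j\<in>J. g' j x)"
  shows "(\<Sum>\<^sub>\<infinity>i\<in>I. f (g i)) = (\<Sum>\<^sub>\<infinity>j\<in>J. f (g' j))"
proof -
  let ?T = "\<lambda>F. (\<Sum>\<^sub>\<infinity>i\<in>I. A i) - (\<Sum>i\<in>F. A i)" and ?T' = "\<lambda>F. (\<Sum>\<^sub>\<infinity>i\<in>J. A' i) - (\<Sum>i\<in>F. A' i)"
  have sum: "(\<lambda>i. f (g i)) summable_on I" "(\<lambda>j. f (g' j)) summable_on J"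
    by (rule abs_summable_bound(2)[OF g(3)], rule C[OF g(1,2)], assumption+)
       (rule abs_summable_bound(2)[OF g'(3)], rule C[OF g'(1,2)], assumption+)
  have key: "cmod ((\<Sum>i\<in>F. f (g i)) - (\<Sum>j\<in>F'. f (g' j))) \<le> C * (?T F + ?T' F')"
    if F: "finite F" "F \<subseteq> I" "finite F'" "F' \<subseteq> J" for F F'
  proof -
    define S where "S x = (\<Sum>i\<in>F. g i x)" for x
    define S' where "S' x = (\<Sum>j\<in>F'. g' j x)" for x
    have SS: "S \<in> Sigma1" "S' \<in> Sigma1"
      unfolding S_def S'_def using F g(1) g'(1) by (auto intro!: Sigma1_sum)
    have fS: "f S = (\<Sum>i\<in>F. f (g i))" "f S' = (\<Sum>j\<in>F'. f (g' j))"
      unfolding S_def S'_def using F g(1) g'(1) by (auto intro!: Sigma1_dual_sum[OF f])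
    have "exp_bound R (?T F + ?T' F') (\<lambda>x. S x - S' x)"
      unfolding exp_bound_def deriv_bound_def
    proof (intro ballI allI)
      fix js :: "'n list" and x assume js: "js \<in> range index_list"
      have D: "pderivs js (\<lambda>x. S x - S' x) x = (\<Sum>i\<in>F. pderivs js (g i) x) - (\<Sum>j\<in>F'. pderivs js (g' j) x)"
        using pderivs_add[OF Sigma1_smooth[OF SS(1)] Sigma1_smooth[OF Sigma1_cmult[OF SS(2), of "-1"]], of js]
          pderivs_cmult[OF Sigma1_smooth[OF SS(2)], of js "-1"]
          pderivs_sum[OF F(1), of g js x] pderivs_sum[OF F(3), of g' js x] F g(1) g'(1)
        by (auto simp: S_def[abs_def] S'_def[abs_def] subset_iff)
      let ?G = "pderivs js (\<lambda>x. \<Sum>\<^sub>\<infinity>i\<in>I. g i x) x"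
      have "cmod (pderivs js (\<lambda>x. S x - S' x) x) \<le>
          cmod (?G - (\<Sum>i\<in>F. pderivs js (g i) x)) + cmod (?G - (\<Sum>j\<in>F'. pderivs js (g' j) x))"
        unfolding D by norm
      also have "\<dots> \<le> list_fact js / R ^ length js * (?T F * exp (- (R * norm x))) + list_fact js / R ^ length js * (?T' F' * exp (- (R * norm x)))"
        using pderivs_tail[OF R g js F(1,2), of x] pderivs_tail[OF R g' js F(3,4), of x] unfolding eq
        by (intro add_mono) auto
      finally show "cmod (pderivs js (\<lambda>x. S x - S' x) x) \<le> list_fact js / R ^ length js * ((?T F + ?T' F') * exp (- (R * norm x)))"
        by (simp add: algebra_simps)
    qed
    from C[OF Sigma1_diff[OF SS] this] show ?thesis by (simp add: Sigma1_dual_diff(2)[OF f SS] fS)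
  qed
  have tT: "(?T \<longlongrightarrow> 0) (finite_subsets_at_top I)" "(?T' \<longlongrightarrow> 0) (finite_subsets_at_top J)"
    using tendsto_diff[OF tendsto_const infsum_tendsto[OF g(3)]] tendsto_diff[OF tendsto_const infsum_tendsto[OF g'(3)]]
    by (metis diff_self)+
  have step: "cmod ((\<Sum>\<^sub>\<infinity>i\<in>I. f (g i)) - (\<Sum>j\<in>F'. f (g' j))) \<le> C * (0 + ?T' F')"
    if F': "finite F'" "F' \<subseteq> J" for F'
  proof (rule tendsto_le)
    show "((\<lambda>F. cmod ((\<Sum>i\<in>F. f (g i)) - (\<Sum>j\<in>F'. f (g' j)))) \<longlongrightarrow> cmod ((\<Sum>\<^sub>\<infinity>i\<in>I. f (g i)) - (\<Sum>j\<in>F'. f (g' j)))) (finite_subsets_at_top I)"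
      by (intro tendsto_intros infsum_tendsto sum)
    show "((\<lambda>F. C * (?T F + ?T' F')) \<longlongrightarrow> C * (0 + ?T' F')) (finite_subsets_at_top I)"
      by (intro tendsto_intros tT)
    show "\<forall>\<^sub>F F in finite_subsets_at_top I. cmod ((\<Sum>i\<in>F. f (g i)) - (\<Sum>j\<in>F'. f (g' j))) \<le> C * (?T F + ?T' F')"
      by (intro eventually_finite_subsets_at_top_weakI key F')
  qed simp
  have "cmod ((\<Sum>\<^sub>\<infinity>i\<in>I. f (g i)) - (\<Sum>\<^sub>\<infinity>j\<in>J. f (g' j))) \<le> C * (0 + 0)"
  proof (rule tendsto_le)
    show "((\<lambda>F. cmod ((\<Sum>\<^sub>\<infinity>i\<in>I. f (g i)) - (\<Sum>j\<in>F. f (g' j)))) \<longlongrightarrow> cmod ((\<Sum>\<^sub>\<infinity>i\<in>I. f (g i)) - (\<Sum>\<^sub>\<infinity>j\<in>J. f (g' j)))) (finite_subsets_at_top J)"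
      by (intro tendsto_intros infsum_tendsto sum)
    show "((\<lambda>F. C * (0 + ?T' F)) \<longlongrightarrow> C * (0 + 0)) (finite_subsets_at_top J)"
      by (intro tendsto_intros tT)
    show "\<forall>\<^sub>F F in finite_subsets_at_top J. cmod ((\<Sum>\<^sub>\<infinity>i\<in>I. f (g i)) - (\<Sum>j\<in>F. f (g' j))) \<le> C * (0 + ?T' F)"
      by (intro eventually_finite_subsets_at_top_weakI step)
  qed simp
  then show ?thesis by simp
qed

text \<open>A bound at rate \<open>2 * R\<close> exceeds what is wanted at rate \<open>R\<close> by
  a factor 2 for each derivative and by a factor of exponential decay. These settle high orders and
  distant points; in the remaining range finitely many derivatives are uniformly continuous on a
  compact ball.\<close>

lemma exp_bound_translate_small:
  fixes \<eta> :: "real^'n \<Rightarrow> complex"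
  assumes "\<eta> \<in> Sigma1" "R > 0" "\<epsilon> > 0"
  shows "\<exists>\<delta>>0. \<forall>x. dist x x0 < \<delta> \<longrightarrow> exp_bound R \<epsilon> (\<lambda>t. \<eta> (t - x) - \<eta> (t - x0))"
proof -
  obtain A0 where A0: "exp_bound (2 * R) A0 \<eta>" using Sigma1_exp_bound[OF assms(1), of "2 * R"] assms(2) by auto
  have R2: "2 * R > 0" using assms(2) by simp
  define A where "A = A0 * exp (2 * R * (norm x0 + 1)) + 1"
  have A0': "A0 \<ge> 0" using exp_bound_nonneg[OF A0] .
  have A: "A > 0" unfolding A_def using A0' by (simp add: add_nonneg_pos)
  have tb: "exp_bound (2 * R) A (\<lambda>t. \<eta> (t - x))" if "norm (x - x0) \<le> 1" for x
  proof (rule exp_bound_mono[OF exp_bound_translate[OF R2 A0, of x]])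
    have "norm x \<le> norm x0 + 1" using that norm_triangle_sub[of x x0] by linarith
    then have "A0 * exp (2 * R * norm x) \<le> A0 * exp (2 * R * (norm x0 + 1))"
      using A0' assms(2) by (intro mult_left_mono) auto
    then show "A0 * exp (2 * R * norm x) \<le> A" unfolding A_def by simp
  qed (use R2 in auto)
  \<comment> \<open>From order \<open>N\<close> on the doubled radius alone makes the bound small
    enough, and from distance \<open>T\<close> on the doubled decay does.\<close>
  obtain N where N: "2 * A / \<epsilon> < 2 ^ N" using real_arch_pow[of 2 "2 * A / \<epsilon>"] by auto
  define T where "T = ln (2 * A / \<epsilon>) / R"
  have T: "2 * A * exp (- (R * t)) \<le> \<epsilon>" if "t \<ge> T" for t
  proof -
    have "ln (2 * A / \<epsilon>) \<le> R * t" using that assms(2) by (simp add: T_def field_simps)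
    then have "2 * A / \<epsilon> \<le> exp (R * t)" using A assms(3) by (metis divide_pos_pos exp_le_cancel_iff exp_ln mult_pos_pos zero_less_numeral)
    then show ?thesis using assms(3) by (simp add: exp_minus field_simps)
  qed
  define K where "K = cball (0::real^'n) (\<bar>T\<bar> + norm x0 + 1)"
  define JS where "JS = {js :: 'n list. length js \<le> N}"
  have finJS: "finite JS" unfolding JS_def using finite_lists_length_le[of "UNIV :: 'n set" N] by simp
  \<comment> \<open>A lower bound for the required right-hand side at all points with
    \<open>norm t < T\<close>, using \<open>list_fact js \<ge> 1\<close>.\<close>
  define e where "e js = exp (- (R * \<bar>T\<bar>)) * \<epsilon> / R ^ length js" for js :: "'n list"
  have epos: "e js > 0" for js unfolding e_def using assms by simp
  have "\<exists>\<delta>>0. \<forall>u\<in>K. \<forall>v\<in>K. dist u v < \<delta> \<longrightarrow> dist (pderivs js \<eta> u) (pderivs js \<eta> v) < e js" for js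
  proof -
    have "uniformly_continuous_on K (pderivs js \<eta>)"
      unfolding K_def by (intro compact_uniformly_continuous compact_cball
          continuous_on_subset[OF smooth_continuous[OF Sigma1_smooth[OF assms(1)]]]) auto
    then show ?thesis unfolding uniformly_continuous_on_def using epos[of js] dist_commute by metis
  qed
  then obtain d where d: "\<And>js. d js > 0"
    "\<And>js u v. u \<in> K \<Longrightarrow> v \<in> K \<Longrightarrow> dist u v < d js \<Longrightarrow> dist (pderivs js \<eta> u) (pderivs js \<eta> v) < e js" by metis
  define \<delta> where "\<delta> = Min (insert 1 (d ` JS))"
  have \<delta>: "\<delta> > 0" "\<delta> \<le> 1" "\<And>js. js \<in> JS \<Longrightarrow> \<delta> \<le> d js"
    unfolding \<delta>_def using finJS d(1) by (auto simp: Min_gr_iff)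
  have "exp_bound R \<epsilon> (\<lambda>t. \<eta> (t - x) - \<eta> (t - x0))" if x: "dist x x0 < \<delta>" for x
    unfolding exp_bound_def deriv_bound_def
  proof (intro ballI allI)
    fix js :: "'n list" and t assume js: "js \<in> range index_list"
    have nx: "norm (x - x0) \<le> 1" using x \<delta>(2) by (simp add: dist_norm)
    have D: "pderivs js (\<lambda>t. \<eta> (t - x) - \<eta> (t - x0)) t = pderivs js \<eta> (t - x) - pderivs js \<eta> (t - x0)"
    proof -
      have s: "smooth (\<lambda>t. \<eta> (t - x))" "smooth (\<lambda>t. \<eta> (t - x0))"
        using smooth_translate[OF Sigma1_smooth[OF assms(1)]] by blast+
      show ?thesis
        using pderivs_add[OF s(1) smooth_cmult[OF s(2), of "-1"], of js] pderivs_cmult[OF s(2), of js "-1"]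
        by (simp add: pderivs_translate)
    qed
    let ?c = "list_fact js / (2 * R) ^ length js"
    have lf: "list_fact js \<ge> 1" by (rule list_fact_ge_1)
    have c: "?c \<ge> 0" "?c = list_fact js / R ^ length js / 2 ^ length js" using lf assms(2) by (auto simp: power_mult_distrib)
    have "cmod (pderivs js \<eta> (t - x) - pderivs js \<eta> (t - x0)) \<le> cmod (pderivs js \<eta> (t - x)) + cmod (pderivs js \<eta> (t - x0))"
      by (rule norm_triangle_ineq4)
    also have "\<dots> \<le> ?c * (A * exp (- (2 * R * norm t))) + ?c * (A * exp (- (2 * R * norm t)))"
      using exp_boundD[OF tb[OF nx] js, of t] exp_boundD[OF tb[of x0] js, of t]
      by (intro add_mono) (auto simp: pderivs_translate)
    also have "\<dots> = ?c * (2 * A * exp (- (2 * R * norm t)))"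
      by (simp only: mult_2[of A] distrib_left distrib_right)
    finally have b1: "cmod (pderivs js \<eta> (t - x) - pderivs js \<eta> (t - x0)) \<le> ?c * (2 * A * exp (- (2 * R * norm t)))" .
    consider "length js > N" | "norm t \<ge> T" | "length js \<le> N" "norm t < T" by linarith
    then have "cmod (pderivs js \<eta> (t - x) - pderivs js \<eta> (t - x0)) \<le> list_fact js / R ^ length js * (\<epsilon> * exp (- (R * norm t)))"
    proof cases
      case 1
      have "2 ^ N \<le> (2::real) ^ length js" using 1 by (intro power_increasing) auto
      then have "2 * A / 2 ^ length js \<le> \<epsilon>" 
      proof -
        have "2 * A / \<epsilon> \<le> 2 ^ length js" using N \<open>2 ^ N \<le> (2::real) ^ length js\<close> by linarith
        then show ?thesis using assms(3) by (simp add: divide_le_eq mult.commute)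
      qed
      moreover have "exp (- (2 * R * norm t)) \<le> exp (- (R * norm t))" using assms(2) by simp
      ultimately have "2 * A / 2 ^ length js * exp (- (2 * R * norm t)) \<le> \<epsilon> * exp (- (R * norm t))"
        using assms(3) by (intro mult_mono) auto
      from mult_left_mono[OF this, of "list_fact js / R ^ length js"] lf assms(2)
      have "?c * (2 * A * exp (- (2 * R * norm t))) \<le> list_fact js / R ^ length js * (\<epsilon> * exp (- (R * norm t)))"
        unfolding c(2) by simp
      then show ?thesis using b1 by linarith
    next
      case 2
      have c1: "?c \<le> list_fact js / R ^ length js" unfolding c(2) using lf assms(2) by (simp add: divide_le_eq mult_le_cancel_left1 one_le_power)
      have "2 * A * exp (- (2 * R * norm t)) = 2 * A * exp (- (R * norm t)) * exp (- (R * norm t))"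
        by (simp add: exp_add[symmetric])
      also have "\<dots> \<le> \<epsilon> * exp (- (R * norm t))" using T[OF 2] by (intro mult_right_mono) auto
      finally have c2: "2 * A * exp (- (2 * R * norm t)) \<le> \<epsilon> * exp (- (R * norm t))" .
      have "?c * (2 * A * exp (- (2 * R * norm t))) \<le> list_fact js / R ^ length js * (\<epsilon> * exp (- (R * norm t)))"
        by (rule mult_mono[OF c1 c2]) (use A lf assms(2) in auto)
      then show ?thesis using b1 by linarith
    next
      case 3
      have u: "t - x \<in> K" "t - x0 \<in> K"
        using 3 nx norm_triangle_ineq4[of t x] norm_triangle_ineq4[of t x0] norm_triangle_sub[of x x0]
        by (auto simp: K_def)
      have "dist (t - x) (t - x0) < d js" using x \<delta>(3)[of js] 3 by (simp add: JS_def dist_norm norm_minus_commute)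
      then have "cmod (pderivs js \<eta> (t - x) - pderivs js \<eta> (t - x0)) < e js" using d(2)[OF u] by (simp add: dist_norm)
      also have "e js \<le> list_fact js / R ^ length js * (\<epsilon> * exp (- (R * norm t)))"
      proof -
        have "exp (- (R * \<bar>T\<bar>)) \<le> exp (- (R * norm t))" using 3 assms(2) by simp
        then have "1 * (\<epsilon> * exp (- (R * \<bar>T\<bar>))) \<le> list_fact js * (\<epsilon> * exp (- (R * norm t)))"
          using lf assms(3) by (intro mult_mono) auto
        then show ?thesis unfolding e_def using assms(2) by (simp add: divide_right_mono mult_ac)
      qed
      finally show ?thesis by simp
    qed
    then show "cmod (pderivs js (\<lambda>t. \<eta> (t - x) - \<eta> (t - x0)) t) \<le> list_fact js / R ^ length js * (\<epsilon> * exp (- (R * norm t)))"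
      unfolding D .
  qed
  then show ?thesis using \<delta>(1) by blast
qed

text \<open>Translation is continuous in \<open>exp_bound (2 * R)\<close>, modulation passes to
  \<open>exp_bound R\<close>, and \<open>f\<close> is bounded with respect to the latter. This
  supplies the measurability in \<open>x\<close> when \<open>f\<close>, applied to translated
  windows, is integrated over a cell.\<close>

lemma Sigma1_dual_translate_continuous:
  fixes f :: "(real^'n \<Rightarrow> complex) \<Rightarrow> complex"
  assumes f: "f \<in> Sigma1_dual" and eta: "\<eta> \<in> Sigma1"
  shows "continuous_on UNIV (\<lambda>x. f (\<lambda>t. \<eta> (t - x) * cis (t \<bullet> \<xi>)))"
proof -
  obtain R C where R: "R > 0" and Cpos: "C > 0" and C: "\<And>\<psi> A. \<psi> \<in> Sigma1 \<Longrightarrow> exp_bound R A \<psi> \<Longrightarrow> cmod (f \<psi>) \<le> C * A"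
    using Sigma1_dual_bounded[OF f] by blast
  define B where "B = exp (2 * R * (real CARD('n) * norm \<xi>))"
  have B: "B > 0" by (simp add: B_def)
  show ?thesis unfolding continuous_on_iff
  proof (intro ballI allI impI)
    fix x0 :: "real^'n" and e :: real assume e: "e > 0"
    define \<epsilon> where "\<epsilon> = e / (2 * C * B)"
    have \<epsilon>: "\<epsilon> > 0" using e Cpos B by (simp add: \<epsilon>_def)
    obtain \<delta> where \<delta>: "\<delta> > 0" "\<And>x. dist x x0 < \<delta> \<Longrightarrow> exp_bound (2 * R) \<epsilon> (\<lambda>t. \<eta> (t - x) - \<eta> (t - x0))"
      using exp_bound_translate_small[OF eta _ \<epsilon>, of "2 * R" x0] R by auto
    show "\<exists>\<delta>>0. \<forall>x\<in>UNIV. dist x x0 < \<delta> \<longrightarrow> dist (f (\<lambda>t. \<eta> (t - x) * cis (t \<bullet> \<xi>))) (f (\<lambda>t. \<eta> (t - x0) * cis (t \<bullet> \<xi>))) < e"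
    proof (rule exI[of _ \<delta>], intro conjI ballI impI \<delta>(1))
      fix x assume x: "dist x x0 < \<delta>"
      have mem: "(\<lambda>t. \<eta> (t - x)) \<in> Sigma1" for x by (rule Sigma1_translate[OF eta])
      have mem2: "(\<lambda>t. \<eta> (t - x) - \<eta> (t - x0)) \<in> Sigma1" by (rule Sigma1_diff[OF mem mem])
      have "exp_bound R (\<epsilon> * B) (\<lambda>t. (\<eta> (t - x) - \<eta> (t - x0)) * cis (t \<bullet> \<xi>))"
        unfolding B_def by (rule exp_bound_cis[OF R Sigma1_smooth[OF mem2] \<delta>(2)[OF x]])
      from C[OF Sigma1_cis[OF mem2] this]
      have "cmod (f (\<lambda>t. (\<eta> (t - x) - \<eta> (t - x0)) * cis (t \<bullet> \<xi>))) \<le> C * (\<epsilon> * B)" .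
      also have "\<dots> < e" using e Cpos B by (simp add: \<epsilon>_def)
      finally show "dist (f (\<lambda>t. \<eta> (t - x) * cis (t \<bullet> \<xi>))) (f (\<lambda>t. \<eta> (t - x0) * cis (t \<bullet> \<xi>))) < e"
        using Sigma1_dual_diff(2)[OF f Sigma1_cis[OF mem[of x], of \<xi>] Sigma1_cis[OF mem[of x0], of \<xi>]]
        by (simp add: dist_norm left_diff_distrib)
    qed
  qed
qed

section \<open>Fourier transform of test functions: decay and regularity\<close>

text \<open>The transform without its normalizing constant, which cancels against the constant in
  the expansion of a functional.\<close>

definition fourier_int :: "(real^'n \<Rightarrow> complex) \<Rightarrow> real^'n \<Rightarrow> complex" where
  "fourier_int \<psi> \<xi> = (\<integral>x. \<psi> x * cis (- (x \<bullet> \<xi>)) \<partial>lborel)"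

lemma borel_measurable_cis_uminus [measurable]: "(\<lambda>x::'a::euclidean_space. cis (- (x \<bullet> \<alpha>))) \<in> borel_measurable borel"
  by (intro borel_measurable_continuous_onI continuous_intros)

lemma fourier_transform_eq:
  fixes \<psi> :: "real^'n \<Rightarrow> complex"
  assumes "continuous_on UNIV \<psi>"
  shows "fourier_transform \<psi> \<xi> = of_real ((2 * pi) powr (- real CARD('n) / 2)) * fourier_int \<psi> \<xi>"
proof -
  have [measurable]: "\<psi> \<in> borel_measurable borel" using assms by (rule borel_measurable_continuous_onI)
  have "(LINT x|lebesgue. \<psi> x * exp (- \<i> * of_real (x \<bullet> \<xi>))) = (LINT x|lebesgue. \<psi> x * cis (- (x \<bullet> \<xi>)))"
    by (simp add: cis_conv_exp)
  also have "\<dots> = fourier_int \<psi> \<xi>"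
    unfolding fourier_int_def by (rule integral_completion) simp
  finally show ?thesis unfolding fourier_transform_def by simp
qed

lemma Sigma1_continuous: "f \<in> Sigma1 \<Longrightarrow> continuous_on UNIV f"
  using smooth_continuous[OF Sigma1_smooth, of f "[]"] by simp

lemma Sigma1_borel [measurable_dest]: "f \<in> Sigma1 \<Longrightarrow> f \<in> borel_measurable borel"
  by (rule borel_measurable_continuous_onI[OF Sigma1_continuous])

lemma exp_decay_integrable:
  fixes h :: "real^'n \<Rightarrow> complex"
  assumes "continuous_on UNIV h" "\<And>x. cmod (h x) \<le> B * exp (- (R * norm x))" "R > 0"
  shows "integrable lborel h"
proof (rule Bochner_Integration.integrable_bound)
  show "integrable lborel (\<lambda>x::real^'n. B * exp (- (R * norm x)))"
    by (intro integrable_mult_right integrable_exp_norm assms)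
  show "AE x in lborel. norm (h x) \<le> norm (B * exp (- (R * norm x)))"
    using assms(2) by (intro AE_I2) (smt (verit) real_norm_def)
qed (use assms(1) in \<open>simp add: borel_measurable_continuous_onI\<close>)

lemma integrable_mult_cis:
  fixes h :: "real^'n \<Rightarrow> complex"
  assumes "integrable lborel h" shows "integrable lborel (\<lambda>x. h x * cis (- (x \<bullet> \<xi>)))"
  by (rule Bochner_Integration.integrable_bound[OF assms]) (use assms in \<open>auto simp: norm_mult\<close>)

lemma Sigma1_integrable: assumes "f \<in> Sigma1" shows "integrable lborel f"
proof -
  obtain A where "exp_bound 1 A f" using Sigma1_exp_bound[OF assms, of 1] by auto
  then show ?thesis using exp_decay_integrable[OF Sigma1_continuous[OF assms], of A 1] exp_bound_0[of 1 A f] by simp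
qed

lemma fourier_int_translate:
  assumes "f \<in> borel_measurable borel"
  shows "fourier_int (\<lambda>x. f (x - y)) \<xi> = cis (- (y \<bullet> \<xi>)) * fourier_int f \<xi>"
proof -
  have [measurable]: "f \<in> borel_measurable borel" by fact
  have "fourier_int (\<lambda>x. f (x - y)) \<xi> = (\<integral>x. f (x + y - y) * cis (- ((x + y) \<bullet> \<xi>)) \<partial>lborel)"
    unfolding fourier_int_def by (rule integral_translate_lborel[symmetric]) measurable
  also have "\<dots> = (\<integral>x. cis (- (y \<bullet> \<xi>)) * (f x * cis (- (x \<bullet> \<xi>))) \<partial>lborel)"
    by (simp add: inner_add_left cis_mult mult.left_commute add.commute)
  finally show ?thesis by (simp add: fourier_int_def)
qed

lemma fourier_int_cis: "fourier_int (\<lambda>x. f x * cis (x \<bullet> \<eta>)) \<xi> = fourier_int f (\<xi> - \<eta>)"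
  unfolding fourier_int_def by (simp add: inner_diff_right cis_mult mult.assoc)

lemma fourier_int_cnj: "fourier_int (\<lambda>x. cnj (f x)) \<xi> = cnj (fourier_int f (- \<xi>))"
  unfolding fourier_int_def
  using Bochner_Integration.integral_cnj[of lborel "\<lambda>x. f x * cis (- (x \<bullet> - \<xi>))"] by (simp add: cis_cnj)

lemma fourier_int_add:
  "f \<in> Sigma1 \<Longrightarrow> g \<in> Sigma1 \<Longrightarrow> fourier_int (\<lambda>x. f x + g x) \<xi> = fourier_int f \<xi> + fourier_int g \<xi>"
  unfolding fourier_int_def by (simp add: distrib_right Sigma1_integrable integrable_mult_cis)

lemma fourier_int_cmult: "fourier_int (\<lambda>x. c * f x) \<xi> = c * fourier_int f \<xi>"
  unfolding fourier_int_def by (simp add: mult.assoc)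

text \<open>The translation rule gives the transform of the difference quotient of \<open>h\<close>
  with increment \<open>t n\<close>. As \<open>t n\<close> tends to 0, dominated convergence yields
  the transform of the derivative on one side, and the derivative of \<open>cis\<close> at 0 appears
  on the other.\<close>

lemma fourier_int_partial_deriv:
  fixes h :: "real^'n \<Rightarrow> complex"
  assumes R: "R > 0" and diff: "\<And>x. h differentiable (at x)"
    and b: "\<And>x. cmod (h x) \<le> B * exp (- (R * norm x))"
    and c': "continuous_on UNIV (partial_deriv i h)" and b': "\<And>x. cmod (partial_deriv i h x) \<le> B' * exp (- (R * norm x))"
  shows "fourier_int (partial_deriv i h) \<xi> = \<i> * of_real (\<xi> $ i) * fourier_int h \<xi>"
proof -
  have ch: "continuous_on UNIV h" using diff by (simp add: continuous_on_eq_continuous_at differentiable_imp_continuous_within)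
  have [measurable]: "h \<in> borel_measurable borel" "partial_deriv i h \<in> borel_measurable borel"
    using ch c' by (auto intro: borel_measurable_continuous_onI)
  have inth: "integrable lborel h" by (rule exp_decay_integrable[OF ch b R])
  define t where "t n = inverse (real (Suc n))" for n
  have t: "t n > 0" "t n \<le> 1" for n by (auto simp: t_def field_simps)
  have t0: "filterlim t (at 0) sequentially"
    unfolding filterlim_at using LIMSEQ_inverse_real_of_nat t(1) by (auto simp: t_def[abs_def])
  define q where "q n x = (h (x + t n *\<^sub>R axis i 1) - h x) /\<^sub>R t n * cis (- (x \<bullet> \<xi>))" for n x
  have qm [measurable]: "q n \<in> borel_measurable borel" for n unfolding q_def by measurable
  have int_t: "integrable lborel (\<lambda>x. h (x + a))" for a by (rule integrable_translate_lborel[OF inth])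
  have qint: "(\<integral>x. q n x \<partial>lborel) = (cis (t n * \<xi> $ i) - 1) /\<^sub>R t n * fourier_int h \<xi>" for n
  proof -
    have "fourier_int (\<lambda>x. h (x + t n *\<^sub>R axis i 1)) \<xi> = cis (t n * \<xi> $ i) * fourier_int h \<xi>"
      using fourier_int_translate[of h "- (t n *\<^sub>R axis i 1)" \<xi>] by (simp add: inner_axis')
    moreover have "(\<integral>x. q n x \<partial>lborel) = (\<integral>x. (h (x + t n *\<^sub>R axis i 1) * cis (- (x \<bullet> \<xi>)) - h x * cis (- (x \<bullet> \<xi>))) /\<^sub>R t n \<partial>lborel)"
      unfolding q_def by (simp add: left_diff_distrib)
    moreover have "\<dots> = (fourier_int (\<lambda>x. h (x + t n *\<^sub>R axis i 1)) \<xi> - fourier_int h \<xi>) /\<^sub>R t n"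
      unfolding fourier_int_def
      by (subst integral_scaleR_right, subst Bochner_Integration.integral_diff) (auto intro!: integrable_mult_cis int_t inth)
    ultimately show ?thesis by (simp add: left_diff_distrib)
  qed
  have "(\<lambda>n. \<integral>x. q n x \<partial>lborel) \<longlonglongrightarrow> (\<integral>x. partial_deriv i h x * cis (- (x \<bullet> \<xi>)) \<partial>lborel)"
  proof (rule integral_dominated_convergence[where w = "\<lambda>x. \<bar>B'\<bar> * exp R * exp (- (R * norm x))"])
    show "integrable lborel (\<lambda>x::real^'n. \<bar>B'\<bar> * exp R * exp (- (R * norm x)))"
      by (intro integrable_mult_right integrable_exp_norm R)
    show "AE x in lborel. (\<lambda>n. q n x) \<longlonglongrightarrow> partial_deriv i h x * cis (- (x \<bullet> \<xi>))"
      unfolding q_def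
      by (intro AE_I2 tendsto_intros filterlim_compose[OF partial_deriv_tendsto[OF diff] t0])
    show "AE x in lborel. norm (q n x) \<le> \<bar>B'\<bar> * exp R * exp (- (R * norm x))" for n
    proof (intro AE_I2)
      fix x :: "real^'n"
      have "cmod (h (x + t n *\<^sub>R axis i 1) - h x) \<le> (\<bar>B'\<bar> * exp R * exp (- (R * norm x))) * \<bar>t n\<bar>"
      proof (rule partial_deriv_Lipschitz[OF diff])
        fix s assume "s \<in> closed_segment 0 (t n)"
        then have "\<bar>s\<bar> \<le> 1" using t[of n] by (auto simp: closed_segment_eq_real_ivl split: if_splits)
        then have "norm (s *\<^sub>R axis i 1 :: real^'n) \<le> 1" by (simp add: norm_axis_1)
        then have "norm x \<le> norm (x + s *\<^sub>R axis i 1) + 1"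
          using norm_triangle_ineq4[of "x + s *\<^sub>R axis i 1" "s *\<^sub>R axis i 1"] by simp
        then have "R * norm x \<le> R * (norm (x + s *\<^sub>R axis i 1) + 1)" using R by (intro mult_left_mono) auto
        then have "exp (- (R * norm (x + s *\<^sub>R axis i 1))) \<le> exp R * exp (- (R * norm x))"
          by (simp add: exp_add[symmetric] algebra_simps)
        then have "\<bar>B'\<bar> * exp (- (R * norm (x + s *\<^sub>R axis i 1))) \<le> \<bar>B'\<bar> * (exp R * exp (- (R * norm x)))"
          by (intro mult_left_mono) auto
        moreover have "B' * exp (- (R * norm (x + s *\<^sub>R axis i 1))) \<le> \<bar>B'\<bar> * exp (- (R * norm (x + s *\<^sub>R axis i 1)))"
          by (intro mult_right_mono) auto
        ultimately show "cmod (partial_deriv i h (x + s *\<^sub>R axis i 1)) \<le> \<bar>B'\<bar> * exp R * exp (- (R * norm x))"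
          using b'[of "x + s *\<^sub>R axis i 1"] unfolding mult.assoc by linarith
      qed
      then show "norm (q n x) \<le> \<bar>B'\<bar> * exp R * exp (- (R * norm x))"
        unfolding q_def norm_mult norm_scaleR norm_cis using t[of n] by (simp add: field_simps)
    qed
  qed auto
  moreover have "(\<lambda>n. (cis (t n * \<xi> $ i) - 1) /\<^sub>R t n * fourier_int h \<xi>) \<longlonglongrightarrow> (\<i> * of_real (\<xi> $ i)) * fourier_int h \<xi>"
  proof (intro tendsto_intros)
    have "((\<lambda>s. cis (s * \<xi> $ i)) has_vector_derivative (\<i> * of_real (\<xi> $ i))) (at 0)"
    proof -
      have 1: "((\<lambda>s. \<i> * complex_of_real (s * \<xi> $ i)) has_derivative (\<lambda>h. \<i> * complex_of_real (h * \<xi> $ i))) (at 0)"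
        by (intro has_derivative_mult_right has_derivative_of_real has_derivative_mult_left has_derivative_ident)
      from has_derivative_compose[OF 1 DERIV_exp[unfolded has_field_derivative_def]]
      show ?thesis by (simp add: cis_conv_exp has_vector_derivative_def scaleR_conv_of_real mult_ac)
    qed
    then have "((\<lambda>s. (cis (s * \<xi> $ i) - 1) /\<^sub>R s) \<longlongrightarrow> \<i> * of_real (\<xi> $ i)) (at 0)"
      unfolding has_vector_derivative_at_0_iff by simp
    then show "(\<lambda>n. (cis (t n * \<xi> $ i) - 1) /\<^sub>R t n) \<longlonglongrightarrow> \<i> * of_real (\<xi> $ i)"
      by (rule filterlim_compose[OF _ t0])
  qed
  ultimately show ?thesis unfolding qint fourier_int_def[symmetric] by (rule LIMSEQ_unique)
qed

lemma replicate_index_list: "replicate k i \<in> range index_list"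
proof -
  have c: "concat (map (\<lambda>j. replicate (if j = i then k else 0) j) is) = (if i \<in> set is then replicate k i else [])"
    if "distinct is" for "is" using that by (induction "is") auto
  have "index_list (\<lambda>j. if j = i then k else 0) = replicate k i"
    unfolding index_list_def using c[OF coord_enum(1)] by (simp add: coord_enum)
  then show ?thesis by (metis rangeI)
qed

lemma list_fact_replicate: "list_fact (replicate k i) = fact k"
  by (induction k) (auto simp: list_fact_Cons count_list_replicate)

lemma fourier_int_partial_deriv_power:
  fixes \<psi> :: "real^'n \<Rightarrow> complex"
  assumes "\<psi> \<in> Sigma1"
  shows "fourier_int (pderivs (replicate k i) \<psi>) \<xi> = (\<i> * of_real (\<xi> $ i)) ^ k * fourier_int \<psi> \<xi>"
proof (induction k)
  case (Suc k)
  obtain A where A: "exp_bound 1 A \<psi>" using Sigma1_exp_bound[OF assms, of 1] by auto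
  have b: "cmod (pderivs (replicate k i) \<psi> x) \<le> (fact k * A) * exp (- (1 * norm x))" for k x
    using exp_boundD[OF A replicate_index_list[of k i], of x] by (simp add: list_fact_replicate mult.assoc)
  have "fourier_int (partial_deriv i (pderivs (replicate k i) \<psi>)) \<xi> = \<i> * of_real (\<xi> $ i) * fourier_int (pderivs (replicate k i) \<psi>) \<xi>"
  proof (rule fourier_int_partial_deriv[OF zero_less_one _ b])
    show "pderivs (replicate k i) \<psi> differentiable at x" for x by (rule smoothD[OF Sigma1_smooth[OF assms]])
    show "continuous_on UNIV (partial_deriv i (pderivs (replicate k i) \<psi>))"
      using smooth_continuous[OF Sigma1_smooth[OF assms], of "replicate (Suc k) i"] by simp
    show "cmod (partial_deriv i (pderivs (replicate k i) \<psi>) x) \<le> (fact (Suc k) * A) * exp (- (1 * norm x))" for x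
      using b[of "Suc k" x] by simp
  qed
  then show ?case using Suc by (simp add: mult.assoc)
qed simp

text \<open>Some coordinate of \<xi> has size at least \<open>norm \<xi> / CARD('n)\<close>.
  Differentiating \<open>k\<close> times in it costs \<open>fact k / R ^ k\<close>, and
  \<open>ex_power_ge_exp\<close> selects a \<open>k\<close>, depending on \<xi>, that makes the
  quotient exponentially small: half the rate, a factor 4, and the loss of \<open>CARD('n)\<close>
  in the exponent.\<close>

lemma fourier_int_decay:
  fixes \<psi> :: "real^'n \<Rightarrow> complex"
  assumes "\<psi> \<in> Sigma1" "R > 0" "exp_bound R A \<psi>"
  shows "cmod (fourier_int \<psi> \<xi>) \<le> 4 * A * (\<integral>x. exp (- (R * norm (x::real^'n))) \<partial>lborel) * exp (- (R / (2 * real CARD('n)) * norm \<xi>))"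
proof -
  define J where "J = (\<integral>x. exp (- (R * norm (x::real^'n))) \<partial>lborel)"
  have A: "A \<ge> 0" using exp_bound_nonneg[OF assms(3)] .
  have J: "J \<ge> 0" unfolding J_def by (intro integral_nonneg_AE) auto
  have "\<exists>i. norm \<xi> / real CARD('n) \<le> \<bar>\<xi> $ i\<bar>"
  proof (rule ccontr)
    assume "\<not> ?thesis"
    then have "(\<Sum>i\<in>(UNIV::'n set). \<bar>\<xi> $ i\<bar>) < (\<Sum>i\<in>(UNIV::'n set). norm \<xi> / real CARD('n))"
      by (intro sum_strict_mono) (auto simp: not_le)
    then show False using norm_le_l1_cart[of \<xi>] by simp
  qed
  then obtain i where i: "norm \<xi> / real CARD('n) \<le> \<bar>\<xi> $ i\<bar>" by blast
  obtain k where k: "exp (R * \<bar>\<xi> $ i\<bar> / 2) / 4 \<le> (R * \<bar>\<xi> $ i\<bar>) ^ k / fact k"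
    using ex_power_ge_exp[of "R * \<bar>\<xi> $ i\<bar>"] assms(2) by auto
  let ?D = "pderivs (replicate k i) \<psi>"
  have b: "cmod (?D x) \<le> fact k / R ^ k * A * exp (- (R * norm x))" for x
    using exp_boundD[OF assms(3) replicate_index_list[of k i], of x] by (simp add: list_fact_replicate mult.assoc)
  have "cmod (fourier_int ?D \<xi>) \<le> (\<integral>x. fact k / R ^ k * A * exp (- (R * norm x)) \<partial>(lborel :: (real^'n) measure))"
    unfolding fourier_int_def
  proof (rule order_trans[OF integral_norm_bound integral_mono])
    show "integrable lborel (\<lambda>x. norm (?D x * cis (- (x \<bullet> \<xi>))))"
      by (intro integrable_norm integrable_mult_cis exp_decay_integrable[OF _ b assms(2)] smooth_continuous Sigma1_smooth assms)
    show "integrable lborel (\<lambda>x::real^'n. fact k / R ^ k * A * exp (- (R * norm x)))"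
      by (intro integrable_mult_right integrable_exp_norm assms)
    show "norm (?D x * cis (- (x \<bullet> \<xi>))) \<le> fact k / R ^ k * A * exp (- (R * norm x))" for x
      using b[of x] by (simp add: norm_mult)
  qed
  also have "\<dots> = fact k / R ^ k * A * J" by (simp add: J_def)
  finally have "\<bar>\<xi> $ i\<bar> ^ k * cmod (fourier_int \<psi> \<xi>) \<le> fact k / R ^ k * A * J"
    unfolding fourier_int_partial_deriv_power[OF assms(1)] by (simp add: norm_mult norm_power)
  then have "(R * \<bar>\<xi> $ i\<bar>) ^ k / fact k * cmod (fourier_int \<psi> \<xi>) \<le> A * J"
    using assms(2) by (simp add: field_simps power_mult_distrib)
  moreover have "exp (R * \<bar>\<xi> $ i\<bar> / 2) / 4 * cmod (fourier_int \<psi> \<xi>) \<le> (R * \<bar>\<xi> $ i\<bar>) ^ k / fact k * cmod (fourier_int \<psi> \<xi>)"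
    by (intro mult_right_mono k) auto
  ultimately have 1: "exp (R * \<bar>\<xi> $ i\<bar> / 2) * cmod (fourier_int \<psi> \<xi>) \<le> 4 * A * J" by linarith
  have "R / 2 * (norm \<xi> / real CARD('n)) \<le> R / 2 * \<bar>\<xi> $ i\<bar>" using i assms(2) by (intro mult_left_mono) auto
  then have "exp (R / (2 * real CARD('n)) * norm \<xi>) \<le> exp (R * \<bar>\<xi> $ i\<bar> / 2)" by simp
  from mult_right_mono[OF this, of "cmod (fourier_int \<psi> \<xi>)"] 1
  have "exp (R / (2 * real CARD('n)) * norm \<xi>) * cmod (fourier_int \<psi> \<xi>) \<le> 4 * A * J" by simp
  from mult_left_mono[OF this, of "exp (- (R / (2 * real CARD('n)) * norm \<xi>))"]
  have "cmod (fourier_int \<psi> \<xi>) * (exp (- (R / (2 * real CARD('n)) * norm \<xi>)) * exp (R / (2 * real CARD('n)) * norm \<xi>)) \<le> 4 * A * J * exp (- (R / (2 * real CARD('n)) * norm \<xi>))"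
    by (simp only: mult_ac exp_ge_zero)
  then show ?thesis unfolding J_def[symmetric] by (simp only: exp_add[symmetric]) simp
qed

text \<open>The preceding estimate divides the rate by \<open>2 * CARD('n)\<close>, which is
  compensated by starting from a larger one: \<open>Sigma1\<close> has bounds at every rate.\<close>

lemma Sigma1_fourier_int_decay:
  fixes \<psi> :: "real^'n \<Rightarrow> complex"
  assumes "\<psi> \<in> Sigma1" "S > 0"
  obtains B where "B > 0" "\<And>\<xi>. cmod (fourier_int \<psi> \<xi>) \<le> B * exp (- (S * norm \<xi>))"
proof -
  define R where "R = 2 * real CARD('n) * S"
  have R: "R > 0" "R / (2 * real CARD('n)) = S" using assms(2) by (auto simp: R_def)
  obtain A where A: "exp_bound R A \<psi>" using Sigma1_exp_bound[OF assms(1) R(1)] by blast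
  define B where "B = 4 * A * (\<integral>x. exp (- (R * norm (x::real^'n))) \<partial>lborel)"
  have "cmod (fourier_int \<psi> \<xi>) \<le> (\<bar>B\<bar> + 1) * exp (- (S * norm \<xi>))" for \<xi>
  proof -
    have "cmod (fourier_int \<psi> \<xi>) \<le> B * exp (- (S * norm \<xi>))"
      using fourier_int_decay[OF assms(1) R(1) A, of \<xi>] R(2) by (simp add: B_def)
    also have "\<dots> \<le> (\<bar>B\<bar> + 1) * exp (- (S * norm \<xi>))" by (intro mult_right_mono) auto
    finally show ?thesis .
  qed
  then show thesis using that[of "\<bar>B\<bar> + 1"] by auto
qed

lemma norm_cis_diff_le: "cmod (cis a - cis b) \<le> \<bar>a - b\<bar>"
proof -
  have "norm (cis a - cis b) \<le> 1 * norm (a - b)"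
  proof (rule differentiable_bound[where S = UNIV and f' = "\<lambda>s h. h *\<^sub>R (\<i> * cis s)"])
    fix s :: real
    have 1: "((\<lambda>s. \<i> * complex_of_real s) has_derivative (\<lambda>h. \<i> * complex_of_real h)) (at s)"
      by (intro has_derivative_mult_right has_derivative_of_real has_derivative_ident)
    from has_derivative_compose[OF 1 DERIV_exp[unfolded has_field_derivative_def]]
    show "(cis has_derivative (\<lambda>h. h *\<^sub>R (\<i> * cis s))) (at s within UNIV)"
      by (simp add: cis_conv_exp[abs_def] scaleR_conv_of_real mult_ac)
    show "onorm (\<lambda>h. h *\<^sub>R (\<i> * cis s)) \<le> 1"
      by (intro onorm_le) (simp add: norm_mult)
  qed auto
  then show ?thesis by simp
qed

text \<open>Under the integral the phases differ by at most
  \<open>\<bar>x \<bullet> (\<xi> - \<xi>')\<bar>\<close>; the factor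
  \<open>norm x \<le> exp (norm x)\<close> is paid by half of the decay at rate 2.\<close>

lemma fourier_int_Lipschitz:
  fixes \<psi> :: "real^'n \<Rightarrow> complex"
  assumes "\<psi> \<in> Sigma1"
  obtains L where "L > 0" "\<And>\<xi> \<xi>'. cmod (fourier_int \<psi> \<xi> - fourier_int \<psi> \<xi>') \<le> L * norm (\<xi> - \<xi>')"
proof -
  have [measurable]: "\<psi> \<in> borel_measurable borel" by (rule Sigma1_borel[OF assms])
  obtain A where A: "exp_bound 2 A \<psi>" using Sigma1_exp_bound[OF assms, of 2] by auto
  have A0: "A \<ge> 0" using exp_bound_nonneg[OF A] .
  define J where "J = (\<integral>x. A * exp (- (1 * norm (x::real^'n))) \<partial>lborel)"
  have intJ: "integrable lborel (\<lambda>x::real^'n. A * exp (- (1 * norm x)))"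
    by (intro integrable_mult_right integrable_exp_norm) simp
  have J: "J \<ge> 0" unfolding J_def using A0 by (intro integral_nonneg_AE) auto
  have "cmod (fourier_int \<psi> \<xi> - fourier_int \<psi> \<xi>') \<le> (J + 1) * norm (\<xi> - \<xi>')" for \<xi> \<xi>'
  proof -
    note int = integrable_mult_cis[OF Sigma1_integrable[OF assms]]
    have "fourier_int \<psi> \<xi> - fourier_int \<psi> \<xi>' = (\<integral>x. \<psi> x * (cis (- (x \<bullet> \<xi>)) - cis (- (x \<bullet> \<xi>'))) \<partial>lborel)"
      unfolding fourier_int_def using int by (simp add: right_diff_distrib)
    also have "cmod \<dots> \<le> (\<integral>x. norm (\<xi> - \<xi>') * (A * exp (- (1 * norm x))) \<partial>(lborel :: (real^'n) measure))"
    proof (rule order_trans[OF integral_norm_bound integral_mono])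
      show "integrable lborel (\<lambda>x. norm (\<psi> x * (cis (- (x \<bullet> \<xi>)) - cis (- (x \<bullet> \<xi>')))))"
        using int by (intro integrable_norm) (simp add: right_diff_distrib)
      show "integrable lborel (\<lambda>x::real^'n. norm (\<xi> - \<xi>') * (A * exp (- (1 * norm x))))"
        by (intro integrable_mult_right intJ[unfolded mult.assoc] integrable_exp_norm) simp
      fix x :: "real^'n"
      have "cmod (cis (- (x \<bullet> \<xi>)) - cis (- (x \<bullet> \<xi>'))) \<le> \<bar>x \<bullet> (\<xi> - \<xi>')\<bar>"
        using norm_cis_diff_le[of "- (x \<bullet> \<xi>)" "- (x \<bullet> \<xi>')"] by (simp add: inner_diff_right abs_minus_commute)
      also have "\<dots> \<le> norm x * norm (\<xi> - \<xi>')" by (rule Cauchy_Schwarz_ineq2)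
      also have "\<dots> \<le> exp (norm x) * norm (\<xi> - \<xi>')"
        using exp_ge_add_one_self[of "norm x"] by (intro mult_right_mono norm_ge_zero) linarith
      finally have "cmod (\<psi> x) * cmod (cis (- (x \<bullet> \<xi>)) - cis (- (x \<bullet> \<xi>'))) \<le> (A * exp (- (2 * norm x))) * (exp (norm x) * norm (\<xi> - \<xi>'))"
        using exp_bound_0[OF A, of x] A0 by (intro mult_mono) auto
      also have "\<dots> = norm (\<xi> - \<xi>') * (A * (exp (- (2 * norm x)) * exp (norm x)))" by simp
      also have "exp (- (2 * norm x)) * exp (norm x) = exp (- (1 * norm x))" by (simp add: exp_add[symmetric])
      finally show "norm (\<psi> x * (cis (- (x \<bullet> \<xi>)) - cis (- (x \<bullet> \<xi>')))) \<le> norm (\<xi> - \<xi>') * (A * exp (- (1 * norm x)))"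
        by (simp add: norm_mult)
    qed
    also have "\<dots> = J * norm (\<xi> - \<xi>')" by (simp add: J_def)
    also have "\<dots> \<le> (J + 1) * norm (\<xi> - \<xi>')" by (intro mult_right_mono) auto
    finally show ?thesis .
  qed
  then show thesis using that[of "J + 1"] J by auto
qed

text \<open>Interpolating the Lipschitz bound with the decay.\<close>

lemma fourier_int_Holder:
  fixes \<psi> :: "real^'n \<Rightarrow> complex"
  assumes "\<psi> \<in> Sigma1" "S > 0"
  obtains B where "B > 0" "\<And>\<xi> \<xi>'. norm (\<xi> - \<xi>') \<le> 1 \<Longrightarrow>
    cmod (fourier_int \<psi> \<xi> - fourier_int \<psi> \<xi>') \<le> B * sqrt (norm (\<xi> - \<xi>')) * exp (- (S * norm \<xi>))"
proof -
  obtain L where L: "L > 0" "\<And>\<xi> \<xi>'. cmod (fourier_int \<psi> \<xi> - fourier_int \<psi> \<xi>') \<le> L * norm (\<xi> - \<xi>')"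
    using fourier_int_Lipschitz[OF assms(1)] by blast
  \<comment> \<open>Twice the desired rate, because the geometric mean with the Lipschitz bound
    halves it.\<close>
  obtain D where D: "D > 0" "\<And>\<xi>. cmod (fourier_int \<psi> \<xi>) \<le> D * exp (- (2 * S * norm \<xi>))"
    using Sigma1_fourier_int_decay[OF assms(1), of "2 * S"] assms(2) by auto
  define D' where "D' = D + D * exp (2 * S)"
  have D': "D' > 0" using D(1) by (simp add: D'_def add_pos_pos)
  have "cmod (fourier_int \<psi> \<xi> - fourier_int \<psi> \<xi>') \<le> sqrt (L * D') * sqrt (norm (\<xi> - \<xi>')) * exp (- (S * norm \<xi>))"
    if n: "norm (\<xi> - \<xi>') \<le> 1" for \<xi> \<xi>'
  proof -
    let ?z = "cmod (fourier_int \<psi> \<xi> - fourier_int \<psi> \<xi>')"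
    have "norm \<xi> \<le> norm \<xi>' + 1" using n norm_triangle_sub[of \<xi> \<xi>'] by linarith
    then have "2 * S * norm \<xi> \<le> 2 * S * (norm \<xi>' + 1)" using assms(2) by (intro mult_left_mono) auto
    then have "exp (- (2 * S * norm \<xi>')) \<le> exp (2 * S) * exp (- (2 * S * norm \<xi>))"
      by (simp add: exp_add[symmetric] algebra_simps)
    then have "D * exp (- (2 * S * norm \<xi>')) \<le> D * (exp (2 * S) * exp (- (2 * S * norm \<xi>)))"
      using D(1) by (intro mult_left_mono) auto
    then have z2: "?z \<le> D' * exp (- (2 * S * norm \<xi>))"
      using norm_triangle_ineq4[of "fourier_int \<psi> \<xi>" "fourier_int \<psi> \<xi>'"] D(2)[of \<xi>] D(2)[of \<xi>']
      unfolding D'_def distrib_right mult.assoc by linarith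
    have e: "exp (- (S * norm \<xi>)) ^ 2 = exp (- (2 * S * norm \<xi>))"
      by (simp add: power2_eq_square exp_add[symmetric])
    have "?z ^ 2 \<le> (L * norm (\<xi> - \<xi>')) * (D' * exp (- (2 * S * norm \<xi>)))"
      unfolding power2_eq_square by (intro mult_mono L z2) (use L(1) in auto)
    also have "\<dots> = (sqrt (L * D') * sqrt (norm (\<xi> - \<xi>')) * exp (- (S * norm \<xi>))) ^ 2"
      unfolding power_mult_distrib e using L(1) D' by simp
    finally have q: "?z ^ 2 \<le> (sqrt (L * D') * sqrt (norm (\<xi> - \<xi>')) * exp (- (S * norm \<xi>))) ^ 2" .
    have "0 \<le> sqrt (L * D') * sqrt (norm (\<xi> - \<xi>')) * exp (- (S * norm \<xi>))"
      using L(1) D' by (intro mult_nonneg_nonneg) auto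
    with q show ?thesis by (rule power2_le_imp_le)
  qed
  then show thesis using that[of "sqrt (L * D')"] L(1) D' by simp
qed

section \<open>Uniqueness for the Fourier transform by way of the Stone-Weierstrass theorem\<close>

text \<open>Trigonometric polynomials with frequencies in \<open>G\<close>. The set \<open>G\<close>
  will be the whole space for the transform on Euclidean space, and the dual lattice for the
  torus.\<close>

inductive trig_poly :: "(real^'n) set \<Rightarrow> (real^'n \<Rightarrow> complex) \<Rightarrow> bool" for G where
  cis: "\<gamma> \<in> G \<Longrightarrow> trig_poly G (\<lambda>x. c * cis (x \<bullet> \<gamma>))"
| add: "trig_poly G p \<Longrightarrow> trig_poly G q \<Longrightarrow> trig_poly G (\<lambda>x. p x + q x)"

lemma trig_poly_mult:
  assumes G: "\<And>a b. a \<in> G \<Longrightarrow> b \<in> G \<Longrightarrow> a + b \<in> G" and "trig_poly G p" "trig_poly G q"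
  shows "trig_poly G (\<lambda>x. p x * q x)"
  using assms(2)
proof induction
  case (cis \<gamma> c)
  from assms(3) show ?case
  proof induction
    case (cis \<delta> e)
    have "(\<lambda>x. c * cis (x \<bullet> \<gamma>) * (e * cis (x \<bullet> \<delta>))) = (\<lambda>x. (c * e) * cis (x \<bullet> (\<gamma> + \<delta>)))"
      by (simp add: inner_add_right cis_mult[symmetric] mult_ac)
    then show ?case using trig_poly.cis[OF G[OF \<open>\<gamma> \<in> G\<close> \<open>\<delta> \<in> G\<close>], of "c * e"] by simp
  next
    case (add p q) then show ?case using trig_poly.add by (simp add: distrib_left)
  qed
next
  case (add p q) then show ?case using trig_poly.add by (simp add: distrib_right)
qed

lemma trig_poly_sum:
  assumes "finite A" "0 \<in> G" "\<And>i. i \<in> A \<Longrightarrow> trig_poly G (p i)"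
  shows "trig_poly G (\<lambda>x. \<Sum>i\<in>A. p i x)"
  using assms(1,3)
proof (induction A rule: finite_induct)
  case empty then show ?case using trig_poly.cis[OF assms(2), of 0] by simp
next
  case (insert i A)
  then show ?case using trig_poly.add[of G "p i" "\<lambda>x. \<Sum>i\<in>A. p i x"] by simp
qed

text \<open>A real-linear functional of \<open>z\<close> is a combination of the
  \<open>Re (z $ i)\<close> and \<open>Im (z $ i)\<close>, and for \<open>z $ i = cis t\<close>
  these are combinations of \<open>cis t\<close> and \<open>cis (- t)\<close>, which is where
  negation in \<open>G\<close> enters. Products add frequencies.\<close>

lemma trig_poly_real_polynomial:
  fixes v :: "'n \<Rightarrow> real^'n" and p :: "complex^'n \<Rightarrow> real"
  assumes G: "0 \<in> G" "\<And>a b. a \<in> G \<Longrightarrow> b \<in> G \<Longrightarrow> a + b \<in> G" "\<And>a. a \<in> G \<Longrightarrow> - a \<in> G"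
    and v: "\<And>i. v i \<in> G" and "real_polynomial_function p"
  shows "trig_poly G (\<lambda>x. complex_of_real (p (\<chi> i. cis (x \<bullet> v i))))"
  using assms(5)
proof induction
  case (linear f)
  interpret f: bounded_linear f by fact
  have dec: "z = (\<Sum>i\<in>UNIV. Re (z $ i) *\<^sub>R axis i 1 + Im (z $ i) *\<^sub>R axis i \<i>)" for z :: "complex^'n"
  proof (rule vec_eq_iff[THEN iffD2], intro allI)
    fix k
    have "(\<Sum>i\<in>UNIV. Re (z $ i) *\<^sub>R axis i 1 + Im (z $ i) *\<^sub>R axis i \<i>) $ k =
        (\<Sum>i\<in>UNIV. if i = k then Re (z $ k) *\<^sub>R 1 + Im (z $ k) *\<^sub>R \<i> else 0)"
      unfolding sum_component by (intro sum.cong) (auto simp: axis_def)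
    also have "\<dots> = z $ k" by (simp add: complex_eq_iff)
    finally show "z $ k = (\<Sum>i\<in>UNIV. Re (z $ i) *\<^sub>R axis i 1 + Im (z $ i) *\<^sub>R axis i \<i>) $ k" by simp
  qed
  have fz: "f z = (\<Sum>i\<in>UNIV. Re (z $ i) * f (axis i 1) + Im (z $ i) * f (axis i \<i>))" for z
    by (subst dec) (simp only: f.sum f.add f.scaleR real_scaleR_def)
  have re: "complex_of_real (Re (cis t)) = 1/2 * cis t + 1/2 * cis (- t)"
    and im: "complex_of_real (Im (cis t)) = (- \<i> / 2) * cis t + (\<i> / 2) * cis (- t)" for t
    by (simp_all add: complex_eq_iff)
  have "trig_poly G (\<lambda>x. complex_of_real (Re (cis (x \<bullet> v i)) * a + Im (cis (x \<bullet> v i)) * b))" for i a b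
  proof -
    have c: "trig_poly G (\<lambda>x. e * cis (x \<bullet> v i))" "trig_poly G (\<lambda>x. e * cis (- (x \<bullet> v i)))" for e
      using trig_poly.cis[OF v[of i], of e] trig_poly.cis[OF G(3)[OF v[of i]], of e] by auto
    have "(\<lambda>x. complex_of_real (Re (cis (x \<bullet> v i)) * a + Im (cis (x \<bullet> v i)) * b)) =
      (\<lambda>x. (1/2 * of_real a - \<i> / 2 * of_real b) * cis (x \<bullet> v i) + (1/2 * of_real a + \<i> / 2 * of_real b) * cis (- (x \<bullet> v i)))"
      unfolding of_real_add of_real_mult re im by (simp add: algebra_simps)
    then show ?thesis using trig_poly.add[OF c] by simp
  qed
  then have "trig_poly G (\<lambda>x. \<Sum>i\<in>UNIV. complex_of_real (Re (cis (x \<bullet> v i)) * f (axis i 1) + Im (cis (x \<bullet> v i)) * f (axis i \<i>)))"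
    by (intro trig_poly_sum[OF finite G(1)])
  moreover have "complex_of_real (f (\<chi> i. cis (x \<bullet> v i))) =
      (\<Sum>i\<in>UNIV. complex_of_real (Re (cis (x \<bullet> v i)) * f (axis i 1) + Im (cis (x \<bullet> v i)) * f (axis i \<i>)))" for x
    by (subst fz) (simp only: of_real_sum vec_lambda_beta)
  ultimately show ?case by simp
next
  case (const c) then show ?case using trig_poly.cis[OF G(1), of "of_real c"] by simp
next
  case (add f g) then show ?case using trig_poly.add by simp
next
  case (mult f g) then show ?case using trig_poly_mult[OF G(2)] by simp
qed

lemma trig_poly_bounded: "trig_poly G p \<Longrightarrow> (\<exists>B. \<forall>x. cmod (p x) \<le> B) \<and> continuous_on UNIV p"
proof (induction rule: trig_poly.induct)
  case (cis \<gamma> c)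
  have "\<forall>x. cmod (c * cis (x \<bullet> \<gamma>)) \<le> cmod c" by (simp add: norm_mult)
  moreover have "continuous_on UNIV (\<lambda>x. c * cis (x \<bullet> \<gamma>))" by (intro continuous_intros)
  ultimately show ?case by blast
next
  case (add p q)
  then obtain B B' where "\<forall>x. cmod (p x) \<le> B" "\<forall>x. cmod (q x) \<le> B'" by blast
  then have "\<forall>x. cmod (p x + q x) \<le> B + B'" by (meson add_mono norm_triangle_le)
  then show ?case using add by (auto intro: continuous_on_add)
qed

lemma integrable_mult_bounded:
  fixes D p :: "real^'n \<Rightarrow> complex"
  assumes "integrable lborel D" "continuous_on UNIV p" "\<And>x. cmod (p x) \<le> B"
  shows "integrable lborel (\<lambda>x. D x * p x)"
proof (rule Bochner_Integration.integrable_bound)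
  show "integrable lborel (\<lambda>x. of_real B * D x)" using assms(1) by simp
  have "p \<in> borel_measurable borel" using assms(2) by (rule borel_measurable_continuous_onI)
  then show "(\<lambda>x. D x * p x) \<in> borel_measurable lborel" using assms(1) by simp
  show "AE x in lborel. norm (D x * p x) \<le> norm (complex_of_real B * D x)"
  proof (intro AE_I2)
    fix x
    have "cmod (p x) \<le> \<bar>B\<bar>" using assms(3)[of x] by linarith
    from mult_right_mono[OF this, of "cmod (D x)"]
    show "norm (D x * p x) \<le> norm (complex_of_real B * D x)" by (simp add: norm_mult mult.commute)
  qed
qed

text \<open>All points \<open>(\<chi> i. cis (x \<bullet> v i))\<close> lie in one compact ball, on
  which \<open>F\<close> is uniformly close to a real polynomial. Composed with this map, the
  polynomial becomes a trigonometric polynomial, against which \<open>D\<close> integrates to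
  0.\<close>

lemma annihilate_continuous:
  fixes D :: "real^'n \<Rightarrow> complex" and F :: "complex^'n \<Rightarrow> real"
  assumes D: "integrable lborel D"
    and G: "0 \<in> G" "\<And>a b. a \<in> G \<Longrightarrow> b \<in> G \<Longrightarrow> a + b \<in> G" "\<And>a. a \<in> G \<Longrightarrow> - a \<in> G"
    and v: "\<And>i. v i \<in> G"
    and z: "\<And>\<gamma>. \<gamma> \<in> G \<Longrightarrow> (\<integral>x. D x * cis (x \<bullet> \<gamma>) \<partial>lborel) = 0"
    and F: "continuous_on UNIV F"
  shows "(\<integral>x. D x * complex_of_real (F (\<chi> i. cis (x \<bullet> v i))) \<partial>lborel) = 0"
proof -
  define Z :: "real^'n \<Rightarrow> complex^'n" where "Z x = (\<chi> i. cis (x \<bullet> v i))" for x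
  have Zc: "continuous_on UNIV Z" unfolding Z_def by (intro continuous_intros)
  define K where "K = cball (0::complex^'n) (real CARD('n))"
  have ZK: "Z x \<in> K" for x
  proof -
    have "norm (Z x) \<le> (\<Sum>i\<in>UNIV. norm (Z x $ i))"
      unfolding norm_vec_def by (rule L2_set_le_sum) auto
    then show ?thesis by (simp add: K_def Z_def)
  qed
  have polyz: "(\<integral>x. D x * p x \<partial>lborel) = 0" if "trig_poly G p" for p using that
  proof induction
    case (cis \<gamma> c)
    have "(\<integral>x. D x * (c * cis (x \<bullet> \<gamma>)) \<partial>lborel) = (\<integral>x. c * (D x * cis (x \<bullet> \<gamma>)) \<partial>lborel)"
      by (simp add: mult_ac)
    then show ?case using z[OF cis] by simp
  next
    case (add p q)
    have "integrable lborel (\<lambda>x. D x * p x)" "integrable lborel (\<lambda>x. D x * q x)"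
      using trig_poly_bounded[OF add(1)] trig_poly_bounded[OF add(2)] by (auto intro: integrable_mult_bounded[OF D])
    then show ?case using add by (simp add: distrib_left)
  qed
  define J where "J = (\<integral>x. cmod (D x) \<partial>lborel)"
  have J: "J \<ge> 0" unfolding J_def by (intro integral_nonneg_AE) auto
  have "cmod (\<integral>x. D x * complex_of_real (F (Z x)) \<partial>lborel) \<le> e * J" if e: "e > 0" for e
  proof -
    obtain p where p: "real_polynomial_function p" "\<And>z. z \<in> K \<Longrightarrow> \<bar>F z - p z\<bar> < e"
      using Stone_Weierstrass_real_polynomial_function[of K F e] F e unfolding K_def
      by (metis compact_cball continuous_on_subset subset_UNIV)
    have tp: "trig_poly G (\<lambda>x. complex_of_real (p (Z x)))"
      unfolding Z_def by (rule trig_poly_real_polynomial[OF G v p(1)])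
    obtain B where B: "\<And>x. cmod (complex_of_real (p (Z x))) \<le> B" and pc: "continuous_on UNIV (\<lambda>x. complex_of_real (p (Z x)))"
      using trig_poly_bounded[OF tp] by auto
    have Fc: "continuous_on UNIV (\<lambda>x. complex_of_real (F (Z x)))"
      by (intro continuous_intros continuous_on_compose2[OF F Zc]) auto
    have FB: "cmod (complex_of_real (F (Z x))) \<le> B + e" for x
      using B[of x] p(2)[OF ZK[of x]] by (simp add: abs_if split: if_splits)
    have i1: "integrable lborel (\<lambda>x. D x * complex_of_real (F (Z x)))" by (rule integrable_mult_bounded[OF D Fc FB])
    have i2: "integrable lborel (\<lambda>x. D x * complex_of_real (p (Z x)))" by (rule integrable_mult_bounded[OF D pc B])
    have "(\<integral>x. D x * complex_of_real (F (Z x)) \<partial>lborel) = (\<integral>x. D x * complex_of_real (F (Z x)) - D x * complex_of_real (p (Z x)) \<partial>lborel)"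
      using i1 i2 polyz[OF tp] by simp
    also have "cmod \<dots> \<le> (\<integral>x. e * cmod (D x) \<partial>lborel)"
    proof (rule order_trans[OF integral_norm_bound integral_mono])
      show "integrable lborel (\<lambda>x. norm (D x * complex_of_real (F (Z x)) - D x * complex_of_real (p (Z x))))"
        using i1 i2 by auto
      show "integrable lborel (\<lambda>x. e * cmod (D x))" using D by auto
      fix x
      have "cmod (D x * complex_of_real (F (Z x)) - D x * complex_of_real (p (Z x))) = cmod (D x) * \<bar>F (Z x) - p (Z x)\<bar>"
        by (simp only: right_diff_distrib[symmetric] of_real_diff[symmetric] norm_mult norm_of_real)
      also have "\<dots> \<le> cmod (D x) * e" using p(2)[OF ZK[of x]] by (intro mult_left_mono) auto
      finally show "norm (D x * complex_of_real (F (Z x)) - D x * complex_of_real (p (Z x))) \<le> e * cmod (D x)" by (simp add: mult.commute)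
    qed
    also have "\<dots> = e * J" by (simp add: J_def)
    finally show ?thesis .
  qed
  note * = this
  have "cmod (\<integral>x. D x * complex_of_real (F (Z x)) \<partial>lborel) \<le> 0"
  proof (rule field_le_epsilon)
    fix e :: real assume "e > 0"
    then have "e / (J + 1) > 0" using J by simp
    from *[OF this] have "cmod (\<integral>x. D x * complex_of_real (F (Z x)) \<partial>lborel) \<le> e / (J + 1) * J" .
    also have "\<dots> \<le> e" using J \<open>e > 0\<close> by (simp add: field_simps)
    finally show "cmod (\<integral>x. D x * complex_of_real (F (Z x)) \<partial>lborel) \<le> 0 + e" by simp
  qed
  then show ?thesis by (simp add: Z_def)
qed

lemma continuous_integral_zero:
  fixes f :: "'a::euclidean_space \<Rightarrow> real"
  assumes "continuous_on UNIV f" "integrable lborel f" "\<And>x. f x \<ge> 0" "(\<integral>x. f x \<partial>lborel) = 0"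
  shows "f x = 0"
proof (rule ccontr)
  assume "f x \<noteq> 0"
  then have fx: "f x > 0" using assms(3)[of x] by simp
  have "AE x in lborel. f x = 0"
    using integral_nonneg_eq_0_iff_AE[OF assms(2)] assms(3,4) by auto
  then have "AE x in lebesgue. f x = 0" by (rule AE_completion)
  then have "negligible {x. f x \<noteq> 0}"
    unfolding negligible_iff_null_sets by (auto simp: eventually_ae_filter elim!: completion.complete2[rotated])
  moreover have "open {x. f x \<noteq> 0}"
    by (rule open_Collect_neq[OF assms(1) continuous_on_const])
  ultimately show False using open_not_negligible[of "{x. f x \<noteq> 0}"] fx by (metis empty_iff less_irrefl mem_Collect_eq)
qed

text \<open>\<open>b\<close> lies in the disc about \<open>a\<close> through 0, hence in the
  half-plane of nonnegative component along \<open>a\<close>. This gives a sign to a complex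
  function near a point where it does not vanish.\<close>

lemma Re_cnj_mult_nonneg:
  assumes "cmod (b - a) \<le> cmod a" shows "Re (cnj a * b) \<ge> 0"
proof -
  have "Re (cnj a * b) = (cmod a)\<^sup>2 + Re (cnj a * (b - a))"
    by (simp add: cmod_power2 algebra_simps power2_eq_square[of "Re a"] power2_eq_square[of "Im a"])
  moreover have "\<bar>Re (cnj a * (b - a))\<bar> \<le> cmod a * cmod (b - a)"
    using abs_Re_le_cmod[of "cnj a * (b - a)"] by (simp add: norm_mult)
  moreover have "cmod a * cmod (b - a) \<le> cmod a * cmod a" using assms by (intro mult_left_mono) auto
  ultimately show ?thesis by (simp add: power2_eq_square)
qed

text \<open>The tent in \<open>x\<close> is a limit of continuous functions of characters. The
  points \<open>Z n x\<close> have the coordinates \<open>cis (t n * x $ i)\<close>, and as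
  \<open>t n\<close> tends to 0 their distances divided by \<open>t n\<close> tend to the distances
  of the points \<open>x\<close>. Tents in \<open>Z n\<close> integrate to 0 against \<psi> and
  converge pointwise to the tent in \<open>x\<close>, with \<open>norm (\<psi> x)\<close> as
  majorant.\<close>

lemma bump_integral_zero:
  fixes \<psi> :: "real^'n \<Rightarrow> complex"
  assumes psi: "integrable lborel \<psi>" and "continuous_on UNIV \<psi>" and z: "\<And>\<xi>. fourier_int \<psi> \<xi> = 0" and K: "K > 0"
  shows "(\<integral>x. \<psi> x * complex_of_real (max 0 (1 - K * norm (x - x0))) \<partial>lborel) = 0"
proof -
  have [measurable]: "\<psi> \<in> borel_measurable borel" using assms(2) by (rule borel_measurable_continuous_onI)
  define t where "t n = inverse (real (Suc n))" for n
  have t: "t n > 0" for n by (auto simp: t_def field_simps)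
  have t0: "filterlim t (at 0) sequentially"
    unfolding filterlim_at using LIMSEQ_inverse_real_of_nat t(1) by (auto simp: t_def[abs_def])
  define Z :: "nat \<Rightarrow> real^'n \<Rightarrow> complex^'n" where "Z n x = (\<chi> i. cis (x \<bullet> (t n *\<^sub>R axis i 1)))" for n x
  have Zc: "continuous_on UNIV (Z n)" for n unfolding Z_def by (intro continuous_intros)
  define F where "F n z = max 0 (1 - K * (norm (z - Z n x0) / t n))" for n z
  have Fc: "continuous_on UNIV (F n)" for n
    unfolding F_def using t[of n] by (intro continuous_intros) auto
  have 0: "(\<integral>x. \<psi> x * complex_of_real (F n (Z n x)) \<partial>lborel) = 0" for n
    unfolding Z_def[of n]
    by (rule annihilate_continuous[where G = UNIV, OF psi _ _ _ _ _ Fc])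
       (use z[of "- _"] in \<open>auto simp: fourier_int_def\<close>)
  have m [measurable]: "(\<lambda>x. F n (Z n x)) \<in> borel_measurable borel" for n
    by (rule borel_measurable_continuous_onI[OF continuous_on_compose2[OF Fc Zc]]) auto
  have lim: "(\<lambda>n. norm (Z n x - Z n x0) / t n) \<longlonglongrightarrow> norm (x - x0)" for x
  proof -
    have c: "(\<lambda>n. (cis (t n * a) - 1) /\<^sub>R t n) \<longlonglongrightarrow> \<i> * of_real a" for a
    proof -
      have 1: "((\<lambda>s. \<i> * complex_of_real (s * a)) has_derivative (\<lambda>h. \<i> * complex_of_real (h * a))) (at 0)"
        by (intro has_derivative_mult_right has_derivative_of_real has_derivative_mult_left has_derivative_ident)
      from has_derivative_compose[OF 1 DERIV_exp[unfolded has_field_derivative_def]]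
      have "((\<lambda>s. cis (s * a)) has_vector_derivative (\<i> * of_real a)) (at 0)"
        by (simp add: cis_conv_exp has_vector_derivative_def scaleR_conv_of_real mult_ac)
      then have "((\<lambda>s. (cis (s * a) - 1) /\<^sub>R s) \<longlongrightarrow> \<i> * of_real a) (at 0)"
        unfolding has_vector_derivative_at_0_iff by simp
      then show ?thesis by (rule filterlim_compose[OF _ t0])
    qed
    define L :: "complex^'n" where "L = (\<chi> i. \<i> * of_real (x $ i) - \<i> * of_real (x0 $ i))"
    have "(\<lambda>n. (Z n x - Z n x0) /\<^sub>R t n) \<longlonglongrightarrow> L"
    proof (rule vec_tendstoI)
      fix i
      have "((Z n x - Z n x0) /\<^sub>R t n) $ i = (cis (t n * x $ i) - 1) /\<^sub>R t n - (cis (t n * x0 $ i) - 1) /\<^sub>R t n" for n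
        by (simp add: Z_def inner_axis scaleR_diff_right)
      then show "(\<lambda>n. ((Z n x - Z n x0) /\<^sub>R t n) $ i) \<longlonglongrightarrow> L $ i"
        unfolding L_def using tendsto_diff[OF c[of "x $ i"] c[of "x0 $ i"]] by simp
    qed
    from tendsto_norm[OF this] have "(\<lambda>n. norm (Z n x - Z n x0) / t n) \<longlonglongrightarrow> norm L"
      using t by (simp add: divide_inverse mult.commute abs_of_pos)
    moreover have "norm L = norm (x - x0)"
    proof -
      have "norm (L $ i) = norm ((x - x0) $ i)" for i
        unfolding L_def by (simp add: right_diff_distrib[symmetric] of_real_diff[symmetric] norm_mult del: of_real_diff)
      then show ?thesis unfolding norm_vec_def by simp
    qed
    ultimately show ?thesis by simp
  qed
  have L: "(\<lambda>n. \<integral>x. \<psi> x * complex_of_real (F n (Z n x)) \<partial>lborel) \<longlonglongrightarrow> (\<integral>x. \<psi> x * complex_of_real (max 0 (1 - K * norm (x - x0))) \<partial>lborel)"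
  proof (rule integral_dominated_convergence[where w = "\<lambda>x. norm (\<psi> x)"])
    show "integrable lborel (\<lambda>x. norm (\<psi> x))" using psi by simp
    show "AE x in lborel. (\<lambda>n. \<psi> x * complex_of_real (F n (Z n x))) \<longlonglongrightarrow> \<psi> x * complex_of_real (max 0 (1 - K * norm (x - x0)))"
      unfolding F_def by (intro AE_I2 tendsto_intros lim)
    show "AE x in lborel. norm (\<psi> x * complex_of_real (F n (Z n x))) \<le> norm (\<psi> x)" for n
    proof (intro AE_I2)
      fix x
      have "0 \<le> F n (Z n x)" "F n (Z n x) \<le> 1" unfolding F_def using K t[of n] by (auto simp: max_def)
      then show "norm (\<psi> x * complex_of_real (F n (Z n x))) \<le> norm (\<psi> x)"
        by (simp add: norm_mult mult_left_le)
    qed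
  qed auto
  show ?thesis by (rule LIMSEQ_unique[OF L[unfolded 0] tendsto_const])
qed

text \<open>Near a point \<open>x0\<close> with \<open>\<psi> x0 \<noteq> 0\<close> the function
  \<open>Re (cnj (\<psi> x0) * \<psi> x)\<close> is nonnegative. If the transform vanished, the
  product with a tent supported there would be nonnegative, continuous and of integral 0, hence 0 at
  \<open>x0\<close>, where its value is the square of \<open>cmod (\<psi> x0)\<close>.\<close>

lemma fourier_int_nonzero:
  fixes \<psi> :: "real^'n \<Rightarrow> complex"
  assumes "\<psi> \<in> Sigma1" "\<psi> \<noteq> (\<lambda>_. 0)"
  obtains \<xi> where "fourier_int \<psi> \<xi> \<noteq> 0"
proof -
  have "\<exists>\<xi>. fourier_int \<psi> \<xi> \<noteq> 0"
  proof (rule ccontr)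
    assume "\<not> ?thesis"
    then have z: "\<And>\<xi>. fourier_int \<psi> \<xi> = 0" by blast
    obtain x0 where x0: "\<psi> x0 \<noteq> 0" using assms(2) by auto
    note c = Sigma1_continuous[OF assms(1)] and int = Sigma1_integrable[OF assms(1)]
    obtain \<delta> where \<delta>: "\<delta> > 0" "\<And>x. dist x x0 < \<delta> \<Longrightarrow> dist (\<psi> x) (\<psi> x0) < cmod (\<psi> x0)"
      using c x0 unfolding continuous_on_iff by (metis UNIV_I zero_less_norm_iff)
    define b where "b x = max 0 (1 - inverse \<delta> * norm (x - x0))" for x
    have bc: "continuous_on UNIV b" unfolding b_def by (intro continuous_intros)
    define f where "f x = Re (cnj (\<psi> x0) * (\<psi> x * complex_of_real (b x)))" for x
    have i: "integrable lborel (\<lambda>x. \<psi> x * complex_of_real (b x))"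
    proof (rule integrable_mult_bounded[OF int, where B = 1])
      show "continuous_on UNIV (\<lambda>x. complex_of_real (b x))" by (intro continuous_intros bc)
      show "cmod (complex_of_real (b x)) \<le> 1" for x using \<delta>(1) by (auto simp: b_def max_def)
    qed
    have "f x0 = 0"
    proof (rule continuous_integral_zero[of f])
      show "continuous_on UNIV f" unfolding f_def by (intro continuous_intros c bc)
      show "integrable lborel f" unfolding f_def using i by (intro integrable_Re integrable_mult_right) auto
      show "f x \<ge> 0" for x
      proof (cases "dist x x0 < \<delta>")
        case True
        have "Re (cnj (\<psi> x0) * \<psi> x) \<ge> 0"
          by (rule Re_cnj_mult_nonneg) (use \<delta>(2)[OF True] in \<open>simp add: dist_norm\<close>)
        moreover have "f x = Re (cnj (\<psi> x0) * \<psi> x) * b x" by (simp add: f_def algebra_simps)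
        moreover have "b x \<ge> 0" by (simp add: b_def)
        ultimately show ?thesis by simp
      next
        case False
        then have "b x = 0" using \<delta>(1) by (simp add: b_def dist_norm field_simps max_def)
        then show ?thesis by (simp add: f_def)
      qed
      have "(\<integral>x. f x \<partial>lborel) = Re (\<integral>x. cnj (\<psi> x0) * (\<psi> x * complex_of_real (b x)) \<partial>lborel)"
        unfolding f_def using i by (intro integral_Re) auto
      also have "\<dots> = 0" using bump_integral_zero[OF int c z, of "inverse \<delta>" x0] \<delta>(1) by (simp add: b_def)
      finally show "(\<integral>x. f x \<partial>lborel) = 0" .
    qed
    moreover have "f x0 = (cmod (\<psi> x0))\<^sup>2" by (simp add: f_def b_def cmod_power2 flip: power2_eq_square)
    ultimately show False using x0 by simp
  qed
  then show thesis using that by blast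
qed

section \<open>Periodic functions: uniqueness of Fourier coefficients on the torus\<close>

context dual_pair
begin

lemma bounded_periodic:
  fixes D :: "real^'n \<Rightarrow> complex"
  assumes "continuous_on UNIV D" and per: "\<And>x y. y \<in> basis_lattice E \<Longrightarrow> D (x + y) = D x"
  obtains B where "\<And>x. cmod (D x) \<le> B"
proof -
  have "bounded (D ` cball 0 (list_diam E))"
    by (intro compact_imp_bounded compact_continuous_image continuous_on_subset[OF assms(1)]) auto
  then obtain B where "\<forall>z\<in>D ` cball 0 (list_diam E). cmod z \<le> B" unfolding bounded_iff by blast
  then have B: "\<And>x. norm x \<le> list_diam E \<Longrightarrow> cmod (D x) \<le> B" by simp
  have "cmod (D x) \<le> B" for x
  proof -
    have "D x = D (x - floor_pt x)" using per[of "- floor_pt x" x] floor_pt_lattice by simp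
    then show ?thesis using B[OF cell_norm_le[OF floor_pt_cell[of x]]] by simp
  qed
  then show thesis using that by blast
qed

lemma cell_integral_infsum:
  fixes h :: "'i \<Rightarrow> real^'n \<Rightarrow> complex"
  assumes "countable I" and m: "\<And>i. i \<in> I \<Longrightarrow> h i \<in> borel_measurable borel"
    and b: "\<And>i x. i \<in> I \<Longrightarrow> x \<in> cell E' \<Longrightarrow> cmod (h i x) \<le> M i" and M: "M summable_on I"
  shows "((\<lambda>i. LINT x:cell E'|lborel. h i x) has_sum (LINT x:cell E'|lborel. (\<Sum>\<^sub>\<infinity>i\<in>I. h i x))) I"
proof -
  have int: "integrable lborel (\<lambda>x. indicat_real (cell E') x *\<^sub>R h i x)" if "i \<in> I" for i
    using cell_integrable[OF m[OF that] b[OF that]] by (simp add: set_integrable_def)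
  have s: "(\<lambda>i. norm (indicat_real (cell E') x *\<^sub>R h i x)) summable_on I" for x
    by (rule abs_summable_bound(1)[OF M, where c = "if x \<in> cell E' then 1 else 0"]) (auto simp: b)
  have "((\<lambda>i. \<integral>x. indicat_real (cell E') x *\<^sub>R h i x \<partial>lborel) has_sum
      (\<integral>x. (\<Sum>\<^sub>\<infinity>i\<in>I. indicat_real (cell E') x *\<^sub>R h i x) \<partial>lborel)) I"
  proof (rule integral_infsum[OF assms(1) int _ s])
    show "(\<lambda>i. \<integral>x. norm (indicat_real (cell E') x *\<^sub>R h i x) \<partial>lborel) summable_on I"
    proof (rule summable_on_comparison_test)
      show "(\<lambda>i. M i * cell_vol) summable_on I" by (rule summable_on_cmult_left[OF M])
      fix i assume i: "i \<in> I"
      have "norm (LINT x:cell E'|lborel. complex_of_real (cmod (h i x))) \<le> M i * cell_vol"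
        by (rule cell_integral_norm_le) (use b[OF i] in auto)
      moreover have "(LINT x:cell E'|lborel. complex_of_real (cmod (h i x))) = complex_of_real (\<integral>x. norm (indicat_real (cell E') x *\<^sub>R h i x) \<partial>lborel)"
        unfolding set_lebesgue_integral_def integral_complex_of_real[symmetric]
        by (intro Bochner_Integration.integral_cong refl) (simp add: indicator_def)
      ultimately show "(\<integral>x. norm (indicat_real (cell E') x *\<^sub>R h i x) \<partial>lborel) \<le> M i * cell_vol" by simp
    qed auto
  qed
  then show ?thesis unfolding set_lebesgue_integral_def by (simp add: infsum_scaleR_right)
qed

lemma cis_eq_imp: "cis a = cis b \<Longrightarrow> (a - b) / (2 * pi) \<in> \<int>"
proof -
  assume "cis a = cis b"
  then obtain n :: int where "\<i> * complex_of_real a = \<i> * complex_of_real b + (of_int (2 * n) * pi) * \<i>"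
    unfolding cis_conv_exp exp_eq by blast
  then have "\<i> * complex_of_real a = \<i> * complex_of_real (b + 2 * of_int n * pi)" by (simp add: algebra_simps)
  then have "a = b + 2 * of_int n * pi" by (metis complex_i_not_zero mult_cancel_left of_real_eq_iff)
  then have "(a - b) / (2 * pi) = of_int n" by (simp add: field_simps)
  then show ?thesis by simp
qed

text \<open>Damping by \<open>exp (- norm x)\<close> makes the periodic function integrable over the
  whole space, while its integral over every tile stays 0. The claim becomes one about continuous
  functions on the whole space, where the boundary of the cell has disappeared.\<close>

lemma cell_integral_nonneg_zero:
  fixes g :: "real^'n \<Rightarrow> real"
  assumes c: "continuous_on UNIV g" and per: "\<And>x y. y \<in> basis_lattice E \<Longrightarrow> g (x + y) = g x"
    and nn: "\<And>x. x \<in> cell E' \<Longrightarrow> g x \<ge> 0" and z: "(LINT x:cell E'|lborel. complex_of_real (g x)) = 0"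
  shows "g x = 0"
proof -
  have [measurable]: "g \<in> borel_measurable borel" using c by (rule borel_measurable_continuous_onI)
  have nn': "g x \<ge> 0" for x
    using nn[OF floor_pt_cell[of x]] per[of "- floor_pt x" x] floor_pt_lattice by simp
  obtain B where B: "\<And>x. cmod (complex_of_real (g x)) \<le> B"
    using bounded_periodic[of "\<lambda>x. complex_of_real (g x)"] c per by (auto intro!: continuous_intros)
  have B0: "B \<ge> 0" using order_trans[OF norm_ge_zero B] .
  have ci: "integrable lborel (\<lambda>x. indicat_real (cell E') x *\<^sub>R complex_of_real (g x))"
    using cell_integrable[of "\<lambda>x. complex_of_real (g x)" B] B by (simp add: set_integrable_def)
  have "complex_of_real (\<integral>x. indicat_real (cell E') x * g x \<partial>lborel) = 0"
    using z unfolding set_lebesgue_integral_def integral_complex_of_real[symmetric] by (simp add: scaleR_conv_of_real)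
  then have z': "(\<integral>x. indicat_real (cell E') x * g x \<partial>lborel) = 0" by simp
  have "integrable lborel (\<lambda>x. indicat_real (cell E') x * g x)"
    using integrable_Re[OF ci] by simp
  then have ae: "AE x in lborel. indicat_real (cell E') x * g x = 0"
    using z' nn' integral_nonneg_eq_0_iff_AE[of lborel "\<lambda>x. indicat_real (cell E') x * g x"] by simp
  define h where "h x = complex_of_real (g x * exp (- (1 * norm x)))" for x
  have hint: "integrable lborel h"
  proof (rule exp_decay_integrable[where B = B and R = 1])
    show "continuous_on UNIV h" unfolding h_def by (intro continuous_intros c)
    show "cmod (h x) \<le> B * exp (- (1 * norm x))" for x
      unfolding h_def norm_of_real abs_mult using B[of x] by (intro mult_mono) (auto simp: B0)
  qed auto
  have "(LINT x:cell E'|lborel. h (x + y)) = 0" if "y \<in> basis_lattice E" for y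
    unfolding set_lebesgue_integral_def
  proof (rule integral_eq_zero_AE)
    show "AE x in lborel. indicat_real (cell E') x *\<^sub>R h (x + y) = 0"
      using ae by eventually_elim (auto simp: h_def per[OF that] indicator_def split: if_splits)
  qed
  then have "((\<lambda>y. 0) has_sum (\<integral>x. h x \<partial>lborel)) (basis_lattice E)"
    using tile_integral[OF hint] by (simp cong: has_sum_cong)
  then have "(\<integral>x. h x \<partial>lborel) = 0" using has_sum_unique[OF _ has_sum_0_simp] by blast
  then have zero: "(\<integral>x. g x * exp (- (1 * norm x)) \<partial>lborel) = 0" unfolding h_def by (simp del: of_real_mult)
  have intg: "integrable lborel (\<lambda>x. g x * exp (- (1 * norm x)))" using integrable_Re[OF hint] by (simp add: h_def)
  have cont: "continuous_on UNIV (\<lambda>x. g x * exp (- (1 * norm x)))" by (intro continuous_intros c)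
  have nng: "g x * exp (- (1 * norm x)) \<ge> 0" for x using nn' by simp
  have "g x * exp (- (1 * norm x)) = 0" by (rule continuous_integral_zero[OF cont intg nng zero])
  then show ?thesis by simp
qed

text \<open>The map \<open>Z\<close>, built from the characters of the vectors of \<open>E'\<close>,
  separates points modulo the lattice, so a tent in \<open>Z\<close> about \<open>Z x0\<close> can
  be confined to where \<open>D\<close> is close to \<open>D x0\<close>. It is a uniform limit of
  trigonometric polynomials with frequencies in the dual lattice, so \<open>D\<close> integrates to
  0 against it over the cell, and positivity forces \<open>D x0 = 0\<close>.\<close>

lemma torus_uniqueness:
  fixes D :: "real^'n \<Rightarrow> complex"
  assumes c: "continuous_on UNIV D" and per: "\<And>x y. y \<in> basis_lattice E \<Longrightarrow> D (x + y) = D x"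
    and z: "\<And>\<alpha>. \<alpha> \<in> basis_lattice E' \<Longrightarrow> (LINT x:cell E'|lborel. D x * cis (x \<bullet> \<alpha>)) = 0"
  shows "D x0 = 0"
proof (rule ccontr)
  assume D0: "D x0 \<noteq> 0"
  interpret dual: dual_pair E' E by (rule dual_pair_sym) (rule dual_pair_axioms)
  obtain b :: "'n \<Rightarrow> nat" where b: "bij_betw b UNIV {..<length E'}"
  proof -
    have "card (UNIV :: 'n set) = card {..<length E'}" by (simp add: length_card length_eq)
    from finite_same_card_bij[OF finite finite_lessThan this] show thesis using that by blast
  qed
  define v where "v i = E' ! b i" for i
  have vset: "range v = set E'"
  proof -
    have "range v = (\<lambda>k. E' ! k) ` range b" by (simp add: v_def[abs_def] image_image)
    also have "\<dots> = set E'" using b by (auto simp: bij_betw_def set_conv_nth)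
    finally show ?thesis .
  qed
  have vL: "v i \<in> basis_lattice E'" for i
  proof -
    have bi: "b i < length E'" using b by (auto simp: bij_betw_def)
    show ?thesis unfolding dual.in_lattice_iff v_def
      using bi inner_dual length_eq by (auto simp: in_set_conv_nth inner_commute)
  qed
  define Z :: "real^'n \<Rightarrow> complex^'n" where "Z x = (\<chi> i. cis (x \<bullet> v i))" for x
  have Zc: "continuous_on UNIV Z" unfolding Z_def by (intro continuous_intros)
  have Zper: "Z (x + y) = Z x" if "y \<in> basis_lattice E" for x y
    unfolding Z_def by (simp add: inner_add_left cis_mult[symmetric] cis_lattice[OF that vL])
  have Zinj: "D x = D x0" if "Z x = Z x0" for x
  proof -
    have "cis (x \<bullet> v i) = cis (x0 \<bullet> v i)" for i
    proof -
      have "Z x $ i = Z x0 $ i" using that by simp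
      then show ?thesis by (simp add: Z_def)
    qed
    then have "((x - x0) \<bullet> v i) / (2 * pi) \<in> \<int>" for i using cis_eq_imp by (simp add: inner_diff_left)
    then have "x - x0 \<in> basis_lattice E" unfolding in_lattice_iff vset[symmetric] by blast
    from per[OF this, of x0] show ?thesis by simp
  qed
  \<comment> \<open>The points where \<open>D\<close> is too far from \<open>D x0\<close> to have a
    sign. By compactness \<open>Z\<close> stays away from \<open>Z x0\<close> there, which
    determines \<open>K\<close> so that the tent vanishes on \<open>S\<close>.\<close>
  define S where "S = {x \<in> cball 0 (list_diam E). cmod (D x0) \<le> cmod (D x - D x0)}"
  have "\<exists>K>0. \<forall>x\<in>S. 1 \<le> K * norm (Z x - Z x0)"
  proof (cases "S = {}")
    case True then show ?thesis by (intro exI[of _ 1]) auto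
  next
    case False
    have "compact S"
    proof -
      have "closed {x. cmod (D x0) \<le> cmod (D x - D x0)}"
        by (intro closed_Collect_le continuous_intros c)
      then have "compact (cball 0 (list_diam E) \<inter> {x. cmod (D x0) \<le> cmod (D x - D x0)})"
        by (rule compact_Int_closed[OF compact_cball])
      moreover have "cball 0 (list_diam E) \<inter> {x. cmod (D x0) \<le> cmod (D x - D x0)} = S" by (auto simp: S_def)
      ultimately show ?thesis by simp
    qed
    moreover have "continuous_on S (\<lambda>x. norm (Z x - Z x0))"
      by (intro continuous_intros continuous_on_subset[OF Zc]) auto
    ultimately obtain m where m: "m \<in> S" "\<And>x. x \<in> S \<Longrightarrow> norm (Z m - Z x0) \<le> norm (Z x - Z x0)"
      using continuous_attains_inf[of S "\<lambda>x. norm (Z x - Z x0)"] False by blast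
    have "Z m \<noteq> Z x0" using Zinj[of m] m(1) D0 by (auto simp: S_def)
    then have pos: "norm (Z m - Z x0) > 0" by simp
    show ?thesis
      by (rule exI[of _ "inverse (norm (Z m - Z x0))"]) (use pos m(2) in \<open>auto simp: field_simps\<close>)
  qed
  then obtain K where K: "K > 0" "\<And>x. x \<in> S \<Longrightarrow> 1 \<le> K * norm (Z x - Z x0)" by blast
  define F where "F z = max 0 (1 - K * norm (z - Z x0))" for z
  have Fc: "continuous_on UNIV F" unfolding F_def by (intro continuous_intros)
  define g where "g x = Re (cnj (D x0) * D x) * F (Z x)" for x
  obtain B where B: "\<And>x. cmod (D x) \<le> B" using bounded_periodic[OF c per] by blast
  have Db: "D \<in> borel_measurable borel" using c by (rule borel_measurable_continuous_onI)
  have Dint: "integrable lborel (\<lambda>x. indicat_real (cell E') x *\<^sub>R D x)"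
    using cell_integrable[OF Db B] by (simp add: set_integrable_def)
  have "(\<integral>x. indicat_real (cell E') x *\<^sub>R D x * complex_of_real (F (\<chi> i. cis (x \<bullet> v i))) \<partial>lborel) = 0"
    by (rule annihilate_continuous[where G = "basis_lattice E'", OF Dint _ _ _ vL _ Fc])
       (use z in \<open>auto simp: set_lebesgue_integral_def dual.lattice_add\<close>)
  then have I0: "(\<integral>x. indicat_real (cell E') x *\<^sub>R D x * complex_of_real (F (Z x)) \<partial>lborel) = 0" by (simp add: Z_def)
  have FZc: "continuous_on UNIV (\<lambda>x. F (Z x))" by (rule continuous_on_compose2[OF Fc Zc]) auto
  have F01: "0 \<le> F z" "F z \<le> 1" for z unfolding F_def using K by (auto simp: max_def)
  have int2: "integrable lborel (\<lambda>x. indicat_real (cell E') x *\<^sub>R D x * complex_of_real (F (Z x)))"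
    by (rule integrable_mult_bounded[OF Dint, where B = 1]) (use F01 FZc in \<open>auto intro: continuous_intros\<close>)
  have "g x0 = 0"
  proof (rule cell_integral_nonneg_zero[of g])
    show "continuous_on UNIV g" unfolding g_def by (intro continuous_intros c FZc)
    show "g (x + y) = g x" if "y \<in> basis_lattice E" for x y unfolding g_def by (simp add: per Zper that)
    show "g x \<ge> 0" if x: "x \<in> cell E'" for x
    proof (cases "x \<in> S")
      case True
      then have "F (Z x) = 0" using K(2)[OF True] by (simp add: F_def)
      then show ?thesis by (simp add: g_def)
    next
      case False
      then have "cmod (D x - D x0) \<le> cmod (D x0)" using cell_norm_le[OF x] by (auto simp: S_def)
      from Re_cnj_mult_nonneg[OF this] show ?thesis using F01 by (simp add: g_def)
    qed
    have "(\<integral>x. indicat_real (cell E') x * g x \<partial>lborel) = Re (\<integral>x. cnj (D x0) * (indicat_real (cell E') x *\<^sub>R D x * complex_of_real (F (Z x))) \<partial>lborel)"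
    proof -
      have "(\<integral>x. indicat_real (cell E') x * g x \<partial>lborel) = (\<integral>x. Re (cnj (D x0) * (indicat_real (cell E') x *\<^sub>R D x * complex_of_real (F (Z x)))) \<partial>lborel)"
        by (intro Bochner_Integration.integral_cong refl) (simp add: g_def algebra_simps)
      also have "\<dots> = Re (\<integral>x. cnj (D x0) * (indicat_real (cell E') x *\<^sub>R D x * complex_of_real (F (Z x))) \<partial>lborel)"
        using int2 by (intro integral_Re integrable_mult_right) auto
      finally show ?thesis .
    qed
    also have "\<dots> = 0" by (simp only: integral_mult_right_zero I0 mult_zero_right zero_complex.sel)
    finally have "complex_of_real (\<integral>x. indicat_real (cell E') x * g x \<partial>lborel) = 0" by simp
    then show "(LINT x:cell E'|lborel. complex_of_real (g x)) = 0"
      unfolding set_lebesgue_integral_def integral_complex_of_real[symmetric] by (simp add: scaleR_conv_of_real)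
  qed
  moreover have "g x0 = (cmod (D x0))\<^sup>2" by (simp add: g_def F_def cmod_power2 flip: power2_eq_square)
  ultimately show False using D0 by simp
qed

section \<open>Periodic functionals and their expansions\<close>

lemma dual: "dual_pair E' E"
  by (rule dual_pair_sym) (rule dual_pair_axioms)

lemma infsum_lattice_uminus: "(\<Sum>\<^sub>\<infinity>y\<in>basis_lattice E. g (- y)) = (\<Sum>\<^sub>\<infinity>y\<in>basis_lattice E. g y)"
  by (rule infsum_reindex_bij_betw) (rule bij_betw_byWitness[where f' = uminus], auto)

lemma infsum_lattice_shift:
  assumes "a \<in> basis_lattice E"
  shows "(\<Sum>\<^sub>\<infinity>y\<in>basis_lattice E. g (y + a)) = (\<Sum>\<^sub>\<infinity>y\<in>basis_lattice E. g y)"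
  by (rule infsum_reindex_bij_betw)
     (rule bij_betw_byWitness[where f' = "\<lambda>y. y - a"], use assms in \<open>auto simp: lattice_add lattice_diff\<close>)

lemma periodization_bound:
  assumes "exp_bound 1 A \<eta>" "norm x \<le> r"
  shows "cmod (\<eta> (x - y)) \<le> (A * exp r) * exp (- (1 * norm y))"
proof -
  have "norm y \<le> norm x + norm (x - y)" using norm_triangle_sub[of y x] by (simp add: norm_minus_commute)
  then have "- (1 * norm (x - y)) \<le> r + - (1 * norm y)" using assms(2) by linarith
  then have "exp (- (1 * norm (x - y))) \<le> exp r * exp (- (1 * norm y))" unfolding exp_add[symmetric] by simp
  then have "A * exp (- (1 * norm (x - y))) \<le> A * (exp r * exp (- (1 * norm y)))"
    using exp_bound_nonneg[OF assms(1)] by (intro mult_left_mono) auto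
  then show ?thesis using exp_bound_0[OF assms(1), of "x - y"] by (simp add: mult.assoc)
qed

text \<open>Continuity is local, so the majorant only has to be uniform on balls. The factor
  \<open>C r\<close> accommodates periodizations, whose terms are shifted along with
  \<open>x\<close>.\<close>

lemma continuous_infsum:
  fixes h :: "'i \<Rightarrow> real^'n \<Rightarrow> complex"
  assumes c: "\<And>i. i \<in> I \<Longrightarrow> continuous_on UNIV (h i)"
    and b: "\<And>i x r. i \<in> I \<Longrightarrow> norm x \<le> r \<Longrightarrow> cmod (h i x) \<le> C r * M i" and M: "M summable_on I"
  shows "continuous_on UNIV (\<lambda>x. \<Sum>\<^sub>\<infinity>i\<in>I. h i x)"
  unfolding continuous_on_eq_continuous_at[OF open_UNIV]
proof
  fix x0 :: "real^'n"
  have "((\<lambda>x. \<Sum>\<^sub>\<infinity>i\<in>I. h i x) \<longlongrightarrow> (\<Sum>\<^sub>\<infinity>i\<in>I. h i x0)) (at x0)"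
  proof (rule tendsto_infsum_dominated)
    show "((\<lambda>x. h i x) \<longlongrightarrow> h i x0) (at x0)" if "i \<in> I" for i
      using c[OF that] by (simp add: continuous_on_eq_continuous_at continuous_at)
    show "\<forall>\<^sub>F x in at x0. \<forall>i\<in>I. cmod (h i x) \<le> C (norm x0 + 1) * M i"
      unfolding eventually_at
    proof (rule exI[of _ 1], intro conjI ballI impI)
      fix x i assume x: "x \<noteq> x0 \<and> dist x x0 < 1" and i: "i \<in> I"
      have "norm x \<le> norm x0 + 1" using x norm_triangle_sub[of x x0] by (simp add: dist_norm)
      then show "cmod (h i x) \<le> C (norm x0 + 1) * M i" by (rule b[OF i])
    qed simp
    show "(\<lambda>i. C (norm x0 + 1) * M i) summable_on I" by (rule summable_on_cmult_right[OF M])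
  qed simp
  then show "isCont (\<lambda>x. \<Sum>\<^sub>\<infinity>i\<in>I. h i x) x0" by (simp add: continuous_at)
qed

text \<open>Both sides are continuous and periodic, so by \<open>torus_uniqueness\<close> it
  suffices to compare Fourier coefficients. Those of the periodization unfold to an integral over
  the whole space, and those of the series follow from orthogonality.\<close>

lemma poisson_summation:
  assumes eta: "\<eta> \<in> Sigma1"
  shows "(\<Sum>\<^sub>\<infinity>y\<in>basis_lattice E. \<eta> (x - y)) =
    (\<Sum>\<^sub>\<infinity>\<beta>\<in>basis_lattice E'. fourier_int \<eta> \<beta> / of_real cell_vol * cis (x \<bullet> \<beta>))"
proof -
  interpret dual: dual_pair E' E by (rule dual)
  obtain A where A: "exp_bound 1 A \<eta>" using Sigma1_exp_bound[OF eta, of 1] by auto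
  obtain B where B: "B > 0" "\<And>\<xi>. cmod (fourier_int \<eta> \<xi>) \<le> B * exp (- (1 * norm \<xi>))"
    using Sigma1_fourier_int_decay[OF eta zero_less_one] by blast
  have etam [measurable]: "\<eta> \<in> borel_measurable borel" by (rule Sigma1_borel[OF eta])
  note sE = summable_on_exp_lattice[OF zero_less_one] and sE' = dual.summable_on_exp_lattice[OF zero_less_one]
  define P where "P x = (\<Sum>\<^sub>\<infinity>y\<in>basis_lattice E. \<eta> (x - y))" for x
  define Q where "Q x = (\<Sum>\<^sub>\<infinity>\<beta>\<in>basis_lattice E'. fourier_int \<eta> \<beta> / of_real cell_vol * cis (x \<bullet> \<beta>))" for x
  have Qb: "cmod (fourier_int \<eta> \<beta> / of_real cell_vol * cis (x \<bullet> \<beta>)) \<le> (B / cell_vol) * exp (- (1 * norm \<beta>))" for \<beta> x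
    using B(2)[of \<beta>] cell_vol_pos by (simp add: norm_mult norm_divide divide_right_mono)
  have Pc: "continuous_on UNIV P" unfolding P_def
  proof (rule continuous_infsum[OF _ _ sE])
    show "continuous_on UNIV (\<lambda>x. \<eta> (x - y))" for y
      by (intro continuous_on_compose2[OF Sigma1_continuous[OF eta]] continuous_intros) auto
    show "cmod (\<eta> (x - y)) \<le> A * exp r * exp (- (1 * norm y))" if "norm x \<le> r" for x y r
      by (rule periodization_bound[OF A that])
  qed
  have Qc: "continuous_on UNIV Q" unfolding Q_def
    by (rule continuous_infsum[OF _ _ sE', where C = "\<lambda>_. B / cell_vol"]) (use Qb cell_vol_pos in \<open>auto intro!: continuous_intros\<close>)
  have Pper: "P (x + a) = P x" if "a \<in> basis_lattice E" for x a
    unfolding P_def using infsum_lattice_shift[OF that, of "\<lambda>y. \<eta> (x + a - y)"] by simp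
  have Qper: "Q (x + a) = Q x" if "a \<in> basis_lattice E" for x a
    unfolding Q_def by (intro infsum_cong) (simp add: inner_add_left cis_mult[symmetric] cis_lattice[OF that])
  have Pm: "P \<in> borel_measurable borel" and Qm: "Q \<in> borel_measurable borel"
    using Pc Qc by (auto intro: borel_measurable_continuous_onI)
  have Pint: "(LINT x:cell E'|lborel. P x * cis (x \<bullet> \<alpha>)) = fourier_int \<eta> (- \<alpha>)" if al: "\<alpha> \<in> basis_lattice E'" for \<alpha>
  proof -
    have "((\<lambda>y. LINT x:cell E'|lborel. \<eta> (x - y) * cis (x \<bullet> \<alpha>)) has_sum
        (LINT x:cell E'|lborel. (\<Sum>\<^sub>\<infinity>y\<in>basis_lattice E. \<eta> (x - y) * cis (x \<bullet> \<alpha>)))) (basis_lattice E)"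
    proof (rule cell_integral_infsum[OF countable_lattice])
      show "cmod (\<eta> (x - y) * cis (x \<bullet> \<alpha>)) \<le> A * exp (list_diam E) * exp (- (1 * norm y))" if "x \<in> cell E'" for x y
        using periodization_bound[OF A cell_norm_le[OF that], of y] by (subst norm_mult) simp
      show "(\<lambda>y. A * exp (list_diam E) * exp (- (1 * norm y))) summable_on basis_lattice E"
        by (rule summable_on_cmult_right[OF sE])
    qed measurable
    then have 1: "(LINT x:cell E'|lborel. P x * cis (x \<bullet> \<alpha>)) = (\<Sum>\<^sub>\<infinity>y\<in>basis_lattice E. LINT x:cell E'|lborel. \<eta> (x - y) * cis (x \<bullet> \<alpha>))"
      unfolding P_def by (simp add: infsumI infsum_cmult_left')
    have "((\<lambda>y. LINT x:cell E'|lborel. \<eta> (x + y) * cis ((x + y) \<bullet> \<alpha>)) has_sum (\<integral>x. \<eta> x * cis (x \<bullet> \<alpha>) \<partial>lborel)) (basis_lattice E)"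
      using tile_integral[OF integrable_mult_cis[OF Sigma1_integrable[OF eta], of "- \<alpha>"]] by simp
    then have "fourier_int \<eta> (- \<alpha>) = (\<Sum>\<^sub>\<infinity>y\<in>basis_lattice E. LINT x:cell E'|lborel. \<eta> (x + y) * cis ((x + y) \<bullet> \<alpha>))"
      by (simp add: fourier_int_def infsumI)
    also have "\<dots> = (\<Sum>\<^sub>\<infinity>y\<in>basis_lattice E. LINT x:cell E'|lborel. \<eta> (x + y) * cis (x \<bullet> \<alpha>))"
      by (intro infsum_cong) (simp add: inner_add_left cis_mult[symmetric] cis_lattice[OF _ al])
    also have "\<dots> = (\<Sum>\<^sub>\<infinity>y\<in>basis_lattice E. LINT x:cell E'|lborel. \<eta> (x - y) * cis (x \<bullet> \<alpha>))"
      using infsum_lattice_uminus[of "\<lambda>y. LINT x:cell E'|lborel. \<eta> (x + y) * cis (x \<bullet> \<alpha>)"] by simp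
    finally show ?thesis using 1 by simp
  qed
  have Qint: "(LINT x:cell E'|lborel. Q x * cis (x \<bullet> \<alpha>)) = fourier_int \<eta> (- \<alpha>)" if al: "\<alpha> \<in> basis_lattice E'" for \<alpha>
  proof -
    have "((\<lambda>\<beta>. LINT x:cell E'|lborel. fourier_int \<eta> \<beta> / of_real cell_vol * cis (x \<bullet> \<beta>) * cis (x \<bullet> \<alpha>)) has_sum
        (LINT x:cell E'|lborel. (\<Sum>\<^sub>\<infinity>\<beta>\<in>basis_lattice E'. fourier_int \<eta> \<beta> / of_real cell_vol * cis (x \<bullet> \<beta>) * cis (x \<bullet> \<alpha>)))) (basis_lattice E')"
    proof (rule cell_integral_infsum[OF dual.countable_lattice])
      show "cmod (fourier_int \<eta> \<beta> / of_real cell_vol * cis (x \<bullet> \<beta>) * cis (x \<bullet> \<alpha>)) \<le> (B / cell_vol) * exp (- (1 * norm \<beta>))" for \<beta> x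
        using Qb[of \<beta> x] by (subst norm_mult) simp
      show "(\<lambda>\<beta>. (B / cell_vol) * exp (- (1 * norm \<beta>))) summable_on basis_lattice E'"
        by (rule summable_on_cmult_right[OF sE'])
    qed measurable
    then have 1: "(LINT x:cell E'|lborel. Q x * cis (x \<bullet> \<alpha>)) = (\<Sum>\<^sub>\<infinity>\<beta>\<in>basis_lattice E'. LINT x:cell E'|lborel. fourier_int \<eta> \<beta> / of_real cell_vol * cis (x \<bullet> \<beta>) * cis (x \<bullet> \<alpha>))"
      unfolding Q_def infsum_cmult_left'[symmetric] by (rule infsumI[symmetric])
    have t: "(LINT x:cell E'|lborel. fourier_int \<eta> \<beta> / of_real cell_vol * cis (x \<bullet> \<beta>) * cis (x \<bullet> \<alpha>)) = (if \<beta> = - \<alpha> then fourier_int \<eta> (- \<alpha>) else 0)"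
      if "\<beta> \<in> basis_lattice E'" for \<beta>
    proof -
      have "(LINT x:cell E'|lborel. fourier_int \<eta> \<beta> / of_real cell_vol * cis (x \<bullet> \<beta>) * cis (x \<bullet> \<alpha>)) =
          (LINT x:cell E'|lborel. fourier_int \<eta> \<beta> / of_real cell_vol * cis (x \<bullet> (\<beta> + \<alpha>)))"
        by (simp only: mult.assoc cis_mult inner_add_right)
      also have "\<dots> = fourier_int \<eta> \<beta> / of_real cell_vol * (LINT x:cell E'|lborel. cis (x \<bullet> (\<beta> + \<alpha>)))"
        by (rule set_integral_mult_right)
      also have "\<dots> = (if \<beta> = - \<alpha> then fourier_int \<eta> (- \<alpha>) else 0)"
        unfolding cell_integral_cis[OF dual.lattice_add[OF that al]] using cell_vol_pos by (auto simp: add_eq_0_iff2)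
      finally show ?thesis .
    qed
    have "((\<lambda>\<beta>. if \<beta> = - \<alpha> then fourier_int \<eta> (- \<alpha>) else 0) has_sum fourier_int \<eta> (- \<alpha>)) (basis_lattice E')"
      using infsum_single_support[of "- \<alpha>" "basis_lattice E'" "\<lambda>\<beta>. if \<beta> = - \<alpha> then fourier_int \<eta> (- \<alpha>) else 0"] al by simp
    then show ?thesis unfolding 1 using t by (simp add: infsumI cong: infsum_cong)
  qed
  obtain B1 B2 where B12: "\<And>x. cmod (P x) \<le> B1" "\<And>x. cmod (Q x) \<le> B2"
    using bounded_periodic[OF Pc Pper] bounded_periodic[OF Qc Qper] by metis
  have "P x - Q x = 0"
  proof (rule torus_uniqueness[of "\<lambda>x. P x - Q x"])
    show "continuous_on UNIV (\<lambda>x. P x - Q x)" by (intro continuous_intros Pc Qc)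
    show "P (x + y) - Q (x + y) = P x - Q x" if "y \<in> basis_lattice E" for x y using Pper Qper that by simp
    fix \<alpha> assume al: "\<alpha> \<in> basis_lattice E'"
    have "set_integrable lborel (cell E') (\<lambda>x. P x * cis (x \<bullet> \<alpha>))" "set_integrable lborel (cell E') (\<lambda>x. Q x * cis (x \<bullet> \<alpha>))"
      using B12 Pm Qm by (auto intro!: cell_integrable simp: norm_mult)
    then show "(LINT x:cell E'|lborel. (P x - Q x) * cis (x \<bullet> \<alpha>)) = 0"
      using Pint[OF al] Qint[OF al] by (simp add: left_diff_distrib set_integral_diff)
  qed
  then show ?thesis by (simp add: P_def Q_def)
qed

text \<open>The lattice is the additive group generated by \<open>E\<close>. In this form invariance
  under the basis vectors extends to all lattice translations.\<close>

lemma lattice_subgroup: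
  assumes "set E \<subseteq> H" "0 \<in> H" and add: "\<And>a b. a \<in> H \<Longrightarrow> b \<in> H \<Longrightarrow> a + b \<in> H" and neg: "\<And>a. a \<in> H \<Longrightarrow> - a \<in> H"
  shows "basis_lattice E \<subseteq> H"
proof
  fix y assume "y \<in> basis_lattice E"
  then obtain xs where xs: "y = lin_comb E xs" "length xs = length E" "set xs \<subseteq> \<int>" by (auto simp: basis_lattice_def)
  have m: "of_int n *\<^sub>R a \<in> H" if "a \<in> H" for n :: int and a
  proof (induction n rule: int_induct[of _ 0])
    case base then show ?case using assms(2) by simp
  next
    case (step1 i) then show ?case using add[OF _ that] by (simp add: scaleR_left_distrib)
  next
    case (step2 i) then show ?case using add[OF _ neg[OF that]] by (simp add: scaleR_left_diff_distrib)
  qed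
  have s: "(\<Sum>k\<in>F. f k) \<in> H" if "finite F" "\<And>k. k \<in> F \<Longrightarrow> f k \<in> H" for F :: "nat set" and f
    using that by (induction F rule: finite_induct) (auto intro: add assms(2))
  show "y \<in> H" unfolding xs(1) lin_comb_def
  proof (rule s)
    fix k assume k: "k \<in> {..<length E}"
    then have "xs ! k \<in> \<int>" using xs by auto
    then obtain n where "xs ! k = of_int n" by (elim Ints_cases)
    moreover have "E ! k \<in> H" using assms(1) nth_mem[of k E] k by blast
    ultimately show "xs ! k *\<^sub>R E ! k \<in> H" using m[of "E ! k" n] by simp
  qed simp
qed

lemma periodic_lattice:
  assumes "periodic E f" "y \<in> basis_lattice E" "\<phi> \<in> Sigma1"
  shows "f (\<lambda>x. \<phi> (x - y)) = f \<phi>"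
proof -
  define H where "H = {y. \<forall>\<phi>\<in>Sigma1. f (\<lambda>x. \<phi> (x - y)) = f \<phi>}"
  have "basis_lattice E \<subseteq> H"
  proof (rule lattice_subgroup)
    show "set E \<subseteq> H" using assms(1) by (auto simp: H_def periodic_def)
    show "0 \<in> H" by (simp add: H_def)
    show "a + b \<in> H" if ab: "a \<in> H" "b \<in> H" for a b
      unfolding H_def
    proof (intro CollectI ballI)
      fix \<phi> :: "real^'n \<Rightarrow> complex" assume phi: "\<phi> \<in> Sigma1"
      have "f (\<lambda>x. (\<lambda>x. \<phi> (x - a)) (x - b)) = f (\<lambda>x. \<phi> (x - a))"
        using bspec[OF ab(2)[unfolded H_def mem_Collect_eq] Sigma1_translate[OF phi, of a]] .
      moreover have "f (\<lambda>x. \<phi> (x - a)) = f \<phi>" using ab(1) phi unfolding H_def by blast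
      ultimately show "f (\<lambda>x. \<phi> (x - (a + b))) = f \<phi>" by (simp add: algebra_simps)
    qed
    show "- a \<in> H" if a: "a \<in> H" for a
      unfolding H_def
    proof (intro CollectI ballI)
      fix \<phi> :: "real^'n \<Rightarrow> complex" assume phi: "\<phi> \<in> Sigma1"
      have "f (\<lambda>x. (\<lambda>x. \<phi> (x - - a)) (x - a)) = f (\<lambda>x. \<phi> (x - - a))"
        using bspec[OF a[unfolded H_def mem_Collect_eq] Sigma1_translate[OF phi, of "- a"]] .
      then show "f (\<lambda>x. \<phi> (x - - a)) = f \<phi>" by simp
    qed
  qed
  then have "\<forall>\<phi>\<in>Sigma1. f (\<lambda>x. \<phi> (x - y)) = f \<phi>" using assms(2) unfolding H_def by blast
  then show ?thesis using assms(3) by (rule bspec)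
qed

text \<open>Poisson summation for \<eta>, multiplied by \<psi> and evaluated under \<open>f\<close>.
  The factor \<psi> gives the terms of both series exponential bounds with summable constants, as
  \<open>Sigma1_dual_series_eq\<close> requires.\<close>

lemma dual_periodization:
  fixes f :: "(real^'n \<Rightarrow> complex) \<Rightarrow> complex"
  assumes f: "f \<in> Sigma1_dual" and eta: "\<eta> \<in> Sigma1" and psi: "\<psi> \<in> Sigma1"
  shows "(\<Sum>\<^sub>\<infinity>y\<in>basis_lattice E. f (\<lambda>x. \<psi> x * \<eta> (x - y))) =
    (\<Sum>\<^sub>\<infinity>\<beta>\<in>basis_lattice E'. fourier_int \<eta> \<beta> / of_real cell_vol * f (\<lambda>x. \<psi> x * cis (x \<bullet> \<beta>)))"
proof -
  interpret dual: dual_pair E' E by (rule dual)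
  obtain R C where R: "R > 0" and Cpos: "C > 0" and C: "\<And>\<psi> A. \<psi> \<in> Sigma1 \<Longrightarrow> exp_bound R A \<psi> \<Longrightarrow> cmod (f \<psi>) \<le> C * A"
    using Sigma1_dual_bounded[OF f] by blast
  obtain A B where A: "exp_bound (2 * R) A \<psi>" and B: "exp_bound (2 * R) B \<eta>"
    using Sigma1_exp_bound[OF psi, of "2 * R"] Sigma1_exp_bound[OF eta, of "2 * R"] R by auto
  \<comment> \<open>Modulating \<psi> by \<beta> costs
    \<open>exp (2 * R * CARD('n) * norm \<beta>)\<close>; the transform of \<eta> has to decay
    faster, with one unit of rate left for summability over the lattice.\<close>
  define S where "S = 2 * R * real CARD('n) + 1"
  have S: "S > 0" using R by (simp add: S_def add_nonneg_pos)
  obtain D where D: "D > 0" "\<And>\<xi>. cmod (fourier_int \<eta> \<xi>) \<le> D * exp (- (S * norm \<xi>))"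
    using Sigma1_fourier_int_decay[OF eta S] by blast
  define A' where "A' \<beta> = cmod (fourier_int \<eta> \<beta> / of_real cell_vol) * (A * exp (2 * R * (real CARD('n) * norm \<beta>)))" for \<beta> :: "real^'n"
  have "(\<Sum>\<^sub>\<infinity>y\<in>basis_lattice E. f (\<lambda>x. \<psi> x * \<eta> (x - y))) =
     (\<Sum>\<^sub>\<infinity>\<beta>\<in>basis_lattice E'. f (\<lambda>x. fourier_int \<eta> \<beta> / of_real cell_vol * (\<psi> x * cis (x \<bullet> \<beta>))))"
  proof (rule Sigma1_dual_series_eq[OF f R C])
    show "(\<lambda>x. \<psi> x * \<eta> (x - y)) \<in> Sigma1" for y by (rule Sigma1_mult_translate[OF psi eta])
    show "exp_bound R (A * B * exp (- (R * norm y))) (\<lambda>x. \<psi> x * \<eta> (x - y))" for y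
      by (rule exp_bound_mult_translate[OF R Sigma1_smooth[OF psi] A Sigma1_smooth[OF eta] B])
    show "(\<lambda>y. A * B * exp (- (R * norm y))) summable_on basis_lattice E"
      by (rule summable_on_cmult_right[OF summable_on_exp_lattice[OF R]])
    show "(\<lambda>x. fourier_int \<eta> \<beta> / of_real cell_vol * (\<psi> x * cis (x \<bullet> \<beta>))) \<in> Sigma1" for \<beta>
      by (rule Sigma1_cmult[OF Sigma1_cis[OF psi]])
    show "exp_bound R (A' \<beta>) (\<lambda>x. fourier_int \<eta> \<beta> / of_real cell_vol * (\<psi> x * cis (x \<bullet> \<beta>)))" for \<beta>
      unfolding A'_def
      by (rule exp_bound_cmult[OF Sigma1_smooth[OF Sigma1_cis[OF psi]] exp_bound_cis[OF R Sigma1_smooth[OF psi] A]])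
    show "A' summable_on basis_lattice E'"
    proof (rule summable_on_comparison_test)
      show "(\<lambda>\<beta>. (D / cell_vol * A) * exp (- (1 * norm \<beta>))) summable_on basis_lattice E'"
        by (rule summable_on_cmult_right[OF dual.summable_on_exp_lattice]) simp
      have A0: "A \<ge> 0" using exp_bound_nonneg[OF A] .
      fix \<beta> :: "real^'n"
      have "A' \<beta> \<le> (D * exp (- (S * norm \<beta>)) / cell_vol) * (A * exp (2 * R * (real CARD('n) * norm \<beta>)))"
        unfolding A'_def norm_divide using D(2)[of \<beta>] cell_vol_pos A0
        by (intro mult_right_mono) (auto simp: divide_right_mono)
      also have "\<dots> = (D / cell_vol * A) * (exp (- (S * norm \<beta>)) * exp (2 * R * (real CARD('n) * norm \<beta>)))" by simp
      also have "exp (- (S * norm \<beta>)) * exp (2 * R * (real CARD('n) * norm \<beta>)) = exp (- (1 * norm \<beta>))"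
        unfolding exp_add[symmetric] by (simp add: S_def algebra_simps)
      finally show "A' \<beta> \<le> (D / cell_vol * A) * exp (- (1 * norm \<beta>))" .
      show "0 \<le> A' \<beta>" unfolding A'_def using A0 by simp
    qed
    show "(\<Sum>\<^sub>\<infinity>y\<in>basis_lattice E. \<psi> x * \<eta> (x - y)) = (\<Sum>\<^sub>\<infinity>\<beta>\<in>basis_lattice E'. fourier_int \<eta> \<beta> / of_real cell_vol * (\<psi> x * cis (x \<bullet> \<beta>)))" for x
      using arg_cong[OF poisson_summation[OF eta, of x], of "\<lambda>z. \<psi> x * z"]
      by (simp only: infsum_cmult_right'[symmetric] mult.left_commute)
  qed
  then show ?thesis by (simp only: Sigma1_dual_cmult[OF f Sigma1_cis[OF psi]])
qed

text \<open>By periodicity \<open>f\<close> does not distinguish whether \<eta> or \<psi> carries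
  the lattice translation, up to its sign. Since the lattice is symmetric, the left side of
  \<open>dual_periodization\<close> is symmetric in the two functions, hence so is the right
  side.\<close>

lemma dual_swap:
  fixes f :: "(real^'n \<Rightarrow> complex) \<Rightarrow> complex"
  assumes f: "f \<in> Sigma1_dual" "periodic E f" and eta: "\<eta> \<in> Sigma1" and psi: "\<psi> \<in> Sigma1"
  shows "(\<Sum>\<^sub>\<infinity>\<beta>\<in>basis_lattice E'. fourier_int \<eta> \<beta> * f (\<lambda>x. \<psi> x * cis (x \<bullet> \<beta>))) =
    (\<Sum>\<^sub>\<infinity>\<beta>\<in>basis_lattice E'. fourier_int \<psi> \<beta> * f (\<lambda>x. \<eta> x * cis (x \<bullet> \<beta>)))"
proof -
  have sw: "f (\<lambda>x. \<psi> x * \<eta> (x - y)) = f (\<lambda>x. \<eta> x * \<psi> (x - - y))" if y: "y \<in> basis_lattice E" for y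
    using periodic_lattice[OF f(2) y Sigma1_mult_translate[OF eta psi, of "- y"]] by (simp add: mult.commute)
  have "(\<Sum>\<^sub>\<infinity>y\<in>basis_lattice E. f (\<lambda>x. \<psi> x * \<eta> (x - y))) = (\<Sum>\<^sub>\<infinity>y\<in>basis_lattice E. f (\<lambda>x. \<eta> x * \<psi> (x - - y)))"
    by (intro infsum_cong sw)
  also have "\<dots> = (\<Sum>\<^sub>\<infinity>y\<in>basis_lattice E. f (\<lambda>x. \<eta> x * \<psi> (x - y)))"
    by (rule infsum_lattice_uminus[of "\<lambda>y. f (\<lambda>x. \<eta> x * \<psi> (x - y))"])
  finally have "(\<Sum>\<^sub>\<infinity>\<beta>\<in>basis_lattice E'. inverse (of_real cell_vol) * (fourier_int \<eta> \<beta> * f (\<lambda>x. \<psi> x * cis (x \<bullet> \<beta>)))) =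
    (\<Sum>\<^sub>\<infinity>\<beta>\<in>basis_lattice E'. inverse (of_real cell_vol) * (fourier_int \<psi> \<beta> * f (\<lambda>x. \<eta> x * cis (x \<bullet> \<beta>))))"
    unfolding dual_periodization[OF f(1) eta psi] dual_periodization[OF f(1) psi eta] by (simp add: divide_inverse mult_ac)
  then show ?thesis unfolding infsum_cmult_right' using cell_vol_pos by simp
qed

end

lemma norm_infsum_le_cmult:
  fixes f :: "'a \<Rightarrow> 'b::banach"
  assumes "A summable_on I" "\<And>i. i \<in> I \<Longrightarrow> norm (f i) \<le> c * A i"
  shows "norm (\<Sum>\<^sub>\<infinity>i\<in>I. f i) \<le> c * (\<Sum>\<^sub>\<infinity>i\<in>I. A i)"
proof (rule norm_infsum_le)
  show "(f has_sum (\<Sum>\<^sub>\<infinity>i\<in>I. f i)) I" by (rule has_sum_infsum[OF abs_summable_bound(2)[OF assms]])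
  show "((\<lambda>i. c * A i) has_sum (c * (\<Sum>\<^sub>\<infinity>i\<in>I. A i))) I"
    by (intro has_sum_cmult_right has_sum_infsum assms(1))
qed (rule assms(2))

definition stft_const :: "'n::finite itself \<Rightarrow> real" where
  "stft_const _ = (2 * pi) powr (- real CARD('n) / 2)"

lemma stft_const_pos: "stft_const TYPE('n::finite) > 0"
  by (simp add: stft_const_def)

section \<open>Existence, uniqueness and short-time Fourier transform of expansions\<close>

context dual_pair
begin

text \<open>The powers of \<open>2 * pi\<close> in the pairing and in
  \<open>fourier_transform\<close> cancel, which leaves the unnormalized transform.\<close>

lemma has_expansion_iff:
  "has_expansion E' f c \<longleftrightarrow> c \<in> formal_expansions E' \<and>
     (\<exists>C>0. \<exists>R>0. \<forall>\<alpha>\<in>basis_lattice E'. cmod (c \<alpha>) \<le> C * exp (R * norm \<alpha>)) \<and>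
     (\<forall>\<psi>\<in>Sigma1. f \<psi> = (\<Sum>\<^sub>\<infinity>\<alpha>\<in>basis_lattice E'. c \<alpha> * fourier_int \<psi> (- \<alpha>)))"
proof -
  have "of_real ((2 * pi) powr (real CARD('n) / 2)) * (\<Sum>\<^sub>\<infinity>\<alpha>\<in>basis_lattice E'. c \<alpha> * fourier_transform \<psi> (- \<alpha>)) =
      (\<Sum>\<^sub>\<infinity>\<alpha>\<in>basis_lattice E'. c \<alpha> * fourier_int \<psi> (- \<alpha>))" if "\<psi> \<in> Sigma1" for \<psi> :: "real^'n \<Rightarrow> complex"
  proof -
    have one: "(2 * pi) powr (real CARD('n) / 2) * (2 * pi) powr (- real CARD('n) / 2) = 1"
      by (simp add: powr_add[symmetric] del: powr_minus)
    have eqn: "of_real ((2 * pi) powr (real CARD('n) / 2)) * (c \<alpha> * fourier_transform \<psi> (- \<alpha>)) =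
        complex_of_real ((2 * pi) powr (real CARD('n) / 2) * (2 * pi) powr (- real CARD('n) / 2)) * (c \<alpha> * fourier_int \<psi> (- \<alpha>))" for \<alpha>
      unfolding fourier_transform_eq[OF Sigma1_continuous[OF that]] of_real_mult by (simp only: mult_ac)
    show ?thesis unfolding infsum_cmult_right'[symmetric] eqn one by simp
  qed
  then show ?thesis unfolding has_expansion_def by (metis (no_types, lifting))
qed

text \<open>\<open>dual_swap\<close> is applied to \<psi> and the translate of \<eta> by
  \<open>x\<close>, and both sides are integrated over \<open>x\<close> in a cell. On the left the
  characters in \<open>x\<close> leave only \<beta> = 0, that is, a nonzero multiple of
  \<open>f \<psi>\<close>. On the right the values of the transform of \<psi> receive coefficients
  \<open>c0 \<beta>\<close> that are independent of \<psi>.\<close>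

lemma periodic_has_expansion:
  fixes f :: "(real^'n \<Rightarrow> complex) \<Rightarrow> complex" and \<phi> :: "real^'n \<Rightarrow> complex"
  assumes f: "f \<in> Sigma1_dual" "periodic E f" and phi: "\<phi> \<in> Sigma1" "\<phi> \<noteq> (\<lambda>_. 0)"
  shows "\<exists>c. has_expansion E' f c"
proof -
  interpret dual: dual_pair E' E by (rule dual)
  obtain \<xi>0 where xi0: "fourier_int \<phi> \<xi>0 \<noteq> 0" using fourier_int_nonzero[OF phi] by blast
  \<comment> \<open>The modulation moves the point where the transform is nonzero to the origin,
    because the multiple of \<open>f \<psi>\<close> contains the transform of \<eta> at 0.\<close>
  define \<eta> where "\<eta> = (\<lambda>x. \<phi> x * cis (x \<bullet> (- \<xi>0)))"
  have eta: "\<eta> \<in> Sigma1" unfolding \<eta>_def by (rule Sigma1_cis[OF phi(1)])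
  have eta0: "fourier_int \<eta> 0 \<noteq> 0" unfolding \<eta>_def fourier_int_cis using xi0 by simp
  obtain R C where R: "R > 0" and Cpos: "C > 0" and C: "\<And>\<psi> A. \<psi> \<in> Sigma1 \<Longrightarrow> exp_bound R A \<psi> \<Longrightarrow> cmod (f \<psi>) \<le> C * A"
    using Sigma1_dual_bounded[OF f(1)] by blast
  have R2: "2 * R > 0" using R by simp
  obtain A0 where A0: "exp_bound (2 * R) A0 \<eta>" using Sigma1_exp_bound[OF eta R2] by blast
  define d where "d = real CARD('n)"
  define T where "T = 2 * R * d"
  have T: "T > 0" using R by (simp add: T_def d_def)
  have fcis: "cmod (f (\<lambda>t. \<psi> t * cis (t \<bullet> \<beta>))) \<le> C * A * exp (T * norm \<beta>)" if "\<psi> \<in> Sigma1" "exp_bound (2 * R) A \<psi>" for \<psi> A \<beta>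
    using C[OF Sigma1_cis[OF that(1)] exp_bound_cis[OF R Sigma1_smooth[OF that(1)] that(2), of \<beta>]] by (simp add: T_def d_def mult_ac)
  define A1 where "A1 = A0 * exp (2 * R * list_diam E)"
  have A1: "exp_bound (2 * R) A1 (\<lambda>t. \<eta> (t - x))" if "x \<in> cell E'" for x
  proof (rule exp_bound_mono[OF exp_bound_translate[OF R2 A0, of x]])
    show "A0 * exp (2 * R * norm x) \<le> A1" unfolding A1_def
      using exp_bound_nonneg[OF A0] cell_norm_le[OF that] R by (intro mult_left_mono) auto
  qed (use R2 in auto)
  define u where "u \<beta> x = f (\<lambda>t. \<eta> (t - x) * cis (t \<bullet> \<beta>))" for \<beta> x
  have ub: "cmod (u \<beta> x) \<le> C * A1 * exp (T * norm \<beta>)" if "x \<in> cell E'" for \<beta> x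
    unfolding u_def by (rule fcis[OF Sigma1_translate[OF eta] A1[OF that]])
  have um: "u \<beta> \<in> borel_measurable borel" for \<beta>
    unfolding u_def by (rule borel_measurable_continuous_onI[OF Sigma1_dual_translate_continuous[OF f(1) eta]])
  define c0 where "c0 \<beta> = (LINT x:cell E'|lborel. u \<beta> x)" for \<beta>
  have key: "of_real cell_vol * fourier_int \<eta> 0 * f \<psi> = (\<Sum>\<^sub>\<infinity>\<beta>\<in>basis_lattice E'. fourier_int \<psi> \<beta> * c0 \<beta>)"
    if psi: "\<psi> \<in> Sigma1" for \<psi>
  proof -
    have T1: "T + 1 > 0" using T by simp
    obtain B where B: "B > 0" "\<And>\<xi>. cmod (fourier_int \<eta> \<xi>) \<le> B * exp (- ((T + 1) * norm \<xi>))"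
      using Sigma1_fourier_int_decay[OF eta T1] by blast
    obtain B' where B': "B' > 0" "\<And>\<xi>. cmod (fourier_int \<psi> \<xi>) \<le> B' * exp (- ((T + 1) * norm \<xi>))"
      using Sigma1_fourier_int_decay[OF psi T1] by blast
    obtain A where A: "exp_bound (2 * R) A \<psi>" using Sigma1_exp_bound[OF psi R2] by blast
    \<comment> \<open>Decay at rate \<open>T + 1\<close> against growth at rate \<open>T\<close>
      leaves the summable rate 1; this majorizes the terms on both sides of the swap.\<close>
    have comb: "a * b \<le> (B1 * D) * exp (- (1 * n))" if "a \<le> B1 * exp (- ((T + 1) * n))" "b \<le> D * exp (T * n)" "0 \<le> a" "0 \<le> b" for a b B1 D n :: real
    proof -
      have "a * b \<le> (B1 * exp (- ((T + 1) * n))) * (D * exp (T * n))" using that by (intro mult_mono) auto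
      also have "\<dots> = (B1 * D) * (exp (- ((T + 1) * n)) * exp (T * n))" by simp
      also have "exp (- ((T + 1) * n)) * exp (T * n) = exp (- (1 * n))" unfolding exp_add[symmetric] by (simp add: algebra_simps)
      finally show ?thesis .
    qed
    note s1 = dual.summable_on_exp_lattice[OF zero_less_one]
    define v where "v \<beta> = fourier_int \<eta> \<beta> * f (\<lambda>t. \<psi> t * cis (t \<bullet> \<beta>))" for \<beta>
    have "((\<lambda>\<beta>. LINT x:cell E'|lborel. cis (x \<bullet> (- \<beta>)) * v \<beta>) has_sum (LINT x:cell E'|lborel. (\<Sum>\<^sub>\<infinity>\<beta>\<in>basis_lattice E'. cis (x \<bullet> (- \<beta>)) * v \<beta>))) (basis_lattice E')"
    proof (rule cell_integral_infsum[OF dual.countable_lattice])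
      show "cmod (cis (x \<bullet> (- \<beta>)) * v \<beta>) \<le> (B * (C * A)) * exp (- (1 * norm \<beta>))" for x \<beta>
      proof -
        have "cmod (cis (x \<bullet> (- \<beta>)) * v \<beta>) = cmod (fourier_int \<eta> \<beta>) * cmod (f (\<lambda>t. \<psi> t * cis (t \<bullet> \<beta>)))"
          by (simp add: v_def norm_mult)
        also have "\<dots> \<le> (B * (C * A)) * exp (- (1 * norm \<beta>))"
          by (rule comb[OF B(2) fcis[OF psi A]]) auto
        finally show ?thesis .
      qed
      show "(\<lambda>\<beta>. (B * (C * A)) * exp (- (1 * norm \<beta>))) summable_on basis_lattice E'" by (rule summable_on_cmult_right[OF s1])
    qed measurable
    then have L: "(LINT x:cell E'|lborel. (\<Sum>\<^sub>\<infinity>\<beta>\<in>basis_lattice E'. cis (x \<bullet> (- \<beta>)) * v \<beta>)) = (\<Sum>\<^sub>\<infinity>\<beta>\<in>basis_lattice E'. LINT x:cell E'|lborel. cis (x \<bullet> (- \<beta>)) * v \<beta>)"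
      by (rule infsumI[symmetric])
    have t: "(LINT x:cell E'|lborel. cis (x \<bullet> (- \<beta>)) * v \<beta>) = (if \<beta> = 0 then of_real cell_vol * v 0 else 0)" if "\<beta> \<in> basis_lattice E'" for \<beta>
    proof -
      have "(LINT x:cell E'|lborel. cis (x \<bullet> (- \<beta>)) * v \<beta>) = (LINT x:cell E'|lborel. cis (x \<bullet> (- \<beta>))) * v \<beta>"
        by (rule set_integral_mult_left)
      also have "\<dots> = (if \<beta> = 0 then of_real cell_vol * v 0 else 0)"
        using cell_integral_cis[of "- \<beta>"] that by auto
      finally show ?thesis .
    qed
    have "((\<lambda>\<beta>. if \<beta> = 0 then of_real cell_vol * v 0 else 0) has_sum (of_real cell_vol * v 0)) (basis_lattice E')"
      using infsum_single_support[of 0 "basis_lattice E'" "\<lambda>\<beta>. if \<beta> = 0 then of_real cell_vol * v 0 else 0"] by simp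
    then have "(\<Sum>\<^sub>\<infinity>\<beta>\<in>basis_lattice E'. LINT x:cell E'|lborel. cis (x \<bullet> (- \<beta>)) * v \<beta>) = of_real cell_vol * v 0"
      using t by (simp add: infsumI cong: infsum_cong)
    moreover have "v 0 = fourier_int \<eta> 0 * f \<psi>" by (simp add: v_def)
    ultimately have L': "(LINT x:cell E'|lborel. (\<Sum>\<^sub>\<infinity>\<beta>\<in>basis_lattice E'. cis (x \<bullet> (- \<beta>)) * v \<beta>)) = of_real cell_vol * fourier_int \<eta> 0 * f \<psi>"
      using L by simp
    have "((\<lambda>\<beta>. LINT x:cell E'|lborel. fourier_int \<psi> \<beta> * u \<beta> x) has_sum (LINT x:cell E'|lborel. (\<Sum>\<^sub>\<infinity>\<beta>\<in>basis_lattice E'. fourier_int \<psi> \<beta> * u \<beta> x))) (basis_lattice E')"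
    proof (rule cell_integral_infsum[OF dual.countable_lattice])
      show "(\<lambda>x. fourier_int \<psi> \<beta> * u \<beta> x) \<in> borel_measurable borel" for \<beta> using um by simp
      show "cmod (fourier_int \<psi> \<beta> * u \<beta> x) \<le> (B' * (C * A1)) * exp (- (1 * norm \<beta>))" if "x \<in> cell E'" for x \<beta>
        unfolding norm_mult by (rule comb[OF B'(2) ub[OF that]]) auto
      show "(\<lambda>\<beta>. (B' * (C * A1)) * exp (- (1 * norm \<beta>))) summable_on basis_lattice E'" by (rule summable_on_cmult_right[OF s1])
    qed
    then have R1: "(\<Sum>\<^sub>\<infinity>\<beta>\<in>basis_lattice E'. LINT x:cell E'|lborel. fourier_int \<psi> \<beta> * u \<beta> x) = (LINT x:cell E'|lborel. (\<Sum>\<^sub>\<infinity>\<beta>\<in>basis_lattice E'. fourier_int \<psi> \<beta> * u \<beta> x))"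
      by (rule infsumI)
    have R2: "(LINT x:cell E'|lborel. fourier_int \<psi> \<beta> * u \<beta> x) = fourier_int \<psi> \<beta> * c0 \<beta>" for \<beta>
      unfolding c0_def by (rule set_integral_mult_right)
    have R3: "(\<Sum>\<^sub>\<infinity>\<beta>\<in>basis_lattice E'. cis (x \<bullet> (- \<beta>)) * v \<beta>) = (\<Sum>\<^sub>\<infinity>\<beta>\<in>basis_lattice E'. fourier_int \<psi> \<beta> * u \<beta> x)" for x
      using dual_swap[OF f Sigma1_translate[OF eta, of x] psi]
      unfolding fourier_int_translate[OF Sigma1_borel[OF eta]] u_def v_def by (simp add: mult.assoc)
    show ?thesis using L' unfolding R3 R1[symmetric] R2 by (rule sym)
  qed
  define K where "K = of_real cell_vol * fourier_int \<eta> 0"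
  have K: "K \<noteq> 0" unfolding K_def using cell_vol_pos eta0 by simp
  \<comment> \<open>The sign changes because an expansion pairs \<open>c \<alpha>\<close> with the
    transform at \<open>- \<alpha>\<close>.\<close>
  define c where "c \<alpha> = (if \<alpha> \<in> basis_lattice E' then c0 (- \<alpha>) / K else 0)" for \<alpha>
  have "has_expansion E' f c" unfolding has_expansion_iff
  proof (intro conjI ballI)
    show "c \<in> formal_expansions E'" by (simp add: c_def formal_expansions_def)
    have "cmod (c \<alpha>) \<le> (cell_vol * C * \<bar>A1\<bar> / cmod K + 1) * exp (T * norm \<alpha>)" if "\<alpha> \<in> basis_lattice E'" for \<alpha>
    proof -
      have "cmod (c0 (- \<alpha>)) \<le> C * A1 * exp (T * norm (- \<alpha>)) * cell_vol"
        unfolding c0_def by (rule cell_integral_norm_le) (rule ub)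
      also have "\<dots> \<le> C * \<bar>A1\<bar> * exp (T * norm \<alpha>) * cell_vol"
        using Cpos cell_vol_pos by (intro mult_right_mono mult_left_mono) auto
      finally have "cmod (c0 (- \<alpha>)) / cmod K \<le> (C * \<bar>A1\<bar> * exp (T * norm \<alpha>) * cell_vol) / cmod K"
        by (intro divide_right_mono) auto
      then have "cmod (c \<alpha>) \<le> (cell_vol * C * \<bar>A1\<bar> / cmod K) * exp (T * norm \<alpha>)"
        using that by (simp add: c_def norm_divide mult_ac)
      also have "\<dots> \<le> (cell_vol * C * \<bar>A1\<bar> / cmod K + 1) * exp (T * norm \<alpha>)" by (intro mult_right_mono) auto
      finally show ?thesis .
    qed
    moreover have "cell_vol * C * \<bar>A1\<bar> / cmod K + 1 > 0" using Cpos cell_vol_pos by (simp add: add_nonneg_pos)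
    ultimately show "\<exists>C>0. \<exists>R>0. \<forall>\<alpha>\<in>basis_lattice E'. cmod (c \<alpha>) \<le> C * exp (R * norm \<alpha>)" using T by blast
    fix \<psi> :: "real^'n \<Rightarrow> complex" assume psi: "\<psi> \<in> Sigma1"
    have "K * f \<psi> = (\<Sum>\<^sub>\<infinity>\<beta>\<in>basis_lattice E'. fourier_int \<psi> (- \<beta>) * c0 (- \<beta>))"
      using key[OF psi] dual.infsum_lattice_uminus[of "\<lambda>\<beta>. fourier_int \<psi> \<beta> * c0 \<beta>"] by (simp add: K_def)
    then have "f \<psi> = inverse K * (\<Sum>\<^sub>\<infinity>\<beta>\<in>basis_lattice E'. fourier_int \<psi> (- \<beta>) * c0 (- \<beta>))" using K by (simp add: field_simps)
    also have "\<dots> = (\<Sum>\<^sub>\<infinity>\<beta>\<in>basis_lattice E'. c \<beta> * fourier_int \<psi> (- \<beta>))"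
      unfolding infsum_cmult_right'[symmetric] by (intro infsum_cong) (simp add: c_def divide_inverse mult_ac)
    finally show "f \<psi> = (\<Sum>\<^sub>\<infinity>\<alpha>\<in>basis_lattice E'. c \<alpha> * fourier_int \<psi> (- \<alpha>))" .
  qed
  then show ?thesis by blast
qed

text \<open>The series itself is taken as the functional. It is bounded because the transform of a
  function with an exponential bound of large rate decays faster than \<open>c\<close> grows;
  periodicity holds since characters of the dual lattice are 1 at the vectors of
  \<open>E\<close>.\<close>

lemma expansion_exists:
  assumes c: "c \<in> formal_expansions E'" and C: "C > 0" and R: "R > 0" and g: "\<And>\<alpha>. \<alpha> \<in> basis_lattice E' \<Longrightarrow> cmod (c \<alpha>) \<le> C * exp (R * norm \<alpha>)"
  obtains f where "f \<in> Sigma1_dual" "periodic E f" "has_expansion E' f c"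
proof -
  interpret dual: dual_pair E' E by (rule dual)
  define f where "f = restrict (\<lambda>\<psi>. \<Sum>\<^sub>\<infinity>\<alpha>\<in>basis_lattice E'. c \<alpha> * fourier_int \<psi> (- \<alpha>)) Sigma1"
  \<comment> \<open>\<open>fourier_int_decay\<close> divides the rate by
    \<open>2 * CARD('n)\<close>, so this \<open>S\<close> gives decay at rate \<open>R + 1\<close>,
    one more than the growth of \<open>c\<close>.\<close>
  define S where "S = 2 * real CARD('n) * (R + 1)"
  have S: "S > 0" "S / (2 * real CARD('n)) = R + 1" using R by (auto simp: S_def)
  define J where "J = (\<integral>x. exp (- (S * norm (x::real^'n))) \<partial>lborel)"
  note s1 = dual.summable_on_exp_lattice[OF zero_less_one]
  have b: "cmod (c \<alpha> * fourier_int \<psi> (- \<alpha>)) \<le> (4 * C * J * A) * exp (- (1 * norm \<alpha>))"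
    if "\<alpha> \<in> basis_lattice E'" "\<psi> \<in> Sigma1" "exp_bound S A \<psi>" for \<alpha> \<psi> A
  proof -
    have "cmod (fourier_int \<psi> (- \<alpha>)) \<le> 4 * A * J * exp (- ((R + 1) * norm \<alpha>))"
      using fourier_int_decay[OF that(2) S(1) that(3), of "- \<alpha>"] unfolding S(2) J_def by simp
    then have "cmod (c \<alpha> * fourier_int \<psi> (- \<alpha>)) \<le> (C * exp (R * norm \<alpha>)) * (4 * A * J * exp (- ((R + 1) * norm \<alpha>)))"
      unfolding norm_mult using g[OF that(1)] C by (intro mult_mono) auto
    also have "\<dots> = (4 * C * J * A) * (exp (R * norm \<alpha>) * exp (- ((R + 1) * norm \<alpha>)))" by simp
    also have "exp (R * norm \<alpha>) * exp (- ((R + 1) * norm \<alpha>)) = exp (- (1 * norm \<alpha>))"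
      unfolding exp_add[symmetric] by (simp add: algebra_simps)
    finally show ?thesis .
  qed
  have sm: "(\<lambda>\<alpha>. c \<alpha> * fourier_int \<psi> (- \<alpha>)) summable_on basis_lattice E'" if psi: "\<psi> \<in> Sigma1" for \<psi>
  proof -
    obtain A where "exp_bound S A \<psi>" using Sigma1_exp_bound[OF psi S(1)] by blast
    from abs_summable_bound(2)[OF s1 b[OF _ psi this]] show ?thesis .
  qed
  have "f \<in> Sigma1_dual"
  proof (rule Sigma1_dualI[OF _ _ _ S(1)])
    show "f \<in> extensional Sigma1" by (simp add: f_def)
    show "f (\<lambda>x. \<phi> x + \<psi> x) = f \<phi> + f \<psi>" if "\<phi> \<in> Sigma1" "\<psi> \<in> Sigma1" for \<phi> \<psi>
      using that infsum_add[OF sm[OF that(1)] sm[OF that(2)]]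
      by (simp add: f_def Sigma1_add fourier_int_add distrib_left)
    show "f (\<lambda>x. a * \<phi> x) = a * f \<phi>" if "\<phi> \<in> Sigma1" for a \<phi>
      using that by (simp add: f_def Sigma1_cmult fourier_int_cmult infsum_cmult_right'[symmetric] mult.left_commute)
    show "cmod (f \<psi>) \<le> (4 * C * J * (\<Sum>\<^sub>\<infinity>\<alpha>\<in>basis_lattice E'. exp (- (1 * norm \<alpha>)))) * A" if "\<psi> \<in> Sigma1" "exp_bound S A \<psi>" for \<psi> A
      using norm_infsum_le_cmult[OF s1 b[OF _ that]] that(1) by (simp add: f_def mult_ac)
  qed
  moreover have "periodic E f" unfolding periodic_def
  proof (intro ballI)
    fix y and \<phi> :: "real^'n \<Rightarrow> complex" assume y: "y \<in> set E" and phi: "\<phi> \<in> Sigma1"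
    have yl: "y \<in> basis_lattice E" unfolding in_lattice_iff
      using y inner_dual length_eq by (auto simp: in_set_conv_nth)
    have "c \<alpha> * fourier_int (\<lambda>x. \<phi> (x - y)) (- \<alpha>) = c \<alpha> * fourier_int \<phi> (- \<alpha>)" if "\<alpha> \<in> basis_lattice E'" for \<alpha>
      unfolding fourier_int_translate[OF Sigma1_borel[OF phi]] using cis_lattice[OF yl that] by simp
    then have "(\<Sum>\<^sub>\<infinity>\<alpha>\<in>basis_lattice E'. c \<alpha> * fourier_int (\<lambda>x. \<phi> (x - y)) (- \<alpha>)) = (\<Sum>\<^sub>\<infinity>\<alpha>\<in>basis_lattice E'. c \<alpha> * fourier_int \<phi> (- \<alpha>))"
      by (rule infsum_cong)
    then show "f (\<lambda>x. \<phi> (x - y)) = f \<phi>" using phi Sigma1_translate[OF phi] by (simp add: f_def)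
  qed
  moreover have "has_expansion E' f c" unfolding has_expansion_iff using c C R g by (auto simp: f_def)
  ultimately show thesis using that by blast
qed

text \<open>The unimodular factor turns the frequencies into differences \<alpha> - \<beta>. For
  \<beta> in the dual lattice an integral over the cell then isolates the term \<alpha> = \<beta>,
  and the variation of the other terms in \<open>x\<close> is measured by their distance from
  \<beta> instead of the size of \<alpha>.\<close>

lemma STFT_expansion:
  assumes ex: "has_expansion E' f c" and phi: "\<phi> \<in> Sigma1"
  shows "cis (x \<bullet> (\<xi> - \<beta>)) * STFT \<phi> f x \<xi> = of_real (stft_const TYPE('n)) *
    (\<Sum>\<^sub>\<infinity>\<alpha>\<in>basis_lattice E'. c \<alpha> * (cis (x \<bullet> (\<alpha> - \<beta>)) * cnj (fourier_int \<phi> (\<alpha> - \<xi>))))"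
proof -
  define g where "g = (\<lambda>y. cnj (\<phi> (y - x)) * cis (y \<bullet> (- \<xi>)))"
  have tr: "(\<lambda>y. \<phi> (y - x)) \<in> Sigma1" by (rule Sigma1_translate[OF phi])
  have g: "g \<in> Sigma1" unfolding g_def by (rule Sigma1_cis[OF Sigma1_cnj[OF tr]])
  have "fourier_int g (- \<alpha>) = cnj (fourier_int (\<lambda>y. \<phi> (y - x)) (\<alpha> - \<xi>))" for \<alpha>
    unfolding g_def fourier_int_cis fourier_int_cnj by simp
  then have fg: "fourier_int g (- \<alpha>) = cis (x \<bullet> (\<alpha> - \<xi>)) * cnj (fourier_int \<phi> (\<alpha> - \<xi>))" for \<alpha>
    unfolding fourier_int_translate[OF Sigma1_borel[OF phi]] by (simp add: cis_cnj)
  have "(\<lambda>y. cnj (\<phi> (y - x) * exp (\<i> * of_real (y \<bullet> \<xi>)))) = g"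
    unfolding g_def cis_conv_exp[symmetric] by (simp add: cis_cnj)
  then have "STFT \<phi> f x \<xi> = of_real (stft_const TYPE('n)) * f g" by (simp add: STFT_def stft_const_def)
  also have "f g = (\<Sum>\<^sub>\<infinity>\<alpha>\<in>basis_lattice E'. c \<alpha> * fourier_int g (- \<alpha>))" using ex g by (simp add: has_expansion_iff)
  finally have S: "STFT \<phi> f x \<xi> = of_real (stft_const TYPE('n)) * (\<Sum>\<^sub>\<infinity>\<alpha>\<in>basis_lattice E'. c \<alpha> * (cis (x \<bullet> (\<alpha> - \<xi>)) * cnj (fourier_int \<phi> (\<alpha> - \<xi>))))"
    unfolding fg .
  have m: "cis (x \<bullet> (\<xi> - \<beta>)) * (c \<alpha> * (cis (x \<bullet> (\<alpha> - \<xi>)) * cnj (fourier_int \<phi> (\<alpha> - \<xi>)))) = c \<alpha> * (cis (x \<bullet> (\<alpha> - \<beta>)) * cnj (fourier_int \<phi> (\<alpha> - \<xi>)))" for \<alpha>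
  proof -
    have "cis (x \<bullet> (\<xi> - \<beta>)) * cis (x \<bullet> (\<alpha> - \<xi>)) = cis (x \<bullet> (\<alpha> - \<beta>))" by (simp add: cis_mult inner_diff_right)
    then show ?thesis by (metis mult.assoc mult.left_commute)
  qed
  have "cis (x \<bullet> (\<xi> - \<beta>)) * STFT \<phi> f x \<xi> = of_real (stft_const TYPE('n)) * (cis (x \<bullet> (\<xi> - \<beta>)) *
      (\<Sum>\<^sub>\<infinity>\<alpha>\<in>basis_lattice E'. c \<alpha> * (cis (x \<bullet> (\<alpha> - \<xi>)) * cnj (fourier_int \<phi> (\<alpha> - \<xi>)))))"
    unfolding S by (simp only: mult.left_commute)
  then show ?thesis unfolding infsum_cmult_right'[symmetric] m .
qed

text \<open>Integration term by term and orthogonality of the characters over the cell. The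
  transform of the window is bounded at rate \<open>R + 1\<close>, one more than the growth of
  \<open>c\<close>, to justify the exchange.\<close>

lemma STFT_coefficient:
  assumes ex: "has_expansion E' f c" and phi: "\<phi> \<in> Sigma1" and be: "\<beta> \<in> basis_lattice E'"
  shows "(LINT x:cell E'|lborel. cis (x \<bullet> (\<xi> - \<beta>)) * STFT \<phi> f x \<xi>) =
    of_real (stft_const TYPE('n) * cell_vol) * (c \<beta> * cnj (fourier_int \<phi> (\<beta> - \<xi>)))"
proof -
  interpret dual: dual_pair E' E by (rule dual)
  obtain C R where C: "C > 0" "R > 0" "\<And>\<alpha>. \<alpha> \<in> basis_lattice E' \<Longrightarrow> cmod (c \<alpha>) \<le> C * exp (R * norm \<alpha>)"
    using ex unfolding has_expansion_iff by blast
  obtain B where B: "B > 0" "\<And>\<xi>. cmod (fourier_int \<phi> \<xi>) \<le> B * exp (- ((R + 1) * norm \<xi>))"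
    using Sigma1_fourier_int_decay[OF phi, of "R + 1"] C(2) by auto
  define h where "h \<alpha> x = c \<alpha> * (cis (x \<bullet> (\<alpha> - \<beta>)) * cnj (fourier_int \<phi> (\<alpha> - \<xi>)))" for \<alpha> x
  have "((\<lambda>\<alpha>. LINT x:cell E'|lborel. h \<alpha> x) has_sum (LINT x:cell E'|lborel. (\<Sum>\<^sub>\<infinity>\<alpha>\<in>basis_lattice E'. h \<alpha> x))) (basis_lattice E')"
  proof (rule cell_integral_infsum[OF dual.countable_lattice])
    show "h \<alpha> \<in> borel_measurable borel" for \<alpha> unfolding h_def by measurable
    show "(\<lambda>\<alpha>. (C * B * exp ((R + 1) * norm \<xi>)) * exp (- (1 * norm \<alpha>))) summable_on basis_lattice E'"
      by (rule summable_on_cmult_right[OF dual.summable_on_exp_lattice]) simp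
    fix \<alpha> x assume al: "\<alpha> \<in> basis_lattice E'"
    have "cmod (h \<alpha> x) = cmod (c \<alpha>) * cmod (fourier_int \<phi> (\<alpha> - \<xi>))" by (simp add: h_def norm_mult)
    also have "\<dots> \<le> (C * exp (R * norm \<alpha>)) * (B * exp (- ((R + 1) * norm (\<alpha> - \<xi>))))"
      using C(1) by (intro mult_mono C(3)[OF al] B(2)) auto
    also have "\<dots> = C * B * (exp (R * norm \<alpha>) * exp (- ((R + 1) * norm (\<alpha> - \<xi>))))" by simp
    also have "\<dots> \<le> C * B * (exp ((R + 1) * norm \<xi>) * exp (- (1 * norm \<alpha>)))"
    proof (rule mult_left_mono)
      have "(R + 1) * norm \<alpha> \<le> (R + 1) * (norm \<xi> + norm (\<alpha> - \<xi>))"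
        using norm_triangle_sub[of \<alpha> \<xi>] C(2) by (intro mult_left_mono) auto
      then show "exp (R * norm \<alpha>) * exp (- ((R + 1) * norm (\<alpha> - \<xi>))) \<le> exp ((R + 1) * norm \<xi>) * exp (- (1 * norm \<alpha>))"
        unfolding exp_add[symmetric] by (simp add: algebra_simps)
    qed (use C(1) B(1) in auto)
    finally show "cmod (h \<alpha> x) \<le> (C * B * exp ((R + 1) * norm \<xi>)) * exp (- (1 * norm \<alpha>))" by (simp add: mult_ac)
  qed
  then have 1: "(LINT x:cell E'|lborel. (\<Sum>\<^sub>\<infinity>\<alpha>\<in>basis_lattice E'. h \<alpha> x)) = (\<Sum>\<^sub>\<infinity>\<alpha>\<in>basis_lattice E'. LINT x:cell E'|lborel. h \<alpha> x)"
    by (rule infsumI[symmetric])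
  let ?v = "of_real cell_vol * (c \<beta> * cnj (fourier_int \<phi> (\<beta> - \<xi>)))"
  have t: "(LINT x:cell E'|lborel. h \<alpha> x) = (if \<alpha> = \<beta> then ?v else 0)" if "\<alpha> \<in> basis_lattice E'" for \<alpha>
  proof -
    have "(LINT x:cell E'|lborel. h \<alpha> x) = (LINT x:cell E'|lborel. (c \<alpha> * cnj (fourier_int \<phi> (\<alpha> - \<xi>))) * cis (x \<bullet> (\<alpha> - \<beta>)))"
      unfolding h_def by (simp only: mult_ac)
    also have "\<dots> = (c \<alpha> * cnj (fourier_int \<phi> (\<alpha> - \<xi>))) * (LINT x:cell E'|lborel. cis (x \<bullet> (\<alpha> - \<beta>)))"
      by (rule set_integral_mult_right)
    finally show ?thesis unfolding cell_integral_cis[OF dual.lattice_diff[OF that be]] by auto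
  qed
  have "((\<lambda>\<alpha>. if \<alpha> = \<beta> then ?v else 0) has_sum ?v) (basis_lattice E')"
    using infsum_single_support[OF be, of "\<lambda>\<alpha>. if \<alpha> = \<beta> then ?v else 0"] by simp
  then have 2: "(\<Sum>\<^sub>\<infinity>\<alpha>\<in>basis_lattice E'. LINT x:cell E'|lborel. h \<alpha> x) = ?v" using t by (simp add: infsumI cong: infsum_cong)
  have "(LINT x:cell E'|lborel. cis (x \<bullet> (\<xi> - \<beta>)) * STFT \<phi> f x \<xi>) =
      (LINT x:cell E'|lborel. of_real (stft_const TYPE('n)) * (\<Sum>\<^sub>\<infinity>\<alpha>\<in>basis_lattice E'. h \<alpha> x))"
    unfolding STFT_expansion[OF ex phi] h_def ..
  also have "\<dots> = of_real (stft_const TYPE('n)) * (LINT x:cell E'|lborel. (\<Sum>\<^sub>\<infinity>\<alpha>\<in>basis_lattice E'. h \<alpha> x))"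
    by (rule set_integral_mult_right)
  finally show ?thesis unfolding 1 2 by (simp add: mult.assoc)
qed

text \<open>The coefficient formula determines \<open>c \<beta>\<close> from \<open>f\<close> once
  \<xi> is chosen so that the transform of the window at \<open>\<beta> - \<xi>\<close> is
  nonzero.\<close>

lemma expansion_unique:
  fixes \<phi> :: "real^'n \<Rightarrow> complex"
  assumes "has_expansion E' f c" "has_expansion E' f c'" and phi: "\<phi> \<in> Sigma1" "\<phi> \<noteq> (\<lambda>_. 0)"
  shows "c = c'"
proof
  fix \<beta>
  obtain \<xi>0 where xi0: "fourier_int \<phi> \<xi>0 \<noteq> 0" using fourier_int_nonzero[OF phi] by blast
  show "c \<beta> = c' \<beta>"
  proof (cases "\<beta> \<in> basis_lattice E'")
    case True
    have "of_real (stft_const TYPE('n) * cell_vol) * (c \<beta> * cnj (fourier_int \<phi> (\<beta> - (\<beta> - \<xi>0)))) =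
       of_real (stft_const TYPE('n) * cell_vol) * (c' \<beta> * cnj (fourier_int \<phi> (\<beta> - (\<beta> - \<xi>0))))"
      using STFT_coefficient[OF assms(1) phi(1) True] STFT_coefficient[OF assms(2) phi(1) True] by metis
    then show ?thesis using xi0 cell_vol_pos stft_const_pos[where 'n = 'n] by simp
  next
    case False
    then show ?thesis using assms(1,2) by (simp add: has_expansion_iff formal_expansions_def)
  qed
qed

lemma expansion_of_eq:
  fixes \<phi> :: "real^'n \<Rightarrow> complex"
  assumes "has_expansion E' f c" "\<phi> \<in> Sigma1" "\<phi> \<noteq> (\<lambda>_. 0)"
  shows "expansion_of E' f = c"
  unfolding expansion_of_def
proof (rule the_equality)
  show "has_expansion E' f c" by (rule assms(1))
  show "c' = c" if "has_expansion E' f c'" for c' by (rule expansion_unique[OF that assms(1) assms(2,3)])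
qed

end

section \<open>Discretization of mixed norms\<close>

lemma ennpowr_top [simp]: "ennpowr \<infinity> a = \<infinity>" "ennpowr top a = top"
  by (simp_all add: ennpowr_def)

lemma ennpowr_ennreal: "x \<ge> 0 \<Longrightarrow> ennpowr (ennreal x) a = ennreal (x powr a)"
  by (simp add: ennpowr_def)

lemma ennpowr_0 [simp]: "ennpowr 0 a = 0"
  by (simp add: ennpowr_def)

lemma ennpowr_mono:
  assumes "a > 0" "x \<le> y" shows "ennpowr x a \<le> ennpowr y a"
proof (cases "y = \<infinity>")
  case False
  then have "x \<noteq> \<infinity>" using assms(2) by (metis infinity_ennreal_def top_unique)
  then show ?thesis using False assms
    by (auto simp: ennpowr_def enn2real_mono less_top intro!: ennreal_leI powr_mono2)
qed simp

lemma ennpowr_inverse: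
  assumes "a > 0" shows "ennpowr (ennpowr x a) (1 / a) = x" "ennpowr (ennpowr x (1 / a)) a = x"
  using assms by (cases x; simp add: ennpowr_ennreal powr_powr)+

lemma ennpowr_mult:
  assumes "a > 0" "c > 0" shows "ennpowr (x * ennreal c) a = ennpowr x a * ennreal (c powr a)"
proof (cases x)
  case (real r)
  then show ?thesis using assms by (simp add: ennreal_mult[symmetric] ennpowr_ennreal powr_mult)
next
  case top
  then show ?thesis using assms by (simp add: ennreal_top_mult)
qed

lemma ennpowr_SUP_le:
  assumes "a > 0" "\<And>i. i \<in> I \<Longrightarrow> ennpowr (f i) a \<le> S" shows "ennpowr (SUP i\<in>I. f i) a \<le> S"
proof -
  have "f i \<le> ennpowr S (1 / a)" if "i \<in> I" for i
    using ennpowr_mono[OF _ assms(2)[OF that], of "1 / a"] assms(1) ennpowr_inverse(1)[OF assms(1)] by simp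
  then have "(SUP i\<in>I. f i) \<le> ennpowr S (1 / a)" by (rule SUP_least)
  from ennpowr_mono[OF assms(1) this] show ?thesis using ennpowr_inverse(2)[OF assms(1)] by simp
qed

lemma Lp_norm_mono:
  assumes "p > 0" "\<And>x. f x \<le> g x" shows "Lp_norm p f \<le> Lp_norm p g"
proof (cases "p = \<infinity>")
  case True
  have "{c. AE x in lebesgue. g x \<le> c} \<subseteq> {c. AE x in lebesgue. f x \<le> c}"
    using assms(2) by (auto elim!: eventually_mono intro: order_trans)
  then show ?thesis using True by (simp add: Lp_norm_def Inf_superset_mono)
next
  case False
  then have "enn2real p > 0" using assms(1) by (simp add: enn2real_positive_iff less_top)
  then show ?thesis using False assms by (auto simp: Lp_norm_def intro!: ennpowr_mono nn_integral_mono)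
qed

text \<open>\<open>nn_integral\<close> is monotone on arbitrary functions, so mixed norms can be
  compared pointwise. Functions whose inner norms are hard to control are squeezed between step
  functions in this way.\<close>

lemma mixed_norm_mono:
  assumes "\<forall>p\<in>set q. p > 0" "\<And>xs. length xs = length q \<Longrightarrow> g xs \<le> g' xs"
  shows "mixed_norm q g \<le> mixed_norm q g'"
  using assms
proof (induction q arbitrary: g g')
  case (Cons p q)
  show ?case unfolding mixed_norm.simps
    by (rule Cons.IH) (use Cons.prems in \<open>auto intro!: Lp_norm_mono\<close>)
qed simp

definition lp_norm :: "ennreal \<Rightarrow> (int \<Rightarrow> ennreal) \<Rightarrow> ennreal" where
  "lp_norm p b = (if p = \<infinity> then (SUP k. b k)
     else ennpowr (\<integral>\<^sup>+k. ennpowr (b k) (enn2real p) \<partial>count_space UNIV) (1 / enn2real p))"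

fun disc_mixed_norm :: "ennreal list \<Rightarrow> (int list \<Rightarrow> ennreal) \<Rightarrow> ennreal" where
  "disc_mixed_norm [] b = b []"
| "disc_mixed_norm (q # qs) b = disc_mixed_norm qs (\<lambda>ks. lp_norm q (\<lambda>k. b (k # ks)))"

lemma enn2real_exponent_pos: "p > 0 \<Longrightarrow> p \<noteq> \<infinity> \<Longrightarrow> enn2real p > 0"
  by (simp add: enn2real_positive_iff less_top)

lemma lp_norm_mono:
  assumes "p > 0" "\<And>k. f k \<le> g k" shows "lp_norm p f \<le> lp_norm p g"
  using assms enn2real_exponent_pos[of p]
  by (auto simp: lp_norm_def intro!: ennpowr_mono nn_integral_mono SUP_mono)

lemma disc_mixed_norm_mono:
  assumes "\<forall>p\<in>set q. p > 0" "\<And>ks. length ks = length q \<Longrightarrow> g ks \<le> g' ks"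
  shows "disc_mixed_norm q g \<le> disc_mixed_norm q g'"
  using assms
proof (induction q arbitrary: g g')
  case (Cons p q)
  show ?case unfolding disc_mixed_norm.simps
    by (rule Cons.IH) (use Cons.prems in \<open>auto intro!: lp_norm_mono\<close>)
qed simp

lemma lp_norm_ge:
  assumes "p > 0" shows "b k \<le> lp_norm p b"
proof (cases "p = \<infinity>")
  case True then show ?thesis by (auto simp: lp_norm_def intro: SUP_upper)
next
  case False
  have pos: "enn2real p > 0" using enn2real_exponent_pos[OF assms False] .
  have "ennpowr (b k) (enn2real p) = (\<integral>\<^sup>+j. ennpowr (b j) (enn2real p) * indicator {k} j \<partial>count_space UNIV)"
    by (subst nn_integral_count_space'[of "{k}"]) (auto simp: indicator_def)
  also have "\<dots> \<le> (\<integral>\<^sup>+j. ennpowr (b j) (enn2real p) \<partial>count_space UNIV)"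
    by (intro nn_integral_mono) (auto simp: indicator_def)
  finally have "ennpowr (ennpowr (b k) (enn2real p)) (1 / enn2real p) \<le> lp_norm p b"
    using False pos by (auto simp: lp_norm_def intro: ennpowr_mono)
  then show ?thesis using ennpowr_inverse(1)[OF pos] by simp
qed

lemma disc_mixed_norm_ge:
  assumes "\<forall>p\<in>set q. p > 0" "length ks = length q" shows "b ks \<le> disc_mixed_norm q b"
  using assms
proof (induction q arbitrary: b ks)
  case (Cons p q)
  then obtain k ks' where ks: "ks = k # ks'" "length ks' = length q" by (cases ks) auto
  have "b (k # ks') \<le> lp_norm p (\<lambda>k. b (k # ks'))" using lp_norm_ge[of p "\<lambda>k. b (k # ks')" k] Cons.prems by simp
  also have "\<dots> \<le> disc_mixed_norm q (\<lambda>ks. lp_norm p (\<lambda>k. b (k # ks)))"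
    using Cons.IH[of ks' "\<lambda>ks. lp_norm p (\<lambda>k. b (k # ks))"] Cons.prems ks by simp
  finally show ?case by (simp add: ks)
qed simp

lemma lp_norm_cmult:
  assumes "p > 0" "c > 0" shows "lp_norm p (\<lambda>k. ennreal c * b k) = ennreal c * lp_norm p b"
proof (cases "p = \<infinity>")
  case True then show ?thesis by (simp add: lp_norm_def SUP_mult_left_ennreal)
next
  case False
  have pos: "enn2real p > 0" using enn2real_exponent_pos[OF assms(1) False] .
  have "(\<integral>\<^sup>+k. ennpowr (ennreal c * b k) (enn2real p) \<partial>count_space UNIV) =
      (\<integral>\<^sup>+k. ennpowr (b k) (enn2real p) \<partial>count_space UNIV) * ennreal (c powr enn2real p)"
    using ennpowr_mult[OF pos assms(2)] by (simp add: mult.commute[of "ennreal c"] nn_integral_multc)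
  moreover have "ennpowr (X * ennreal (c powr enn2real p)) (1 / enn2real p) = ennpowr X (1 / enn2real p) * ennreal c" for X
    using ennpowr_mult[of "1 / enn2real p" "c powr enn2real p" X] pos assms(2) by (simp add: powr_powr)
  ultimately show ?thesis using False by (simp only: lp_norm_def if_False mult.commute[of "ennreal c"])
qed

lemma disc_mixed_norm_cmult:
  assumes "\<forall>p\<in>set q. p > 0" "c > 0"
  shows "disc_mixed_norm q (\<lambda>ks. ennreal c * b ks) = ennreal c * disc_mixed_norm q b"
  using assms by (induction q arbitrary: b) (auto simp: lp_norm_cmult)

lemma lp_norm_shift: "lp_norm p (\<lambda>k. b (k + m)) = lp_norm p b"
proof -
  have bij: "bij (\<lambda>k::int. k + m)" by (rule bij_betw_byWitness[where f' = "\<lambda>k. k - m"]) auto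
  have "(\<integral>\<^sup>+k. ennpowr (b (k + m)) a \<partial>count_space UNIV) = (\<integral>\<^sup>+k. ennpowr (b k) a \<partial>count_space UNIV)" for a
    using nn_integral_bij_count_space[OF bij, of "\<lambda>k. ennpowr (b k) a"] by simp
  moreover have "(SUP k. b (k + m)) = (SUP k. b k)"
  proof -
    have "range (\<lambda>k. b (k + m)) = b ` range (\<lambda>k. k + m)" by (simp only: image_image)
    then show ?thesis using bij by (simp only: bij_def)
  qed
  ultimately show ?thesis by (simp add: lp_norm_def)
qed

lemma disc_mixed_norm_shift:
  assumes "length ms = length q"
  shows "disc_mixed_norm q (\<lambda>ks. b (map2 (+) ks ms)) = disc_mixed_norm q b"
  using assms
proof (induction q arbitrary: b ms)
  case (Cons p q)
  then obtain m ms' where ms: "ms = m # ms'" "length ms' = length q" by (cases ms) auto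
  have "lp_norm p (\<lambda>k. b (map2 (+) (k # ks) ms)) = lp_norm p (\<lambda>k. b (k # map2 (+) ks ms'))" for ks
    using lp_norm_shift[of p "\<lambda>k. b (k # map2 (+) ks ms')" m] by (simp add: ms)
  then show ?case using Cons.IH[OF ms(2), of "\<lambda>ks. lp_norm p (\<lambda>k. b (k # ks))"] by simp
qed simp

text \<open>For finite \<open>p\<close> the \<open>p\<close>-th power of a supremum is at most the
  sum of the \<open>p\<close>-th powers, and for \<infinity> each entry is bounded by its norm.
  Inserting the factors \<open>\<kappa> i\<close> and taking them out again reduces the sum over
  \<open>i\<close> to that of \<open>\<kappa> i powr (- p)\<close>, which must converge even for
  small \<open>p\<close>.\<close>

lemma lp_norm_SUP_le:
  assumes p: "p > 0" and I: "countable I" and \<kappa>: "\<And>i. i \<in> I \<Longrightarrow> \<kappa> i \<ge> (1::real)"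
    and fin: "\<And>a. a > 0 \<Longrightarrow> (\<integral>\<^sup>+i. ennreal (\<kappa> i powr (- a)) \<partial>count_space I) < \<infinity>"
  shows "\<exists>C>0. \<forall>G. lp_norm p (\<lambda>k. SUP i\<in>I. G i k) \<le> ennreal C * (SUP i\<in>I. ennreal (\<kappa> i) * lp_norm p (G i))"
proof (cases "p = \<infinity>")
  case True
  have "lp_norm p (\<lambda>k. SUP i\<in>I. G i k) \<le> ennreal 1 * (SUP i\<in>I. ennreal (\<kappa> i) * lp_norm p (G i))" for G
  proof -
    have "G i k \<le> (SUP i\<in>I. ennreal (\<kappa> i) * lp_norm p (G i))" if i: "i \<in> I" for i k
    proof -
      have "G i k \<le> 1 * lp_norm p (G i)" using lp_norm_ge[OF p, of "G i" k] by simp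
      also have "\<dots> \<le> ennreal (\<kappa> i) * lp_norm p (G i)" using \<kappa>[OF i] by (intro mult_right_mono) auto
      also have "\<dots> \<le> (SUP i\<in>I. ennreal (\<kappa> i) * lp_norm p (G i))" using i by (rule SUP_upper)
      finally show ?thesis .
    qed
    then have "(SUP k. SUP i\<in>I. G i k) \<le> (SUP i\<in>I. ennreal (\<kappa> i) * lp_norm p (G i))" by (intro SUP_least)
    then show ?thesis using True by (simp add: lp_norm_def)
  qed
  then show ?thesis by (intro exI[of _ 1]) auto
next
  case False
  define a where "a = enn2real p"
  have a: "a > 0" unfolding a_def using enn2real_exponent_pos[OF p False] .
  define S where "S = (\<integral>\<^sup>+i. ennreal (\<kappa> i powr (- a)) \<partial>count_space I)"
  obtain s where s: "S = ennreal s" "s \<ge> 0" using fin[OF a] unfolding S_def[symmetric] by (cases S) auto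
  \<comment> \<open>With \<open>s + 1\<close> the constant is positive even if \<open>I\<close> is
    empty.\<close>
  define C where "C = (s + 1) powr (1 / a)"
  have "lp_norm p (\<lambda>k. SUP i\<in>I. G i k) \<le> ennreal C * (SUP i\<in>I. ennreal (\<kappa> i) * lp_norm p (G i))" for G
  proof -
    define T where "T = (SUP i\<in>I. ennreal (\<kappa> i) * lp_norm p (G i))"
    have t: "(\<integral>\<^sup>+k. ennpowr (G i k) a \<partial>count_space UNIV) \<le> ennpowr T a * ennreal (\<kappa> i powr (- a))" if i: "i \<in> I" for i
    proof -
      have k: "\<kappa> i > 0" using \<kappa>[OF i] by simp
      have "ennreal (\<kappa> i) * lp_norm p (G i) \<le> T" unfolding T_def using i by (rule SUP_upper)
      then have "ennreal (inverse (\<kappa> i)) * (ennreal (\<kappa> i) * lp_norm p (G i)) \<le> ennreal (inverse (\<kappa> i)) * T"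
        by (rule mult_left_mono) auto
      moreover have "ennreal (inverse (\<kappa> i)) * (ennreal (\<kappa> i) * lp_norm p (G i)) = lp_norm p (G i)"
        using k by (simp add: mult.assoc[symmetric] ennreal_mult[symmetric])
      ultimately have "lp_norm p (G i) \<le> T * ennreal (inverse (\<kappa> i))" by (simp add: mult.commute)
      from ennpowr_mono[OF a this] have "ennpowr (lp_norm p (G i)) a \<le> ennpowr T a * ennreal (inverse (\<kappa> i) powr a)"
        using ennpowr_mult[OF a, of "inverse (\<kappa> i)" T] k by simp
      moreover have "inverse (\<kappa> i) powr a = \<kappa> i powr (- a)" using k by (simp add: powr_minus inverse_powr)
      moreover have "ennpowr (lp_norm p (G i)) a = (\<integral>\<^sup>+k. ennpowr (G i k) a \<partial>count_space UNIV)"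
        using False ennpowr_inverse(2)[OF a] by (simp add: lp_norm_def a_def)
      ultimately show ?thesis by simp
    qed
    have "(\<integral>\<^sup>+k. ennpowr (SUP i\<in>I. G i k) a \<partial>count_space UNIV) \<le> (\<integral>\<^sup>+k. (\<integral>\<^sup>+i. ennpowr (G i k) a \<partial>count_space I) \<partial>count_space UNIV)"
    proof (intro nn_integral_mono ennpowr_SUP_le a)
      fix k :: int and i assume i: "i \<in> I"
      have "ennpowr (G i k) a = (\<integral>\<^sup>+j. ennpowr (G j k) a * indicator {i} j \<partial>count_space I)"
        using i by (subst nn_integral_count_space'[of "{i}"]) (auto simp: indicator_def)
      also have "\<dots> \<le> (\<integral>\<^sup>+j. ennpowr (G j k) a \<partial>count_space I)" by (intro nn_integral_mono) (auto simp: indicator_def)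
      finally show "ennpowr (G i k) a \<le> (\<integral>\<^sup>+i. ennpowr (G i k) a \<partial>count_space I)" .
    qed
    also have "\<dots> = (\<integral>\<^sup>+i. (\<integral>\<^sup>+k. ennpowr (G i k) a \<partial>count_space UNIV) \<partial>count_space I)"
      by (rule nn_integral_count_space_nn_integral[OF I]) simp
    also have "\<dots> \<le> (\<integral>\<^sup>+i. ennpowr T a * ennreal (\<kappa> i powr (- a)) \<partial>count_space I)"
      by (intro nn_integral_mono t) simp
    also have "\<dots> = ennpowr T a * S" unfolding S_def by (rule nn_integral_cmult) simp
    also have "\<dots> \<le> ennpowr T a * ennreal (s + 1)" unfolding s(1) by (intro mult_left_mono ennreal_leI) auto
    finally have "ennpowr (\<integral>\<^sup>+k. ennpowr (SUP i\<in>I. G i k) a \<partial>count_space UNIV) (1 / a) \<le> ennpowr (ennpowr T a * ennreal (s + 1)) (1 / a)"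
      using a by (intro ennpowr_mono) auto
    also have "\<dots> = T * ennreal C"
      using ennpowr_mult[of "1 / a" "s + 1" "ennpowr T a"] a s(2) ennpowr_inverse(1)[OF a] by (simp add: C_def)
    finally show ?thesis using False by (simp add: lp_norm_def a_def T_def mult.commute)
  qed
  moreover have "C > 0" using s(2) by (simp add: C_def)
  ultimately show ?thesis by blast
qed

text \<open>Each coordinate is treated by \<open>lp_norm_SUP_le\<close> and costs one factor
  \<kappa>, which is carried along inside the supremum; this explains the exponent
  \<open>length q\<close>.\<close>

lemma disc_mixed_norm_SUP_le:
  assumes I: "countable I" and \<kappa>: "\<And>i. i \<in> I \<Longrightarrow> \<kappa> i \<ge> (1::real)"
    and fin: "\<And>a. a > 0 \<Longrightarrow> (\<integral>\<^sup>+i. ennreal (\<kappa> i powr (- a)) \<partial>count_space I) < \<infinity>"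
    and "\<forall>p\<in>set q. p > 0"
  shows "\<exists>C>0. \<forall>G. disc_mixed_norm q (\<lambda>ks. SUP i\<in>I. G i ks) \<le>
    ennreal C * (SUP i\<in>I. ennreal (\<kappa> i ^ length q) * disc_mixed_norm q (G i))"
  using assms(4)
proof (induction q)
  case Nil
  show ?case by (intro exI[of _ 1]) (auto simp: image_comp)
next
  case (Cons p q)
  then obtain C2 where C2: "C2 > 0" "\<And>G. disc_mixed_norm q (\<lambda>ks. SUP i\<in>I. G i ks) \<le>
    ennreal C2 * (SUP i\<in>I. ennreal (\<kappa> i ^ length q) * disc_mixed_norm q (G i))" by auto
  have p: "p > 0" and q: "\<forall>p\<in>set q. p > 0" using Cons.prems by auto
  obtain C1 where C1: "C1 > 0" "\<And>G. lp_norm p (\<lambda>k. SUP i\<in>I. G i k) \<le> ennreal C1 * (SUP i\<in>I. ennreal (\<kappa> i) * lp_norm p (G i))"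
    using lp_norm_SUP_le[of p I \<kappa>, OF p I \<kappa> fin] by blast
  have "disc_mixed_norm (p # q) (\<lambda>ks. SUP i\<in>I. G i ks) \<le>
      ennreal (C1 * C2) * (SUP i\<in>I. ennreal (\<kappa> i ^ length (p # q)) * disc_mixed_norm (p # q) (G i))" for G :: "_ \<Rightarrow> int list \<Rightarrow> ennreal"
  proof -
    let ?H = "\<lambda>i ks. ennreal (\<kappa> i) * lp_norm p (\<lambda>k. G i (k # ks))"
    have "disc_mixed_norm (p # q) (\<lambda>ks. SUP i\<in>I. G i ks) \<le> disc_mixed_norm q (\<lambda>ks. ennreal C1 * (SUP i\<in>I. ?H i ks))"
      unfolding disc_mixed_norm.simps by (intro disc_mixed_norm_mono q C1(2))
    also have "\<dots> = ennreal C1 * disc_mixed_norm q (\<lambda>ks. SUP i\<in>I. ?H i ks)" by (rule disc_mixed_norm_cmult[OF q C1(1)])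
    also have "\<dots> \<le> ennreal C1 * (ennreal C2 * (SUP i\<in>I. ennreal (\<kappa> i ^ length q) * disc_mixed_norm q (?H i)))"
      by (intro mult_left_mono C2(2)) auto
    also have "(SUP i\<in>I. ennreal (\<kappa> i ^ length q) * disc_mixed_norm q (?H i)) =
        (SUP i\<in>I. ennreal (\<kappa> i ^ length (p # q)) * disc_mixed_norm (p # q) (G i))"
    proof (intro SUP_cong refl)
      fix i assume i: "i \<in> I"
      have k: "\<kappa> i > 0" using \<kappa>[OF i] by simp
      show "ennreal (\<kappa> i ^ length q) * disc_mixed_norm q (?H i) = ennreal (\<kappa> i ^ length (p # q)) * disc_mixed_norm (p # q) (G i)"
        using k by (simp add: disc_mixed_norm_cmult[OF q k] ennreal_mult mult_ac)
    qed
    finally show ?thesis using C1(1) C2(1) by (simp add: ennreal_mult mult.assoc)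
  qed
  then show ?case using C1(1) C2(1) by (intro exI[of _ "C1 * C2"]) auto
qed

text \<open>The \<open>Lp_norm\<close> of the indicator function of an interval of length
  \<delta>.\<close>

definition dil_const :: "real \<Rightarrow> ennreal \<Rightarrow> real" where
  "dil_const \<delta> p = (if p = \<infinity> then 1 else \<delta> powr (1 / enn2real p))"

lemma dil_const_pos: "\<delta> > 0 \<Longrightarrow> dil_const \<delta> p > 0"
  by (simp add: dil_const_def)

lemma dil_const_prod_pos: "\<delta> > 0 \<Longrightarrow> (\<Prod>p\<leftarrow>q. dil_const \<delta> p) > 0"
  by (induction q) (auto simp: dil_const_pos)

lemma dil_const_prod_1: "(\<Prod>p\<leftarrow>q. dil_const 1 p) = 1"
  by (induction q) (auto simp: dil_const_def)

text \<open>An interval of positive length is not a null set. This is how essential bounds of step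
  functions are read off for the exponent \<infinity>.\<close>

lemma AE_lebesgue_interval:
  assumes "AE x in lebesgue. P x" "a < (b::real)" shows "\<exists>x\<in>{a..<b}. P x"
proof (rule ccontr)
  assume "\<not> ?thesis"
  then have "AE x in lebesgue. x \<notin> {a..<b}" using assms(1) by (auto elim: eventually_mono)
  then have "{a..<b} \<in> null_sets lebesgue" using AE_iff_null_sets[of "{a..<b}" lebesgue] by simp
  then have "emeasure lborel {a..<b} = 0" by (auto simp: null_sets_def)
  then show False using assms(2) by simp
qed

lemma nn_integral_count_space_single:
  "(\<And>k. k \<noteq> k0 \<Longrightarrow> f k = 0) \<Longrightarrow> (\<integral>\<^sup>+k. f k \<partial>count_space UNIV) = f k0"
  by (subst nn_integral_count_space'[of "{k0}"]) auto

text \<open>Since \<delta> \<le> 1, the function has the values \<open>b k\<close> on disjoint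
  intervals of length \<delta> beginning at \<open>u + k\<close>, so the norm is computed exactly.
  The case \<delta> = 1, \<open>u = 0\<close> serves upper bounds by functions constant on cells; a
  small \<delta> and a general offset serve lower bounds on boxes.\<close>

lemma Lp_norm_step:
  assumes p: "p > 0" and \<delta>: "0 < \<delta>" "\<delta> \<le> 1"
  shows "Lp_norm p (\<lambda>x. if frac (x - u) < \<delta> then b \<lfloor>x - u\<rfloor> else 0) = ennreal (dil_const \<delta> p) * lp_norm p b"
proof -
  have mem: "frac (x - u) < \<delta> \<and> \<lfloor>x - u\<rfloor> = k \<longleftrightarrow> x \<in> {u + of_int k..<u + of_int k + \<delta>}" for x k
  proof
    assume a: "frac (x - u) < \<delta> \<and> \<lfloor>x - u\<rfloor> = k"
    then have "x - u - of_int k < \<delta>" "of_int k \<le> x - u" unfolding frac_def by auto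
    then show "x \<in> {u + of_int k..<u + of_int k + \<delta>}" by auto
  next
    assume "x \<in> {u + of_int k..<u + of_int k + \<delta>}"
    then have b: "of_int k \<le> x - u" "x - u < of_int k + \<delta>" by auto
    then have "\<lfloor>x - u\<rfloor> = k" using \<delta> by (simp add: floor_eq_iff)
    then show "frac (x - u) < \<delta> \<and> \<lfloor>x - u\<rfloor> = k" using b unfolding frac_def by auto
  qed
  show ?thesis
  proof (cases "p = \<infinity>")
    case True
    have "Inf {c. AE x in lebesgue. (if frac (x - u) < \<delta> then b \<lfloor>x - u\<rfloor> else 0) \<le> c} = (SUP k. b k)"
    proof (rule antisym)
      show "Inf {c. AE x in lebesgue. (if frac (x - u) < \<delta> then b \<lfloor>x - u\<rfloor> else 0) \<le> c} \<le> (SUP k. b k)"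
        by (rule Inf_lower) (auto intro!: AE_I2 SUP_upper)
      show "(SUP k. b k) \<le> Inf {c. AE x in lebesgue. (if frac (x - u) < \<delta> then b \<lfloor>x - u\<rfloor> else 0) \<le> c}"
      proof (rule Inf_greatest, rule SUP_least)
        fix c k assume "c \<in> {c. AE x in lebesgue. (if frac (x - u) < \<delta> then b \<lfloor>x - u\<rfloor> else 0) \<le> c}"
        then obtain x where x: "x \<in> {u + of_int k..<u + of_int k + \<delta>}" "(if frac (x - u) < \<delta> then b \<lfloor>x - u\<rfloor> else 0) \<le> c"
          using AE_lebesgue_interval[of "\<lambda>x. (if frac (x - u) < \<delta> then b \<lfloor>x - u\<rfloor> else 0) \<le> c" "u + of_int k" "u + of_int k + \<delta>"] \<delta> by auto
        then show "b k \<le> c" using mem[of x k] by auto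
      qed
    qed
    then show ?thesis using True by (simp add: Lp_norm_def lp_norm_def dil_const_def)
  next
    case False
    define a where "a = enn2real p"
    have a: "a > 0" unfolding a_def using enn2real_exponent_pos[OF p False] .
    have "(\<integral>\<^sup>+x. ennpowr (if frac (x - u) < \<delta> then b \<lfloor>x - u\<rfloor> else 0) a \<partial>lebesgue) =
        (\<integral>\<^sup>+x. (\<integral>\<^sup>+k. ennpowr (b k) a * indicator {u + of_int k..<u + of_int k + \<delta>} x \<partial>count_space UNIV) \<partial>lborel)"
      unfolding nn_integral_completion
    proof (intro nn_integral_cong)
      fix x
      have "(\<integral>\<^sup>+k. ennpowr (b k) a * indicator {u + of_int k..<u + of_int k + \<delta>} x \<partial>count_space UNIV) =
          ennpowr (b \<lfloor>x - u\<rfloor>) a * indicator {u + of_int \<lfloor>x - u\<rfloor>..<u + of_int \<lfloor>x - u\<rfloor> + \<delta>} x"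
      proof -
        have z: "ennpowr (b k) a * indicator {u + of_int k..<u + of_int k + \<delta>} x = 0" if "k \<notin> {\<lfloor>x - u\<rfloor>}" for k
          using mem[of x k] that by (simp add: indicator_def)
        show ?thesis by (rule nn_integral_count_space_single) (use z in blast)
      qed
      then show "ennpowr (if frac (x - u) < \<delta> then b \<lfloor>x - u\<rfloor> else 0) a =
          (\<integral>\<^sup>+k. ennpowr (b k) a * indicator {u + of_int k..<u + of_int k + \<delta>} x \<partial>count_space UNIV)"
        using mem[of x "\<lfloor>x - u\<rfloor>"] by (auto simp: indicator_def)
    qed
    also have "\<dots> = (\<integral>\<^sup>+k. (\<integral>\<^sup>+x. ennpowr (b k) a * indicator {u + of_int k..<u + of_int k + \<delta>} x \<partial>lborel) \<partial>count_space UNIV)"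
      by (rule nn_integral_count_space_nn_integral) auto
    also have "\<dots> = (\<integral>\<^sup>+k. ennpowr (b k) a * ennreal \<delta> \<partial>count_space UNIV)"
      using \<delta> by (intro nn_integral_cong) (simp add: nn_integral_cmult_indicator)
    also have "\<dots> = (\<integral>\<^sup>+k. ennpowr (b k) a \<partial>count_space UNIV) * ennreal \<delta>" by (rule nn_integral_multc) simp
    finally show ?thesis using False ennpowr_mult[of "1 / a" \<delta>] a \<delta>
      by (subst mult.commute) (simp add: Lp_norm_def lp_norm_def dil_const_def a_def)
  qed
qed

lemma Lp_norm_0: "p > 0 \<Longrightarrow> Lp_norm p (\<lambda>x. 0) = 0"
  by (auto simp: Lp_norm_def bot_ennreal)

text \<open>The condition on the first coordinate separates from the others, so the innermost norm
  of a step function is again a step function in the remaining coordinates, with values given by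
  \<open>lp_norm\<close>.\<close>

lemma mixed_norm_step:
  assumes "\<forall>p\<in>set q. p > 0" "0 < \<delta>" "\<delta> \<le> 1" "length us = length q"
  shows "mixed_norm q (\<lambda>xs. if (\<forall>j<length q. frac (xs ! j - us ! j) < \<delta>) then b (map2 (\<lambda>x u. \<lfloor>x - u\<rfloor>) xs us) else 0) =
    ennreal (\<Prod>p\<leftarrow>q. dil_const \<delta> p) * disc_mixed_norm q b"
  using assms(1,4)
proof (induction q arbitrary: us b)
  case Nil then show ?case by simp
next
  case (Cons p q)
  then obtain u us' where us: "us = u # us'" "length us' = length q" by (cases us) auto
  have p: "p > 0" and q: "\<forall>p\<in>set q. p > 0" using Cons.prems by auto
  have "Lp_norm p (\<lambda>x. if (\<forall>j<length (p # q). frac ((x # z) ! j - us ! j) < \<delta>) then b (map2 (\<lambda>x u. \<lfloor>x - u\<rfloor>) (x # z) us) else 0) =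
     (if (\<forall>j<length q. frac (z ! j - us' ! j) < \<delta>) then ennreal (dil_const \<delta> p) * lp_norm p (\<lambda>k. b (k # map2 (\<lambda>x u. \<lfloor>x - u\<rfloor>) z us')) else 0)" for z
  proof (cases "\<forall>j<length q. frac (z ! j - us' ! j) < \<delta>")
    case True
    have "(\<lambda>x. if (\<forall>j<length (p # q). frac ((x # z) ! j - us ! j) < \<delta>) then b (map2 (\<lambda>x u. \<lfloor>x - u\<rfloor>) (x # z) us) else 0) =
      (\<lambda>x. if frac (x - u) < \<delta> then (\<lambda>k. b (k # map2 (\<lambda>x u. \<lfloor>x - u\<rfloor>) z us')) \<lfloor>x - u\<rfloor> else 0)"
      using True by (auto simp: us All_less_Suc2)
    then show ?thesis using True Lp_norm_step[OF p assms(2,3), of u "\<lambda>k. b (k # map2 (\<lambda>x u. \<lfloor>x - u\<rfloor>) z us')"] by simp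
  next
    case False
    have "(\<lambda>x. if (\<forall>j<length (p # q). frac ((x # z) ! j - us ! j) < \<delta>) then b (map2 (\<lambda>x u. \<lfloor>x - u\<rfloor>) (x # z) us) else 0) = (\<lambda>x. 0)"
      using False unfolding us length_Cons All_less_Suc2 nth_Cons_0 nth_Cons_Suc by (intro ext if_not_P) blast
    then show ?thesis by (simp only: if_not_P[OF False] Lp_norm_0[OF p])
  qed
  note st = this
  have e: "ennreal (\<Prod>p\<leftarrow>p # q. dil_const \<delta> p) = ennreal (dil_const \<delta> p) * ennreal (\<Prod>p\<leftarrow>q. dil_const \<delta> p)"
    using dil_const_pos[OF assms(2), of p] dil_const_prod_pos[OF assms(2), of q] by (simp add: ennreal_mult)
  show ?case
    unfolding mixed_norm.simps st e
      Cons.IH[OF q us(2), of "\<lambda>ks. ennreal (dil_const \<delta> p) * lp_norm p (\<lambda>k. b (k # ks))"]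
      disc_mixed_norm_cmult[OF q dil_const_pos[OF assms(2)]] disc_mixed_norm.simps
    by (simp only: mult_ac)
qed

lemma Lp_norm_box:
  assumes p: "p > 0" and \<delta>: "0 < \<delta>"
  shows "Lp_norm p (\<lambda>x. if s \<le> x \<and> x \<le> s + \<delta> then h else 0) = h * ennreal (dil_const \<delta> p)"
proof (cases "p = \<infinity>")
  case True
  have "Inf {c. AE x in lebesgue. (if s \<le> x \<and> x \<le> s + \<delta> then h else 0) \<le> c} = h"
  proof (rule antisym)
    show "Inf {c. AE x in lebesgue. (if s \<le> x \<and> x \<le> s + \<delta> then h else 0) \<le> c} \<le> h"
      by (rule Inf_lower) auto
    show "h \<le> Inf {c. AE x in lebesgue. (if s \<le> x \<and> x \<le> s + \<delta> then h else 0) \<le> c}"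
    proof (rule Inf_greatest)
      fix c assume "c \<in> {c. AE x in lebesgue. (if s \<le> x \<and> x \<le> s + \<delta> then h else 0) \<le> c}"
      then obtain x where "x \<in> {s..<s + \<delta>}" "(if s \<le> x \<and> x \<le> s + \<delta> then h else 0) \<le> c"
        using AE_lebesgue_interval[of "\<lambda>x. (if s \<le> x \<and> x \<le> s + \<delta> then h else 0) \<le> c" s "s + \<delta>"] \<delta> by auto
      then show "h \<le> c" by auto
    qed
  qed
  then show ?thesis using True by (simp add: Lp_norm_def dil_const_def)
next
  case False
  define a where "a = enn2real p"
  have a: "a > 0" unfolding a_def using enn2real_exponent_pos[OF p False] .
  have "(\<integral>\<^sup>+x. ennpowr (if s \<le> x \<and> x \<le> s + \<delta> then h else 0) a \<partial>lebesgue) = (\<integral>\<^sup>+x. ennpowr h a * indicator {s..s + \<delta>} x \<partial>lborel)"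
    unfolding nn_integral_completion by (intro nn_integral_cong) (auto simp: indicator_def)
  also have "\<dots> = ennpowr h a * ennreal \<delta>" using \<delta> by (simp add: nn_integral_cmult_indicator)
  finally show ?thesis using False ennpowr_mult[of "1 / a" \<delta>] ennpowr_inverse(1)[OF a] a \<delta>
    by (simp add: Lp_norm_def dil_const_def a_def)
qed

lemma mixed_norm_box:
  assumes "\<forall>p\<in>set q. p > 0" "0 < \<delta>" "length s = length q"
  shows "mixed_norm q (\<lambda>xs. if (\<forall>j<length q. s ! j \<le> xs ! j \<and> xs ! j \<le> s ! j + \<delta>) then h else 0) =
    h * ennreal (\<Prod>p\<leftarrow>q. dil_const \<delta> p)"
  using assms(1,3)
proof (induction q arbitrary: s h)
  case Nil then show ?case by simp
next
  case (Cons p q)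
  then obtain t s' where s: "s = t # s'" "length s' = length q" by (cases s) auto
  have p: "p > 0" and q: "\<forall>p\<in>set q. p > 0" using Cons.prems by auto
  have "Lp_norm p (\<lambda>x. if (\<forall>j<length (p # q). s ! j \<le> (x # z) ! j \<and> (x # z) ! j \<le> s ! j + \<delta>) then h else 0) =
     (if (\<forall>j<length q. s' ! j \<le> z ! j \<and> z ! j \<le> s' ! j + \<delta>) then h * ennreal (dil_const \<delta> p) else 0)" for z
  proof (cases "\<forall>j<length q. s' ! j \<le> z ! j \<and> z ! j \<le> s' ! j + \<delta>")
    case True
    have "(\<lambda>x. if (\<forall>j<length (p # q). s ! j \<le> (x # z) ! j \<and> (x # z) ! j \<le> s ! j + \<delta>) then h else 0) = (\<lambda>x. if t \<le> x \<and> x \<le> t + \<delta> then h else 0)"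
      using True by (auto simp: s All_less_Suc2)
    then show ?thesis using True Lp_norm_box[OF p assms(2), of t h] by simp
  next
    case False
    have "(\<lambda>x. if (\<forall>j<length (p # q). s ! j \<le> (x # z) ! j \<and> (x # z) ! j \<le> s ! j + \<delta>) then h else 0) = (\<lambda>x. 0)"
      using False unfolding s length_Cons All_less_Suc2 nth_Cons_0 nth_Cons_Suc by (intro ext if_not_P) blast
    then show ?thesis by (simp only: if_not_P[OF False] Lp_norm_0[OF p])
  qed
  then show ?case using Cons.IH[OF q s(2), of "h * ennreal (dil_const \<delta> p)"]
      dil_const_pos[OF assms(2), of p] dil_const_prod_pos[OF assms(2), of q]
    by (simp add: ennreal_mult mult_ac)
qed

lemma disc_mixed_norm_cong:
  assumes "\<forall>p\<in>set q. p > 0" "\<And>ks. length ks = length q \<Longrightarrow> g ks = g' ks"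
  shows "disc_mixed_norm q g = disc_mixed_norm q g'"
  by (intro antisym disc_mixed_norm_mono assms(1)) (simp_all add: assms(2))

lemma nn_integral_count_space_finite_sum:
  fixes f :: "'a \<Rightarrow> real"
  assumes "f summable_on I" "\<And>i. i \<in> I \<Longrightarrow> f i \<ge> 0"
  shows "(\<integral>\<^sup>+i. ennreal (f i) \<partial>count_space I) < \<infinity>"
proof -
  have "(\<lambda>i. norm (f i)) summable_on I"
    using assms(1) by (rule summable_on_cong[THEN iffD2, rotated]) (use assms(2) in auto)
  then have "integrable (count_space I) f"
    unfolding abs_summable_equivalent Infinite_Set_Sum.abs_summable_on_def .
  then have "(\<integral>\<^sup>+i. ennreal (norm (f i)) \<partial>count_space I) < \<infinity>"
    by (rule integrable_iff_bounded[THEN iffD1, THEN conjunct2])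
  also have "(\<integral>\<^sup>+i. ennreal (norm (f i)) \<partial>count_space I) = (\<integral>\<^sup>+i. ennreal (f i) \<partial>count_space I)"
    by (intro nn_integral_cong) (use assms(2) in auto)
  finally show ?thesis .
qed

section \<open>Norms on the dual lattice and their comparison with split norms\<close>

context dual_pair
begin

definition lattice_pt :: "int list \<Rightarrow> real^'n" where
  "lattice_pt ks = lin_comb E' (map of_int ks)"

definition lattice_norm :: "ennreal list \<Rightarrow> (real^'n \<Rightarrow> ennreal) \<Rightarrow> ennreal" where
  "lattice_norm q b = disc_mixed_norm q (\<lambda>ks. b (lattice_pt ks))"

lemma parallelepiped_iff: "x \<in> parallelepiped E \<longleftrightarrow> (\<forall>j<length E. 0 \<le> coords E' x ! j \<and> coords E' x ! j \<le> 1)"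
proof
  assume "x \<in> parallelepiped E"
  then obtain xs where xs: "x = lin_comb E xs" "length xs = length E" "set xs \<subseteq> {0..1}"
    by (auto simp: parallelepiped_def)
  then show "\<forall>j<length E. 0 \<le> coords E' x ! j \<and> coords E' x ! j \<le> 1"
    using nth_mem[of _ xs] by (auto simp del: nth_coords simp: coords_lin_comb subset_iff)
next
  assume a: "\<forall>j<length E. 0 \<le> coords E' x ! j \<and> coords E' x ! j \<le> 1"
  have "set (coords E' x) \<subseteq> {0..1}"
  proof
    fix t assume "t \<in> set (coords E' x)"
    then obtain j where "j < length E" "t = coords E' x ! j" by (metis in_set_conv_nth length_coords length_eq)
    then show "t \<in> {0..1}" using a by simp
  qed
  then show "x \<in> parallelepiped E" unfolding parallelepiped_def
    using lin_comb_coords[of x] length_eq length_coords[of E' x] by (metis (mono_tags, lifting) mem_Collect_eq)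
qed

lemma norm_le_coords:
  assumes "\<And>j. j < length E \<Longrightarrow> \<bar>coords E' x ! j\<bar> \<le> c" shows "norm x \<le> c * list_diam E"
  using norm_lin_comb_le[of E "coords E' x" c] assms lin_comb_coords by simp

lemma coords_diff: "j < length E' \<Longrightarrow> coords E' (x - y) ! j = coords E' x ! j - coords E' y ! j"
  by (simp add: inner_diff_left diff_divide_distrib)

lemma lattice_pt_in: "length ks = length E \<Longrightarrow> lattice_pt ks \<in> basis_lattice E'"
  unfolding lattice_pt_def basis_lattice_def using length_eq by (intro CollectI exI conjI refl) auto

lemma coords_lattice_pt:
  assumes "length ks = length E" shows "coords E (lattice_pt ks) = map of_int ks"
proof -
  interpret dual: dual_pair E' E by (rule dual)
  show ?thesis unfolding lattice_pt_def by (rule dual.coords_lin_comb) (simp add: assms length_eq)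
qed

lemma ex_lattice_pt:
  assumes "\<alpha> \<in> basis_lattice E'" obtains ks where "length ks = length E" "lattice_pt ks = \<alpha>"
proof -
  obtain xs where xs: "\<alpha> = lin_comb E' xs" "length xs = length E'" "set xs \<subseteq> \<int>"
    using assms by (auto simp: basis_lattice_def)
  have "map of_int (map floor xs) = xs"
  proof (intro nth_equalityI)
    fix i assume "i < length (map of_int (map floor xs) :: real list)"
    then have i: "i < length xs" by simp
    then have "xs ! i \<in> \<int>" using xs(3) nth_mem by blast
    then show "map of_int (map floor xs) ! i = xs ! i" using i by (auto elim: Ints_cases)
  qed simp
  then show thesis using that[of "map floor xs"] xs length_eq by (simp add: lattice_pt_def)
qed

lemma lattice_pt_add:
  assumes "length ks = length E" "length ms = length E"
  shows "lattice_pt (map2 (+) ks ms) = lattice_pt ks + lattice_pt ms"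
  unfolding lattice_pt_def lin_comb_def sum.distrib[symmetric]
  by (intro sum.cong refl) (use assms length_eq in \<open>auto simp: scaleR_left_distrib\<close>)

lemma lattice_norm_mono:
  assumes "q \<in> exponents CARD('n)" "\<And>\<alpha>. \<alpha> \<in> basis_lattice E' \<Longrightarrow> b \<alpha> \<le> b' \<alpha>"
  shows "lattice_norm q b \<le> lattice_norm q b'"
  unfolding lattice_norm_def
  by (rule disc_mixed_norm_mono) (use assms length_card in \<open>auto simp: exponents_def intro!: assms(2) lattice_pt_in\<close>)

lemma lattice_norm_ge:
  assumes "q \<in> exponents CARD('n)" "\<alpha> \<in> basis_lattice E'" shows "b \<alpha> \<le> lattice_norm q b"
proof -
  obtain ks where ks: "length ks = length E" "lattice_pt ks = \<alpha>" using ex_lattice_pt[OF assms(2)] .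
  then show ?thesis unfolding lattice_norm_def
    using disc_mixed_norm_ge[of q ks "\<lambda>ks. b (lattice_pt ks)"] assms(1) length_card by (auto simp: exponents_def)
qed

lemma lattice_norm_cmult:
  assumes "q \<in> exponents CARD('n)" "c > 0"
  shows "lattice_norm q (\<lambda>\<alpha>. ennreal c * b \<alpha>) = ennreal c * lattice_norm q b"
  unfolding lattice_norm_def by (rule disc_mixed_norm_cmult) (use assms in \<open>auto simp: exponents_def\<close>)

lemma lattice_norm_shift:
  assumes q: "q \<in> exponents CARD('n)" and "\<beta> \<in> basis_lattice E'"
  shows "lattice_norm q (\<lambda>\<gamma>. b (\<gamma> + \<beta>)) = lattice_norm q b"
proof -
  obtain ms where ms: "length ms = length E" "lattice_pt ms = \<beta>" using ex_lattice_pt[OF assms(2)] .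
  have lq: "length q = length E" using q length_card by (simp add: exponents_def)
  have "lattice_norm q (\<lambda>\<gamma>. b (\<gamma> + \<beta>)) = disc_mixed_norm q (\<lambda>ks. b (lattice_pt (map2 (+) ks ms)))"
    unfolding lattice_norm_def
  proof (rule disc_mixed_norm_cong)
    show "\<forall>p\<in>set q. p > 0" using q by (simp add: exponents_def)
    show "b (lattice_pt ks + \<beta>) = b (lattice_pt (map2 (+) ks ms))" if "length ks = length q" for ks
      using lattice_pt_add[of ks ms] that ms lq by simp
  qed
  also have "\<dots> = lattice_norm q b"
    unfolding lattice_norm_def using disc_mixed_norm_shift[of ms q "\<lambda>ks. b (lattice_pt ks)"] ms lq by simp
  finally show ?thesis .
qed

text \<open>The maximal function of the upper bounds. Its rate \<open>CARD('n)\<close> is the number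
  of iterated norms, each of which takes one factor \<open>exp (norm \<beta>)\<close>.\<close>

definition decay_sup :: "(real^'n \<Rightarrow> ennreal) \<Rightarrow> real^'n \<Rightarrow> ennreal" where
  "decay_sup b \<gamma> = (SUP \<beta>\<in>basis_lattice E'. ennreal (exp (- (real CARD('n) * norm \<beta>))) * b (\<gamma> + \<beta>))"

lemma decay_sup_upper:
  assumes "\<gamma> \<in> basis_lattice E'" "\<alpha> \<in> basis_lattice E'"
  shows "ennreal (exp (- (real CARD('n) * norm (\<alpha> - \<gamma>)))) * b \<alpha> \<le> decay_sup b \<gamma>"
proof -
  interpret dual: dual_pair E' E by (rule dual)
  show ?thesis unfolding decay_sup_def
    by (rule SUP_upper2[OF dual.lattice_diff[OF assms(2,1)]]) simp
qed

text \<open>The supremum bound is applied with the factors \<open>exp (norm \<beta>)\<close>, whose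
  negative powers are summable over the lattice. Their \<open>CARD('n)\<close>-th power cancels the
  decay exactly, and what remains is the norm of a shift of \<open>b\<close>.\<close>

lemma lattice_norm_decay_sup:
  assumes q: "q \<in> exponents CARD('n)"
  obtains C where "C > 0" "\<And>b. lattice_norm q (decay_sup b) \<le> ennreal C * lattice_norm q b"
proof -
  interpret dual: dual_pair E' E by (rule dual)
  have q': "\<forall>p\<in>set q. p > 0" and lq: "length q = CARD('n)" using q by (auto simp: exponents_def)
  have "\<exists>C>0. \<forall>G. disc_mixed_norm q (\<lambda>ks. SUP i\<in>basis_lattice E'. G i ks) \<le>
    ennreal C * (SUP i\<in>basis_lattice E'. ennreal (exp (norm i) ^ length q) * disc_mixed_norm q (G i))"
  proof (rule disc_mixed_norm_SUP_le[OF dual.countable_lattice _ _ q'])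
    fix a :: real assume a: "a > 0"
    show "(\<integral>\<^sup>+i. ennreal (exp (norm i) powr - a) \<partial>count_space (basis_lattice E')) < \<infinity>"
      using nn_integral_count_space_finite_sum[OF dual.summable_on_exp_lattice[OF a]] by (simp add: powr_def)
  qed simp
  then obtain C where C: "C > 0" "\<And>G. disc_mixed_norm q (\<lambda>ks. SUP i\<in>basis_lattice E'. G i ks) \<le>
    ennreal C * (SUP i\<in>basis_lattice E'. ennreal (exp (norm i) ^ length q) * disc_mixed_norm q (G i))" by blast
  have "lattice_norm q (decay_sup b) \<le> ennreal C * lattice_norm q b" for b
  proof -
    let ?G = "\<lambda>\<beta> ks. ennreal (exp (- (real CARD('n) * norm \<beta>))) * b (lattice_pt ks + \<beta>)"
    have "lattice_norm q (decay_sup b) \<le> ennreal C * (SUP i\<in>basis_lattice E'. ennreal (exp (norm i) ^ length q) * disc_mixed_norm q (?G i))"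
      unfolding lattice_norm_def decay_sup_def by (rule C(2))
    also have "\<dots> \<le> ennreal C * lattice_norm q b"
    proof (rule mult_left_mono, rule SUP_least)
      fix \<beta> assume be: "\<beta> \<in> basis_lattice E'"
      have "disc_mixed_norm q (?G \<beta>) = ennreal (exp (- (real CARD('n) * norm \<beta>))) * disc_mixed_norm q (\<lambda>ks. b (lattice_pt ks + \<beta>))"
        by (rule disc_mixed_norm_cmult[OF q']) simp
      also have "disc_mixed_norm q (\<lambda>ks. b (lattice_pt ks + \<beta>)) = lattice_norm q b"
        using lattice_norm_shift[OF q be, of b] by (simp add: lattice_norm_def)
      finally have "ennreal (exp (norm \<beta>) ^ length q) * disc_mixed_norm q (?G \<beta>) =
          ennreal (exp (norm \<beta>) ^ length q * exp (- (real CARD('n) * norm \<beta>))) * lattice_norm q b"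
        by (simp add: ennreal_mult mult.assoc)
      also have "exp (norm \<beta>) ^ length q * exp (- (real CARD('n) * norm \<beta>)) = 1"
        unfolding lq exp_of_nat_mult[symmetric] exp_add[symmetric] by simp
      finally show "ennreal (exp (norm \<beta>) ^ length q) * disc_mixed_norm q (?G \<beta>) \<le> lattice_norm q b" by simp
    qed simp
    finally show ?thesis .
  qed
  then show thesis using that C(1) by blast
qed

text \<open>With all factors \<kappa> equal to 1 the supremum bound stands in for the triangle
  inequality over a finite family.\<close>

lemma lattice_norm_Max_finite:
  assumes q: "q \<in> exponents CARD('n)" and L: "finite L" and f: "\<And>l. l \<in> L \<Longrightarrow> lattice_norm q (g l) < \<infinity>"
  shows "lattice_norm q (\<lambda>\<alpha>. SUP l\<in>L. g l \<alpha>) < \<infinity>"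
proof -
  have q': "\<forall>p\<in>set q. p > 0" using q by (auto simp: exponents_def)
  have "\<exists>C>0. \<forall>G. disc_mixed_norm q (\<lambda>ks. SUP i\<in>L. G i ks) \<le>
    ennreal C * (SUP i\<in>L. ennreal (1 ^ length q) * disc_mixed_norm q (G i))"
    by (rule disc_mixed_norm_SUP_le[OF countable_finite[OF L] _ _ q'])
       (use L in \<open>auto simp: nn_integral_count_space_finite ennreal_of_nat_eq_real_of_nat\<close>)
  then obtain C where C: "\<forall>G. disc_mixed_norm q (\<lambda>ks. SUP i\<in>L. G i ks) \<le>
    ennreal C * (SUP i\<in>L. ennreal (1 ^ length q) * disc_mixed_norm q (G i))" by blast
  have "disc_mixed_norm q (\<lambda>ks. SUP i\<in>L. g i (lattice_pt ks)) \<le> ennreal C * (SUP i\<in>L. lattice_norm q (g i))"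
    using spec[OF C, of "\<lambda>i ks. g i (lattice_pt ks)"] by (simp add: lattice_norm_def)
  also have "(SUP i\<in>L. lattice_norm q (g i)) < \<infinity>"
    using L f by (induction L rule: finite_induct) (simp_all add: sup_max bot_ennreal)
  then have "ennreal C * (SUP i\<in>L. lattice_norm q (g i)) < \<infinity>" by (simp add: ennreal_mult_less_top)
  finally show ?thesis by (simp add: lattice_norm_def)
qed

text \<open>The floor of the coordinates makes the bound constant on the half-open cells of the dual
  lattice: a step function with \<delta> = 1, whose norm is \<open>lattice_norm q b\<close>.\<close>

lemma split_norm_upper:
  assumes q: "q \<in> exponents CARD('n)" and H: "\<And>\<xi>. H \<xi> * ennreal \<bar>\<theta> \<xi>\<bar> \<le> b (lattice_pt (map floor (coords E \<xi>)))"
  shows "split_norm E' q \<theta> H \<le> lattice_norm q b"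
proof -
  interpret dual: dual_pair E' E by (rule dual)
  have q': "\<forall>p\<in>set q. p > 0" and lq: "length q = CARD('n)" using q by (auto simp: exponents_def)
  have lE': "length E' = CARD('n)" using length_eq length_card by simp
  let ?us = "replicate (length q) (0::real)"
  let ?b = "\<lambda>ks. b (lattice_pt ks)"
  have "split_norm E' q \<theta> H \<le> mixed_norm q (\<lambda>xs. if (\<forall>j<length q. frac (xs ! j - ?us ! j) < 1) then ?b (map2 (\<lambda>x u. \<lfloor>x - u\<rfloor>) xs ?us) else 0)"
    unfolding split_norm_def
  proof (rule mixed_norm_mono[OF q'])
    fix xs :: "real list" assume xs: "length xs = length q"
    have c: "coords E (lin_comb E' xs) = xs" by (rule dual.coords_lin_comb) (simp add: xs lq lE')
    have "map2 (\<lambda>x u. \<lfloor>x - u\<rfloor>) xs ?us = map floor xs" by (intro nth_equalityI) (auto simp: xs)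
    then show "H (lin_comb E' xs) * ennreal \<bar>\<theta> (lin_comb E' xs)\<bar> \<le> (if (\<forall>j<length q. frac (xs ! j - ?us ! j) < 1) then ?b (map2 (\<lambda>x u. \<lfloor>x - u\<rfloor>) xs ?us) else 0)"
      using H[of "lin_comb E' xs"] c by (simp add: frac_lt_1)
  qed
  also have "\<dots> = lattice_norm q b"
    using mixed_norm_step[OF q' zero_less_one order_refl, of ?us ?b] by (simp add: dil_const_prod_1 lattice_norm_def)
  finally show ?thesis .
qed

text \<open>Only one box of side \<delta> per lattice point \<beta> is used, with corner
  \<open>u\<close> relative to \<beta>; elsewhere \<open>H\<close> is bounded below by 0. As
  \<delta> \<le> 1, rounding down after subtraction of \<open>u\<close> recovers the coordinates of
  \<beta>.\<close>

lemma split_norm_lower: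
  assumes q: "q \<in> exponents CARD('n)" and \<delta>: "0 < \<delta>" "\<delta> \<le> 1" and u: "length u = length E"
    and H: "\<And>\<beta> \<xi>. \<beta> \<in> basis_lattice E' \<Longrightarrow> (\<And>j. j < length E \<Longrightarrow> u ! j \<le> coords E (\<xi> - \<beta>) ! j \<and> coords E (\<xi> - \<beta>) ! j \<le> u ! j + \<delta>) \<Longrightarrow>
      b \<beta> \<le> H \<xi> * ennreal \<bar>\<theta> \<xi>\<bar>"
  shows "ennreal (\<Prod>p\<leftarrow>q. dil_const \<delta> p) * lattice_norm q b \<le> split_norm E' q \<theta> H"
proof -
  interpret dual: dual_pair E' E by (rule dual)
  have q': "\<forall>p\<in>set q. p > 0" and lq: "length q = length E" using q length_card by (auto simp: exponents_def)
  let ?b = "\<lambda>ks. b (lattice_pt ks)"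
  have "ennreal (\<Prod>p\<leftarrow>q. dil_const \<delta> p) * lattice_norm q b =
     mixed_norm q (\<lambda>xs. if (\<forall>j<length q. frac (xs ! j - u ! j) < \<delta>) then ?b (map2 (\<lambda>x u. \<lfloor>x - u\<rfloor>) xs u) else 0)"
    unfolding lattice_norm_def by (rule mixed_norm_step[OF q' \<delta>, symmetric]) (simp add: u lq)
  also have "\<dots> \<le> split_norm E' q \<theta> H"
    unfolding split_norm_def
  proof (rule mixed_norm_mono[OF q'])
    fix xs :: "real list" assume xs: "length xs = length q"
    show "(if (\<forall>j<length q. frac (xs ! j - u ! j) < \<delta>) then ?b (map2 (\<lambda>x u. \<lfloor>x - u\<rfloor>) xs u) else 0) \<le> H (lin_comb E' xs) * ennreal \<bar>\<theta> (lin_comb E' xs)\<bar>"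
    proof (cases "\<forall>j<length q. frac (xs ! j - u ! j) < \<delta>")
      case True
      let ?ks = "map2 (\<lambda>x u. \<lfloor>x - u\<rfloor>) xs u"
      have lk: "length ?ks = length E" using xs u lq by simp
      have c: "coords E (lin_comb E' xs) = xs" by (rule dual.coords_lin_comb) (simp add: xs lq length_eq)
      have "b (lattice_pt ?ks) \<le> H (lin_comb E' xs) * ennreal \<bar>\<theta> (lin_comb E' xs)\<bar>"
      proof (rule H[OF lattice_pt_in[OF lk]])
        fix j assume j: "j < length E"
        have "coords E (lin_comb E' xs - lattice_pt ?ks) ! j = coords E (lin_comb E' xs) ! j - coords E (lattice_pt ?ks) ! j"
          by (rule dual.coords_diff) (use j in simp)
        also have "\<dots> = xs ! j - of_int \<lfloor>xs ! j - u ! j\<rfloor>"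
          unfolding c coords_lattice_pt[OF lk] using j xs u lq by simp
        also have "\<dots> = u ! j + frac (xs ! j - u ! j)" by (simp add: frac_def)
        finally have e: "coords E (lin_comb E' xs - lattice_pt ?ks) ! j = u ! j + frac (xs ! j - u ! j)" .
        have "frac (xs ! j - u ! j) < \<delta>" using True j lq by simp
        then show "u ! j \<le> coords E (lin_comb E' xs - lattice_pt ?ks) ! j \<and> coords E (lin_comb E' xs - lattice_pt ?ks) ! j \<le> u ! j + \<delta>"
          unfolding e by simp
      qed
      then show ?thesis using True by simp
    next
      case False
      show ?thesis unfolding if_not_P[OF False] by simp
    qed
  qed
  finally show ?thesis .
qed

lemma floor_pt_eq_lattice_pt: "dual_pair.floor_pt E' E \<xi> = lattice_pt (map floor (coords E \<xi>))"
proof -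
  interpret dual: dual_pair E' E by (rule dual)
  show ?thesis by (simp add: dual.floor_pt_def lattice_pt_def comp_def)
qed

text \<open>The rate of the kernel \<open>k\<close> is spent in three portions: \<open>R\<close>
  moves the weight from \<alpha> to \<xi>, \<open>CARD('n)\<close> is the rate of
  \<open>decay_sup\<close>, and 1 makes the lattice sum converge. Replacing \<xi> by the corner
  \<gamma> of its cell, at distance at most \<open>D\<close>, costs
  \<open>exp ((d + 1) * D)\<close>.\<close>

lemma weighted_series_upper:
  assumes K: "K \<ge> 1" and W: "\<And>x. W x > 0" "\<And>x y. W y \<le> K * exp (R * norm (x - y)) * W x"
    and B: "B > 0" and R: "R \<ge> 0"
  obtains C where "C > 0"
    "\<And>c k \<xi>. (\<And>\<alpha>. \<alpha> \<in> basis_lattice E' \<Longrightarrow> cmod (k \<alpha>) \<le> B * exp (- ((R + real CARD('n) + 1) * norm (\<alpha> - \<xi>)))) \<Longrightarrow>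
      ennreal (cmod (\<Sum>\<^sub>\<infinity>\<alpha>\<in>basis_lattice E'. c \<alpha> * k \<alpha>)) * ennreal (W \<xi>) \<le>
      ennreal C * decay_sup (\<lambda>\<alpha>. ennreal (cmod (c \<alpha>) * W \<alpha>)) (lattice_pt (map floor (coords E \<xi>)))"
proof -
  interpret dual: dual_pair E' E by (rule dual)
  define d where "d = real CARD('n)"
  define D where "D = list_diam E'"
  define s where "s = (\<Sum>\<^sub>\<infinity>\<beta>\<in>basis_lattice E'. exp (- (1 * norm \<beta>)))"
  have s0: "s \<ge> 0" unfolding s_def by (rule infsum_nonneg) auto
  define C where "C = B * K * exp ((d + 1) * D) * (s + 1)"
  have C: "C > 0" using B K s0 by (simp add: C_def add_nonneg_pos)
  have "ennreal (cmod (\<Sum>\<^sub>\<infinity>\<alpha>\<in>basis_lattice E'. c \<alpha> * k \<alpha>)) * ennreal (W \<xi>) \<le>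
      ennreal C * decay_sup (\<lambda>\<alpha>. ennreal (cmod (c \<alpha>) * W \<alpha>)) (lattice_pt (map floor (coords E \<xi>)))"
    if k: "\<And>\<alpha>. \<alpha> \<in> basis_lattice E' \<Longrightarrow> cmod (k \<alpha>) \<le> B * exp (- ((R + d + 1) * norm (\<alpha> - \<xi>)))" for c k \<xi>
  proof -
    define \<gamma> where "\<gamma> = lattice_pt (map floor (coords E \<xi>))"
    have \<gamma>: "\<gamma> = dual.floor_pt \<xi>" by (simp add: \<gamma>_def floor_pt_eq_lattice_pt)
    have \<gamma>L: "\<gamma> \<in> basis_lattice E'" unfolding \<gamma> by (rule dual.floor_pt_lattice)
    have \<xi>\<gamma>: "norm (\<xi> - \<gamma>) \<le> D" unfolding \<gamma> D_def by (rule dual.cell_norm_le[OF dual.floor_pt_cell])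
    define m where "m = decay_sup (\<lambda>\<alpha>. ennreal (cmod (c \<alpha>) * W \<alpha>)) \<gamma>"
    show ?thesis
    proof (cases m)
      case top
      then show ?thesis using C unfolding \<gamma>_def[symmetric] m_def[symmetric] by (simp add: ennreal_mult_top)
    next
      case (real m')
      \<comment> \<open>A finite value of the maximal function at \<gamma> bounds all weighted
        coefficients at once, up to growth at rate \<open>d\<close> away from \<gamma>.\<close>
      have cW: "cmod (c \<alpha>) * W \<alpha> \<le> m' * exp (d * norm (\<alpha> - \<gamma>))" if "\<alpha> \<in> basis_lattice E'" for \<alpha>
      proof -
        have "ennreal (exp (- (d * norm (\<alpha> - \<gamma>)))) * ennreal (cmod (c \<alpha>) * W \<alpha>) \<le> ennreal m'"
          using decay_sup_upper[OF \<gamma>L that, of "\<lambda>\<alpha>. ennreal (cmod (c \<alpha>) * W \<alpha>)"] real(2) unfolding m_def d_def by simp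
        then have "exp (- (d * norm (\<alpha> - \<gamma>))) * (cmod (c \<alpha>) * W \<alpha>) \<le> m'"
          using real(1) W(1)[of \<alpha>] by (simp add: ennreal_mult[symmetric])
        then have "exp (d * norm (\<alpha> - \<gamma>)) * (exp (- (d * norm (\<alpha> - \<gamma>))) * (cmod (c \<alpha>) * W \<alpha>)) \<le> exp (d * norm (\<alpha> - \<gamma>)) * m'"
          by (intro mult_left_mono) auto
        then show ?thesis unfolding mult.assoc[symmetric] exp_add[symmetric] by (simp add: mult.commute)
      qed
      have t: "cmod (c \<alpha> * k \<alpha>) \<le> (m' * B * K * exp ((d + 1) * D) / W \<xi>) * exp (- (1 * norm (\<alpha> + - \<gamma>)))" if al: "\<alpha> \<in> basis_lattice E'" for \<alpha>
      proof -
        have "W \<xi> \<le> K * exp (R * norm (\<alpha> - \<xi>)) * W \<alpha>" by (rule W(2))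
        then have "cmod (c \<alpha>) * W \<xi> \<le> cmod (c \<alpha>) * (K * exp (R * norm (\<alpha> - \<xi>)) * W \<alpha>)" by (intro mult_left_mono) auto
        also have "\<dots> = (cmod (c \<alpha>) * W \<alpha>) * (K * exp (R * norm (\<alpha> - \<xi>)))" by simp
        also have "\<dots> \<le> (m' * exp (d * norm (\<alpha> - \<gamma>))) * (K * exp (R * norm (\<alpha> - \<xi>)))"
          using cW[OF al] K by (intro mult_right_mono) auto
        finally have h1: "cmod (c \<alpha>) * W \<xi> \<le> (m' * exp (d * norm (\<alpha> - \<gamma>))) * (K * exp (R * norm (\<alpha> - \<xi>)))" .
        have "cmod (c \<alpha>) * W \<xi> * cmod (k \<alpha>) \<le> (m' * exp (d * norm (\<alpha> - \<gamma>))) * (K * exp (R * norm (\<alpha> - \<xi>))) * (B * exp (- ((R + d + 1) * norm (\<alpha> - \<xi>))))"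
          by (rule mult_mono[OF h1 k[OF al]]) (use real(1) K in auto)
        also have "\<dots> = m' * B * K * (exp (d * norm (\<alpha> - \<gamma>)) * exp (R * norm (\<alpha> - \<xi>)) * exp (- ((R + d + 1) * norm (\<alpha> - \<xi>))))" by simp
        also have "\<dots> \<le> m' * B * K * (exp ((d + 1) * D) * exp (- (1 * norm (\<alpha> + - \<gamma>))))"
        proof (rule mult_left_mono)
          have "norm (\<alpha> - \<gamma>) \<le> norm (\<alpha> - \<xi>) + norm (\<xi> - \<gamma>)" using norm_triangle_ineq[of "\<alpha> - \<xi>" "\<xi> - \<gamma>"] by simp
          then have "(d + 1) * norm (\<alpha> - \<gamma>) \<le> (d + 1) * (norm (\<alpha> - \<xi>) + D)"
            using \<xi>\<gamma> by (intro mult_left_mono) (auto simp: d_def)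
          then show "exp (d * norm (\<alpha> - \<gamma>)) * exp (R * norm (\<alpha> - \<xi>)) * exp (- ((R + d + 1) * norm (\<alpha> - \<xi>))) \<le> exp ((d + 1) * D) * exp (- (1 * norm (\<alpha> + - \<gamma>)))"
            unfolding exp_add[symmetric] by (simp add: algebra_simps)
        qed (use real(1) B K in auto)
        finally have "cmod (c \<alpha> * k \<alpha>) * W \<xi> \<le> m' * B * K * exp ((d + 1) * D) * exp (- (1 * norm (\<alpha> + - \<gamma>)))"
          by (simp add: norm_mult mult_ac)
        then show ?thesis using W(1)[of \<xi>] by (simp add: pos_le_divide_eq)
      qed
      have sm: "(\<lambda>\<alpha>. exp (- (1 * norm (\<alpha> + - \<gamma>)))) summable_on basis_lattice E'"
      proof -
        have b: "bij_betw (\<lambda>\<alpha>. \<alpha> + - \<gamma>) (basis_lattice E') (basis_lattice E')"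
          by (rule bij_betw_byWitness[where f' = "\<lambda>y. y - - \<gamma>"])
             (use \<gamma>L in \<open>auto simp: dual.lattice_add dual.lattice_diff\<close>)
        show ?thesis using summable_on_reindex_bij_betw[OF b, of "\<lambda>y. exp (- (1 * norm y))"] dual.summable_on_exp_lattice[OF zero_less_one] by blast
      qed
      have "cmod (\<Sum>\<^sub>\<infinity>\<alpha>\<in>basis_lattice E'. c \<alpha> * k \<alpha>) \<le> (m' * B * K * exp ((d + 1) * D) / W \<xi>) * (\<Sum>\<^sub>\<infinity>\<alpha>\<in>basis_lattice E'. exp (- (1 * norm (\<alpha> + - \<gamma>))))"
        by (rule norm_infsum_le_cmult[OF sm t])
      also have "(\<Sum>\<^sub>\<infinity>\<alpha>\<in>basis_lattice E'. exp (- (1 * norm (\<alpha> + - \<gamma>)))) = s"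
        unfolding s_def using \<gamma>L by (intro dual.infsum_lattice_shift[of "- \<gamma>" "\<lambda>y. exp (- (1 * norm y))"]) simp
      finally have "cmod (\<Sum>\<^sub>\<infinity>\<alpha>\<in>basis_lattice E'. c \<alpha> * k \<alpha>) * W \<xi> \<le> (m' * B * K * exp ((d + 1) * D) / W \<xi>) * s * W \<xi>"
        using W(1)[of \<xi>] by (intro mult_right_mono) auto
      also have "\<dots> = B * K * exp ((d + 1) * D) * s * m'" using W(1)[of \<xi>] by simp
      also have "\<dots> \<le> C * m'" unfolding C_def using B K s0 real(1) by (intro mult_right_mono mult_left_mono) auto
      finally have "ennreal (cmod (\<Sum>\<^sub>\<infinity>\<alpha>\<in>basis_lattice E'. c \<alpha> * k \<alpha>) * W \<xi>) \<le> ennreal (C * m')" by (rule ennreal_leI)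
      then show ?thesis using C real W(1)[of \<xi>] unfolding \<gamma>_def[symmetric] m_def[symmetric] by (simp add: ennreal_mult)
    qed
  qed
  then show thesis using that[OF C] unfolding d_def by blast
qed

end

lemma split_norm_mono:
  assumes "q \<in> exponents d" "\<And>x. H x \<le> H' x" shows "split_norm B q \<theta> H \<le> split_norm B q \<theta> H'"
  unfolding split_norm_def
  by (rule mixed_norm_mono) (use assms in \<open>auto simp: exponents_def intro!: mult_right_mono\<close>)

lemma moderate_weight_mult_exp_bound:
  fixes \<theta> \<omega>\<^sub>0 :: "real^'n \<Rightarrow> real"
  assumes th: "\<theta> \<in> moderate_weights" and om: "\<omega>\<^sub>0 \<in> moderate_weights"
  obtains K R where "K \<ge> 1" "R \<ge> 0" "\<And>x y. \<omega>\<^sub>0 y * \<theta> y \<le> K * exp (R * norm (x - y)) * (\<omega>\<^sub>0 x * \<theta> x)"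
proof -
  define W where "W x = \<omega>\<^sub>0 x * \<theta> x" for x
  have pos: "\<theta> x > 0" "\<omega>\<^sub>0 x > 0" for x using th om by (auto simp: moderate_weights_def weights_def)
  obtain K1 R1 where K1: "K1 \<ge> 1" "R1 \<ge> 0" "\<And>x y. \<theta> y \<le> K1 * exp (R1 * norm (x - y)) * \<theta> x"
    using moderate_weight_exp_bound[OF th] by blast
  obtain K2 R2 where K2: "K2 \<ge> 1" "R2 \<ge> 0" "\<And>x y. \<omega>\<^sub>0 y \<le> K2 * exp (R2 * norm (x - y)) * \<omega>\<^sub>0 x"
    using moderate_weight_exp_bound[OF om] by blast
  define K where "K = K2 * K1"
  define R where "R = R2 + R1"
  have K: "K \<ge> 1" unfolding K_def using mult_mono[of 1 K2 1 K1] K1(1) K2(1) by simp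
  have R: "R \<ge> 0" using K1(2) K2(2) by (simp add: R_def)
  have KR: "W y \<le> K * exp (R * norm (x - y)) * W x" for x y
  proof -
    have "W y \<le> (K2 * exp (R2 * norm (x - y)) * \<omega>\<^sub>0 x) * (K1 * exp (R1 * norm (x - y)) * \<theta> x)"
      unfolding W_def by (intro mult_mono K1(3) K2(3)) (use pos K2(1) in \<open>auto intro: less_imp_le\<close>)
    also have "\<dots> = K * (exp (R2 * norm (x - y)) * exp (R1 * norm (x - y))) * W x" by (simp add: K_def W_def)
    also have "exp (R2 * norm (x - y)) * exp (R1 * norm (x - y)) = exp (R * norm (x - y))"
      unfolding exp_add[symmetric] by (simp add: R_def distrib_right)
    finally show ?thesis .
  qed
  show thesis using that[OF K R] KR unfolding W_def by blast
qed

context dual_pair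
begin

definition box :: "real list \<Rightarrow> real \<Rightarrow> (real^'n) set" where
  "box s \<delta> = {x. \<forall>j<length E. s ! j \<le> coords E' x ! j \<and> coords E' x ! j \<le> s ! j + \<delta>}"

lemma norm_box_diff: assumes "x \<in> box s \<delta>" "x' \<in> box s \<delta>" shows "norm (x - x') \<le> \<delta> * list_diam E"
proof (rule norm_le_coords)
  fix j assume j: "j < length E"
  have "coords E' (x - x') ! j = coords E' x ! j - coords E' x' ! j" by (rule coords_diff) (simp add: j length_eq)
  moreover have "s ! j \<le> coords E' x ! j \<and> coords E' x ! j \<le> s ! j + \<delta>" "s ! j \<le> coords E' x' ! j \<and> coords E' x' ! j \<le> s ! j + \<delta>"
    using assms j unfolding box_def by blast+
  ultimately show "\<bar>coords E' (x - x') ! j\<bar> \<le> \<delta>" by linarith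
qed

lemma lin_comb_in_box: "length s = length E \<Longrightarrow> \<delta> \<ge> 0 \<Longrightarrow> lin_comb E s \<in> box s \<delta>"
  unfolding box_def by (simp only: coords_lin_comb mem_Collect_eq) simp

text \<open>A constant cut off to a box of side 1 has itself as its mixed norm, so a pointwise bound
  passes through the local quasi-norm without loss, uniformly in \<open>j\<close>.\<close>

lemma split_norm_on_le:
  assumes r: "r \<in> exponents CARD('n)" and "\<And>x. g x \<le> h"
  shows "split_norm_on E r ((+) j ` parallelepiped E) g \<le> h"
proof -
  have r': "\<forall>p\<in>set r. p > 0" and lr: "length r = length E" using r length_card by (auto simp: exponents_def)
  have "split_norm_on E r ((+) j ` parallelepiped E) g \<le>
      mixed_norm r (\<lambda>xs. if (\<forall>i<length r. coords E' j ! i \<le> xs ! i \<and> xs ! i \<le> coords E' j ! i + 1) then h else 0)"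
    unfolding split_norm_on_def split_norm_def
  proof (rule mixed_norm_mono[OF r'])
    fix xs :: "real list" assume xs: "length xs = length r"
    have c: "coords E' (lin_comb E xs) = xs" by (rule coords_lin_comb) (simp add: xs lr)
    show "g (lin_comb E xs) * indicator ((+) j ` parallelepiped E) (lin_comb E xs) * ennreal \<bar>1\<bar> \<le>
        (if (\<forall>i<length r. coords E' j ! i \<le> xs ! i \<and> xs ! i \<le> coords E' j ! i + 1) then h else 0)"
    proof (cases "lin_comb E xs \<in> (+) j ` parallelepiped E")
      case True
      then have "lin_comb E xs - j \<in> parallelepiped E" by auto
      then have p: "0 \<le> coords E' (lin_comb E xs - j) ! i \<and> coords E' (lin_comb E xs - j) ! i \<le> 1" if "i < length E" for i
        using that unfolding parallelepiped_iff by blast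
      have "coords E' j ! i \<le> xs ! i \<and> xs ! i \<le> coords E' j ! i + 1" if "i < length r" for i
        using p[of i] coords_diff[of i "lin_comb E xs" j] that lr length_eq unfolding c by linarith
      then show ?thesis using True assms(2) by simp
    qed simp
  qed
  also have "\<dots> = h"
    using mixed_norm_box[OF r' zero_less_one, of "coords E' j" h] lr length_eq by (simp add: dil_const_prod_1)
  finally show ?thesis .
qed

lemma split_norm_on_ge:
  assumes r: "r \<in> exponents CARD('n)" and s: "length s = length E" "\<And>j. j < length E \<Longrightarrow> 0 \<le> s ! j \<and> s ! j + \<delta> \<le> 1"
    and \<delta>: "\<delta> > 0" and g: "\<And>x. x \<in> box s \<delta> \<Longrightarrow> h \<le> g x"
  shows "h * ennreal (\<Prod>p\<leftarrow>r. dil_const \<delta> p) \<le> split_norm_on E r ((+) 0 ` parallelepiped E) g"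
proof -
  have r': "\<forall>p\<in>set r. p > 0" and lr: "length r = length E" using r length_card by (auto simp: exponents_def)
  have "h * ennreal (\<Prod>p\<leftarrow>r. dil_const \<delta> p) =
      mixed_norm r (\<lambda>xs. if (\<forall>i<length r. s ! i \<le> xs ! i \<and> xs ! i \<le> s ! i + \<delta>) then h else 0)"
    by (rule mixed_norm_box[OF r' \<delta>, symmetric]) (simp add: s lr)
  also have "\<dots> \<le> split_norm_on E r ((+) 0 ` parallelepiped E) g"
    unfolding split_norm_on_def split_norm_def
  proof (rule mixed_norm_mono[OF r'])
    fix xs :: "real list" assume xs: "length xs = length r"
    have c: "coords E' (lin_comb E xs) = xs" by (rule coords_lin_comb) (simp add: xs lr)
    show "(if (\<forall>i<length r. s ! i \<le> xs ! i \<and> xs ! i \<le> s ! i + \<delta>) then h else 0) \<le>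
        g (lin_comb E xs) * indicator ((+) 0 ` parallelepiped E) (lin_comb E xs) * ennreal \<bar>1\<bar>"
    proof (cases "\<forall>i<length r. s ! i \<le> xs ! i \<and> xs ! i \<le> s ! i + \<delta>")
      case True
      have tr: "s ! i \<le> xs ! i \<and> xs ! i \<le> s ! i + \<delta>" if "i < length E" for i using True that unfolding lr by blast
      have bx: "lin_comb E xs \<in> box s \<delta>" unfolding box_def mem_Collect_eq c using tr by blast
      have pe: "lin_comb E xs \<in> parallelepiped E" unfolding parallelepiped_iff c
      proof (intro allI impI)
        fix j assume "j < length E"
        then show "0 \<le> xs ! j \<and> xs ! j \<le> 1" using tr[of j] s(2)[of j] by linarith
      qed
      show ?thesis unfolding if_P[OF True] using g[OF bx] pe by simp
    next
      case False
      show ?thesis unfolding if_not_P[OF False] by simp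
    qed
  qed
  finally show ?thesis .
qed

text \<open>Evaluated at the corner of the cell of \<xi>, the maximal function is constant on cells,
  so discretization and \<open>lattice_norm_decay_sup\<close> combine. This is the common end of
  both upper bounds.\<close>

lemma split_norm_finite:
  assumes q: "q \<in> exponents CARD('n)" and C: "C > 0"
    and H: "\<And>\<xi>. H \<xi> * ennreal \<bar>\<theta> \<xi>\<bar> \<le> ennreal C * decay_sup b (lattice_pt (map floor (coords E \<xi>)))"
    and b: "lattice_norm q b < \<infinity>"
  shows "split_norm E' q \<theta> H < \<infinity>"
proof -
  obtain C2 where C2: "lattice_norm q (decay_sup b) \<le> ennreal C2 * lattice_norm q b"
    using lattice_norm_decay_sup[OF q] by blast
  have "split_norm E' q \<theta> H \<le> lattice_norm q (\<lambda>\<alpha>. ennreal C * decay_sup b \<alpha>)"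
    by (rule split_norm_upper[where b = "\<lambda>\<alpha>. ennreal C * decay_sup b \<alpha>", OF q H])
  also have "\<dots> = ennreal C * lattice_norm q (decay_sup b)" by (rule lattice_norm_cmult[OF q C])
  also have "\<dots> \<le> ennreal C * (ennreal C2 * lattice_norm q b)" by (intro mult_left_mono C2) auto
  also have "\<dots> < \<infinity>" using b by (simp add: ennreal_mult_less_top)
  finally show ?thesis .
qed

text \<open>The closed cells overlap in their faces, where the sum in the discrete norm has several
  terms. From above, the indicators of the cells are treated as a kernel in
  \<open>weighted_series_upper\<close>. From below, only the middle box with coordinates in
  [1/4, 3/4] of each cell is used, where a single term survives.\<close>

lemma discrete_norm_finite_iff:
  assumes q: "q \<in> exponents CARD('n)" and th: "\<theta> \<in> moderate_weights" and om: "\<And>x. \<omega>\<^sub>0 x > 0"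
  shows "discrete_norm (split_norm E' q \<theta>) E' (\<lambda>\<alpha>. c \<alpha> * of_real (\<omega>\<^sub>0 \<alpha>)) < \<infinity> \<longleftrightarrow>
    lattice_norm q (\<lambda>\<alpha>. ennreal (cmod (c \<alpha>) * (\<omega>\<^sub>0 \<alpha> * \<theta> \<alpha>))) < \<infinity>"
proof -
  interpret dual: dual_pair E' E by (rule dual)
  have pos: "\<theta> x > 0" for x using th by (auto simp: moderate_weights_def weights_def)
  obtain K R where K: "K \<ge> 1" and R: "R \<ge> 0" and KR: "\<And>x y. \<theta> y \<le> K * exp (R * norm (x - y)) * \<theta> x"
    using moderate_weight_exp_bound[OF th] by blast
  define a where "a \<alpha> = c \<alpha> * complex_of_real (\<omega>\<^sub>0 \<alpha>)" for \<alpha>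
  have ca: "cmod (a \<alpha>) * \<theta> \<alpha> = cmod (c \<alpha>) * (\<omega>\<^sub>0 \<alpha> * \<theta> \<alpha>)" for \<alpha>
    using om[of \<alpha>] by (simp add: a_def norm_mult)
  define k :: "real^'n \<Rightarrow> real^'n \<Rightarrow> complex" where "k \<xi> \<alpha> = indicator ((+) \<alpha> ` parallelepiped E') \<xi>" for \<xi> \<alpha>
  define D where "D = list_diam E'"
  have mem: "\<xi> \<in> (+) \<alpha> ` parallelepiped E' \<longleftrightarrow> (\<forall>j<length E. 0 \<le> coords E (\<xi> - \<alpha>) ! j \<and> coords E (\<xi> - \<alpha>) ! j \<le> 1)" for \<xi> \<alpha>
  proof -
    have "\<xi> \<in> (+) \<alpha> ` parallelepiped E' \<longleftrightarrow> \<xi> - \<alpha> \<in> parallelepiped E'" by force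
    then show ?thesis unfolding dual.parallelepiped_iff length_eq .
  qed
  have near: "norm (\<xi> - \<alpha>) \<le> D" if "\<And>j. j < length E \<Longrightarrow> 0 \<le> coords E (\<xi> - \<alpha>) ! j \<and> coords E (\<xi> - \<alpha>) ! j \<le> 1" for \<xi> \<alpha>
  proof -
    have "norm (\<xi> - \<alpha>) \<le> 1 * list_diam E'"
    proof (rule dual.norm_le_coords)
      fix j assume "j < length E'"
      then show "\<bar>coords E (\<xi> - \<alpha>) ! j\<bar> \<le> 1" using that[of j] length_eq by linarith
    qed
    then show ?thesis by (simp add: D_def)
  qed
  define H where "H \<xi> = ennreal (cmod (\<Sum>\<^sub>\<infinity>\<alpha>\<in>basis_lattice E'. a \<alpha> * k \<xi> \<alpha>))" for \<xi>
  have dn: "discrete_norm (split_norm E' q \<theta>) E' (\<lambda>\<alpha>. c \<alpha> * of_real (\<omega>\<^sub>0 \<alpha>)) = split_norm E' q \<theta> H"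
    by (simp add: discrete_norm_def H_def[abs_def] a_def k_def)
  show ?thesis unfolding dn
  proof
    \<comment> \<open>Makes the exponential majorant at least 1 up to distance \<open>D\<close>,
      that is, wherever the indicator is nonzero.\<close>
    define B where "B = exp ((R + real CARD('n) + 1) * D)"
    have B: "B > 0" by (simp add: B_def)
    obtain C where C: "C > 0"
      "\<And>c k \<xi>. (\<And>\<alpha>. \<alpha> \<in> basis_lattice E' \<Longrightarrow> cmod (k \<alpha>) \<le> B * exp (- ((R + real CARD('n) + 1) * norm (\<alpha> - \<xi>)))) \<Longrightarrow>
        ennreal (cmod (\<Sum>\<^sub>\<infinity>\<alpha>\<in>basis_lattice E'. c \<alpha> * k \<alpha>)) * ennreal (\<theta> \<xi>) \<le>
        ennreal C * decay_sup (\<lambda>\<alpha>. ennreal (cmod (c \<alpha>) * \<theta> \<alpha>)) (lattice_pt (map floor (coords E \<xi>)))"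
      using weighted_series_upper[of K \<theta> R B, OF K pos KR B R] by blast
    assume fin: "lattice_norm q (\<lambda>\<alpha>. ennreal (cmod (c \<alpha>) * (\<omega>\<^sub>0 \<alpha> * \<theta> \<alpha>))) < \<infinity>"
    show "split_norm E' q \<theta> H < \<infinity>"
    proof (rule split_norm_finite[OF q C(1) _ fin])
      fix \<xi>
      have "cmod (k \<xi> \<alpha>) \<le> B * exp (- ((R + real CARD('n) + 1) * norm (\<alpha> - \<xi>)))" for \<alpha>
      proof (cases "\<xi> \<in> (+) \<alpha> ` parallelepiped E'")
        case True
        then have "norm (\<alpha> - \<xi>) \<le> D" using near[of \<xi> \<alpha>] unfolding mem by (simp add: norm_minus_commute)
        then have "(R + real CARD('n) + 1) * norm (\<alpha> - \<xi>) \<le> (R + real CARD('n) + 1) * D" using R by (intro mult_left_mono) auto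
        then have "1 \<le> B * exp (- ((R + real CARD('n) + 1) * norm (\<alpha> - \<xi>)))" unfolding B_def exp_add[symmetric] by simp
        then show ?thesis using True by (simp add: k_def)
      next
        case False then show ?thesis using B by (simp add: k_def)
      qed
      from C(2)[of "k \<xi>" \<xi> a, OF this]
      show "H \<xi> * ennreal \<bar>\<theta> \<xi>\<bar> \<le> ennreal C * decay_sup (\<lambda>\<alpha>. ennreal (cmod (c \<alpha>) * (\<omega>\<^sub>0 \<alpha> * \<theta> \<alpha>))) (lattice_pt (map floor (coords E \<xi>)))"
        unfolding H_def ca using pos[of \<xi>] by (simp add: abs_of_pos)
    qed
  next
    assume fin: "split_norm E' q \<theta> H < \<infinity>"
    \<comment> \<open>By the exponential bound of the weight,
      \<open>e * \<theta> \<beta> \<le> \<theta> \<xi>\<close> for all \<xi> in the cell at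
      \<beta>.\<close>
    define e where "e = inverse (K * exp (R * D))"
    have e: "e > 0" using K by (simp add: e_def)
    have u: "length (replicate (length E) (1/4::real)) = length E" by simp
    have "ennreal (\<Prod>p\<leftarrow>q. dil_const (1/2) p) * lattice_norm q (\<lambda>\<alpha>. ennreal e * ennreal (cmod (c \<alpha>) * (\<omega>\<^sub>0 \<alpha> * \<theta> \<alpha>))) \<le> split_norm E' q \<theta> H"
    proof (rule split_norm_lower[OF q _ _ u])
      fix \<beta> \<xi> assume be: "\<beta> \<in> basis_lattice E'"
        and xi: "\<And>j. j < length E \<Longrightarrow> replicate (length E) (1/4::real) ! j \<le> coords E (\<xi> - \<beta>) ! j \<and> coords E (\<xi> - \<beta>) ! j \<le> replicate (length E) (1/4::real) ! j + 1/2"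
      have xi': "1/4 \<le> coords E (\<xi> - \<beta>) ! j \<and> coords E (\<xi> - \<beta>) ! j \<le> 3/4" if "j < length E" for j
        using xi[OF that] that by (simp del: nth_coords)
      have z: "k \<xi> \<alpha> = 0" if al: "\<alpha> \<in> basis_lattice E'" "\<alpha> \<noteq> \<beta>" for \<alpha>
      proof -
        have "\<xi> \<notin> (+) \<alpha> ` parallelepiped E'"
        proof
          assume "\<xi> \<in> (+) \<alpha> ` parallelepiped E'"
          then have m: "0 \<le> coords E (\<xi> - \<alpha>) ! j \<and> coords E (\<xi> - \<alpha>) ! j \<le> 1" if "j < length E" for j
            using that unfolding mem by blast
          \<comment> \<open>Coordinates in [1/4, 3/4] relative to \<beta> and in [0, 1] relative to
            \<alpha> differ by less than 1, whereas those of a lattice point are integers.\<close>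
          have "coords E (\<alpha> - \<beta>) ! j = 0" if j: "j < length E" for j
          proof -
            have "coords E (\<xi> - \<beta> - (\<xi> - \<alpha>)) ! j = coords E (\<xi> - \<beta>) ! j - coords E (\<xi> - \<alpha>) ! j"
              by (rule dual.coords_diff) (use j in simp)
            moreover have "\<xi> - \<beta> - (\<xi> - \<alpha>) = \<alpha> - \<beta>" by simp
            ultimately have "\<bar>coords E (\<alpha> - \<beta>) ! j\<bar> < 1" using xi'[OF j] m[OF j] by (simp only:) linarith
            moreover have "coords E (\<alpha> - \<beta>) ! j \<in> \<int>"
              using dual.lattice_diff[OF al(1) be] j unfolding dual.in_lattice_iff by simp
            ultimately show ?thesis by (metis Ints_nonzero_abs_less1)
          qed
          then have "norm (\<alpha> - \<beta>) \<le> 0 * list_diam E'" by (intro dual.norm_le_coords) (simp add: length_eq del: nth_coords)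
          then show False using al(2) by simp
        qed
        then show ?thesis by (simp add: k_def)
      qed
      have "\<xi> \<in> (+) \<beta> ` parallelepiped E'" unfolding mem
      proof (intro allI impI)
        fix j assume "j < length E"
        then show "0 \<le> coords E (\<xi> - \<beta>) ! j \<and> coords E (\<xi> - \<beta>) ! j \<le> 1" using xi'[of j] by linarith
      qed
      then have k1: "k \<xi> \<beta> = 1" by (simp only: k_def indicator_simps)
      have "((\<lambda>\<alpha>. a \<alpha> * k \<xi> \<alpha>) has_sum (a \<beta> * k \<xi> \<beta>)) (basis_lattice E')"
        by (rule infsum_single_support[OF be]) (simp add: z)
      then have H: "H \<xi> = ennreal (cmod (a \<beta>))" by (simp add: H_def infsumI k1)
      have "norm (\<xi> - \<beta>) \<le> D"
      proof (rule near)
        fix j assume "j < length E"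
        then show "0 \<le> coords E (\<xi> - \<beta>) ! j \<and> coords E (\<xi> - \<beta>) ! j \<le> 1" using xi'[of j] by linarith
      qed
      then have "K * exp (R * norm (\<xi> - \<beta>)) * \<theta> \<xi> \<le> K * exp (R * D) * \<theta> \<xi>"
        using R K pos[of \<xi>] by (intro mult_right_mono mult_left_mono) (auto simp: mult_left_mono)
      then have "\<theta> \<beta> \<le> K * exp (R * D) * \<theta> \<xi>" using KR[of \<beta> \<xi>] by linarith
      then have "e * \<theta> \<beta> \<le> \<theta> \<xi>" using K by (simp add: e_def field_simps)
      then have "cmod (a \<beta>) * (e * \<theta> \<beta>) \<le> cmod (a \<beta>) * \<theta> \<xi>" by (intro mult_left_mono) auto
      then have "ennreal (e * (cmod (a \<beta>) * \<theta> \<beta>)) \<le> ennreal (cmod (a \<beta>) * \<theta> \<xi>)" by (intro ennreal_leI) (simp add: mult_ac)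
      then show "ennreal e * ennreal (cmod (c \<beta>) * (\<omega>\<^sub>0 \<beta> * \<theta> \<beta>)) \<le> H \<xi> * ennreal \<bar>\<theta> \<xi>\<bar>"
        unfolding H ca[symmetric] using e pos[of \<xi>] pos[of \<beta>] by (simp add: ennreal_mult abs_of_pos)
    qed auto
    also note fin
    finally have "ennreal (\<Prod>p\<leftarrow>q. dil_const (1/2) p) * (ennreal e * lattice_norm q (\<lambda>\<alpha>. ennreal (cmod (c \<alpha>) * (\<omega>\<^sub>0 \<alpha> * \<theta> \<alpha>)))) < \<infinity>"
      unfolding lattice_norm_cmult[OF q e] .
    then show "lattice_norm q (\<lambda>\<alpha>. ennreal (cmod (c \<alpha>) * (\<omega>\<^sub>0 \<alpha> * \<theta> \<alpha>))) < \<infinity>"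
      using e dil_const_prod_pos[of "1/2" q] by (auto simp: ennreal_mult_less_top ennreal_mult_eq_top_iff less_top)
  qed
qed

text \<open>The series bound is uniform in \<open>x\<close>, so the supremum over \<open>x\<close>
  can stand inside the norm. It dominates the local quasi-norms in both orders of integration, hence
  one estimate serves \<open>M_space\<close> and \<open>W_space\<close>.\<close>

lemma STFT_upper:
  assumes q: "q \<in> exponents CARD('n)" and th: "\<theta> \<in> moderate_weights" and om: "\<omega>\<^sub>0 \<in> moderate_weights"
    and w: "\<And>x \<xi>. \<omega> (x, \<xi>) = \<omega>\<^sub>0 \<xi>" and ex: "has_expansion E' f c" and phi: "\<phi> \<in> Sigma1"
    and fin: "lattice_norm q (\<lambda>\<alpha>. ennreal (cmod (c \<alpha>) * (\<omega>\<^sub>0 \<alpha> * \<theta> \<alpha>))) < \<infinity>"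
  shows "split_norm E' q \<theta> (\<lambda>\<xi>. SUP x. weighted_STFT \<phi> \<omega> f x \<xi>) < \<infinity>"
proof -
  define W where "W x = \<omega>\<^sub>0 x * \<theta> x" for x
  have pos: "\<theta> x > 0" "\<omega>\<^sub>0 x > 0" for x using th om by (auto simp: moderate_weights_def weights_def)
  have Wpos: "W x > 0" for x using pos by (simp add: W_def)
  obtain K R where K: "K \<ge> 1" and R: "R \<ge> 0" and KR: "\<And>x y. W y \<le> K * exp (R * norm (x - y)) * W x"
    using moderate_weight_mult_exp_bound[OF th om] unfolding W_def by blast
  have S: "R + real CARD('n) + 1 > 0" using R by simp
  obtain B where B: "B > 0" "\<And>\<xi>. cmod (fourier_int \<phi> \<xi>) \<le> B * exp (- ((R + real CARD('n) + 1) * norm \<xi>))"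
    using Sigma1_fourier_int_decay[OF phi S] by blast
  obtain C where C: "C > 0"
      "\<And>c k \<xi>. (\<And>\<alpha>. \<alpha> \<in> basis_lattice E' \<Longrightarrow> cmod (k \<alpha>) \<le> B * exp (- ((R + real CARD('n) + 1) * norm (\<alpha> - \<xi>)))) \<Longrightarrow>
        ennreal (cmod (\<Sum>\<^sub>\<infinity>\<alpha>\<in>basis_lattice E'. c \<alpha> * k \<alpha>)) * ennreal (W \<xi>) \<le>
        ennreal C * decay_sup (\<lambda>\<alpha>. ennreal (cmod (c \<alpha>) * W \<alpha>)) (lattice_pt (map floor (coords E \<xi>)))"
    using weighted_series_upper[of K W R B, OF K Wpos KR B(1) R] by blast
  define \<kappa> where "\<kappa> = stft_const TYPE('n)"
  have \<kappa>: "\<kappa> > 0" unfolding \<kappa>_def by (rule stft_const_pos)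
  have fin': "lattice_norm q (\<lambda>\<alpha>. ennreal (cmod (c \<alpha>) * W \<alpha>)) < \<infinity>" using fin by (simp add: W_def)
  have kC: "\<kappa> * C > 0" using \<kappa> C(1) by simp
  show ?thesis
  proof (rule split_norm_finite[OF q kC _ fin'])
    fix \<xi>
    have "weighted_STFT \<phi> \<omega> f x \<xi> * ennreal \<bar>\<theta> \<xi>\<bar> \<le> ennreal (\<kappa> * C) * decay_sup (\<lambda>\<alpha>. ennreal (cmod (c \<alpha>) * W \<alpha>)) (lattice_pt (map floor (coords E \<xi>)))" for x
    proof -
      define k where "k \<alpha> = cis (x \<bullet> (\<alpha> - 0)) * cnj (fourier_int \<phi> (\<alpha> - \<xi>))" for \<alpha>
      have "cmod (STFT \<phi> f x \<xi>) = cmod (cis (x \<bullet> (\<xi> - 0)) * STFT \<phi> f x \<xi>)" by (simp add: norm_mult)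
      also have "\<dots> = \<kappa> * cmod (\<Sum>\<^sub>\<infinity>\<alpha>\<in>basis_lattice E'. c \<alpha> * k \<alpha>)"
        unfolding STFT_expansion[OF ex phi] k_def using \<kappa> by (simp add: norm_mult \<kappa>_def)
      finally have st: "cmod (STFT \<phi> f x \<xi>) = \<kappa> * cmod (\<Sum>\<^sub>\<infinity>\<alpha>\<in>basis_lattice E'. c \<alpha> * k \<alpha>)" .
      have "weighted_STFT \<phi> \<omega> f x \<xi> * ennreal \<bar>\<theta> \<xi>\<bar> = ennreal (cmod (STFT \<phi> f x \<xi>) * W \<xi>)"
        unfolding weighted_STFT_def w W_def using pos[of \<xi>] by (simp add: norm_mult ennreal_mult mult.assoc)
      also have "\<dots> = ennreal \<kappa> * (ennreal (cmod (\<Sum>\<^sub>\<infinity>\<alpha>\<in>basis_lattice E'. c \<alpha> * k \<alpha>)) * ennreal (W \<xi>))"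
        unfolding st using \<kappa> Wpos[of \<xi>] by (simp add: ennreal_mult mult.assoc)
      also have "\<dots> \<le> ennreal \<kappa> * (ennreal C * decay_sup (\<lambda>\<alpha>. ennreal (cmod (c \<alpha>) * W \<alpha>)) (lattice_pt (map floor (coords E \<xi>))))"
        by (rule mult_left_mono[OF C(2)]) (use B(2) in \<open>auto simp: k_def norm_mult\<close>)
      finally show ?thesis using \<kappa> C(1) by (simp add: ennreal_mult mult.assoc)
    qed
    then show "(SUP x. weighted_STFT \<phi> \<omega> f x \<xi>) * ennreal \<bar>\<theta> \<xi>\<bar> \<le> ennreal (\<kappa> * C) * decay_sup (\<lambda>\<alpha>. ennreal (cmod (c \<alpha>) * W \<alpha>)) (lattice_pt (map floor (coords E \<xi>)))"
      unfolding SUP_mult_right_ennreal by (intro SUP_least)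
  qed
qed

section \<open>Lower bounds for the short-time Fourier transform\<close>

text \<open>\<open>M\<close> measures the coefficients as seen from \<beta>, so the error is
  relative to that size, with a constant independent of \<beta>. Once the phase at \<beta> is
  removed, a change of \<open>x\<close> alters each character by at most \<rho> times
  \<open>norm (\<alpha> - \<beta>)\<close>, and a change of \<xi> is governed by
  \<open>fourier_int_Holder\<close>; this gives the common order \<open>sqrt \<rho>\<close>.\<close>

lemma STFT_osc:
  assumes ex: "has_expansion E' f c" and phi: "\<phi> \<in> Sigma1" and R: "R \<ge> 0" and r: "r \<ge> 0"
  obtains C where "C > 0"
    "\<And>x x' \<xi> \<xi>' \<beta> M \<rho>. \<lbrakk>\<beta> \<in> basis_lattice E'; M \<ge> 0; \<And>\<alpha>. \<alpha> \<in> basis_lattice E' \<Longrightarrow> cmod (c \<alpha>) \<le> M * exp (R * norm (\<alpha> - \<beta>));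
      norm (\<xi> - \<beta>) \<le> r; norm (x - x') \<le> \<rho>; norm (\<xi> - \<xi>') \<le> \<rho>; \<rho> \<le> 1\<rbrakk> \<Longrightarrow>
      cmod (STFT \<phi> f x \<xi>) \<le> cmod (STFT \<phi> f x' \<xi>') + C * sqrt \<rho> * M"
proof -
  interpret dual: dual_pair E' E by (rule dual)
  \<comment> \<open>\<open>R\<close> compensates the growth of \<open>c\<close>, 1 the factor
    \<open>norm (\<alpha> - \<beta>) + 1\<close> caused by the phases, and 1 is left for
    summability.\<close>
  define S where "S = R + 2"
  have S: "S > 0" using R by (simp add: S_def)
  let ?F = "fourier_int \<phi>"
  obtain B1 where B1: "B1 > 0" "\<And>\<xi>. cmod (?F \<xi>) \<le> B1 * exp (- (S * norm \<xi>))"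
    using Sigma1_fourier_int_decay[OF phi S] by blast
  obtain B2 where B2: "B2 > 0" "\<And>\<xi> \<xi>'. norm (\<xi> - \<xi>') \<le> 1 \<Longrightarrow>
      cmod (?F \<xi> - ?F \<xi>') \<le> B2 * sqrt (norm (\<xi> - \<xi>')) * exp (- (S * norm \<xi>))"
    using fourier_int_Holder[OF phi S] by blast
  define s where "s = (\<Sum>\<^sub>\<infinity>\<beta>\<in>basis_lattice E'. exp (- (1 * norm \<beta>)))"
  have s0: "s \<ge> 0" unfolding s_def by (rule infsum_nonneg) auto
  define \<kappa> where "\<kappa> = stft_const TYPE('n)"
  have \<kappa>: "\<kappa> > 0" unfolding \<kappa>_def by (rule stft_const_pos)
  define C where "C = \<kappa> * ((B1 + B2) * exp (S * r) * (s + 1))"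
  have C: "C > 0" using \<kappa> B1(1) B2(1) s0 by (simp add: C_def)
  have "cmod (STFT \<phi> f x \<xi>) \<le> cmod (STFT \<phi> f x' \<xi>') + C * sqrt \<rho> * M"
    if be: "\<beta> \<in> basis_lattice E'" and M: "M \<ge> 0"
      and gr: "\<And>\<alpha>. \<alpha> \<in> basis_lattice E' \<Longrightarrow> cmod (c \<alpha>) \<le> M * exp (R * norm (\<alpha> - \<beta>))"
      and xb: "norm (\<xi> - \<beta>) \<le> r" and xx: "norm (x - x') \<le> \<rho>" and xi: "norm (\<xi> - \<xi>') \<le> \<rho>" and rho: "\<rho> \<le> 1"
    for x x' \<xi> \<xi>' \<beta> M \<rho>
  proof -
    have rho0: "\<rho> \<ge> 0" using norm_ge_zero[of "x - x'"] xx by linarith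
    \<comment> \<open>Brings the error of the phases, linear in \<rho>, to the order of the error in
      frequency.\<close>
    have sq: "\<rho> \<le> sqrt \<rho>" by (rule real_le_rsqrt) (use rho rho0 in \<open>simp add: power2_eq_square mult_left_le\<close>)
    define k where "k \<alpha> = cis (x \<bullet> (\<alpha> - \<beta>)) * cnj (?F (\<alpha> - \<xi>))" for \<alpha>
    define k' where "k' \<alpha> = cis (x' \<bullet> (\<alpha> - \<beta>)) * cnj (?F (\<alpha> - \<xi>'))" for \<alpha>
    have sm: "(\<lambda>\<alpha>. exp (- (1 * norm (\<alpha> + - \<beta>)))) summable_on basis_lattice E'"
    proof -
      have b: "bij_betw (\<lambda>\<alpha>. \<alpha> + - \<beta>) (basis_lattice E') (basis_lattice E')"
        by (rule bij_betw_byWitness[where f' = "\<lambda>y. y - - \<beta>"])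
           (use be in \<open>auto simp: dual.lattice_add dual.lattice_diff\<close>)
      show ?thesis using summable_on_reindex_bij_betw[OF b, of "\<lambda>y. exp (- (1 * norm y))"] dual.summable_on_exp_lattice[OF zero_less_one] by blast
    qed
    have dec: "exp (- (S * norm (\<alpha> - \<xi>))) \<le> exp (S * r) * exp (- (S * norm (\<alpha> - \<beta>)))" for \<alpha>
    proof -
      have "norm (\<alpha> - \<beta>) \<le> norm (\<alpha> - \<xi>) + r" using norm_triangle_ineq[of "\<alpha> - \<xi>" "\<xi> - \<beta>"] xb by simp
      then have "S * norm (\<alpha> - \<beta>) \<le> S * (norm (\<alpha> - \<xi>) + r)" using S by (intro mult_left_mono) auto
      then show ?thesis unfolding exp_add[symmetric] by (simp add: algebra_simps)
    qed
    have absorb: "cmod (c \<alpha>) * (D * (norm (\<alpha> - \<beta>) + 1) * exp (- (S * norm (\<alpha> - \<xi>)))) \<le> M * D * exp (S * r) * exp (- (1 * norm (\<alpha> + - \<beta>)))"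
      if "\<alpha> \<in> basis_lattice E'" "D \<ge> 0" for \<alpha> D
    proof -
      define t where "t = norm (\<alpha> - \<beta>)"
      have "t + 1 \<le> exp t" using exp_ge_add_one_self[of t] by (simp add: add.commute)
      then have "D * (t + 1) * exp (- (S * norm (\<alpha> - \<xi>))) \<le> D * exp t * (exp (S * r) * exp (- (S * t)))"
        using dec[of \<alpha>] that(2) by (intro mult_mono mult_left_mono) (auto simp: t_def)
      then have "cmod (c \<alpha>) * (D * (t + 1) * exp (- (S * norm (\<alpha> - \<xi>)))) \<le> (M * exp (R * t)) * (D * exp t * (exp (S * r) * exp (- (S * t))))"
        by (rule mult_mono[OF gr[OF that(1), folded t_def]]) (use M that(2) in \<open>auto simp: t_def\<close>)
      also have "\<dots> = M * D * exp (S * r) * (exp (R * t) * exp t * exp (- (S * t)))" by simp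
      also have "exp (R * t) * exp t * exp (- (S * t)) = exp (- (1 * t))"
        unfolding exp_add[symmetric] by (simp add: S_def algebra_simps)
      finally show ?thesis by (simp add: t_def)
    qed
    have t1: "cmod (c \<alpha> * k \<alpha>) \<le> (M * B1 * exp (S * r)) * exp (- (1 * norm (\<alpha> + - \<beta>)))" if al: "\<alpha> \<in> basis_lattice E'" for \<alpha>
    proof -
      have "cmod (k \<alpha>) \<le> B1 * 1 * exp (- (S * norm (\<alpha> - \<xi>)))" using B1(2)[of "\<alpha> - \<xi>"] by (simp add: k_def norm_mult)
      also have "\<dots> \<le> B1 * (norm (\<alpha> - \<beta>) + 1) * exp (- (S * norm (\<alpha> - \<xi>)))"
        using B1(1) by (intro mult_right_mono mult_left_mono) auto
      finally have "cmod (c \<alpha>) * cmod (k \<alpha>) \<le> cmod (c \<alpha>) * (B1 * (norm (\<alpha> - \<beta>) + 1) * exp (- (S * norm (\<alpha> - \<xi>))))"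
        by (rule mult_left_mono) auto
      also have "\<dots> \<le> M * B1 * exp (S * r) * exp (- (1 * norm (\<alpha> + - \<beta>)))" by (rule absorb[OF al]) (use B1(1) in simp)
      finally show ?thesis by (simp only: norm_mult)
    qed
    have t2: "cmod (c \<alpha> * k \<alpha> - c \<alpha> * k' \<alpha>) \<le> (M * (sqrt \<rho> * (B1 + B2)) * exp (S * r)) * exp (- (1 * norm (\<alpha> + - \<beta>)))" if al: "\<alpha> \<in> basis_lattice E'" for \<alpha>
    proof -
      define e where "e = exp (- (S * norm (\<alpha> - \<xi>)))"
      have e: "e > 0" by (simp add: e_def)
      have "k \<alpha> - k' \<alpha> = (cis (x \<bullet> (\<alpha> - \<beta>)) - cis (x' \<bullet> (\<alpha> - \<beta>))) * cnj (?F (\<alpha> - \<xi>)) + cis (x' \<bullet> (\<alpha> - \<beta>)) * cnj (?F (\<alpha> - \<xi>) - ?F (\<alpha> - \<xi>'))"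
        unfolding k_def k'_def by (simp add: algebra_simps)
      then have "cmod (k \<alpha> - k' \<alpha>) \<le> cmod (cis (x \<bullet> (\<alpha> - \<beta>)) - cis (x' \<bullet> (\<alpha> - \<beta>))) * cmod (?F (\<alpha> - \<xi>)) + cmod (?F (\<alpha> - \<xi>) - ?F (\<alpha> - \<xi>'))"
        using norm_triangle_ineq[of "(cis (x \<bullet> (\<alpha> - \<beta>)) - cis (x' \<bullet> (\<alpha> - \<beta>))) * cnj (?F (\<alpha> - \<xi>))" "cis (x' \<bullet> (\<alpha> - \<beta>)) * cnj (?F (\<alpha> - \<xi>) - ?F (\<alpha> - \<xi>'))"]
        by (simp only: norm_mult complex_mod_cnj norm_cis mult_1)
      moreover have "cmod (cis (x \<bullet> (\<alpha> - \<beta>)) - cis (x' \<bullet> (\<alpha> - \<beta>))) * cmod (?F (\<alpha> - \<xi>)) \<le> (sqrt \<rho> * norm (\<alpha> - \<beta>)) * (B1 * e)"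
      proof (rule mult_mono)
        have "cmod (cis (x \<bullet> (\<alpha> - \<beta>)) - cis (x' \<bullet> (\<alpha> - \<beta>))) \<le> \<bar>(x - x') \<bullet> (\<alpha> - \<beta>)\<bar>"
          using norm_cis_diff_le[of "x \<bullet> (\<alpha> - \<beta>)" "x' \<bullet> (\<alpha> - \<beta>)"] by (simp add: inner_diff_left)
        also have "\<dots> \<le> norm (x - x') * norm (\<alpha> - \<beta>)" by (rule Cauchy_Schwarz_ineq2)
        also have "\<dots> \<le> sqrt \<rho> * norm (\<alpha> - \<beta>)" using xx sq by (intro mult_right_mono) auto
        finally show "cmod (cis (x \<bullet> (\<alpha> - \<beta>)) - cis (x' \<bullet> (\<alpha> - \<beta>))) \<le> sqrt \<rho> * norm (\<alpha> - \<beta>)" .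
      qed (use B1(2)[of "\<alpha> - \<xi>"] rho0 in \<open>auto simp: e_def\<close>)
      moreover have "cmod (?F (\<alpha> - \<xi>) - ?F (\<alpha> - \<xi>')) \<le> B2 * sqrt \<rho> * e"
      proof -
        have n: "norm ((\<alpha> - \<xi>) - (\<alpha> - \<xi>')) = norm (\<xi> - \<xi>')" by (simp add: norm_minus_commute)
        have "cmod (?F (\<alpha> - \<xi>) - ?F (\<alpha> - \<xi>')) \<le> B2 * sqrt (norm (\<xi> - \<xi>')) * e"
          using B2(2)[of "\<alpha> - \<xi>" "\<alpha> - \<xi>'"] unfolding n e_def using xi rho by linarith
        also have "\<dots> \<le> B2 * sqrt \<rho> * e" using xi B2(1) e by (intro mult_right_mono mult_left_mono) auto
        finally show ?thesis .
      qed
      ultimately have "cmod (k \<alpha> - k' \<alpha>) \<le> (sqrt \<rho> * norm (\<alpha> - \<beta>)) * (B1 * e) + B2 * sqrt \<rho> * e" by linarith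
      also have "\<dots> \<le> (sqrt \<rho> * (B1 + B2)) * (norm (\<alpha> - \<beta>) + 1) * e"
        using B1(1) B2(1) rho0 e by (simp add: algebra_simps)
      finally have "cmod (c \<alpha>) * cmod (k \<alpha> - k' \<alpha>) \<le> cmod (c \<alpha>) * ((sqrt \<rho> * (B1 + B2)) * (norm (\<alpha> - \<beta>) + 1) * e)"
        by (rule mult_left_mono) auto
      also have "\<dots> \<le> M * (sqrt \<rho> * (B1 + B2)) * exp (S * r) * exp (- (1 * norm (\<alpha> + - \<beta>)))"
        unfolding e_def by (rule absorb[OF al]) (use B1(1) B2(1) rho0 in simp)
      finally show ?thesis unfolding right_diff_distrib[symmetric] norm_mult .
    qed
    have sk: "(\<lambda>\<alpha>. c \<alpha> * k \<alpha>) summable_on basis_lattice E'" by (rule abs_summable_bound(2)[OF sm t1])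
    have sd: "(\<lambda>\<alpha>. c \<alpha> * k \<alpha> - c \<alpha> * k' \<alpha>) summable_on basis_lattice E'" by (rule abs_summable_bound(2)[OF sm t2])
    have sk': "(\<lambda>\<alpha>. c \<alpha> * k' \<alpha>) summable_on basis_lattice E'"
      using summable_on_add[OF sk summable_on_uminus[THEN iffD2, OF sd]] by simp
    have split: "(\<Sum>\<^sub>\<infinity>\<alpha>\<in>basis_lattice E'. c \<alpha> * k \<alpha>) = (\<Sum>\<^sub>\<infinity>\<alpha>\<in>basis_lattice E'. c \<alpha> * k' \<alpha>) + (\<Sum>\<^sub>\<infinity>\<alpha>\<in>basis_lattice E'. c \<alpha> * k \<alpha> - c \<alpha> * k' \<alpha>)"
      using infsum_add[OF sk' sd] by simp
    have "cmod (\<Sum>\<^sub>\<infinity>\<alpha>\<in>basis_lattice E'. c \<alpha> * k \<alpha> - c \<alpha> * k' \<alpha>) \<le> (M * (sqrt \<rho> * (B1 + B2)) * exp (S * r)) * (\<Sum>\<^sub>\<infinity>\<alpha>\<in>basis_lattice E'. exp (- (1 * norm (\<alpha> + - \<beta>))))"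
      by (rule norm_infsum_le_cmult[OF sm t2])
    also have "(\<Sum>\<^sub>\<infinity>\<alpha>\<in>basis_lattice E'. exp (- (1 * norm (\<alpha> + - \<beta>)))) = s"
      unfolding s_def using be by (intro dual.infsum_lattice_shift[of "- \<beta>" "\<lambda>y. exp (- (1 * norm y))"]) simp
    also have "(M * (sqrt \<rho> * (B1 + B2)) * exp (S * r)) * s \<le> (M * (sqrt \<rho> * (B1 + B2)) * exp (S * r)) * (s + 1)"
      using M rho0 B1(1) B2(1) by (intro mult_left_mono) auto
    finally have d: "\<kappa> * cmod (\<Sum>\<^sub>\<infinity>\<alpha>\<in>basis_lattice E'. c \<alpha> * k \<alpha> - c \<alpha> * k' \<alpha>) \<le> C * sqrt \<rho> * M"
      using \<kappa> by (simp add: C_def mult_ac)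
    have "cmod (STFT \<phi> f x \<xi>) = cmod (cis (x \<bullet> (\<xi> - \<beta>)) * STFT \<phi> f x \<xi>)" by (simp add: norm_mult)
    also have "\<dots> = \<kappa> * cmod (\<Sum>\<^sub>\<infinity>\<alpha>\<in>basis_lattice E'. c \<alpha> * k \<alpha>)"
      unfolding STFT_expansion[OF ex phi] k_def using \<kappa> by (simp add: norm_mult \<kappa>_def)
    also have "\<dots> \<le> \<kappa> * (cmod (\<Sum>\<^sub>\<infinity>\<alpha>\<in>basis_lattice E'. c \<alpha> * k' \<alpha>) + cmod (\<Sum>\<^sub>\<infinity>\<alpha>\<in>basis_lattice E'. c \<alpha> * k \<alpha> - c \<alpha> * k' \<alpha>))"
      unfolding split using \<kappa> by (intro mult_left_mono norm_triangle_ineq) auto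
    also have "\<dots> \<le> \<kappa> * cmod (\<Sum>\<^sub>\<infinity>\<alpha>\<in>basis_lattice E'. c \<alpha> * k' \<alpha>) + C * sqrt \<rho> * M"
      using d by (simp add: distrib_left)
    also have "\<kappa> * cmod (\<Sum>\<^sub>\<infinity>\<alpha>\<in>basis_lattice E'. c \<alpha> * k' \<alpha>) = cmod (cis (x' \<bullet> (\<xi>' - \<beta>)) * STFT \<phi> f x' \<xi>')"
      unfolding STFT_expansion[OF ex phi] k'_def using \<kappa> by (simp add: norm_mult \<kappa>_def)
    also have "\<dots> = cmod (STFT \<phi> f x' \<xi>')" by (simp add: norm_mult)
    finally show ?thesis .
  qed
  then show thesis using that[OF C] by blast
qed

text \<open>If \<open>a \<beta>\<close> is controlled by \<open>\<mu> \<beta>\<close> up to half of any majorant of \<open>a\<close> of exponential growth around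
  \<open>\<beta>\<close>, the latter part can be absorbed into the left-hand side.\<close>

lemma absorb_exp_majorant:
  assumes a0: "\<And>\<alpha>. \<alpha> \<in> basis_lattice E' \<Longrightarrow> 0 \<le> a \<alpha>"
    and gr: "\<And>\<alpha>. \<alpha> \<in> basis_lattice E' \<Longrightarrow> a \<alpha> \<le> C * exp (R * norm \<alpha>)" and R: "R \<ge> 0"
    and mu: "\<And>\<alpha>. \<alpha> \<in> basis_lattice E' \<Longrightarrow> 0 \<le> \<mu> \<alpha>" and A: "A \<ge> 0"
    and step: "\<And>\<beta> M. \<beta> \<in> basis_lattice E' \<Longrightarrow> M \<ge> 0 \<Longrightarrow>
      (\<And>\<alpha>. \<alpha> \<in> basis_lattice E' \<Longrightarrow> a \<alpha> \<le> M * exp (R * norm (\<alpha> - \<beta>))) \<Longrightarrow> a \<beta> \<le> A * \<mu> \<beta> + M / 2"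
    and be: "\<beta> \<in> basis_lattice E'" and T: "\<And>\<alpha>. \<alpha> \<in> basis_lattice E' \<Longrightarrow> exp (- (R * norm (\<alpha> - \<beta>))) * \<mu> \<alpha> \<le> T"
  shows "a \<beta> \<le> 2 * A * T"
proof -
  let ?L = "basis_lattice E'"
  \<comment> \<open>The least constant that majorizes \<open>a\<close> around \<beta> with growth
    rate \<open>R\<close>. The a priori growth of \<open>a\<close> makes it finite.\<close>
  define M where "M \<beta> = (SUP \<alpha>\<in>?L. a \<alpha> * exp (- (R * norm (\<alpha> - \<beta>))))" for \<beta>
  have bdd: "bdd_above ((\<lambda>\<alpha>. a \<alpha> * exp (- (R * norm (\<alpha> - \<beta>)))) ` ?L)" for \<beta>
  proof (rule bdd_aboveI2)
    fix \<alpha> assume al: "\<alpha> \<in> ?L"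
    have C: "C \<ge> 0" using a0[OF al] gr[OF al] by (meson exp_gt_zero order_trans zero_le_mult_iff not_le)
    have "a \<alpha> * exp (- (R * norm (\<alpha> - \<beta>))) \<le> C * exp (R * norm \<alpha>) * exp (- (R * norm (\<alpha> - \<beta>)))"
      using gr[OF al] by (intro mult_right_mono) auto
    also have "\<dots> = C * exp (R * norm \<alpha> - R * norm (\<alpha> - \<beta>))" by (simp add: exp_diff exp_minus field_simps)
    also have "\<dots> \<le> C * exp (R * norm \<beta>)"
    proof -
      have "norm \<alpha> \<le> norm (\<alpha> - \<beta>) + norm \<beta>" using norm_triangle_ineq[of "\<alpha> - \<beta>" \<beta>] by simp
      then have "R * norm \<alpha> \<le> R * (norm (\<alpha> - \<beta>) + norm \<beta>)" using R by (rule mult_left_mono)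
      then show ?thesis using C by (intro mult_left_mono) (auto simp: distrib_left)
    qed
    finally show "a \<alpha> * exp (- (R * norm (\<alpha> - \<beta>))) \<le> C * exp (R * norm \<beta>)" .
  qed
  have up: "a \<alpha> * exp (- (R * norm (\<alpha> - \<beta>))) \<le> M \<beta>" if "\<alpha> \<in> ?L" for \<alpha> \<beta>
    unfolding M_def by (rule cSUP_upper[OF that bdd])
  have M0: "M \<beta> \<ge> 0" if "\<beta> \<in> ?L" for \<beta> using up[OF that, of \<beta>] a0[OF that] by simp
  have le: "a \<alpha> \<le> A * \<mu> \<alpha> + M \<alpha> / 2" if al: "\<alpha> \<in> ?L" for \<alpha>
  proof (rule step[OF al M0[OF al]])
    fix \<gamma> assume "\<gamma> \<in> ?L"
    from up[OF this, of \<alpha>] show "a \<gamma> \<le> M \<alpha> * exp (R * norm (\<gamma> - \<alpha>))"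
      by (simp add: exp_minus field_simps)
  qed
  \<comment> \<open>\<open>M\<close> itself grows at most at rate \<open>R\<close>, by the triangle
    inequality. Hence \<open>M \<alpha> / 2\<close>, damped by the exponential, is at most
    \<open>M \<beta> / 2\<close>, uniformly in \<alpha>.\<close>
  have Mtr: "exp (- (R * norm (\<alpha> - \<beta>))) * M \<alpha> \<le> M \<beta>" if al: "\<alpha> \<in> ?L" for \<alpha>
  proof -
    have "M \<alpha> \<le> exp (R * norm (\<alpha> - \<beta>)) * M \<beta>" unfolding M_def[of \<alpha>]
    proof (rule cSUP_least)
      fix \<gamma> assume ga: "\<gamma> \<in> ?L"
      have "norm (\<gamma> - \<beta>) \<le> norm (\<alpha> - \<beta>) + norm (\<gamma> - \<alpha>)" using norm_triangle_ineq[of "\<gamma> - \<alpha>" "\<alpha> - \<beta>"] by simp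
      then have "R * norm (\<gamma> - \<beta>) \<le> R * (norm (\<alpha> - \<beta>) + norm (\<gamma> - \<alpha>))" using R by (rule mult_left_mono)
      then have "exp (- (R * norm (\<gamma> - \<alpha>))) \<le> exp (R * norm (\<alpha> - \<beta>)) * exp (- (R * norm (\<gamma> - \<beta>)))"
        unfolding exp_add[symmetric] by (simp add: distrib_left)
      then have "a \<gamma> * exp (- (R * norm (\<gamma> - \<alpha>))) \<le> a \<gamma> * (exp (R * norm (\<alpha> - \<beta>)) * exp (- (R * norm (\<gamma> - \<beta>))))"
        using a0[OF ga] by (rule mult_left_mono)
      also have "\<dots> = exp (R * norm (\<alpha> - \<beta>)) * (a \<gamma> * exp (- (R * norm (\<gamma> - \<beta>))))" by simp
      also have "\<dots> \<le> exp (R * norm (\<alpha> - \<beta>)) * M \<beta>" by (intro mult_left_mono up ga) auto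
      finally show "a \<gamma> * exp (- (R * norm (\<gamma> - \<alpha>))) \<le> exp (R * norm (\<alpha> - \<beta>)) * M \<beta>" .
    qed (use al in auto)
    then show ?thesis by (simp add: exp_minus field_simps)
  qed
  \<comment> \<open>The supremum over \<alpha> of the damped inequality \<open>le\<close>. As
    \<open>M \<beta>\<close> is finite, half of it can be subtracted.\<close>
  have "M \<beta> \<le> A * T + M \<beta> / 2" unfolding M_def[of \<beta>]
  proof (rule cSUP_least, goal_cases)
    case (2 \<alpha>)
    let ?e = "exp (- (R * norm (\<alpha> - \<beta>)))"
    have "a \<alpha> * ?e \<le> (A * \<mu> \<alpha> + M \<alpha> / 2) * ?e" using le[OF 2] by (intro mult_right_mono) auto
    also have "\<dots> = A * (?e * \<mu> \<alpha>) + (?e * M \<alpha>) / 2" by (simp add: algebra_simps)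
    also have "\<dots> \<le> A * T + M \<beta> / 2" using mult_left_mono[OF T[OF 2] A] Mtr[OF 2] by linarith
    finally show ?case by (simp add: M_def)
  qed (use be in auto)
  then have "M \<beta> \<le> 2 * A * T" by linarith
  moreover have "a \<beta> \<le> M \<beta>" using up[OF be, of \<beta>] by simp
  ultimately show ?thesis by linarith
qed

text \<open>Moving the weight between \<alpha> and \<beta> costs rate \<open>R\<^sub>0\<close>, and
  the maximal function has rate \<open>CARD('n)\<close>; the requirement on \<open>R\<close>
  provides for both. Pointwise absorption then bounds the weighted \<open>a\<close> by a multiple of
  the maximal function of the weighted \<mu>.\<close>

lemma lattice_norm_absorb:
  assumes q: "q \<in> exponents CARD('n)"
    and K: "K \<ge> 1" and W: "\<And>x. W x > 0" "\<And>x y. W y \<le> K * exp (R\<^sub>0 * norm (x - y)) * W x" and R: "R \<ge> R\<^sub>0 + real CARD('n)" "R \<ge> 0"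
    and a0: "\<And>\<alpha>. \<alpha> \<in> basis_lattice E' \<Longrightarrow> 0 \<le> a \<alpha>"
    and gr: "\<And>\<alpha>. \<alpha> \<in> basis_lattice E' \<Longrightarrow> a \<alpha> \<le> C * exp (R * norm \<alpha>)"
    and mu: "\<And>\<alpha>. \<alpha> \<in> basis_lattice E' \<Longrightarrow> 0 \<le> \<mu> \<alpha>" and A: "A > 0"
    and step: "\<And>\<beta> M. \<beta> \<in> basis_lattice E' \<Longrightarrow> M \<ge> 0 \<Longrightarrow>
      (\<And>\<alpha>. \<alpha> \<in> basis_lattice E' \<Longrightarrow> a \<alpha> \<le> M * exp (R * norm (\<alpha> - \<beta>))) \<Longrightarrow> a \<beta> \<le> A * \<mu> \<beta> + M / 2"
    and fin: "lattice_norm q (\<lambda>\<alpha>. ennreal (\<mu> \<alpha> * W \<alpha>)) < \<infinity>"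
  shows "lattice_norm q (\<lambda>\<alpha>. ennreal (a \<alpha> * W \<alpha>)) < \<infinity>"
proof -
  let ?b = "\<lambda>\<alpha>. ennreal (\<mu> \<alpha> * W \<alpha>)"
  obtain C2 where C2: "lattice_norm q (decay_sup ?b) \<le> ennreal C2 * lattice_norm q ?b"
    using lattice_norm_decay_sup[OF q] by blast
  have AK: "2 * A * K > 0" using A K by simp
  have "lattice_norm q (\<lambda>\<alpha>. ennreal (a \<alpha> * W \<alpha>)) \<le> lattice_norm q (\<lambda>\<alpha>. ennreal (2 * A * K) * decay_sup ?b \<alpha>)"
  proof (rule lattice_norm_mono[OF q])
    fix \<beta> assume be: "\<beta> \<in> basis_lattice E'"
    show "ennreal (a \<beta> * W \<beta>) \<le> ennreal (2 * A * K) * decay_sup ?b \<beta>"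
    proof (cases "decay_sup ?b \<beta>")
      case top then show ?thesis using A K by (simp add: ennreal_mult_top)
    next
      case (real m)
      have "a \<beta> \<le> 2 * A * (K * m / W \<beta>)"
      proof (rule absorb_exp_majorant[where C = C and R = R and \<mu> = \<mu>])
        fix \<alpha> assume al: "\<alpha> \<in> basis_lattice E'"
        define t where "t = norm (\<alpha> - \<beta>)"
        have "ennreal (exp (- (real CARD('n) * t))) * ennreal (\<mu> \<alpha> * W \<alpha>) \<le> ennreal m"
          using decay_sup_upper[OF be al, of ?b] real(2) by (simp add: t_def)
        then have 1: "exp (- (real CARD('n) * t)) * (\<mu> \<alpha> * W \<alpha>) \<le> m"
          using real(1) mu[OF al] W(1)[of \<alpha>] by (simp add: ennreal_mult[symmetric])
        have "W \<beta> \<le> K * exp (R\<^sub>0 * t) * W \<alpha>" using W(2)[of \<beta> \<alpha>] by (simp add: t_def)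
        then have "exp (- (R * t)) * \<mu> \<alpha> * W \<beta> \<le> exp (- (R * t)) * \<mu> \<alpha> * (K * exp (R\<^sub>0 * t) * W \<alpha>)"
          using mu[OF al] by (intro mult_left_mono) auto
        also have "\<dots> = K * (\<mu> \<alpha> * W \<alpha>) * exp (R\<^sub>0 * t - R * t)" by (simp add: exp_diff exp_minus field_simps)
        also have "\<dots> \<le> K * (\<mu> \<alpha> * W \<alpha>) * exp (- (real CARD('n) * t))"
        proof (rule mult_left_mono)
          have "(R\<^sub>0 + real CARD('n)) * t \<le> R * t" using R(1) by (intro mult_right_mono) (auto simp: t_def)
          then show "exp (R\<^sub>0 * t - R * t) \<le> exp (- (real CARD('n) * t))" by (simp add: distrib_right)
        qed (use K mu[OF al] W(1)[of \<alpha>] in simp)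
        also have "\<dots> = K * (exp (- (real CARD('n) * t)) * (\<mu> \<alpha> * W \<alpha>))" by simp
        also have "\<dots> \<le> K * m" using 1 K by (intro mult_left_mono) auto
        finally show "exp (- (R * norm (\<alpha> - \<beta>))) * \<mu> \<alpha> \<le> K * m / W \<beta>"
          using W(1)[of \<beta>] by (simp add: pos_le_divide_eq t_def)
      qed (use a0 gr R(2) mu A step be in auto)
      then have "a \<beta> * W \<beta> \<le> 2 * A * K * m" using W(1)[of \<beta>] by (simp add: pos_le_divide_eq[symmetric] mult.assoc)
      then have "ennreal (a \<beta> * W \<beta>) \<le> ennreal (2 * A * K * m)" by (rule ennreal_leI)
      also have "\<dots> = ennreal (2 * A * K) * decay_sup ?b \<beta>"
        unfolding real(2) by (rule ennreal_mult) (use AK real(1) in auto)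
      finally show ?thesis .
    qed
  qed
  also have "\<dots> = ennreal (2 * A * K) * lattice_norm q (decay_sup ?b)" by (rule lattice_norm_cmult[OF q AK])
  also have "\<dots> \<le> ennreal (2 * A * K) * (ennreal C2 * lattice_norm q ?b)" by (intro mult_left_mono C2) auto
  also have "\<dots> < \<infinity>" using fin by (simp add: ennreal_mult_less_top)
  finally show ?thesis .
qed

section \<open>Grids of small boxes and recovery of the coefficients\<close>

definition grid :: "nat \<Rightarrow> real list set" where
  "grid m = {s. set s \<subseteq> (\<lambda>i. real i / real m) ` {..<m} \<and> length s = length E}"

lemma finite_grid: "finite (grid m)"
  unfolding grid_def by (rule finite_lists_length_eq) simp

lemma grid_bounds:
  assumes "s \<in> grid m" "j < length E" shows "0 \<le> s ! j \<and> s ! j + 1 / real m \<le> 1"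
proof -
  have "s ! j \<in> (\<lambda>i. real i / real m) ` {..<m}" using assms nth_mem[of j s] by (auto simp: grid_def)
  then obtain i where i: "s ! j = real i / real m" "i < m" by auto
  then have "real i + 1 \<le> real m" by linarith
  then have "real i / real m + 1 / real m \<le> 1" using i(2) by (simp add: add_divide_distrib[symmetric])
  then show ?thesis using i by simp
qed

lemma grid_cover:
  assumes x: "x \<in> cell E'" and m: "m > 0" obtains s where "s \<in> grid m" "x \<in> box s (1 / real m)"
proof -
  define s where "s = map (\<lambda>t. real (nat \<lfloor>real m * t\<rfloor>) / real m) (coords E' x)"
  have co: "0 \<le> coords E' x ! j \<and> coords E' x ! j < 1" if "j < length E" for j
  proof -
    have "E' ! j \<in> set E'" using that length_eq by simp
    then show ?thesis using x that length_eq by (simp add: cell_def)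
  qed
  have fl: "real (nat \<lfloor>real m * t\<rfloor>) \<le> real m * t \<and> real m * t < real (nat \<lfloor>real m * t\<rfloor>) + 1 \<and> nat \<lfloor>real m * t\<rfloor> < m"
    if "0 \<le> t" "t < 1" for t
  proof -
    have "0 \<le> real m * t" using that by simp
    moreover have "real m * t < real m" using that m by simp
    ultimately show ?thesis by (auto simp: nat_less_iff floor_less_iff)
  qed
  have ls: "length s = length E" by (simp add: s_def length_eq)
  have nth: "s ! j = real (nat \<lfloor>real m * (coords E' x ! j)\<rfloor>) / real m" if "j < length E" for j
    unfolding s_def by (rule nth_map) (use that length_eq in simp)
  show thesis
  proof (rule that[of s])
    show "s \<in> grid m" unfolding grid_def mem_Collect_eq
    proof (intro conjI ls subsetI)
      fix t assume "t \<in> set s"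
      then obtain j where j: "j < length E" "t = s ! j" using ls by (auto simp: in_set_conv_nth)
      have "nat \<lfloor>real m * (coords E' x ! j)\<rfloor> < m" using fl co[OF j(1)] by blast
      then show "t \<in> (\<lambda>i. real i / real m) ` {..<m}" unfolding j(2) nth[OF j(1)] by blast
    qed
    show "x \<in> box s (1 / real m)" unfolding box_def mem_Collect_eq
    proof (intro allI impI)
      fix j assume j: "j < length E"
      define y where "y = coords E' x ! j"
      have f: "real (nat \<lfloor>real m * y\<rfloor>) \<le> real m * y" "real m * y < real (nat \<lfloor>real m * y\<rfloor>) + 1"
        using fl[of y] co[OF j] by (simp_all only: y_def)
      show "s ! j \<le> coords E' x ! j \<and> coords E' x ! j \<le> s ! j + 1 / real m"
        unfolding nth[OF j] y_def[symmetric] using f m by (simp add: field_simps)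
    qed
  qed
qed

text \<open>An infimum over a product of boxes is a lower bound for all \<open>x\<close> and all
  \<xi> in them at once, so it can be pulled out of the norms in \<open>x\<close> and in \<xi> in
  either order. The frequency box is placed relative to \<beta>.\<close>

definition stft_inf where
  "stft_inf \<phi> f u \<delta> s \<beta> = (INF p\<in>box s \<delta> \<times> dual_pair.box E' E u \<delta>. cmod (STFT \<phi> f (fst p) (\<beta> + snd p)))"

lemma stft_inf_le:
  assumes "x \<in> box s \<delta>" "\<xi> - \<beta> \<in> dual_pair.box E' E u \<delta>"
  shows "stft_inf \<phi> f u \<delta> s \<beta> \<le> cmod (STFT \<phi> f x \<xi>)"
proof -
  have "stft_inf \<phi> f u \<delta> s \<beta> \<le> cmod (STFT \<phi> f (fst (x, \<xi> - \<beta>)) (\<beta> + snd (x, \<xi> - \<beta>)))"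
    unfolding stft_inf_def by (rule cINF_lower) (use assms in \<open>auto intro!: bdd_belowI[of _ 0]\<close>)
  then show ?thesis by simp
qed

lemma stft_inf_ge:
  assumes "length s = length E" "length u = length E" "\<delta> \<ge> 0"
    and "\<And>x \<xi>. x \<in> box s \<delta> \<Longrightarrow> \<xi> - \<beta> \<in> dual_pair.box E' E u \<delta> \<Longrightarrow> h \<le> cmod (STFT \<phi> f x \<xi>)"
  shows "h \<le> stft_inf \<phi> f u \<delta> s \<beta>"
proof -
  interpret dual: dual_pair E' E by (rule dual)
  have "lin_comb E s \<in> box s \<delta>" by (rule lin_comb_in_box[OF assms(1,3)])
  moreover have "lin_comb E' u \<in> dual.box u \<delta>" by (rule dual.lin_comb_in_box) (use assms length_eq in auto)
  ultimately show ?thesis unfolding stft_inf_def by (intro cINF_greatest) (auto intro!: assms(4))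
qed

text \<open>At the frequency \<beta> - \<xi>0 the cell integral is \<open>c \<beta>\<close> times a
  constant of modulus independent of \<beta>, so the transform cannot be small on the whole cell;
  the oscillation bound spreads a large value over a box. The error is a small multiple of the local
  size \<open>M\<close>, the form that \<open>lattice_norm_absorb\<close> removes.\<close>

lemma STFT_lower:
  assumes q: "q \<in> exponents CARD('n)" and ex: "has_expansion E' f c" and phi: "\<phi> \<in> Sigma1" "\<phi> \<noteq> (\<lambda>_. 0)"
    and K: "K \<ge> 1" and W: "\<And>x. W x > 0" "\<And>x y. W y \<le> K * exp (R\<^sub>0 * norm (x - y)) * W x" and R\<^sub>0: "R\<^sub>0 \<ge> 0"
  obtains u m where "length u = length E" "m > 0"
    "(\<And>s. s \<in> grid m \<Longrightarrow> lattice_norm q (\<lambda>\<beta>. ennreal (stft_inf \<phi> f u (1 / real m) s \<beta> * W \<beta>)) < \<infinity>) \<Longrightarrow>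
      lattice_norm q (\<lambda>\<beta>. ennreal (cmod (c \<beta>) * W \<beta>)) < \<infinity>"
proof -
  interpret dual: dual_pair E' E by (rule dual)
  obtain \<xi>0 where xi0: "fourier_int \<phi> \<xi>0 \<noteq> 0" using fourier_int_nonzero[OF phi] by blast
  obtain C R1 where C: "C > 0" "R1 > 0" "\<And>\<alpha>. \<alpha> \<in> basis_lattice E' \<Longrightarrow> cmod (c \<alpha>) \<le> C * exp (R1 * norm \<alpha>)"
    using ex unfolding has_expansion_def by blast
  \<comment> \<open>Not less than the growth rate \<open>R1\<close> of \<open>c\<close>, and large
    enough for the weight and the maximal function in \<open>lattice_norm_absorb\<close>.\<close>
  define R where "R = R\<^sub>0 + real CARD('n) + R1"
  have R: "R \<ge> 0" "R \<ge> R\<^sub>0 + real CARD('n)" "R1 \<le> R" using C(2) R\<^sub>0 by (auto simp: R_def)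
  \<comment> \<open>The corner of the frequency box is the point
    \<open>\<xi> - \<beta> = - \<xi>0\<close> at which the coefficient is recovered.\<close>
  define u where "u = coords E (- \<xi>0)"
  have lu: "length u = length E" by (simp add: u_def)
  define \<eta> where "\<eta> = stft_const TYPE('n) * cmod (fourier_int \<phi> \<xi>0)"
  have \<eta>: "\<eta> > 0" using xi0 stft_const_pos[where 'n='n] by (simp add: \<eta>_def)
  obtain Co where Co: "Co > 0"
    "\<And>x x' \<xi> \<xi>' \<beta> M \<rho>. \<lbrakk>\<beta> \<in> basis_lattice E'; M \<ge> 0; \<And>\<alpha>. \<alpha> \<in> basis_lattice E' \<Longrightarrow> cmod (c \<alpha>) \<le> M * exp (R * norm (\<alpha> - \<beta>));
      norm (\<xi> - \<beta>) \<le> norm \<xi>0; norm (x - x') \<le> \<rho>; norm (\<xi> - \<xi>') \<le> \<rho>; \<rho> \<le> 1\<rbrakk> \<Longrightarrow>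
      cmod (STFT \<phi> f x \<xi>) \<le> cmod (STFT \<phi> f x' \<xi>') + Co * sqrt \<rho> * M"
    using STFT_osc[OF ex phi(1) R(1) norm_ge_zero[of \<xi>0]] by blast
  define D where "D = list_diam E + list_diam E'"
  have D: "D \<ge> 0" "list_diam E \<le> D" "list_diam E' \<le> D" using list_diam_nonneg[of E] list_diam_nonneg[of E'] by (auto simp: D_def)
  \<comment> \<open>Chosen so that \<open>Co * sqrt \<rho>\<close> becomes at most
    \<open>\<eta> / 2\<close>; division by \<eta> then leaves the error \<open>M / 2\<close>. The
    minimum with 1 ensures the condition \<rho> \<le> 1 of the oscillation bound.\<close>
  define \<epsilon> where "\<epsilon> = min 1 ((\<eta> / (2 * Co))\<^sup>2)"
  have \<epsilon>: "\<epsilon> > 0" using \<eta> Co(1) by (simp add: \<epsilon>_def)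
  obtain n where n: "D / \<epsilon> < real n" using reals_Archimedean2 by blast
  define m where "m = Suc n"
  have m: "m > 0" by (simp add: m_def)
  define \<rho> where "\<rho> = D / real m"
  have \<rho>\<epsilon>: "\<rho> \<le> \<epsilon>"
  proof -
    have "D < real n * \<epsilon>" using n \<epsilon> by (simp add: pos_divide_less_eq)
    also have "\<dots> \<le> real m * \<epsilon>" using \<epsilon> by (simp add: m_def)
    finally show ?thesis using m by (simp add: \<rho>_def pos_divide_le_eq mult.commute)
  qed
  have \<rho>1: "\<rho> \<le> 1" using \<rho>\<epsilon> by (simp add: \<epsilon>_def)
  have "sqrt \<rho> \<le> \<eta> / (2 * Co)"
    by (rule real_le_lsqrt) (use \<rho>\<epsilon> \<eta> Co(1) in \<open>auto simp: \<epsilon>_def\<close>)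
  then have half: "Co * sqrt \<rho> \<le> \<eta> / 2" using Co(1) by (simp add: field_simps)
  \<comment> \<open>The box with the largest infimum may change with \<beta>; since the grid is
    finite, \<open>lattice_norm_Max_finite\<close> reduces the maximum to the separate
    boxes.\<close>
  define \<mu> where "\<mu> \<beta> = Max ((\<lambda>s. stft_inf \<phi> f u (1 / real m) s \<beta>) ` grid m)" for \<beta>
  have gne: "grid m \<noteq> {}"
  proof -
    have "replicate (length E) (0::real) \<in> grid m" using m by (auto simp: grid_def intro!: image_eqI[of _ _ 0])
    then show ?thesis by blast
  qed
  have le\<mu>: "stft_inf \<phi> f u (1 / real m) s \<beta> \<le> \<mu> \<beta>" if "s \<in> grid m" for s \<beta>
    unfolding \<mu>_def by (rule Max_ge) (use that finite_grid in auto)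
  have lg: "length s = length E" if "s \<in> grid m" for s using that by (simp add: grid_def)
  have i0: "0 \<le> stft_inf \<phi> f u (1 / real m) s \<beta>" if "s \<in> grid m" for s \<beta>
    by (rule stft_inf_ge[OF lg[OF that] lu]) auto
  have \<mu>0: "0 \<le> \<mu> \<beta>" for \<beta>
  proof -
    obtain s where "s \<in> grid m" using gne by blast
    then show ?thesis using i0 le\<mu> order_trans by blast
  qed
  show thesis
  proof (rule that[OF lu m])
    assume fin: "\<And>s. s \<in> grid m \<Longrightarrow> lattice_norm q (\<lambda>\<beta>. ennreal (stft_inf \<phi> f u (1 / real m) s \<beta> * W \<beta>)) < \<infinity>"
    have "lattice_norm q (\<lambda>\<beta>. ennreal (\<mu> \<beta> * W \<beta>)) \<le> lattice_norm q (\<lambda>\<beta>. SUP s\<in>grid m. ennreal (stft_inf \<phi> f u (1 / real m) s \<beta> * W \<beta>))"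
    proof (rule lattice_norm_mono[OF q])
      fix \<beta>
      have "\<mu> \<beta> \<in> (\<lambda>s. stft_inf \<phi> f u (1 / real m) s \<beta>) ` grid m"
        unfolding \<mu>_def by (rule Max_in) (use finite_grid gne in auto)
      then obtain s where s: "s \<in> grid m" "\<mu> \<beta> = stft_inf \<phi> f u (1 / real m) s \<beta>" by blast
      show "ennreal (\<mu> \<beta> * W \<beta>) \<le> (SUP s\<in>grid m. ennreal (stft_inf \<phi> f u (1 / real m) s \<beta> * W \<beta>))"
        unfolding s(2) by (rule SUP_upper[OF s(1)])
    qed
    also have "\<dots> < \<infinity>" by (rule lattice_norm_Max_finite[OF q finite_grid fin])
    finally have fin\<mu>: "lattice_norm q (\<lambda>\<beta>. ennreal (\<mu> \<beta> * W \<beta>)) < \<infinity>" .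
    show "lattice_norm q (\<lambda>\<beta>. ennreal (cmod (c \<beta>) * W \<beta>)) < \<infinity>"
    proof (rule lattice_norm_absorb[where a = "\<lambda>\<beta>. cmod (c \<beta>)" and A = "1 / \<eta>" and \<mu> = \<mu> and W = W, OF q K W R(2,1)])
      show "cmod (c \<alpha>) \<le> C * exp (R * norm \<alpha>)" if "\<alpha> \<in> basis_lattice E'" for \<alpha>
      proof -
        have "C * exp (R1 * norm \<alpha>) \<le> C * exp (R * norm \<alpha>)" using C(1) R(3) by (simp add: mult_right_mono)
        then show ?thesis using C(3)[OF that] by linarith
      qed
      fix \<beta> M assume be: "\<beta> \<in> basis_lattice E'" and M: "M \<ge> 0"
        and gr: "\<And>\<alpha>. \<alpha> \<in> basis_lattice E' \<Longrightarrow> cmod (c \<alpha>) \<le> M * exp (R * norm (\<alpha> - \<beta>))"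
      define \<xi> where "\<xi> = \<beta> - \<xi>0"
      have \<xi>b: "\<xi> - \<beta> = - \<xi>0" "\<beta> - \<xi> = \<xi>0" by (simp_all add: \<xi>_def)
      have \<xi>box: "\<xi> - \<beta> \<in> dual.box u (1 / real m)"
        unfolding \<xi>b dual.box_def u_def mem_Collect_eq using m by simp
      have n\<xi>: "norm (\<xi> - \<beta>) \<le> norm \<xi>0" unfolding \<xi>b by simp
      have diam: "1 / real m * list_diam E \<le> \<rho>" "1 / real m * list_diam E' \<le> \<rho>"
        unfolding \<rho>_def using D m by (simp_all add: divide_right_mono)
      \<comment> \<open>Every \<open>x\<close> of the cell lies in a grid box, on which the value at
        \<open>x\<close> minus the oscillation error is a lower bound. Integration over the cell
        turns this into a bound for the coefficient.\<close>
      have pt: "cmod (cis (x \<bullet> (\<xi> - \<beta>)) * STFT \<phi> f x \<xi>) \<le> \<mu> \<beta> + Co * sqrt \<rho> * M" if x: "x \<in> cell E'" for x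
      proof -
        obtain s where s: "s \<in> grid m" "x \<in> box s (1 / real m)" using grid_cover[OF x m] by blast
        have "cmod (STFT \<phi> f x \<xi>) - Co * sqrt \<rho> * M \<le> stft_inf \<phi> f u (1 / real m) s \<beta>"
        proof (rule stft_inf_ge[OF lg[OF s(1)] lu])
          fix x' \<xi>' assume x': "x' \<in> box s (1 / real m)" and \<xi>': "\<xi>' - \<beta> \<in> dual.box u (1 / real m)"
          have 1: "norm (x - x') \<le> \<rho>" using norm_box_diff[OF s(2) x'] diam(1) by linarith
          have 2: "norm (\<xi> - \<xi>') \<le> \<rho>" using dual.norm_box_diff[OF \<xi>box \<xi>'] diam(2) by simp
          show "cmod (STFT \<phi> f x \<xi>) - Co * sqrt \<rho> * M \<le> cmod (STFT \<phi> f x' \<xi>')"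
            using Co(2)[OF be M gr n\<xi> 1 2 \<rho>1] by simp
        qed simp
        then show ?thesis using le\<mu>[OF s(1), of \<beta>] by (simp add: norm_mult)
      qed
      have "cmod (of_real (stft_const TYPE('n) * cell_vol) * (c \<beta> * cnj (fourier_int \<phi> (\<beta> - \<xi>)))) \<le> (\<mu> \<beta> + Co * sqrt \<rho> * M) * cell_vol"
        unfolding STFT_coefficient[OF ex phi(1) be, symmetric] by (rule cell_integral_norm_le[OF pt])
      then have "(\<eta> * cmod (c \<beta>)) * cell_vol \<le> (\<mu> \<beta> + Co * sqrt \<rho> * M) * cell_vol"
        unfolding \<xi>b(2) norm_mult norm_of_real complex_mod_cnj \<eta>_def
        using stft_const_pos[where 'n='n] cell_vol_pos by (simp add: abs_mult mult_ac)
      then have "\<eta> * cmod (c \<beta>) \<le> \<mu> \<beta> + Co * sqrt \<rho> * M" using cell_vol_pos by simp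
      also have "\<dots> \<le> \<mu> \<beta> + \<eta> / 2 * M" using mult_right_mono[OF half M] by simp
      finally show "cmod (c \<beta>) \<le> 1 / \<eta> * \<mu> \<beta> + M / 2" using \<eta> by (simp add: field_simps)
    qed (use \<eta> \<mu>0 fin\<mu> in auto)
  qed
qed

text \<open>The parameter \<open>p\<close> serves the two orders of integration: it is the norm of
  the \<open>x\<close>-box when that norm is taken first, at fixed \<xi>, and 1 when it is taken
  last. The constant \<open>e\<close> combines the norm of the frequency box with the variation of
  the weight near \<beta>, and depends on neither \<open>p\<close> nor \<open>G\<close>.\<close>

lemma split_norm_stft_inf:
  assumes q: "q \<in> exponents CARD('n)" and K: "K \<ge> 1" and R: "R \<ge> 0" and pos: "\<And>x. \<theta> x > 0" "\<And>x. \<omega>\<^sub>0 x > 0"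
    and W: "\<And>x y. \<omega>\<^sub>0 y * \<theta> y \<le> K * exp (R * norm (x - y)) * (\<omega>\<^sub>0 x * \<theta> x)"
    and s: "length s = length E" and u: "length u = length E" and \<delta>: "0 < \<delta>" "\<delta> \<le> 1"
  obtains e where "e > 0" "\<And>p G. p > 0 \<Longrightarrow>
    (\<And>\<beta> \<xi>. \<xi> - \<beta> \<in> dual_pair.box E' E u \<delta> \<Longrightarrow> ennreal (stft_inf \<phi> f u \<delta> s \<beta> * \<omega>\<^sub>0 \<xi>) * ennreal p \<le> G \<xi>) \<Longrightarrow>
    ennreal (e * p) * lattice_norm q (\<lambda>\<beta>. ennreal (stft_inf \<phi> f u \<delta> s \<beta> * (\<omega>\<^sub>0 \<beta> * \<theta> \<beta>))) \<le> split_norm E' q \<theta> G"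
proof -
  interpret dual: dual_pair E' E by (rule dual)
  \<comment> \<open>The radius of a ball about 0 containing the frequency box; it limits the
    variation of the weight between \<beta> and \<xi>.\<close>
  define r where "r = norm (lin_comb E' u) + \<delta> * list_diam E'"
  have r: "norm z \<le> r" if "z \<in> dual.box u \<delta>" for z
  proof -
    have "lin_comb E' u \<in> dual.box u \<delta>" by (rule dual.lin_comb_in_box) (use u \<delta> length_eq in auto)
    from dual.norm_box_diff[OF that this] show ?thesis
      using norm_triangle_ineq[of "z - lin_comb E' u" "lin_comb E' u"] by (simp add: r_def)
  qed
  define P where "P = (\<Prod>p\<leftarrow>q. dil_const \<delta> p)"
  have P: "P > 0" unfolding P_def by (rule dil_const_prod_pos[OF \<delta>(1)])
  define k where "k = inverse (K * exp (R * r))"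
  have k: "k > 0" using K by (simp add: k_def)
  have "ennreal (P * k * p) * lattice_norm q (\<lambda>\<beta>. ennreal (stft_inf \<phi> f u \<delta> s \<beta> * (\<omega>\<^sub>0 \<beta> * \<theta> \<beta>))) \<le> split_norm E' q \<theta> G"
    if p: "p > 0" and G: "\<And>\<beta> \<xi>. \<xi> - \<beta> \<in> dual.box u \<delta> \<Longrightarrow> ennreal (stft_inf \<phi> f u \<delta> s \<beta> * \<omega>\<^sub>0 \<xi>) * ennreal p \<le> G \<xi>" for p G
  proof -
    have kp: "k * p > 0" using k p by simp
    have "ennreal P * lattice_norm q (\<lambda>\<beta>. ennreal (k * p) * ennreal (stft_inf \<phi> f u \<delta> s \<beta> * (\<omega>\<^sub>0 \<beta> * \<theta> \<beta>))) \<le> split_norm E' q \<theta> G"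
      unfolding P_def
    proof (rule split_norm_lower[OF q \<delta> u])
      fix \<beta> \<xi> assume "\<And>j. j < length E \<Longrightarrow> u ! j \<le> coords E (\<xi> - \<beta>) ! j \<and> coords E (\<xi> - \<beta>) ! j \<le> u ! j + \<delta>"
      then have bx: "\<xi> - \<beta> \<in> dual.box u \<delta>" unfolding dual.box_def mem_Collect_eq length_eq by blast
      define i where "i = stft_inf \<phi> f u \<delta> s \<beta>"
      have i: "i \<ge> 0" unfolding i_def by (rule stft_inf_ge[OF s u]) (use \<delta> in auto)
      have "K * exp (R * norm (\<xi> - \<beta>)) * (\<omega>\<^sub>0 \<xi> * \<theta> \<xi>) \<le> K * exp (R * r) * (\<omega>\<^sub>0 \<xi> * \<theta> \<xi>)"
        using r[OF bx] R K pos[of \<xi>] by (intro mult_right_mono mult_left_mono) (auto simp: mult_left_mono)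
      then have "\<omega>\<^sub>0 \<beta> * \<theta> \<beta> \<le> K * exp (R * r) * (\<omega>\<^sub>0 \<xi> * \<theta> \<xi>)" using W[of \<beta> \<xi>] by linarith
      then have "k * (\<omega>\<^sub>0 \<beta> * \<theta> \<beta>) \<le> \<omega>\<^sub>0 \<xi> * \<theta> \<xi>" using K by (simp add: k_def field_simps)
      then have "(i * p) * (k * (\<omega>\<^sub>0 \<beta> * \<theta> \<beta>)) \<le> (i * p) * (\<omega>\<^sub>0 \<xi> * \<theta> \<xi>)" using i p by (intro mult_left_mono) auto
      then have "ennreal ((k * p) * (i * (\<omega>\<^sub>0 \<beta> * \<theta> \<beta>))) \<le> ennreal (i * \<omega>\<^sub>0 \<xi> * p * \<theta> \<xi>)"
        by (intro ennreal_leI) (simp add: mult_ac)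
      also have "ennreal ((k * p) * (i * (\<omega>\<^sub>0 \<beta> * \<theta> \<beta>))) = ennreal (k * p) * ennreal (i * (\<omega>\<^sub>0 \<beta> * \<theta> \<beta>))"
        by (rule ennreal_mult) (use kp i pos[of \<beta>] in auto)
      also have "ennreal (i * \<omega>\<^sub>0 \<xi> * p * \<theta> \<xi>) = ennreal (i * \<omega>\<^sub>0 \<xi>) * ennreal p * ennreal \<bar>\<theta> \<xi>\<bar>"
        using i p pos[of \<xi>] by (simp add: ennreal_mult)
      also have "\<dots> \<le> G \<xi> * ennreal \<bar>\<theta> \<xi>\<bar>" unfolding i_def by (rule mult_right_mono[OF G[OF bx]]) simp
      finally show "ennreal (k * p) * ennreal (stft_inf \<phi> f u \<delta> s \<beta> * (\<omega>\<^sub>0 \<beta> * \<theta> \<beta>)) \<le> G \<xi> * ennreal \<bar>\<theta> \<xi>\<bar>"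
        by (simp only: i_def)
    qed
    then show ?thesis unfolding lattice_norm_cmult[OF q kp] using P k p by (simp add: ennreal_mult mult.assoc)
  qed
  then show thesis using that[of "P * k"] P k by simp
qed

lemma ennreal_mult_finite_cancel: "e > 0 \<Longrightarrow> ennreal e * x < \<infinity> \<Longrightarrow> x < \<infinity>"
  by (auto simp: ennreal_mult_less_top less_top[symmetric])

text \<open>The upper bounds pass through the supremum over \<open>x\<close>. For the lower bounds
  the cell at \<open>j = 0\<close> suffices, as the grid boxes lie inside it; the norm of such a box
  is taken before the norm in \<xi> for \<open>M_space\<close> and after it for
  \<open>W_space\<close>.\<close>

lemma M_W_space_iff:
  assumes r: "r \<in> exponents CARD('n)" and q: "q \<in> exponents CARD('n)"
    and th: "\<theta> \<in> moderate_weights" and om: "\<omega>\<^sub>0 \<in> moderate_weights"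
    and w: "\<And>x \<xi>. \<omega> (x, \<xi>) = \<omega>\<^sub>0 \<xi>" and phi: "\<phi> \<in> Sigma1" "\<phi> \<noteq> (\<lambda>_. 0)"
    and f: "f \<in> Sigma1_dual" and ex: "has_expansion E' f c"
  shows "f \<in> M_space \<phi> E r \<omega> (split_norm E' q \<theta>) \<longleftrightarrow>
      lattice_norm q (\<lambda>\<alpha>. ennreal (cmod (c \<alpha>) * (\<omega>\<^sub>0 \<alpha> * \<theta> \<alpha>))) < \<infinity>" (is "?M \<longleftrightarrow> ?D")
    and "f \<in> W_space \<phi> E r \<omega> (split_norm E' q \<theta>) \<longleftrightarrow>
      lattice_norm q (\<lambda>\<alpha>. ennreal (cmod (c \<alpha>) * (\<omega>\<^sub>0 \<alpha> * \<theta> \<alpha>))) < \<infinity>" (is "?W \<longleftrightarrow> ?D")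
proof -
  let ?w = "weighted_STFT \<phi> \<omega> f"
  let ?N = "split_norm E' q \<theta>"
  let ?n = "\<lambda>j. split_norm_on E r ((+) j ` parallelepiped E)"
  have 0: "0 \<in> basis_lattice E" by (rule lattice_0)
  have pos: "\<And>x. \<theta> x > 0" "\<And>x. \<omega>\<^sub>0 x > 0" using th om by (auto simp: moderate_weights_def weights_def)
  have upM: ?M if ?D
  proof -
    have "?N (\<lambda>\<xi>. SUP j\<in>basis_lattice E. ?n j (\<lambda>x. ?w x \<xi>)) \<le> ?N (\<lambda>\<xi>. SUP x. ?w x \<xi>)"
      by (rule split_norm_mono[OF q], rule SUP_least, rule split_norm_on_le[OF r], rule SUP_upper) simp
    also have "\<dots> < \<infinity>" by (rule STFT_upper[OF q th om w ex phi(1) that])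
    finally show ?M using f by (simp add: M_space_def)
  qed
  have upW: ?W if ?D
  proof -
    have "(SUP j\<in>basis_lattice E. ?n j (\<lambda>x. ?N (?w x))) \<le> ?N (\<lambda>\<xi>. SUP x. ?w x \<xi>)"
      by (rule SUP_least, rule split_norm_on_le[OF r], rule split_norm_mono[OF q], rule SUP_upper) simp
    also have "\<dots> < \<infinity>" by (rule STFT_upper[OF q th om w ex phi(1) that])
    finally show ?W using f by (simp add: W_space_def)
  qed
  obtain K R where K: "K \<ge> 1" and R: "R \<ge> 0" and KR: "\<And>x y. \<omega>\<^sub>0 y * \<theta> y \<le> K * exp (R * norm (x - y)) * (\<omega>\<^sub>0 x * \<theta> x)"
    using moderate_weight_mult_exp_bound[OF th om] by blast
  have Wpos: "\<And>x. \<omega>\<^sub>0 x * \<theta> x > 0" using pos by simp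
  obtain u m where u: "length u = length E" and m: "m > 0"
    and low: "(\<And>s. s \<in> grid m \<Longrightarrow> lattice_norm q (\<lambda>\<beta>. ennreal (stft_inf \<phi> f u (1 / real m) s \<beta> * (\<omega>\<^sub>0 \<beta> * \<theta> \<beta>))) < \<infinity>) \<Longrightarrow> ?D"
    using STFT_lower[where W = "\<lambda>x. \<omega>\<^sub>0 x * \<theta> x", OF q ex phi K Wpos KR R] by blast
  define \<delta> where "\<delta> = 1 / real m"
  have \<delta>: "0 < \<delta>" "\<delta> \<le> 1" using m by (auto simp: \<delta>_def)
  define p where "p = (\<Prod>p\<leftarrow>r. dil_const \<delta> p)"
  have p: "p > 0" unfolding p_def by (rule dil_const_prod_pos[OF \<delta>(1)])
  have wl: "ennreal (stft_inf \<phi> f u \<delta> s \<beta> * \<omega>\<^sub>0 \<xi>) \<le> ?w x \<xi>" if "x \<in> box s \<delta>" "\<xi> - \<beta> \<in> dual_pair.box E' E u \<delta>" for s x \<xi> \<beta>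
    unfolding weighted_STFT_def using stft_inf_le[OF that] pos(2)[of \<xi>]
    by (intro ennreal_leI) (simp add: norm_mult w mult_right_mono)
  have gb: "0 \<le> s ! j \<and> s ! j + \<delta> \<le> 1" if "s \<in> grid m" "j < length E" for s j
    using grid_bounds[OF that] by (simp add: \<delta>_def)
  have fin: "lattice_norm q (\<lambda>\<beta>. ennreal (stft_inf \<phi> f u \<delta> s \<beta> * (\<omega>\<^sub>0 \<beta> * \<theta> \<beta>))) < \<infinity>"
    if MW: "?M \<or> ?W" and s: "s \<in> grid m" for s
  proof -
    let ?I = "lattice_norm q (\<lambda>\<beta>. ennreal (stft_inf \<phi> f u \<delta> s \<beta> * (\<omega>\<^sub>0 \<beta> * \<theta> \<beta>)))"
    have ls: "length s = length E" using s by (simp add: grid_def)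
    obtain e where e: "e > 0" and eG: "\<And>p G. p > 0 \<Longrightarrow>
        (\<And>\<beta> \<xi>. \<xi> - \<beta> \<in> dual_pair.box E' E u \<delta> \<Longrightarrow> ennreal (stft_inf \<phi> f u \<delta> s \<beta> * \<omega>\<^sub>0 \<xi>) * ennreal p \<le> G \<xi>) \<Longrightarrow>
        ennreal (e * p) * ?I \<le> ?N G"
      using split_norm_stft_inf[where \<phi> = \<phi> and f = f, OF q K R pos KR ls u \<delta>] by blast
    have ep: "e * p > 0" using e p by simp
    from MW show ?thesis
    proof
      assume ?M
      have "ennreal (e * p) * ?I \<le> ?N (\<lambda>\<xi>. SUP j\<in>basis_lattice E. ?n j (\<lambda>x. ?w x \<xi>))"
      proof (rule eG[OF p])
        fix \<beta> \<xi> assume bx: "\<xi> - \<beta> \<in> dual_pair.box E' E u \<delta>"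
        have "ennreal (stft_inf \<phi> f u \<delta> s \<beta> * \<omega>\<^sub>0 \<xi>) * ennreal p \<le> ?n 0 (\<lambda>x. ?w x \<xi>)"
          unfolding p_def by (rule split_norm_on_ge[OF r ls gb[OF s] \<delta>(1) wl[OF _ bx]])
        also have "\<dots> \<le> (SUP j\<in>basis_lattice E. ?n j (\<lambda>x. ?w x \<xi>))" by (rule SUP_upper[OF 0])
        finally show "ennreal (stft_inf \<phi> f u \<delta> s \<beta> * \<omega>\<^sub>0 \<xi>) * ennreal p \<le> (SUP j\<in>basis_lattice E. ?n j (\<lambda>x. ?w x \<xi>))" .
      qed
      also have "\<dots> < \<infinity>" using \<open>?M\<close> by (simp add: M_space_def)
      finally show ?thesis by (rule ennreal_mult_finite_cancel[OF ep])
    next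
      assume ?W
      have "ennreal (e * 1) * ?I * ennreal p \<le> ?n 0 (\<lambda>x. ?N (?w x))" unfolding p_def
      proof (rule split_norm_on_ge[OF r ls gb[OF s] \<delta>(1)])
        fix x assume x: "x \<in> box s \<delta>"
        show "ennreal (e * 1) * ?I \<le> ?N (?w x)" by (rule eG) (use wl[OF x] in auto)
      qed
      also have "\<dots> \<le> (SUP j\<in>basis_lattice E. ?n j (\<lambda>x. ?N (?w x)))" by (rule SUP_upper[OF 0])
      also have "\<dots> < \<infinity>" using \<open>?W\<close> by (simp add: W_space_def)
      also have "ennreal (e * 1) * ?I * ennreal p = ennreal (e * p) * ?I" using e p by (simp add: ennreal_mult mult_ac)
      finally show ?thesis by (rule ennreal_mult_finite_cancel[OF ep])
    qed
  qed
  have dn: "?D" if "?M \<or> ?W" by (rule low) (use fin[OF that] in \<open>simp add: \<delta>_def\<close>)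
  show "?M \<longleftrightarrow> ?D" using upM dn by blast
  show "?W \<longleftrightarrow> ?D" using upW dn by blast
qed

text \<open>Every entry is bounded by the norm, and the weight decreases at most exponentially. Thus
  a formal expansion in \<open>L_space\<close>, which has no growth condition built in, defines an
  element of \<open>Sigma1_dual\<close>.\<close>

lemma lattice_norm_finite_growth:
  assumes q: "q \<in> exponents CARD('n)" and th: "\<theta> \<in> moderate_weights" and om: "\<omega>\<^sub>0 \<in> moderate_weights"
    and fin: "lattice_norm q (\<lambda>\<alpha>. ennreal (cmod (c \<alpha>) * (\<omega>\<^sub>0 \<alpha> * \<theta> \<alpha>))) < \<infinity>"
  obtains C R where "C > 0" "R > 0" "\<And>\<alpha>. \<alpha> \<in> basis_lattice E' \<Longrightarrow> cmod (c \<alpha>) \<le> C * exp (R * norm \<alpha>)"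
proof -
  obtain K R where K: "K \<ge> 1" and R: "R \<ge> 0" and KR: "\<And>x y. \<omega>\<^sub>0 y * \<theta> y \<le> K * exp (R * norm (x - y)) * (\<omega>\<^sub>0 x * \<theta> x)"
    using moderate_weight_mult_exp_bound[OF th om] by blast
  define W where "W x = \<omega>\<^sub>0 x * \<theta> x" for x
  have W: "W x > 0" for x using th om by (auto simp: W_def moderate_weights_def weights_def)
  obtain T where T: "T \<ge> 0" "lattice_norm q (\<lambda>\<alpha>. ennreal (cmod (c \<alpha>) * (\<omega>\<^sub>0 \<alpha> * \<theta> \<alpha>))) = ennreal T"
    using fin by (cases "lattice_norm q (\<lambda>\<alpha>. ennreal (cmod (c \<alpha>) * (\<omega>\<^sub>0 \<alpha> * \<theta> \<alpha>)))") auto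
  have "cmod (c \<alpha>) \<le> ((T + 1) * K / W 0) * exp ((R + 1) * norm \<alpha>)" if "\<alpha> \<in> basis_lattice E'" for \<alpha>
  proof -
    have "ennreal (cmod (c \<alpha>) * W \<alpha>) \<le> ennreal T" using lattice_norm_ge[OF q that, of "\<lambda>\<alpha>. ennreal (cmod (c \<alpha>) * W \<alpha>)"] T(2) by (simp add: W_def)
    then have 1: "cmod (c \<alpha>) * W \<alpha> \<le> T" using T(1) by simp
    have "W 0 \<le> K * exp (R * norm \<alpha>) * W \<alpha>" using KR[of 0 \<alpha>] by (simp add: W_def)
    then have "cmod (c \<alpha>) * W 0 \<le> cmod (c \<alpha>) * (K * exp (R * norm \<alpha>) * W \<alpha>)" by (intro mult_left_mono) auto
    also have "\<dots> = (cmod (c \<alpha>) * W \<alpha>) * (K * exp (R * norm \<alpha>))" by simp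
    also have "\<dots> \<le> (T + 1) * (K * exp ((R + 1) * norm \<alpha>))"
      by (rule mult_mono) (use 1 T(1) K in \<open>auto simp: mult_right_mono intro!: mult_left_mono\<close>)
    finally show ?thesis using W[of 0] by (simp add: field_simps)
  qed
  moreover have "(T + 1) * K / W 0 > 0" using T(1) K W[of 0] by (intro divide_pos_pos mult_pos_pos) auto
  moreover have "R + 1 > 0" using R by simp
  ultimately show thesis using that[of "(T + 1) * K / W 0" "R + 1"] by blast
qed

end

theorem proposition2:
  fixes E E' :: "(real^'n) list" and r\<^sub>v q :: "ennreal list" and r :: real
    and \<theta> \<omega>\<^sub>0 :: "real^'n \<Rightarrow> real" and \<omega> :: "(real^'n) \<times> (real^'n) \<Rightarrow> real"
    and \<phi> :: "real^'n \<Rightarrow> complex" and N :: "(real^'n \<Rightarrow> ennreal) \<Rightarrow> ennreal"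
  assumes "ordered_basis E" and "dual_basis E E'"
    and "r\<^sub>v \<in> exponents CARD('n)" and "0 < r" and "r \<le> 1"
    and "q \<in> exponents CARD('n)" and "\<theta> \<in> moderate_weights"
    and "split_Lebesgue E' q \<theta> \<subseteq> Lr_loc r"
    and "N = split_norm E' q \<theta>"
    and "\<omega>\<^sub>0 \<in> moderate_weights" and "\<And>x \<xi>. \<omega> (x, \<xi>) = \<omega>\<^sub>0 \<xi>"
    and "\<phi> \<in> Sigma1" and "\<phi> \<noteq> (\<lambda>_. 0)"
  shows "L_space E' \<omega>\<^sub>0 N = periodic_elements E E' (M_space \<phi> E r\<^sub>v \<omega> N) \<and>
    periodic_elements E E' (M_space \<phi> E r\<^sub>v \<omega> N)
      = periodic_elements E E' (W_space \<phi> E r\<^sub>v \<omega> N)"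
proof -
  note rv = assms(3) and q = assms(6) and th = assms(7) and N = assms(9) and om = assms(10)
    and w = assms(11) and phi = assms(12,13)
  interpret dual_pair E E' by (rule dual_pairI[OF assms(1,2)])
  define D where "D c \<longleftrightarrow> lattice_norm q (\<lambda>\<alpha>. ennreal (cmod (c \<alpha>) * (\<omega>\<^sub>0 \<alpha> * \<theta> \<alpha>))) < \<infinity>" for c
  have L: "L_space E' \<omega>\<^sub>0 N = {c \<in> formal_expansions E'. D c}"
  proof -
    have pos: "\<omega>\<^sub>0 x > 0" for x using om by (auto simp: moderate_weights_def weights_def)
    show ?thesis unfolding L_space_def N D_def discrete_norm_finite_iff[where \<omega>\<^sub>0 = \<omega>\<^sub>0, OF q th pos] ..
  qed
  \<comment> \<open>Both intersections are instances: \<open>X\<close> is any set of functionals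
    whose membership is decided by \<open>D\<close> of the expansion. One inclusion uses the
    existence of an expansion, the other realizes a given formal expansion by a functional, and
    uniqueness makes \<open>expansion_of\<close> return the expected sequence.\<close>
  have key: "periodic_elements E E' X = L_space E' \<omega>\<^sub>0 N"
    if sub: "X \<subseteq> Sigma1_dual" and X: "\<And>f c. f \<in> Sigma1_dual \<Longrightarrow> has_expansion E' f c \<Longrightarrow> f \<in> X \<longleftrightarrow> D c" for X
  proof (intro equalityI subsetI)
    fix c assume "c \<in> periodic_elements E E' X"
    then obtain f where f: "f \<in> X" "periodic E f" "c = expansion_of E' f" by (auto simp: periodic_elements_def)
    have fd: "f \<in> Sigma1_dual" using f(1) sub by blast
    obtain c' where c': "has_expansion E' f c'" using periodic_has_expansion[OF fd f(2) phi] by blast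
    have "c = c'" unfolding f(3) by (rule expansion_of_eq[OF c' phi])
    moreover have "c' \<in> formal_expansions E'" using c' by (simp add: has_expansion_def)
    moreover have "D c'" using X[OF fd c'] f(1) by simp
    ultimately show "c \<in> L_space E' \<omega>\<^sub>0 N" unfolding L by simp
  next
    fix c assume "c \<in> L_space E' \<omega>\<^sub>0 N"
    then have c: "c \<in> formal_expansions E'" "D c" unfolding L by auto
    obtain C R where CR: "C > 0" "R > 0" "\<And>\<alpha>. \<alpha> \<in> basis_lattice E' \<Longrightarrow> cmod (c \<alpha>) \<le> C * exp (R * norm \<alpha>)"
      using lattice_norm_finite_growth[OF q th om c(2)[unfolded D_def]] by blast
    obtain f where f: "f \<in> Sigma1_dual" "periodic E f" "has_expansion E' f c"
      using expansion_exists[OF c(1) CR] by blast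
    have "f \<in> X" using X[OF f(1,3)] c(2) by simp
    moreover have "c = expansion_of E' f" by (rule expansion_of_eq[OF f(3) phi, symmetric])
    ultimately show "c \<in> periodic_elements E E' X" unfolding periodic_elements_def using f(2) by blast
  qed
  have "periodic_elements E E' (M_space \<phi> E r\<^sub>v \<omega> N) = L_space E' \<omega>\<^sub>0 N"
    by (rule key) (use M_W_space_iff(1)[OF rv q th om w phi] in \<open>auto simp: M_space_def N D_def\<close>)
  moreover have "periodic_elements E E' (W_space \<phi> E r\<^sub>v \<omega> N) = L_space E' \<omega>\<^sub>0 N"
    by (rule key) (use M_W_space_iff(2)[OF rv q th om w phi] in \<open>auto simp: W_space_def N D_def\<close>)
  ultimately show ?thesis by simp
qed

end
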